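(* For all $\mathsf{U}^\mathsf{t}\subseteq\{\mathbf{F},\mathbf{G},\neg\}$, $\mathsf{B}^\mathsf{l}\subseteq\mathrm{Bin}_{lg}$ and $n\in\mathbb{N}$, the problem $\mathrm{CTL}_{\mathrm{Learn}}(\mathsf{U}^\mathsf{t},\emptyset,\mathsf{B}^\mathsf{l},n)$ is in NL. If moreover $\mathbf{F}\in\mathsf{U}^\mathsf{t}$ or $\mathbf{G}\in\mathsf{U}^\mathsf{t}$, then it is NL-complete (under logarithmic-space reductions).
   Context: $\mathrm{Bin}_{lg}$ is the set of binary logical operators $\vee,\wedge,\Rightarrow,\Leftarrow,\Leftrightarrow$ and their negations ($x(\neg* )y:=\neg(x*y)$). A Kripke structure is $\langle Q,I,\mathsf{Prop},\pi,\mathrm{Succ}\rangle$ with finite $Q$, initial states $I\subseteq Q$, labelling $\pi:Q\to2^{\mathsf{Prop}}$ and nonempty successor sets $\mathrm{Succ}(q)\subseteq Q$. CTL formulas of $\mathrm{CTL}(\mathsf{Prop},\mathsf{U}^\mathsf{t},\emptyset,\mathsf{B}^\mathsf{l})$: $\phi::=p\mid\neg\phi\mid\phi*\phi\ ( *\in\mathsf{B}^\mathsf{l})\mid\exists\circ\phi\mid\forall\circ\phi$ with $\circ\in\mathsf{U}^\mathsf{t}\setminus\{\neg\}$, negation available only if $\neg\in\mathsf{U}^\mathsf{t}$. Semantics: $q\models\exists\circ\phi$ (resp. $\forall\circ\phi$) iff some (resp. every) infinite $\mathrm{Succ}$-path $\rho$ from $q$ satisfies $\circ\phi$, where $\mathbf{F}\phi$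 holds iff $\rho[i]\models\phi$ for some $i\ge1$ and $\mathbf{G}\phi$ iff for all $i\ge1$. A structure satisfies $\phi$ iff all initial states do. $|\phi|$ = number of distinct subformulas; $|\phi|_{\mathrm{Bin}}$ = number of distinct subformulas of the form $\phi_1*\phi_2$. $\mathrm{CTL}_{\mathrm{Learn}}(\mathsf{U}^\mathsf{t},\emptyset,\mathsf{B}^\mathsf{l},n)$: input $(\mathsf{Prop},\mathcal{P},\mathcal{N},B)$ with $\mathcal{P},\mathcal{N}$ finite sets of Kripke structures and $B$ in unary; yes iff some $\phi$ in the fragment with $|\phi|\le B$ and $|\phi|_{\mathrm{Bin}}\le n$ is satisfied by every structure of $\mathcal{P}$ and by none of $\mathcal{N}$. *)

theory Defs
  imports Complex_Main
begin

section \<open>CTL formulas\<close>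

datatype conn = Disj | Conj | Implies | ImpliedBy | Iff

text \<open>The type \<open>binop\<close> has exactly the ten elements of \<open>Bin_lg\<close>.\<close>

datatype binop = Plain conn | Negated conn

datatype temporal = Eventually | Globally

text \<open>The type \<open>unop\<close> has exactly the three elements F, G and negation.\<close>

datatype unop = Negation | Temporal temporal

datatype quantifier = Exists_Path | All_Paths

datatype 'p ctl =
    Atom 'p
  | Neg "'p ctl"
  | Bin binop "'p ctl" "'p ctl"
  | Quant quantifier temporal "'p ctl"

primrec fragment :: "'p set \<Rightarrow> unop set \<Rightarrow> binop set \<Rightarrow> 'p ctl \<Rightarrow> bool" where
  "fragment AP Ut Bl (Atom p) \<longleftrightarrow> p \<in> AP"
| "fragment AP Ut Bl (Neg \<phi>) \<longleftrightarrow> Negation \<in> Ut \<and> fragment AP Ut Bl \<phi>"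
| "fragment AP Ut Bl (Bin b \<phi> \<psi>) \<longleftrightarrow> b \<in> Bl \<and> fragment AP Ut Bl \<phi> \<and> fragment AP Ut Bl \<psi>"
| "fragment AP Ut Bl (Quant Q t \<phi>) \<longleftrightarrow> Temporal t \<in> Ut \<and> fragment AP Ut Bl \<phi>"

primrec subformulas :: "'p ctl \<Rightarrow> 'p ctl set" where
  "subformulas (Atom p) = {Atom p}"
| "subformulas (Neg \<phi>) = insert (Neg \<phi>) (subformulas \<phi>)"
| "subformulas (Bin b \<phi> \<psi>) = insert (Bin b \<phi> \<psi>) (subformulas \<phi> \<union> subformulas \<psi>)"
| "subformulas (Quant Q t \<phi>) = insert (Quant Q t \<phi>) (subformulas \<phi>)"

definition ctl_size :: "'p ctl \<Rightarrow> nat" where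
  "ctl_size \<phi> = card (subformulas \<phi>)"

definition ctl_bin_size :: "'p ctl \<Rightarrow> nat" where
  "ctl_bin_size \<phi> = card {\<psi> \<in> subformulas \<phi>. \<exists>b \<psi>1 \<psi>2. \<psi> = Bin b \<psi>1 \<psi>2}"

section \<open>Kripke structures and semantics\<close>

record ('q, 'p) kripke =
  states :: "'q set"
  init :: "'q set"
  props :: "'p set"
  label :: "'q \<Rightarrow> 'p set"
  succ :: "'q \<Rightarrow> 'q set"

definition kripke_structure :: "('q, 'p) kripke \<Rightarrow> bool" where
  "kripke_structure K \<longleftrightarrow>
     finite (states K) \<and> init K \<subseteq> states K \<and>
     (\<forall>q \<in> states K. label K q \<subseteq> props K) \<and>
     (\<forall>q \<in> states K. succ K q \<noteq> {} \<and> succ K q \<subseteq> states K)"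

text \<open>
  Positions on a path are counted from 1 in the usual presentation of these operators, and
  the first position is the current state; here position \<open>i\<close> is \<open>\<rho> (i - 1)\<close>.
  Hence F and G both take the current state into account.
\<close>

definition paths :: "('q, 'p) kripke \<Rightarrow> 'q \<Rightarrow> (nat \<Rightarrow> 'q) set" where
  "paths K q = {\<rho>. \<rho> 0 = q \<and> (\<forall>i. \<rho> (Suc i) \<in> succ K (\<rho> i))}"

primrec conn_sem :: "conn \<Rightarrow> bool \<Rightarrow> bool \<Rightarrow> bool" where
  "conn_sem Disj x y \<longleftrightarrow> x \<or> y"
| "conn_sem Conj x y \<longleftrightarrow> x \<and> y"
| "conn_sem Implies x y \<longleftrightarrow> (x \<longrightarrow> y)"
| "conn_sem ImpliedBy x y \<longleftrightarrow> (y \<longrightarrow> x)"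
| "conn_sem Iff x y \<longleftrightarrow> (x \<longleftrightarrow> y)"

primrec binop_sem :: "binop \<Rightarrow> bool \<Rightarrow> bool \<Rightarrow> bool" where
  "binop_sem (Plain c) x y \<longleftrightarrow> conn_sem c x y"
| "binop_sem (Negated c) x y \<longleftrightarrow> \<not> conn_sem c x y"

primrec temporal_sem :: "temporal \<Rightarrow> ('q \<Rightarrow> bool) \<Rightarrow> (nat \<Rightarrow> 'q) \<Rightarrow> bool" where
  "temporal_sem Eventually S \<rho> \<longleftrightarrow> (\<exists>i. S (\<rho> i))"
| "temporal_sem Globally S \<rho> \<longleftrightarrow> (\<forall>i. S (\<rho> i))"

primrec quantifier_sem :: "quantifier \<Rightarrow> 'r set \<Rightarrow> ('r \<Rightarrow> bool) \<Rightarrow> bool" where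
  "quantifier_sem Exists_Path R T \<longleftrightarrow> (\<exists>\<rho> \<in> R. T \<rho>)"
| "quantifier_sem All_Paths R T \<longleftrightarrow> (\<forall>\<rho> \<in> R. T \<rho>)"

primrec sat :: "('q, 'p) kripke \<Rightarrow> 'p ctl \<Rightarrow> 'q \<Rightarrow> bool" where
  "sat K (Atom p) = (\<lambda>q. p \<in> label K q)"
| "sat K (Neg \<phi>) = (\<lambda>q. \<not> sat K \<phi> q)"
| "sat K (Bin b \<phi> \<psi>) = (\<lambda>q. binop_sem b (sat K \<phi> q) (sat K \<psi> q))"
| "sat K (Quant Q t \<phi>) = (\<lambda>q. quantifier_sem Q (paths K q) (temporal_sem t (sat K \<phi>)))"

definition models :: "('q, 'p) kripke \<Rightarrow> 'p ctl \<Rightarrow> bool" where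
  "models K \<phi> \<longleftrightarrow> (\<forall>q \<in> init K. sat K \<phi> q)"

section \<open>The learning problem\<close>

definition learnable ::
  "unop set \<Rightarrow> binop set \<Rightarrow> nat \<Rightarrow> 'p set \<Rightarrow> ('q, 'p) kripke set \<Rightarrow> ('q, 'p) kripke set \<Rightarrow> nat \<Rightarrow> bool"
where
  "learnable Ut Bl n AP Ps Ns B \<longleftrightarrow>
     (\<exists>\<phi>. fragment AP Ut Bl \<phi> \<and> ctl_size \<phi> \<le> B \<and> ctl_bin_size \<phi> \<le> n \<and>
          (\<forall>K \<in> Ps. models K \<phi>) \<and> (\<forall>K \<in> Ns. \<not> models K \<phi>))"

text \<open>
  To be written down as words, inputs are taken with propositions \<open>{..<m}\<close> and with states
  \<open>{..<k}\<close> in each structure; up to renaming this is the general case. A structure is given by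
  the number of its states in unary and, for each state, by one bit for membership in the
  initial states, its row of the labelling matrix and its row of the adjacency matrix. The
  finite sets of positive and negative structures are given by lists of their elements. The
  unary headers make the encoding self-delimiting.
\<close>

definition input_structure :: "nat \<Rightarrow> (nat, nat) kripke \<Rightarrow> bool" where
  "input_structure m K \<longleftrightarrow>
     kripke_structure K \<and> props K = {..<m} \<and> (\<exists>k. states K = {..<k})"

definition unary :: "nat \<Rightarrow> bool list" where
  "unary k = replicate k True @ [False]"

definition encode_state :: "nat \<Rightarrow> (nat, nat) kripke \<Rightarrow> nat \<Rightarrow> bool list" where
  "encode_state m K q =
     (q \<in> init K) # map (\<lambda>p. p \<in> label K q) [0..<m]
       @ map (\<lambda>r. r \<in> succ K q) [0..<card (states K)]"

definition encode_structure :: "nat \<Rightarrow> (nat, nat) kripke \<Rightarrow> bool list" where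
  "encode_structure m K =
     unary (card (states K)) @ concat (map (encode_state m K) [0..<card (states K)])"

definition encode_structures :: "nat \<Rightarrow> (nat, nat) kripke list \<Rightarrow> bool list" where
  "encode_structures m Ks = unary (length Ks) @ concat (map (encode_structure m) Ks)"

definition encode_input ::
  "nat \<Rightarrow> (nat, nat) kripke list \<Rightarrow> (nat, nat) kripke list \<Rightarrow> nat \<Rightarrow> bool list" where
  "encode_input m Ps Ns B =
     unary m @ unary B @ encode_structures m Ps @ encode_structures m Ns"

definition CTL_Learn :: "unop set \<Rightarrow> binop set \<Rightarrow> nat \<Rightarrow> bool list set" where
  "CTL_Learn Ut Bl n =
     {encode_input m Ps Ns B | m Ps Ns B.
        (\<forall>K \<in> set Ps \<union> set Ns. input_structure m K) \<and>
        learnable Ut Bl n {..<m} (set Ps) (set Ns) B}"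

section \<open>Turing machines, NL and logarithmic-space reductions\<close>

text \<open>
  Nondeterministic Turing machines with a read-only two-way input tape between end markers, a
  fixed number of one-way infinite work tapes (blank symbol 0), and a write-only one-way output
  tape, to which each step appends a word. States and work symbols are natural numbers; since
  the set of rules is finite, only finitely many of them matter. Output is irrelevant for
  acceptors.
\<close>

datatype cell = LeftEnd | Bit bool | RightEnd

datatype move = MoveLeft | Stay | MoveRight

record rule =
  source :: nat
  input_read :: cell
  work_read :: "nat list"
  target :: nat
  input_move :: move
  work_action :: "(nat \<times> move) list"
  emit :: "bool list"

record machine =
  tapes :: nat
  start :: nat
  accept :: nat
  rules :: "rule set"

type_synonym tape = "(nat \<Rightarrow> nat) \<times> nat"

record config =
  state :: nat
  input_pos :: nat
  work :: "tape list"

definition machine_wf :: "machine \<Rightarrow> bool" where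
  "machine_wf M \<longleftrightarrow>
     finite (rules M) \<and>
     (\<forall>r \<in> rules M. length (work_read r) = tapes M \<and> length (work_action r) = tapes M \<and>
        source r \<noteq> accept M)"

definition deterministic :: "machine \<Rightarrow> bool" where
  "deterministic M \<longleftrightarrow>
     (\<forall>r \<in> rules M. \<forall>r' \<in> rules M.
        source r = source r' \<and> input_read r = input_read r' \<and> work_read r = work_read r'
        \<longrightarrow> r = r')"

definition input_cell :: "bool list \<Rightarrow> nat \<Rightarrow> cell" where
  "input_cell w i =
     (if i = 0 then LeftEnd else if i \<le> length w then Bit (w ! (i - 1)) else RightEnd)"

text \<open>A move to the left from position 0 leaves the head where it is.\<close>

primrec move_head :: "move \<Rightarrow> nat \<Rightarrow> nat" where
  "move_head MoveLeft h = h - 1"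
| "move_head Stay h = h"
| "move_head MoveRight h = Suc h"

definition act :: "nat \<times> move \<Rightarrow> tape \<Rightarrow> tape" where
  "act = (\<lambda>(b, d) (t, h). (t(h := b), move_head d h))"

definition enabled :: "bool list \<Rightarrow> rule \<Rightarrow> config \<Rightarrow> bool" where
  "enabled w r c \<longleftrightarrow>
     state c = source r \<and> input_cell w (input_pos c) = input_read r \<and>
     map (\<lambda>(t, h). t h) (work c) = work_read r"

definition fire :: "bool list \<Rightarrow> rule \<Rightarrow> config \<Rightarrow> config" where
  "fire w r c =
     \<lparr>state = target r,
      input_pos = min (move_head (input_move r) (input_pos c)) (length w + 1),
      work = map2 act (work_action r) (work c)\<rparr>"

definition initial :: "machine \<Rightarrow> config" where
  "initial M = \<lparr>state = start M, input_pos = 0, work = replicate (tapes M) (\<lambda>_. 0, 0)\<rparr>"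

inductive run :: "machine \<Rightarrow> bool list \<Rightarrow> config \<Rightarrow> bool list \<Rightarrow> config \<Rightarrow> bool"
  for M :: machine and w :: "bool list" where
  run_refl: "run M w c [] c"
| run_step: "r \<in> rules M \<Longrightarrow> enabled w r c \<Longrightarrow> run M w (fire w r c) out c'
    \<Longrightarrow> run M w c (emit r @ out) c'"

text \<open>
  Space is measured on the work tapes only, over all computations. The argument of the logarithm
  is shifted so that the bound is positive on all inputs.
\<close>

definition log_space :: "machine \<Rightarrow> bool" where
  "log_space M \<longleftrightarrow>
     (\<exists>C :: nat. \<forall>w out c. run M w (initial M) out c \<longrightarrow>
        (\<forall>(t, h) \<in> set (work c). real (h + 1) \<le> real C * log 2 (real (length w + 2))))"

definition accepts :: "machine \<Rightarrow> bool list \<Rightarrow> bool" where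
  "accepts M w \<longleftrightarrow> (\<exists>out c. run M w (initial M) out c \<and> state c = accept M)"

definition NL :: "bool list set set" where
  "NL = {L. \<exists>M. machine_wf M \<and> log_space M \<and> L = {w. accepts M w}}"

definition computes :: "machine \<Rightarrow> (bool list \<Rightarrow> bool list) \<Rightarrow> bool" where
  "computes M f \<longleftrightarrow> (\<forall>w. \<exists>c. run M w (initial M) (f w) c \<and> state c = accept M)"

definition log_space_computable :: "(bool list \<Rightarrow> bool list) \<Rightarrow> bool" where
  "log_space_computable f \<longleftrightarrow>
     (\<exists>M. machine_wf M \<and> deterministic M \<and> log_space M \<and> computes M f)"

definition log_space_reducible :: "bool list set \<Rightarrow> bool list set \<Rightarrow> bool" where
  "log_space_reducible L L' \<longleftrightarrow>
     (\<exists>f. log_space_computable f \<and> (\<forall>w. w \<in> L \<longleftrightarrow> f w \<in> L'))"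

definition NL_complete :: "bool list set \<Rightarrow> bool" where
  "NL_complete L \<longleftrightarrow> L \<in> NL \<and> (\<forall>L' \<in> NL. log_space_reducible L' L)"

end

theory Submission
  imports Defs "HOL-Library.Countable"
begin

text \<open>
  EF and AF are closure operators on the sets of states, EG and AG their duals. As in Kuratowski's
  closure-complement theorem, only finitely many words in these operators and negation are
  pairwise inequivalent. A formula of least size has no two equivalent subformulas of which one can
  replace the other, so with at most \<open>n\<close> binary connectives its size is bounded by a constant.
  It therefore suffices to try finitely many formula shapes and to guess the propositions at the
  atoms. Each candidate is evaluated in every structure in nondeterministic logarithmic space:
  EF is reachability, EG is reachability of a cycle inside a set, and their negations are
  verifiable by inductive counting (Immerman, Szelepcsenyi). Membership in NL is shown for programs
  over counters that range up to a polynomial in the input length, which are compiled to Turing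
  machines whose work tapes hold these counters in binary or another fixed base.

  For hardness, the configuration graph of an NL machine, with the accepting configurations marked
  by the only proposition, is compared with a single unmarked loop. EF separates the two if an
  accepting configuration is reachable; otherwise no formula does, since all reachable states look
  the same. AG serves in the same way if only G is available.
\<close>

section \<open>A structured language for Turing machines\<close>

text \<open>Three obstacles shape the development. \<open>log_space\<close> constrains every
  computation on every input, including rejecting and endless ones, so the space bound must hold
  whatever a program does: each work tape carries a right end marker, written once in an initial
  phase that measures the input. Counters therefore have a fixed number of digits and wrap around.
  Next, in a nested formula the inner formula decides which edges a search may use and may occur
  negated; hence the induction over formulas carries a verifying program for a predicate together
  with one for its complement, and every predicate is indexed by the first free variable, so that
  programs nest without clashes. Finally, configuration codes of an arbitrary machine are bounded by
  a polynomial whose degree depends on the machine, which is why the base of the counters is a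
  parameter.

  The size bound counts distinct subformulas: with \<open>n\<close> binary ones there are at most
  \<open>2 ^ n\<close> atoms, and above each atom or binary subformula only a constant number of
  inequivalent unary prefixes. The constant arises because among eight alternating closures and
  interiors some four neighbours always collapse to two.\<close>

datatype test = Tape_In nat "nat list" | Input_In "cell list"

datatype com =
    Out "bool list"
  | Input_Move move
  | Upd nat "(nat \<times> nat \<times> move) list"
  | Seq com com
  | Cond test com com
  | While test com
  | Choice com com
  | Star com

instance cell :: countable by countable_datatype
instance move :: countable by countable_datatype
instance test :: countable by countable_datatype
instance com :: countable by countable_datatype

text \<open>Position of the input head and the work tapes; the control state is kept apart, as a
  continuation.\<close>

type_synonym tm_state = "nat \<times> tape list"

definition reads :: "tape list \<Rightarrow> nat list" where
  "reads wk = map (\<lambda>(t, h). t h) wk"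

primrec holds_on :: "test \<Rightarrow> cell \<Rightarrow> nat list \<Rightarrow> bool" where
  "holds_on (Tape_In i A) x rs \<longleftrightarrow> rs ! i \<in> set A"
| "holds_on (Input_In A) x rs \<longleftrightarrow> x \<in> set A"

definition holds :: "bool list \<Rightarrow> test \<Rightarrow> tm_state \<Rightarrow> bool" where
  "holds w T s = holds_on T (input_cell w (fst s)) (reads (snd s))"

lemma holds_simps [simp]:
  "holds w (Tape_In i A) s \<longleftrightarrow> reads (snd s) ! i \<in> set A"
  "holds w (Input_In C) s \<longleftrightarrow> input_cell w (fst s) \<in> set C"
  by (auto simp: holds_def)

text \<open>An instruction touches at most one work tape, whereas a machine rule acts on all of
  them; the other tapes have their scanned symbols rewritten in place.\<close>

definition keep :: "nat list \<Rightarrow> (nat \<times> move) list" where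
  "keep rs = map (\<lambda>a. (a, Stay)) rs"

lemma map2_act_keep: "map2 act (keep (reads wk)) wk = wk"
  by (auto simp: keep_def reads_def act_def intro!: nth_equalityI split: prod.splits)

lemma map2_act_keep_update:
  "i < length wk \<Longrightarrow> map2 act ((keep (reads wk))[i := bd]) wk = wk[i := act bd (wk ! i)]"
  by (rule nth_equalityI)
     (auto simp: keep_def reads_def act_def nth_list_update split: prod.splits)

text \<open>The control states of the machine for a program are its continuations, i.e. lists of
  programs that remain to be executed in sequence.\<close>

fun nexts ::
  "com list \<Rightarrow> cell \<Rightarrow> nat list \<Rightarrow> (com list \<times> move \<times> (nat \<times> move) list \<times> bool list) list" where
  "nexts [] x rs = []"
| "nexts (Out bs # K) x rs = [(K, Stay, keep rs, bs)]"
| "nexts (Input_Move d # K) x rs = [(K, d, keep rs, [])]"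
| "nexts (Upd i tbl # K) x rs =
     (case map_of tbl (rs ! i) of None \<Rightarrow> [] | Some bd \<Rightarrow> [(K, Stay, (keep rs)[i := bd], [])])"
| "nexts (Seq a b # K) x rs = [(a # b # K, Stay, keep rs, [])]"
| "nexts (Cond T a b # K) x rs = [((if holds_on T x rs then a else b) # K, Stay, keep rs, [])]"
| "nexts (While T a # K) x rs =
     [(if holds_on T x rs then a # While T a # K else K, Stay, keep rs, [])]"
| "nexts (Choice a b # K) x rs = [(a # K, Stay, keep rs, []), (b # K, Stay, keep rs, [])]"
| "nexts (Star a # K) x rs = [(K, Stay, keep rs, []), (a # Star a # K, Stay, keep rs, [])]"

text \<open>A finite set closed under execution, from which the control states are drawn. A loop
  contributes the continuations of its body, each followed by the loop itself, so unfolding produces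
  nothing new.\<close>

primrec conts :: "com \<Rightarrow> com list set" where
  "conts (Out bs) = {[Out bs], []}"
| "conts (Input_Move d) = {[Input_Move d], []}"
| "conts (Upd i tbl) = {[Upd i tbl], []}"
| "conts (Seq a b) = insert [Seq a b] ((\<lambda>L. L @ [b]) ` conts a \<union> conts b)"
| "conts (Cond T a b) = insert [Cond T a b] (conts a \<union> conts b)"
| "conts (While T a) = {[While T a], []} \<union> (\<lambda>L. L @ [While T a]) ` conts a"
| "conts (Choice a b) = insert [Choice a b] (conts a \<union> conts b)"
| "conts (Star a) = {[Star a], []} \<union> (\<lambda>L. L @ [Star a]) ` conts a"

lemma finite_conts [simp]: "finite (conts c)"
  by (induction c) auto

lemma conts_self [simp]: "[c] \<in> conts c"
  by (cases c) auto

lemma conts_nil [simp]: "[] \<in> conts c"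
  by (induction c) auto

text \<open>Only the first instruction is inspected; the tail of the continuation is carried
  along.\<close>

lemma nexts_append:
  "L \<noteq> [] \<Longrightarrow> nexts (L @ M) x rs = map (\<lambda>(K, y). (K @ M, y)) (nexts L x rs)"
  by (cases "(L, x, rs)" rule: nexts.cases) (auto split: option.splits)

lemma conts_closed_append:
  assumes "\<And>L y. L \<in> conts a \<Longrightarrow> y \<in> set (nexts L x rs) \<Longrightarrow> fst y \<in> conts a"
    and "L \<in> conts a" "y \<in> set (nexts (L @ M) x rs)" "L \<noteq> []"
  shows "fst y \<in> (\<lambda>L. L @ M) ` conts a"
  using assms by (fastforce simp: nexts_append)

text \<open>A step inside the first part of a sequence or inside a loop body stays among the
  continuations of that part; once the part is used up, its empty continuation leaves just the
  tail.\<close>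

lemma conts_closed:
  "K \<in> conts c \<Longrightarrow> y \<in> set (nexts K x rs) \<Longrightarrow> fst y \<in> conts c"
proof (induction c arbitrary: K y)
  case (Seq a b)
  consider "K = [Seq a b]" | "K \<in> conts b" | L where "L \<in> conts a" "L \<noteq> []" "K = L @ [b]"
    using Seq.prems(1) by auto (metis append_Nil conts_self)
  then show ?case
  proof cases
    case 1
    then show ?thesis using Seq.prems(2) by (auto intro!: image_eqI[of _ _ "[a]"])
  next
    case 2
    then show ?thesis using Seq by auto
  next
    case 3
    then have "fst y \<in> (\<lambda>L. L @ [b]) ` conts a"
      using Seq.prems(2) Seq.IH(1) by (intro conts_closed_append[of a x rs L y "[b]"]) auto
    then show ?thesis by auto
  qed
next
  case (While T a)
  consider "K = []" | "K = [While T a]" | L where "L \<in> conts a" "L \<noteq> []" "K = L @ [While T a]"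
    using While.prems(1) by auto
  then show ?case
  proof cases
    case 3
    then have "fst y \<in> (\<lambda>L. L @ [While T a]) ` conts a"
      using While.prems(2) While.IH by (intro conts_closed_append[of a x rs L y "[While T a]"]) auto
    then show ?thesis by auto
  qed (use While.prems(2) in \<open>auto intro!: image_eqI[of _ _ "[a]"] split: if_splits\<close>)
next
  case (Star a)
  consider "K = []" | "K = [Star a]" | L where "L \<in> conts a" "L \<noteq> []" "K = L @ [Star a]"
    using Star.prems(1) by auto
  then show ?case
  proof cases
    case 3
    then have "fst y \<in> (\<lambda>L. L @ [Star a]) ` conts a"
      using Star.prems(2) Star.IH by (intro conts_closed_append[of a x rs L y "[Star a]"]) auto
    then show ?thesis by auto
  qed (use Star.prems(2) in \<open>auto intro!: image_eqI[of _ _ "[a]"] split: if_splits\<close>)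
next
  case (Cond T a b)
  consider "K = [Cond T a b]" | "K \<in> conts a" | "K \<in> conts b" using Cond.prems(1) by auto
  then show ?case
  proof cases
    case 2
    then show ?thesis using Cond.IH(1)[OF 2 Cond.prems(2)] by simp
  next
    case 3
    then show ?thesis using Cond.IH(2)[OF 3 Cond.prems(2)] by simp
  qed (use Cond.prems(2) in simp)
next
  case (Choice a b)
  consider "K = [Choice a b]" | "K \<in> conts a" | "K \<in> conts b" using Choice.prems(1) by auto
  then show ?case
  proof cases
    case 2
    then show ?thesis using Choice.IH(1)[OF 2 Choice.prems(2)] by simp
  next
    case 3
    then show ?thesis using Choice.IH(2)[OF 3 Choice.prems(2)] by simp
  qed (use Choice.prems(2) in auto)
qed (auto split: option.splits)

text \<open>\<open>k\<close> is the number of work tapes and \<open>S\<close> the size of the work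
  alphabet.\<close>

primrec wf_com :: "nat \<Rightarrow> nat \<Rightarrow> com \<Rightarrow> bool" where
  "wf_com k S (Out bs) \<longleftrightarrow> True"
| "wf_com k S (Input_Move d) \<longleftrightarrow> True"
| "wf_com k S (Upd i tbl) \<longleftrightarrow> i < k \<and> (\<forall>(a, b, d) \<in> set tbl. b < S)"
| "wf_com k S (Seq a b) \<longleftrightarrow> wf_com k S a \<and> wf_com k S b"
| "wf_com k S (Cond T a b) \<longleftrightarrow> wf_com k S a \<and> wf_com k S b"
| "wf_com k S (While T a) \<longleftrightarrow> wf_com k S a"
| "wf_com k S (Choice a b) \<longleftrightarrow> wf_com k S a \<and> wf_com k S b"
| "wf_com k S (Star a) \<longleftrightarrow> wf_com k S a"

text \<open>Symbol 2 is the right end marker of a work tape; that it is never overwritten or passed bounds the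
  space.\<close>

primrec bounded_com :: "com \<Rightarrow> bool" where
  "bounded_com (Out bs) \<longleftrightarrow> True"
| "bounded_com (Input_Move d) \<longleftrightarrow> True"
| "bounded_com (Upd i tbl) \<longleftrightarrow> (\<forall>(a, b, d) \<in> set tbl. a = 2 \<longrightarrow> b = 2 \<and> d \<noteq> MoveRight)"
| "bounded_com (Seq a b) \<longleftrightarrow> bounded_com a \<and> bounded_com b"
| "bounded_com (Cond T a b) \<longleftrightarrow> bounded_com a \<and> bounded_com b"
| "bounded_com (While T a) \<longleftrightarrow> bounded_com a"
| "bounded_com (Choice a b) \<longleftrightarrow> bounded_com a \<and> bounded_com b"
| "bounded_com (Star a) \<longleftrightarrow> bounded_com a"

primrec det_com :: "com \<Rightarrow> bool" where
  "det_com (Out bs) \<longleftrightarrow> True"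
| "det_com (Input_Move d) \<longleftrightarrow> True"
| "det_com (Upd i tbl) \<longleftrightarrow> True"
| "det_com (Seq a b) \<longleftrightarrow> det_com a \<and> det_com b"
| "det_com (Cond T a b) \<longleftrightarrow> det_com a \<and> det_com b"
| "det_com (While T a) \<longleftrightarrow> det_com a"
| "det_com (Choice a b) \<longleftrightarrow> False"
| "det_com (Star a) \<longleftrightarrow> False"

lemma conts_all:
  "wf_com k S c \<Longrightarrow> K \<in> conts c \<Longrightarrow> list_all (wf_com k S) K"
  "det_com c \<Longrightarrow> K \<in> conts c \<Longrightarrow> list_all det_com K"
  by (induction c arbitrary: K) auto

lemma length_det_nexts: "list_all det_com K \<Longrightarrow> length (nexts K x rs) \<le> 1"
  by (cases "(K, x, rs)" rule: nexts.cases) (simp_all split: option.split)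

lemma det_nexts:
  "list_all det_com K \<Longrightarrow> y \<in> set (nexts K x rs) \<Longrightarrow> z \<in> set (nexts K x rs) \<Longrightarrow> y = z"
  using length_det_nexts[of K x rs] by (cases "nexts K x rs") auto

definition cfg :: "com list \<Rightarrow> tm_state \<Rightarrow> config" where
  "cfg K s = \<lparr>state = to_nat K, input_pos = fst s, work = snd s\<rparr>"

text \<open>The empty continuation is the accepting state, so acceptance means that the program
  terminates; a missing table entry in \<open>Upd\<close> blocks the machine and thus
  rejects.\<close>

definition machine_of :: "nat \<Rightarrow> nat \<Rightarrow> com \<Rightarrow> machine" where
  "machine_of k S c =
     \<lparr>tapes = k, start = to_nat [c], accept = to_nat ([] :: com list),
      rules = {\<lparr>source = to_nat K, input_read = x, work_read = rs, target = to_nat K',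
               input_move = d, work_action = acts, emit = e\<rparr> | K x rs K' d acts e.
               K \<in> conts c \<and> set rs \<subseteq> {..<S} \<and> length rs = k \<and>
               (K', d, acts, e) \<in> set (nexts K x rs)}\<rparr>"

lemma finite_cell [simp]: "finite (UNIV :: cell set)"
proof -
  have "x \<in> {LeftEnd, Bit True, Bit False, RightEnd}" for x :: cell
  proof (cases x)
    case (Bit b)
    then show ?thesis by (cases b) auto
  qed auto
  then have "(UNIV :: cell set) \<subseteq> {LeftEnd, Bit True, Bit False, RightEnd}" by blast
  then show ?thesis by (rule finite_subset) simp
qed

lemma length_nexts_action:
  "(K', d, acts, e) \<in> set (nexts K x rs) \<Longrightarrow> length acts = length rs"
  by (cases "(K, x, rs)" rule: nexts.cases) (auto simp: keep_def split: option.splits)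

lemma rules_machine_ofE:
  assumes "r \<in> rules (machine_of k S c)"
  obtains K x rs K' d acts e where
    "r = \<lparr>source = to_nat K, input_read = x, work_read = rs, target = to_nat K',
       input_move = d, work_action = acts, emit = e\<rparr>"
    "K \<in> conts c" "set rs \<subseteq> {..<S}" "length rs = k" "(K', d, acts, e) \<in> set (nexts K x rs)"
  using assms unfolding machine_of_def by auto

lemma machine_of_wf: "machine_wf (machine_of k S c)"
proof -
  have "rules (machine_of k S c) \<subseteq>
    (\<Union>K\<in>conts c. \<Union>x\<in>UNIV. \<Union>rs\<in>{rs. set rs \<subseteq> {..<S} \<and> length rs = k}.
      (\<lambda>(K', d, acts, e). \<lparr>source = to_nat K, input_read = x, work_read = rs, target = to_nat K',
               input_move = d, work_action = acts, emit = e\<rparr>) ` set (nexts K x rs))"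
  proof
    fix r assume "r \<in> rules (machine_of k S c)"
    then obtain K x rs K' d acts e where r: "r = \<lparr>source = to_nat K, input_read = x,
        work_read = rs, target = to_nat K', input_move = d, work_action = acts, emit = e\<rparr>"
      and "K \<in> conts c" "set rs \<subseteq> {..<S}" "length rs = k" "(K', d, acts, e) \<in> set (nexts K x rs)"
      by (auto simp: machine_of_def)
    then show "r \<in> (\<Union>K\<in>conts c. \<Union>x\<in>UNIV. \<Union>rs\<in>{rs. set rs \<subseteq> {..<S} \<and> length rs = k}.
      (\<lambda>(K', d, acts, e). \<lparr>source = to_nat K, input_read = x, work_read = rs, target = to_nat K',
               input_move = d, work_action = acts, emit = e\<rparr>) ` set (nexts K x rs))"
      by (intro UN_I[of K] UN_I[of x] UN_I[of rs] image_eqI[of _ _ "(K', d, acts, e)"]) auto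
  qed
  moreover have "finite \<dots>"
    by (intro finite_UN_I finite_imageI finite_lists_length_eq) auto
  ultimately have "finite (rules (machine_of k S c))"
    by (rule finite_subset)
  then show ?thesis
    by (auto simp: machine_wf_def machine_of_def dest: length_nexts_action)
qed

lemma machine_of_deterministic: "det_com c \<Longrightarrow> deterministic (machine_of k S c)"
proof -
  assume det: "det_com c"
  have "r = r'" if rs: "r \<in> rules (machine_of k S c)" "r' \<in> rules (machine_of k S c)"
    and eqs: "source r = source r'" "input_read r = input_read r'" "work_read r = work_read r'" for r r'
  proof -
    obtain K x rs K1 d1 a1 e1 where r: "r = \<lparr>source = to_nat K, input_read = x, work_read = rs,
        target = to_nat K1, input_move = d1, work_action = a1, emit = e1\<rparr>"
      and K: "K \<in> conts c" and m1: "(K1, d1, a1, e1) \<in> set (nexts K x rs)"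
      by (rule rules_machine_ofE[OF rs(1)]) blast
    obtain L y ss K2 d2 a2 e2 where r': "r' = \<lparr>source = to_nat L, input_read = y, work_read = ss,
        target = to_nat K2, input_move = d2, work_action = a2, emit = e2\<rparr>"
      and m2: "(K2, d2, a2, e2) \<in> set (nexts L y ss)"
      by (rule rules_machine_ofE[OF rs(2)]) blast
    have "L = K" "y = x" "ss = rs" using eqs r r' by simp_all
    then have "(K1, d1, a1, e1) = (K2, d2, a2, e2)"
      using det_nexts[OF conts_all(2)[OF det K] m1] m2 by blast
    then show ?thesis using r r' \<open>L = K\<close> \<open>y = x\<close> \<open>ss = rs\<close> by simp
  qed
  then show ?thesis unfolding deterministic_def by blast
qed

text \<open>Rules exist only for vectors of symbols below \<open>S\<close> of length
  \<open>k\<close>; this invariant guarantees that they match.\<close>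

definition good :: "nat \<Rightarrow> nat \<Rightarrow> tm_state \<Rightarrow> bool" where
  "good k S s \<longleftrightarrow> length (snd s) = k \<and> (\<forall>(t, h) \<in> set (snd s). \<forall>j. t j < S)"

lemma good_reads: "good k S s \<Longrightarrow> set (reads (snd s)) \<subseteq> {..<S} \<and> length (reads (snd s)) = k"
  by (fastforce simp: good_def reads_def)

lemma good_update:
  "good k S (ip, wk) \<Longrightarrow> b < S \<Longrightarrow> i < k \<Longrightarrow> good k S (ip', wk[i := act (b, d) (wk ! i)])"
  unfolding good_def
  by (auto simp: act_def split: prod.splits dest!: set_update_subset_insert[THEN subsetD])
     (metis nth_mem old.prod.case split_conv)

section \<open>Small-step execution of programs and its agreement with machine runs\<close>

inductive cstep :: "bool list \<Rightarrow> com list \<Rightarrow> tm_state \<Rightarrow> bool list \<Rightarrow> com list \<Rightarrow> tm_state \<Rightarrow> bool"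
  for w where
  cs_Out: "cstep w (Out bs # K) s bs K s"
| cs_Move: "cstep w (Input_Move d # K) s [] K (min (move_head d (fst s)) (length w + 1), snd s)"
| cs_Upd: "map_of tbl (reads (snd s) ! i) = Some bd \<Longrightarrow>
     cstep w (Upd i tbl # K) s [] K (fst s, (snd s)[i := act bd (snd s ! i)])"
| cs_Seq: "cstep w (Seq a b # K) s [] (a # b # K) s"
| cs_Cond: "cstep w (Cond T a b # K) s [] ((if holds w T s then a else b) # K) s"
| cs_While: "cstep w (While T a # K) s [] (if holds w T s then a # While T a # K else K) s"
| cs_Choice1: "cstep w (Choice a b # K) s [] (a # K) s"
| cs_Choice2: "cstep w (Choice a b # K) s [] (b # K) s"
| cs_Star1: "cstep w (Star a # K) s [] K s"
| cs_Star2: "cstep w (Star a # K) s [] (a # Star a # K) s"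

inductive_simps cstep_simps:
  "cstep w [] s e K' s'"
  "cstep w (Out bs # K) s e K' s'"
  "cstep w (Input_Move d # K) s e K' s'"
  "cstep w (Upd i tbl # K) s e K' s'"
  "cstep w (Seq a b # K) s e K' s'"
  "cstep w (Cond T a b # K) s e K' s'"
  "cstep w (While T a # K) s e K' s'"
  "cstep w (Choice a b # K) s e K' s'"
  "cstep w (Star a # K) s e K' s'"

definition next_state :: "bool list \<Rightarrow> move \<Rightarrow> (nat \<times> move) list \<Rightarrow> tm_state \<Rightarrow> tm_state" where
  "next_state w d acts s = (min (move_head d (fst s)) (length w + 1), map2 act acts (snd s))"

lemma cstep_nexts:
  assumes "list_all (wf_com k S) K" "good k S s" "fst s \<le> length w + 1"
  shows "cstep w K s e K' s' \<longleftrightarrow>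
    (K', e, s') \<in> set (map (\<lambda>(K', d, acts, e). (K', e, next_state w d acts s))
      (nexts K (input_cell w (fst s)) (reads (snd s))))"
proof -
  \<comment> \<open>A move \<open>Stay\<close> must leave the input head in place although
    \<open>next_state\<close> clamps its position.\<close>
  have [simp]: "min (fst s) (Suc (length w)) = fst s" using assms(3) by simp
  have len: "length (snd s) = k" using assms(2) by (auto simp: good_def)
  show ?thesis using assms(1)
    by (cases "(K, input_cell w (fst s), reads (snd s))" rule: nexts.cases)
       (simp_all add: next_state_def map2_act_keep map2_act_keep_update len cstep_simps holds_def
          del: holds_simps split: option.split,
        auto simp: map2_act_keep_update len dest!: sym[of "Some _"])
qed

lemma cstep_conts_closed:
  assumes "cstep w K s e K' s'" "list_all (wf_com k S) K" "good k S s" "fst s \<le> length w + 1"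
    "K \<in> conts c"
  shows "K' \<in> conts c"
proof -
  have "(K', e, s') \<in> set (map (\<lambda>(K', d, acts, e). (K', e, next_state w d acts s))
      (nexts K (input_cell w (fst s)) (reads (snd s))))"
    using cstep_nexts assms(1-4) by blast
  then obtain d acts where "(K', d, acts, e) \<in> set (nexts K (input_cell w (fst s)) (reads (snd s)))"
    by auto
  from conts_closed[OF assms(5) this] show ?thesis by simp
qed

lemma good_cstep:
  assumes "cstep w K s e K' s'" "list_all (wf_com k S) K" "good k S s" "fst s \<le> length w + 1"
  shows "good k S s' \<and> fst s' \<le> length w + 1"
  using assms
proof (cases rule: cstep.cases)
  case (cs_Upd tbl i bd)
  obtain b d where bd: "bd = (b, d)" by (cases bd)
  have "b < S" "i < k" using cs_Upd assms(2) bd by (auto dest!: map_of_SomeD)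
  then show ?thesis using good_update[of k S "fst s" "snd s"] cs_Upd bd assms by simp
qed (auto simp: good_def)

inductive cruns :: "bool list \<Rightarrow> com list \<Rightarrow> tm_state \<Rightarrow> bool list \<Rightarrow> com list \<Rightarrow> tm_state \<Rightarrow> bool" for w where
  cruns_refl: "cruns w K s [] K s"
| cruns_step: "cstep w K s e K1 s1 \<Longrightarrow> cruns w K1 s1 out K' s' \<Longrightarrow> cruns w K s (e @ out) K' s'"

lemma cruns_trans: "cruns w K s o1 K1 s1 \<Longrightarrow> cruns w K1 s1 o2 K2 s2 \<Longrightarrow> cruns w K s (o1 @ o2) K2 s2"
  by (induction rule: cruns.induct) (auto intro: cruns_step)

context
  fixes k S :: nat and c :: com and w :: "bool list"
  assumes wf: "wf_com k S c"
begin

definition valid :: "com list \<Rightarrow> tm_state \<Rightarrow> bool" where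
  "valid K s \<longleftrightarrow> K \<in> conts c \<and> good k S s \<and> fst s \<le> length w + 1"

lemma rule_to_cstep:
  assumes "r \<in> rules (machine_of k S c)" "enabled w r (cfg K s)" "valid K s"
  shows "\<exists>K' s'. fire w r (cfg K s) = cfg K' s' \<and> cstep w K s (emit r) K' s' \<and> valid K' s'"
proof -
  obtain x rs K' d acts e where r: "r = \<lparr>source = to_nat K, input_read = x, work_read = rs,
      target = to_nat K', input_move = d, work_action = acts, emit = e\<rparr>"
    and mem: "K \<in> conts c" "(K', d, acts, e) \<in> set (nexts K x rs)"
    using assms(1,2) by (auto simp: machine_of_def enabled_def cfg_def)
  have xr: "x = input_cell w (fst s)" "rs = reads (snd s)"
    using assms(2) by (auto simp: r enabled_def cfg_def reads_def)
  have wfK: "list_all (wf_com k S) K" using conts_all(1)[OF wf mem(1)] .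
  have st: "cstep w K s e K' (next_state w d acts s)"
    unfolding cstep_nexts[OF wfK assms(3)[unfolded valid_def, THEN conjunct2, THEN conjunct1]
      assms(3)[unfolded valid_def, THEN conjunct2, THEN conjunct2]]
    using mem(2) xr by (auto intro!: rev_image_eqI)
  moreover have "valid K' (next_state w d acts s)"
    using good_cstep[OF st wfK] assms(3) conts_closed[OF mem] by (auto simp: valid_def)
  moreover have "fire w r (cfg K s) = cfg K' (next_state w d acts s)"
    by (simp add: r fire_def cfg_def next_state_def)
  ultimately show ?thesis
    by (intro exI[of _ K'] exI[of _ "next_state w d acts s"]) (simp add: r)
qed

lemma cstep_to_rule:
  assumes "cstep w K s e K' s'" "valid K s"
  shows "\<exists>r \<in> rules (machine_of k S c). enabled w r (cfg K s) \<and> fire w r (cfg K s) = cfg K' s' \<and>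
           emit r = e"
proof -
  have K: "K \<in> conts c" using assms(2) by (auto simp: valid_def)
  obtain d acts where n: "(K', d, acts, e) \<in> set (nexts K (input_cell w (fst s)) (reads (snd s)))"
    "s' = next_state w d acts s"
    using cstep_nexts[OF conts_all(1)[OF wf K]] assms by (auto simp: valid_def)
  let ?r = "\<lparr>source = to_nat K, input_read = input_cell w (fst s), work_read = reads (snd s),
      target = to_nat K', input_move = d, work_action = acts, emit = e\<rparr>"
  have "set (reads (snd s)) \<subseteq> {..<S}" "length (reads (snd s)) = k"
    using good_reads[of k S s] assms(2) by (auto simp: valid_def)
  then have "?r \<in> rules (machine_of k S c)"
    using n(1) K by (auto simp: machine_of_def)
  moreover have "enabled w ?r (cfg K s)" by (simp add: enabled_def cfg_def reads_def)
  moreover have "fire w ?r (cfg K s) = cfg K' s'"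
    by (simp add: fire_def cfg_def n(2) next_state_def)
  ultimately show ?thesis by auto
qed

lemma valid_cstep: "cstep w K s e K' s' \<Longrightarrow> valid K s \<Longrightarrow> valid K' s'"
  using good_cstep cstep_conts_closed conts_all(1)[OF wf] unfolding valid_def by metis

lemma cruns_to_run:
  "cruns w K s out K' s' \<Longrightarrow> valid K s \<Longrightarrow> run (machine_of k S c) w (cfg K s) out (cfg K' s')"
proof (induction rule: cruns.induct)
  case (cruns_step K s e K1 s1 out K' s')
  then show ?case
    using cstep_to_rule[OF cruns_step(1) cruns_step.prems] valid_cstep
    by (metis run_step)
qed (rule run_refl)

lemma run_to_cruns:
  "run (machine_of k S c) w x out y \<Longrightarrow> x = cfg K s \<Longrightarrow> valid K s \<Longrightarrow>
     \<exists>K' s'. y = cfg K' s' \<and> cruns w K s out K' s'"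
proof (induction arbitrary: K s rule: run.induct)
  case (run_step r x out y)
  then show ?case using rule_to_cstep by (metis cruns.cruns_step)
qed (auto intro: cruns_refl)

end

section \<open>Denotations of programs\<close>

text \<open>One notion serves both loops: \<open>while_rel\<close> adds the exit condition,
  \<open>star_rel\<close> takes the test to be constantly true. Outputs are concatenated along the
  way.\<close>

inductive iters :: "('s \<Rightarrow> bool) \<Rightarrow> ('s \<Rightarrow> ('o list \<times> 's) set) \<Rightarrow> 's \<Rightarrow> 'o list \<Rightarrow> 's \<Rightarrow> bool"
  for T R where
  iters_refl: "iters T R s [] s"
| iters_step: "T s \<Longrightarrow> (o1, t) \<in> R s \<Longrightarrow> iters T R t o2 u \<Longrightarrow> iters T R s (o1 @ o2) u"

definition rseq ::
  "('s \<Rightarrow> ('o list \<times> 's) set) \<Rightarrow> ('s \<Rightarrow> ('o list \<times> 's) set) \<Rightarrow> 's \<Rightarrow> ('o list \<times> 's) set" where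
  "rseq R R' s = {(o1 @ o2, u) | o1 t o2 u. (o1, t) \<in> R s \<and> (o2, u) \<in> R' t}"

lemma rseqI: "(o1, t) \<in> R s \<Longrightarrow> (o2, u) \<in> R' t \<Longrightarrow> (o1 @ o2, u) \<in> rseq R R' s"
  by (auto simp: rseq_def)

lemma rseq_single: "R s = {(o1, t)} \<Longrightarrow> rseq R R' s = (\<lambda>(o2, u). (o1 @ o2, u)) ` R' t"
  by (auto simp: rseq_def)

lemma rseq_single_nil: "R s = {([], t)} \<Longrightarrow> rseq R R' s = R' t"
  by (auto simp: rseq_def)

lemma rseq_empty [simp]: "R s = {} \<Longrightarrow> rseq R R' s = {}"
  by (auto simp: rseq_def)

definition while_rel ::
  "('s \<Rightarrow> bool) \<Rightarrow> ('s \<Rightarrow> ('o list \<times> 's) set) \<Rightarrow> 's \<Rightarrow> ('o list \<times> 's) set" where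
  "while_rel T R s = {(out, t). iters T R s out t \<and> \<not> T t}"

definition star_rel :: "('s \<Rightarrow> ('o list \<times> 's) set) \<Rightarrow> 's \<Rightarrow> ('o list \<times> 's) set" where
  "star_rel R s = {(out, t). iters (\<lambda>_. True) R s out t}"

lemma while_rel_False: "\<not> T s \<Longrightarrow> while_rel T R s = {([], s)}"
  by (auto simp: while_rel_def iters.simps[of T R s])

lemma while_rel_True: "T s \<Longrightarrow> while_rel T R s = rseq R (while_rel T R) s"
  unfolding while_rel_def rseq_def by (auto simp: iters.simps[of T R s])

text \<open>A simulation argument with state map \<open>f\<close> and invariant \<open>P\<close>. It
  transfers loops over counters to loops over tapes.\<close>

lemma iters_image:
  assumes T: "\<And>s. P s \<Longrightarrow> T' (f s) \<longleftrightarrow> T s"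
    and R: "\<And>s. P s \<Longrightarrow> T s \<Longrightarrow> R' (f s) = (\<lambda>(out, t). (out, f t)) ` R s"
    and P: "\<And>s out t. P s \<Longrightarrow> T s \<Longrightarrow> (out, t) \<in> R s \<Longrightarrow> P t"
    and "P s"
  shows "{(out, t). iters T' R' (f s) out t} = (\<lambda>(out, t). (out, f t)) ` {(out, t). iters T R s out t \<and> P t}"
proof -
  have 1: "iters T' R' x out y \<Longrightarrow> P s \<Longrightarrow> x = f s \<Longrightarrow> \<exists>t. y = f t \<and> P t \<and> iters T R s out t" for x out y s
  proof (induction arbitrary: s rule: iters.induct)
    case (iters_step x o1 y o2 z)
    then have "T s" using T by auto
    then obtain t where t: "y = f t" "(o1, t) \<in> R s" using R[of s] iters_step by auto
    then have "P t" using P \<open>T s\<close> iters_step.prems by blast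
    then show ?case using iters_step.IH[of t] t \<open>T s\<close> by (auto intro: iters.intros)
  qed (auto intro: iters.intros)
  have 2: "iters T R s out t \<Longrightarrow> P s \<Longrightarrow> iters T' R' (f s) out (f t) \<and> P t" for s out t
  proof (induction rule: iters.induct)
    case (iters_step s o1 t o2 u)
    then have "(o1, f t) \<in> R' (f s)" using R by force
    then show ?case using iters_step T P by (auto intro: iters.intros)
  qed (auto intro: iters.intros)
  show ?thesis using 1 2 \<open>P s\<close> by fastforce
qed

primrec cden :: "bool list \<Rightarrow> com \<Rightarrow> tm_state \<Rightarrow> (bool list \<times> tm_state) set" where
  "cden w (Out bs) = (\<lambda>s. {(bs, s)})"
| "cden w (Input_Move d) = (\<lambda>s. {([], min (move_head d (fst s)) (length w + 1), snd s)})"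
| "cden w (Upd i tbl) = (\<lambda>s. case map_of tbl (reads (snd s) ! i) of None \<Rightarrow> {}
     | Some bd \<Rightarrow> {([], fst s, (snd s)[i := act bd (snd s ! i)])})"
| "cden w (Seq a b) = rseq (cden w a) (cden w b)"
| "cden w (Cond T a b) = (\<lambda>s. if holds w T s then cden w a s else cden w b s)"
| "cden w (While T a) = while_rel (holds w T) (cden w a)"
| "cden w (Choice a b) = (\<lambda>s. cden w a s \<union> cden w b s)"
| "cden w (Star a) = star_rel (cden w a)"

primrec kden :: "bool list \<Rightarrow> com list \<Rightarrow> tm_state \<Rightarrow> (bool list \<times> tm_state) set" where
  "kden w [] = (\<lambda>s. {([], s)})"
| "kden w (c # K) = rseq (cden w c) (kden w K)"

lemma rseq_assoc: "rseq (rseq R R') R'' s = rseq R (rseq R' R'') s"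
  by (auto simp: rseq_def) (metis append.assoc)+

lemma rseq_cong: "R s = R2 s \<Longrightarrow> rseq R R' s = rseq R2 R' s"
  by (auto simp: rseq_def)

text \<open>Read backwards, a small step puts its output in front of each outcome of what remains;
  for loops this is the unfolding of the iteration.\<close>

lemma cstep_kden:
  assumes "cstep w K s e K' s'" "(out, t) \<in> kden w K' s'"
  shows "(e @ out, t) \<in> kden w K s"
  using assms
proof (cases rule: cstep.cases)
  case (cs_While T a K0)
  show ?thesis
  proof (cases "holds w T s")
    case True
    have "kden w (While T a # K0) s = rseq (rseq (cden w a) (cden w (While T a))) (kden w K0) s"
      unfolding kden.simps cden.simps by (rule rseq_cong, rule while_rel_True, rule True)
    also have "\<dots> = kden w (a # While T a # K0) s"
      unfolding kden.simps rseq_assoc ..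
    finally have eq: "kden w (While T a # K0) s = kden w (a # While T a # K0) s" .
    have "K = While T a # K0" "e = []" "s' = s" using cs_While by blast+
    moreover have "K' = a # While T a # K0" using cs_While(3) True by argo
    ultimately show ?thesis using assms(2) eq by (metis append_Nil)
  qed (use cs_While assms(2) in \<open>simp add: while_rel_False rseq_single_nil\<close>)
next
  case (cs_Star1 a)
  have "([], s) \<in> star_rel (cden w a) s" by (simp add: star_rel_def iters_refl)
  then have "([] @ out, t) \<in> rseq (star_rel (cden w a)) (kden w K') s"
    by (rule rseqI) (use cs_Star1 assms(2) in simp)
  then show ?thesis using cs_Star1 by simp
next
  case (cs_Star2 a K0)
  then obtain o1 o2 o3 s1 s2 where "(o1, s1) \<in> cden w a s" "(o2, s2) \<in> star_rel (cden w a) s1"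
    "(o3, t) \<in> kden w K0 s2" "out = o1 @ o2 @ o3"
    using assms(2) by (auto simp: rseq_def)
  moreover from this have "(o1 @ o2, s2) \<in> star_rel (cden w a) s"
    by (auto simp: star_rel_def intro: iters_step)
  ultimately show ?thesis using cs_Star2 rseqI[of "o1 @ o2" s2 "star_rel (cden w a)" s o3 t "kden w K0"]
    by simp
next
  case (cs_Seq a b K0)
  then have "(out, t) \<in> rseq (cden w a) (rseq (cden w b) (kden w K0)) s" using assms(2) by simp
  then have "(out, t) \<in> rseq (rseq (cden w a) (cden w b)) (kden w K0) s" unfolding rseq_assoc .
  then show ?thesis using cs_Seq by simp
next
  case (cs_Cond T a b K0)
  then show ?thesis using assms(2) by (cases "holds w T s") (simp_all add: rseq_def)
next
  case (cs_Upd tbl i bd)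
  then show ?thesis using assms(2) by (cases t) (simp add: rseq_def)
next
  case (cs_Choice1 a b K0)
  then show ?thesis using assms(2) by (simp add: rseq_def) blast
next
  case (cs_Choice2 a b K0)
  then show ?thesis using assms(2) by (simp add: rseq_def) blast
qed (use assms(2) in \<open>cases t; cases s; simp add: rseq_def\<close>)+

lemma cruns_kden: "cruns w K s out K' s' \<Longrightarrow> (o2, t) \<in> kden w K' s' \<Longrightarrow> (out @ o2, t) \<in> kden w K s"
  by (induction rule: cruns.induct) (auto dest: cstep_kden)

lemma cruns_one: "cstep w K s e K1 s1 \<Longrightarrow> cruns w K s e K1 s1"
  using cruns_step[OF _ cruns_refl] by fastforce

text \<open>The arbitrary continuation \<open>K\<close> lets the induction pass through sequences
  and loop bodies.\<close>

lemma cden_cruns: "(out, t) \<in> cden w c s \<Longrightarrow> cruns w (c # K) s out K t"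
proof (induction c arbitrary: s out t K)
  case (Out bs)
  then show ?case by (auto intro: cruns_one cs_Out)
next
  case (Input_Move d)
  then show ?case using cruns_one[OF cs_Move] by auto
next
  case (Upd i tbl)
  then show ?case using cruns_one[OF cs_Upd] by (auto split: option.splits)
next
  case (Seq a b)
  then obtain o1 o2 u where "(o1, u) \<in> cden w a s" "(o2, t) \<in> cden w b u" "out = o1 @ o2"
    by (auto simp: rseq_def)
  then have "cruns w (a # b # K) s out K t"
    using Seq.IH(1)[of o1 u s "b # K"] Seq.IH(2)[of o2 t u K] by (metis cruns_trans)
  then show ?case using cruns_step[OF cs_Seq] by fastforce
next
  case (Cond T a b)
  then have "cruns w ((if holds w T s then a else b) # K) s out K t" by (auto split: if_splits)
  then show ?case using cruns_step[OF cs_Cond] by fastforce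
next
  case (While T a)
  have "iters (holds w T) (cden w a) s out t \<Longrightarrow> \<not> holds w T t \<Longrightarrow>
      cruns w (While T a # K) s out K t" for s
  proof (induction rule: iters.induct)
    case (iters_refl s)
    then show ?case using cruns_one[OF cs_While[of w T a K s]] by simp
  next
    case (iters_step s o1 u o2 v)
    then have "cruns w (a # While T a # K) s (o1 @ o2) K v"
      by (metis cruns_trans While.IH)
    then show ?case using cruns_step[OF cs_While[of w T a K s]] iters_step by fastforce
  qed
  then show ?case using While.prems by (auto simp: while_rel_def)
next
  case (Choice a b)
  then show ?case using cruns_step[OF cs_Choice1] cruns_step[OF cs_Choice2]
    by simp (metis append_Nil)
next
  case (Star a)
  have "iters (\<lambda>_. True) (cden w a) s out t \<Longrightarrow> cruns w (Star a # K) s out K t" for s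
  proof (induction rule: iters.induct)
    case (iters_refl s)
    then show ?case using cruns_one[OF cs_Star1] by simp
  next
    case (iters_step s o1 u o2 v)
    then have "cruns w (a # Star a # K) s (o1 @ o2) K v"
      by (metis cruns_trans Star.IH)
    then show ?case using cruns_step[OF cs_Star2] by fastforce
  qed
  then show ?case using Star.prems by (auto simp: star_rel_def)
qed

lemma cden_iff_cruns: "(out, t) \<in> cden w c s \<longleftrightarrow> cruns w [c] s out [] t"
  using cden_cruns[of out t w c s "[]"] cruns_kden[of w "[c]" s out "[]" t "[]" t]
  by (auto simp: rseq_def)

section \<open>Space bounds\<close>

text \<open>Position \<open>m\<close> holds the end marker of each tape. Programs satisfying
  \<open>bounded_com\<close> preserve this in every step, which bounds the space of all runs and not
  only of terminating ones.\<close>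

definition marked :: "nat \<Rightarrow> tm_state \<Rightarrow> bool" where
  "marked m s \<longleftrightarrow> (\<forall>(t, h) \<in> set (snd s). h \<le> m \<and> t m = 2)"

lemma marked_cstep:
  assumes "cstep w K s e K' s'" "list_all bounded_com K" "marked m s"
  shows "list_all bounded_com K' \<and> marked m s'"
  using assms
proof (cases rule: cstep.cases)
  case (cs_Upd tbl i bd)
  obtain t h where th: "snd s ! i = (t, h)" by (cases "snd s ! i")
  obtain b d where bd: "bd = (b, d)" by (cases bd)
  have "marked m s'"
  proof (cases "i < length (snd s)")
    case True
    then have t: "h \<le> m" "t m = 2" using assms(3) th nth_mem[OF True] by (auto simp: marked_def)
    have "(t h, b, d) \<in> set tbl"
      using cs_Upd True th bd by (auto simp: reads_def dest!: map_of_SomeD)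
    then have "t h = 2 \<longrightarrow> b = 2 \<and> d \<noteq> MoveRight" using cs_Upd assms(2) by auto
    then have "(t(h := b)) m = 2 \<and> move_head d h \<le> m"
      using t by (cases d; cases "h = m") auto
    then have "case act bd (t, h) of (t, h) \<Rightarrow> h \<le> m \<and> t m = 2"
      by (simp add: act_def bd)
    then show ?thesis using assms(3) cs_Upd th
      by (auto simp: marked_def dest!: set_update_subset_insert[THEN subsetD])
  qed (use cs_Upd assms(3) in \<open>auto simp: marked_def list_update_beyond\<close>)
  then show ?thesis using cs_Upd assms by simp
qed (auto simp: marked_def)

lemma marked_cruns:
  "cruns w K s out K' s' \<Longrightarrow> list_all bounded_com K \<Longrightarrow> marked m s \<Longrightarrow> marked m s'"
  by (induction rule: cruns.induct) (blast dest: marked_cstep)+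

section \<open>Deterministic executions with bounded heads\<close>

definition heads_le :: "nat \<Rightarrow> tm_state \<Rightarrow> bool" where
  "heads_le n s \<longleftrightarrow> (\<forall>(t, h) \<in> set (snd s). h \<le> n)"

text \<open>Big-step execution without choice or output that also records the head bound at the
  start of every subprogram. It yields the denotation of a macro and, for the initial phase, a space
  bound while there is no end marker yet.\<close>

inductive dexec :: "bool list \<Rightarrow> nat \<Rightarrow> com \<Rightarrow> tm_state \<Rightarrow> tm_state \<Rightarrow> bool" for w n where
  dx_Skip: "heads_le n s \<Longrightarrow> dexec w n (Out []) s s"
| dx_Move: "heads_le n s \<Longrightarrow> ip = min (move_head d (fst s)) (length w + 1) \<Longrightarrow>
     dexec w n (Input_Move d) s (ip, snd s)"
| dx_Upd: "heads_le n s \<Longrightarrow> map_of tbl (reads (snd s) ! i) = Some bd \<Longrightarrow>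
     s' = (fst s, (snd s)[i := act bd (snd s ! i)]) \<Longrightarrow> dexec w n (Upd i tbl) s s'"
| dx_Seq: "dexec w n a s t \<Longrightarrow> dexec w n b t u \<Longrightarrow> heads_le n s \<Longrightarrow> dexec w n (Seq a b) s u"
| dx_Cond: "dexec w n (if holds w T s then a else b) s t \<Longrightarrow> heads_le n s \<Longrightarrow> dexec w n (Cond T a b) s t"
| dx_While_False: "heads_le n s \<Longrightarrow> \<not> holds w T s \<Longrightarrow> dexec w n (While T a) s s"
| dx_While_True: "heads_le n s \<Longrightarrow> holds w T s \<Longrightarrow> dexec w n a s t \<Longrightarrow> dexec w n (While T a) t u \<Longrightarrow>
     dexec w n (While T a) s u"

lemma dexec_cden: "dexec w n c s t \<Longrightarrow> cden w c s = {([], t)}"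
proof (induction rule: dexec.induct)
  case (dx_While_True s T a t u)
  then show ?case by (simp add: while_rel_True[of _ s] rseq_single_nil)
next
  case (dx_Seq a s t b u)
  then show ?case by (simp add: rseq_single_nil)
qed (simp_all add: while_rel_False split: if_splits)

lemma dexec_heads: "dexec w n c s t \<Longrightarrow> heads_le n s"
  by (erule dexec.cases) auto

lemma cruns_cases:
  assumes "cruns w K s out K' s'"
  obtains "K' = K" "s' = s" "out = []"
  | e K1 s1 out' where "cstep w K s e K1 s1" "cruns w K1 s1 out' K' s'" "out = e @ out'"
  using assms by (cases rule: cruns.cases) auto

text \<open>Determinism leaves two cases: either the run is still inside \<open>c\<close>, where the
  heads are bounded and the continuation is not empty, or it has passed through \<open>t\<close> and
  goes on from there.\<close>

lemma dexec_cruns: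
  assumes "dexec w n c s t" "cruns w (c # K) s out K' s'"
  shows "(heads_le n s' \<and> K' \<noteq> []) \<or> cruns w K t out K' s'"
  using assms
proof (induction arbitrary: K out rule: dexec.induct)
  case (dx_Seq a s t b u)
  from dx_Seq.prems show ?case
  proof (cases rule: cruns_cases)
    case (2 e K1 s1 out')
    then have "cruns w (a # b # K) s out K' s'" by (auto simp: cstep_simps)
    then show ?thesis using dx_Seq.IH by blast
  qed (use dx_Seq in auto)
next
  case (dx_Cond T s a b t)
  from dx_Cond.prems show ?case
  proof (cases rule: cruns_cases)
    case (2 e K1 s1 out')
    then have "cruns w ((if holds w T s then a else b) # K) s out K' s'" by (auto simp: cstep_simps)
    then show ?thesis using dx_Cond.IH by blast
  qed (use dx_Cond in auto)
next
  case (dx_While_True s T a t u)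
  from dx_While_True.prems show ?case
  proof (cases rule: cruns_cases)
    case (2 e K1 s1 out')
    then have "cruns w (a # While T a # K) s out K' s'"
      using dx_While_True.hyps by (auto simp: cstep_simps)
    then show ?thesis using dx_While_True.IH by blast
  qed (use dx_While_True in auto)
qed (erule cruns_cases; auto simp: cstep_simps)+

section \<open>Numbers on tapes\<close>

definition tp :: "nat list \<Rightarrow> nat \<Rightarrow> nat" where
  "tp xs j = (if j < length xs then xs ! j else 0)"

lemma tp_nil [simp]: "tp [] = (\<lambda>_. 0)"
  by (auto simp: tp_def)

lemma tp_update: "h < length xs \<Longrightarrow> (tp xs)(h := b) = tp (xs[h := b])"
  by (auto simp: tp_def fun_eq_iff)

lemma tp_update_end: "(tp xs)(length xs := b) = tp (xs @ [b])"
  by (auto simp: tp_def fun_eq_iff nth_append)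

definition on_tape :: "nat \<Rightarrow> tape list \<Rightarrow> nat \<Rightarrow> nat list \<Rightarrow> nat \<Rightarrow> tm_state" where
  "on_tape ip wk i xs h = (ip, wk[i := (tp xs, h)])"

context
  fixes w :: "bool list" and n ip :: nat and wk :: "tape list" and i :: nat
  assumes i: "i < length wk" and wk: "heads_le n (ip, wk)"
begin

lemma heads_on_tape: "h \<le> n \<Longrightarrow> heads_le n (on_tape ip wk i xs h)"
  using wk by (auto simp: on_tape_def heads_le_def dest!: set_update_subset_insert[THEN subsetD])

lemma reads_on_tape: "reads (snd (on_tape ip wk i xs h)) ! i = tp xs h"
  using i by (simp add: on_tape_def reads_def)

lemma dexec_Upd:
  assumes "h < length xs" "h \<le> n" "map_of tbl (xs ! h) = Some (b, d)"
  shows "dexec w n (Upd i tbl) (on_tape ip wk i xs h) (on_tape ip wk i (xs[h := b]) (move_head d h))"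
proof (rule dx_Upd[of n "on_tape ip wk i xs h" tbl i "(b, d)"])
  show "map_of tbl (reads (snd (on_tape ip wk i xs h)) ! i) = Some (b, d)"
    unfolding reads_on_tape using assms by (simp add: tp_def)
qed (use assms i in \<open>simp_all add: heads_on_tape\<close>, simp add: on_tape_def act_def tp_update)

lemma dexec_Upd_end:
  assumes "length xs \<le> n" "map_of tbl 0 = Some (b, d)"
  shows "dexec w n (Upd i tbl) (on_tape ip wk i xs (length xs)) (on_tape ip wk i (xs @ [b]) (move_head d (length xs)))"
proof (rule dx_Upd[of n "on_tape ip wk i xs (length xs)" tbl i "(b, d)"])
  show "map_of tbl (reads (snd (on_tape ip wk i xs (length xs))) ! i) = Some (b, d)"
    unfolding reads_on_tape using assms by (simp add: tp_def)
qed (use assms i in \<open>simp_all add: heads_on_tape\<close>, simp add: on_tape_def act_def tp_update_end)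

text \<open>The common core of carries and borrows, where \<open>g\<close> overwrites the digits
  passed, and of plain scans, where \<open>g\<close> is the identity.\<close>

lemma dexec_sweep_right:
  assumes "set mid \<subseteq> set A" "tp (pre @ mid @ post) (length (pre @ mid)) \<notin> set A"
    "length (pre @ mid) \<le> n"
  shows "dexec w n (While (Tape_In i A) (Upd i (map (\<lambda>a. (a, g a, MoveRight)) A)))
    (on_tape ip wk i (pre @ mid @ post) (length pre)) (on_tape ip wk i (pre @ map g mid @ post) (length (pre @ mid)))"
  using assms
proof (induction mid arbitrary: pre)
  case Nil
  then show ?case
    by (auto intro!: dx_While_False heads_on_tape simp: reads_on_tape)
next
  case (Cons a mid)
  have a: "(pre @ (a # mid) @ post) ! length pre = a" "a \<in> set A" using Cons.prems by auto
  have "dexec w n (Upd i (map (\<lambda>a. (a, g a, MoveRight)) A)) (on_tape ip wk i (pre @ (a # mid) @ post) (length pre))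
    (on_tape ip wk i ((pre @ (a # mid) @ post)[length pre := g a]) (move_head MoveRight (length pre)))"
    using a Cons.prems by (intro dexec_Upd) (auto simp: map_of_map_restrict)
  then have "dexec w n (Upd i (map (\<lambda>a. (a, g a, MoveRight)) A)) (on_tape ip wk i (pre @ (a # mid) @ post) (length pre))
    (on_tape ip wk i ((pre @ [g a]) @ mid @ post) (length (pre @ [g a])))"
    by (simp add: list_update_append)
  moreover have "dexec w n (While (Tape_In i A) (Upd i (map (\<lambda>a. (a, g a, MoveRight)) A)))
    (on_tape ip wk i ((pre @ [g a]) @ mid @ post) (length (pre @ [g a])))
    (on_tape ip wk i ((pre @ [g a]) @ map g mid @ post) (length ((pre @ [g a]) @ mid)))"
    using Cons.prems by (intro Cons.IH) (auto simp: tp_def nth_append)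
  moreover have "holds w (Tape_In i A) (on_tape ip wk i (pre @ (a # mid) @ post) (length pre))"
    using a by (simp add: reads_on_tape tp_def)
  ultimately show ?case
    using Cons.prems dx_While_True heads_on_tape[of "length pre"] by fastforce
qed

lemma dexec_sweep_left:
  assumes "h < length xs" "h \<le> n" "xs ! 0 \<notin> set A" "\<And>j. 0 < j \<Longrightarrow> j \<le> h \<Longrightarrow> xs ! j \<in> set A"
  shows "dexec w n (While (Tape_In i A) (Upd i (map (\<lambda>a. (a, a, MoveLeft)) A)))
    (on_tape ip wk i xs h) (on_tape ip wk i xs 0)"
  using assms
proof (induction h)
  case 0
  then show ?case
    by (auto intro!: dx_While_False heads_on_tape simp: reads_on_tape tp_def)
next
  case (Suc h)
  then have a: "xs ! Suc h \<in> set A" by simp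
  have "dexec w n (Upd i (map (\<lambda>a. (a, a, MoveLeft)) A)) (on_tape ip wk i xs (Suc h))
    (on_tape ip wk i (xs[Suc h := xs ! Suc h]) (move_head MoveLeft (Suc h)))"
    using Suc.prems a by (intro dexec_Upd) (auto simp: map_of_map_restrict)
  moreover have "holds w (Tape_In i A) (on_tape ip wk i xs (Suc h))"
    using a Suc.prems by (simp add: reads_on_tape tp_def)
  ultimately show ?case
    using Suc dx_While_True heads_on_tape[of "Suc h"] by simp
qed

end

text \<open>Isolates the block of digits through which a carry or a borrow propagates.\<close>

lemma split_leading: "\<exists>m rest. ds = replicate m (x :: nat) @ rest \<and> (rest = [] \<or> hd rest \<noteq> x)"
proof (induction ds)
  case Nil
  then show ?case by (intro exI[of _ 0] exI[of _ "[]"]) simp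
next
  case (Cons d ds)
  then obtain m rest where "ds = replicate m x @ rest" "rest = [] \<or> hd rest \<noteq> x" by blast
  then show ?case
    by (cases "d = x")
      (auto intro: exI[of _ "Suc m"] exI[of _ rest] exI[of _ 0] exI[of _ "d # ds"])
qed

text \<open>Binary counting on an initially empty list of digits fixes the length of the tapes.\<close>

primrec bin_inc :: "nat list \<Rightarrow> nat list" where
  "bin_inc [] = [1]"
| "bin_inc (d # ds) = (if d = 1 then 0 # bin_inc ds else 1 # ds)"

primrec bin_val :: "nat list \<Rightarrow> nat" where
  "bin_val [] = 0"
| "bin_val (d # ds) = d + 2 * bin_val ds"

definition bits :: "nat \<Rightarrow> nat list" where
  "bits n = (bin_inc ^^ n) []"

lemma bits_simps [simp]: "bits 0 = []" "bits (Suc n) = bin_inc (bits n)"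
  by (simp_all add: bits_def)

lemma bin_inc_leading:
  "bin_inc (replicate m 1 @ rest) = replicate m 0 @ bin_inc rest"
  by (induction m) auto

lemma bits_props:
  "set (bits n) \<subseteq> {0, 1} \<and> bin_val (bits n) = n \<and> (bits n = [] \<or> last (bits n) = 1)"
proof (induction n)
  case (Suc n)
  have "set ds \<subseteq> {0, 1} \<Longrightarrow> ds = [] \<or> last ds = 1 \<Longrightarrow>
    set (bin_inc ds) \<subseteq> {0, 1} \<and> bin_val (bin_inc ds) = Suc (bin_val ds) \<and>
    bin_inc ds \<noteq> [] \<and> last (bin_inc ds) = 1" for ds
    by (induction ds) (auto split: if_splits)
  with Suc show ?case by auto
qed auto

lemma bin_val_less: "set ds \<subseteq> {0, 1} \<Longrightarrow> bin_val ds < 2 ^ length ds"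
  by (induction ds) auto

lemma bin_val_ge: "ds \<noteq> [] \<Longrightarrow> last ds = 1 \<Longrightarrow> 2 ^ (length ds - 1) \<le> bin_val ds"
proof (induction ds)
  case (Cons d ds)
  then show ?case by (cases ds) auto
qed auto

lemma length_bin_inc: "length ds \<le> length (bin_inc ds)"
  by (induction ds) auto

lemma length_bits_mono: "m \<le> n \<Longrightarrow> length (bits m) \<le> length (bits n)"
  by (induction rule: dec_induct) (auto intro: order_trans[OF _ length_bin_inc])

text \<open>The initial phase increments a binary number once for each input cell, the two end
  markers included; this is the number of digits it ends up with.\<close>

definition tape_len :: "bool list \<Rightarrow> nat" where
  "tape_len w = length (bits (length w + 2))"

lemma tape_len_bounds:
  "2 ^ (tape_len w - 1) \<le> length w + 2" "length w + 2 < 2 ^ tape_len w" "tape_len w \<ge> 2"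
proof -
  let ?b = "bits (length w + 2)"
  have p: "set ?b \<subseteq> {0, 1}" "bin_val ?b = length w + 2" "?b = [] \<or> last ?b = 1"
    using bits_props by blast+
  have "?b \<noteq> []" using p(2) by auto
  then show "2 ^ (tape_len w - 1) \<le> length w + 2"
    using bin_val_ge[of ?b] p unfolding tape_len_def by metis
  show *: "length w + 2 < 2 ^ tape_len w"
    using bin_val_less[OF p(1)] p(2) unfolding tape_len_def by simp
  show "tape_len w \<ge> 2"
  proof (rule ccontr)
    assume "\<not> tape_len w \<ge> 2"
    then have "(2 :: nat) ^ tape_len w \<le> 2 ^ 1" by (intro power_increasing) auto
    then show False using * by simp
  qed
qed

text \<open>A tape has \<open>tape_len w + 2\<close> cells in use, digits and two markers. Since the
  logarithm is at least 1 and \<open>tape_len w\<close> exceeds it by at most 1, the factor 4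
  absorbs the additive 3.\<close>

lemma tape_len_log: "real (tape_len w + 2) \<le> 4 * log 2 (real (length w + 2))"
proof -
  have "real (tape_len w - 1) = log 2 (2 ^ (tape_len w - 1))" by simp
  also have "\<dots> \<le> log 2 (real (length w + 2))"
    using of_nat_mono[OF tape_len_bounds(1)[of w], where ?'a = real]
    by (subst log_le_cancel_iff) auto
  finally have "real (tape_len w) \<le> log 2 (real (length w + 2)) + 1" by linarith
  moreover have "1 \<le> log 2 (real (length w + 2))" by (subst le_log_iff) auto
  moreover have "real (tape_len w + 2) = real (tape_len w) + 2" by simp
  ultimately show ?thesis by linarith
qed

text \<open>Counters with \<open>tape_len w\<close> digits range up to a polynomial in the input
  length whose degree grows with the base. Base 2 is enough for membership in NL; for hardness the
  base depends on the machine to be simulated.\<close>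

locale base =
  fixes b :: nat
  assumes b2: "b \<ge> 2"
begin

primrec digs :: "nat \<Rightarrow> nat \<Rightarrow> nat list" where
  "digs 0 v = []"
| "digs (Suc l) v = v mod b # digs l (v div b)"

lemma length_digs [simp]: "length (digs l v) = l"
  by (induction l arbitrary: v) auto

lemma set_digs: "set (digs l v) \<subseteq> {..<b}"
  using b2 by (induction l arbitrary: v) auto

lemma digs_zero: "digs l 0 = replicate l 0"
  by (induction l) auto

lemma digs_eq_zero: "v < b ^ l \<Longrightarrow> digs l v = replicate l 0 \<longleftrightarrow> v = 0"
proof (induction l arbitrary: v)
  case (Suc l)
  have "v div b < b ^ l" using Suc.prems b2 by (simp add: less_mult_imp_div_less mult.commute)
  then show ?case using Suc.IH b2 by auto
qed auto

lemma digs_add: "digs l (v + b ^ l * c) = digs l v"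
proof (induction l arbitrary: v)
  case (Suc l)
  have "(v + b ^ Suc l * c) mod b = v mod b" by (simp add: mult.assoc)
  moreover have "(v + b ^ Suc l * c) div b = v div b + b ^ l * c"
    using b2 by (simp add: mult.assoc)
  ultimately show ?case using Suc by simp
qed auto

lemma digs_mod: "digs l (v mod b ^ l) = digs l v"
  using digs_add[of l "v mod b ^ l" "v div b ^ l"] by simp

text \<open>The least significant digit comes first, and a carry out of the last digit is lost: this
  is arithmetic modulo the power of the base.\<close>

primrec inc_digs :: "nat list \<Rightarrow> nat list" where
  "inc_digs [] = []"
| "inc_digs (d # ds) = (if d = b - 1 then 0 # inc_digs ds else Suc d # ds)"

primrec dec_digs :: "nat list \<Rightarrow> nat list" where
  "dec_digs [] = []"
| "dec_digs (d # ds) = (if d = 0 then (b - 1) # dec_digs ds else (d - 1) # ds)"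

lemma inc_digs: "inc_digs (digs l v) = digs l (Suc v)"
proof (induction l arbitrary: v)
  case (Suc l)
  have "Suc (v mod b) = b \<longleftrightarrow> v mod b = b - 1" using b2 by auto
  then show ?case using Suc by (simp add: mod_Suc div_Suc)
qed auto

lemma dec_digs_Suc: "dec_digs (digs l (Suc v)) = digs l v"
proof (induction l arbitrary: v)
  case (Suc l)
  show ?case using Suc b2 by (auto simp: mod_Suc div_Suc)
qed auto

text \<open>Adding \<open>b ^ l\<close> does not change the last \<open>l\<close> digits, so the
  predecessor can be taken at 0 as well.\<close>

lemma dec_digs: "dec_digs (digs l v) = digs l ((v + (b ^ l - 1)) mod b ^ l)"
proof -
  have "b ^ l \<ge> 1" using b2 by simp
  then have "v + b ^ l * 1 = Suc (v + (b ^ l - 1))" by simp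
  then have "digs l v = digs l (Suc (v + (b ^ l - 1)))" using digs_add[of l v 1] by metis
  then show ?thesis by (simp add: dec_digs_Suc digs_mod)
qed

lemma inc_digs_leading:
  "inc_digs (replicate m (b - 1) @ rest) = replicate m 0 @ inc_digs rest"
  by (induction m) auto

lemma dec_digs_leading:
  "dec_digs (replicate m 0 @ rest) = replicate m (b - 1) @ dec_digs rest"
  by (induction m) auto

text \<open>Symbol 0 is blank, 1 and 2 are the end markers and \<open>d + 3\<close> is the digit \<open>d\<close>.\<close>

definition enc :: "nat list \<Rightarrow> nat list" where
  "enc ds = 1 # map (\<lambda>d. d + 3) ds @ [2]"

definition return :: "nat \<Rightarrow> com" where
  "return i = While (Tape_In i (2 # [3..<b + 3]))
     (Upd i (map (\<lambda>a. (a, a, MoveLeft)) (2 # [3..<b + 3])))"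

text \<open>Symbol \<open>b + 2\<close> is the largest digit and symbol 3 the digit zero. The sweep
  performs the carry; if it ends on the end marker, all digits were maximal and the number has
  wrapped to zero.\<close>

definition inc_com :: "nat \<Rightarrow> com" where
  "inc_com i = Seq (Upd i [(1, 1, MoveRight)])
     (Seq (While (Tape_In i [b + 2]) (Upd i (map (\<lambda>a. (a, 3, MoveRight)) [b + 2])))
     (Seq (Upd i ((2, 2, Stay) # map (\<lambda>a. (a, a + 1, Stay)) [3..<b + 2]))
       (return i)))"

definition dec_com :: "nat \<Rightarrow> com" where
  "dec_com i = Seq (Upd i [(1, 1, MoveRight)])
     (Seq (While (Tape_In i [3]) (Upd i (map (\<lambda>a. (a, b + 2, MoveRight)) [3])))
     (Seq (Upd i ((2, 2, Stay) # map (\<lambda>a. (a, a - 1, Stay)) [4..<b + 3]))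
       (return i)))"

text \<open>The head stops on the first nonzero digit or on the end marker, and
  \<open>nonzero\<close> tells the two apart. The head still has to be sent back in either
  branch.\<close>

definition test_com :: "nat \<Rightarrow> com" where
  "test_com i = Seq (Upd i [(1, 1, MoveRight)])
     (While (Tape_In i [3]) (Upd i (map (\<lambda>a. (a, a, MoveRight)) [3])))"

definition nonzero :: "nat \<Rightarrow> test" where
  "nonzero i = Tape_In i [4..<b + 3]"

text \<open>Binary increment on a tape that has no end marker yet: a carry that runs onto a blank
  appends a new digit 1, whose symbol is 4.\<close>

definition grow_com :: "nat \<Rightarrow> com" where
  "grow_com i = Seq (Upd i [(1, 1, MoveRight)])
     (Seq (While (Tape_In i [4]) (Upd i (map (\<lambda>a. (a, 3, MoveRight)) [4])))
     (Seq (Upd i [(3, 4, Stay), (0, 4, Stay)])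
       (return i)))"

text \<open>Only the number of digits is of interest; the digits are reset and the end marker is
  placed behind them.\<close>

definition finish_com :: "nat \<Rightarrow> com" where
  "finish_com i = Seq (Upd i [(1, 1, MoveRight)])
     (Seq (While (Tape_In i [3, 4]) (Upd i (map (\<lambda>a. (a, 3, MoveRight)) [3, 4])))
     (Seq (Upd i [(0, 2, Stay)])
       (return i)))"

definition lead :: "nat list \<Rightarrow> nat" where
  "lead ds = length (takeWhile (\<lambda>d. d = 0) ds)"

context
  fixes w :: "bool list" and n ip :: nat and wk :: "tape list" and i :: nat
  assumes i: "i < length wk" and wk: "heads_le n (ip, wk)"
begin

lemma dexec_return:
  assumes "h < length xs" "h \<le> n" "xs ! 0 = 1" "\<And>j. 0 < j \<Longrightarrow> j \<le> h \<Longrightarrow> xs ! j \<in> {2..<b + 3}"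
  shows "dexec w n (return i) (on_tape ip wk i xs h) (on_tape ip wk i xs 0)"
  unfolding return_def using assms
  by (intro dexec_sweep_left[OF i wk]) (auto, metis antisym_conv atLeastLessThan_iff not_less_eq_eq numeral_2_eq_2 numeral_3_eq_3)

lemma dexec_first:
  "xs \<noteq> [] \<Longrightarrow> xs ! 0 = 1 \<Longrightarrow>
    dexec w n (Upd i [(1, 1, MoveRight)]) (on_tape ip wk i xs 0) (on_tape ip wk i xs 1)"
  using dexec_Upd[OF i wk, of 0 xs "[(1, 1, MoveRight)]" 1 MoveRight w]
  by (cases xs) auto

lemma dexec_inc:
  assumes "set ds \<subseteq> {..<b}" "length ds < n"
  shows "dexec w n (inc_com i) (on_tape ip wk i (enc ds) 0) (on_tape ip wk i (enc (inc_digs ds)) 0)"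
proof -
  obtain m rest where ds: "ds = replicate m (b - 1) @ rest" "rest = [] \<or> hd rest \<noteq> b - 1"
    using split_leading by blast
  let ?post = "map (\<lambda>d. d + 3) rest @ [2]"
  have 1: "dexec w n (Upd i [(1, 1, MoveRight)]) (on_tape ip wk i (enc ds) 0) (on_tape ip wk i (enc ds) 1)"
    by (rule dexec_first) (auto simp: enc_def)
  have e: "enc ds = [1] @ replicate m (b + 2) @ ?post" using b2 by (simp add: enc_def ds map_replicate_const[symmetric])
  have 2: "dexec w n (While (Tape_In i [b + 2]) (Upd i (map (\<lambda>a. (a, 3, MoveRight)) [b + 2])))
     (on_tape ip wk i (enc ds) 1)
     (on_tape ip wk i ([1] @ replicate m 3 @ ?post) (m + 1))"
    using dexec_sweep_right[OF i wk, of "replicate m (b + 2)" "[b + 2]" "[1]" ?post w "\<lambda>a. 3"]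
      ds(2) assms(2) b2 unfolding e
    by (cases rest) (auto simp: tp_def nth_append ds(1) set_replicate_conv_if)
  have 3: "dexec w n (Upd i ((2, 2, Stay) # map (\<lambda>a. (a, a + 1, Stay)) [3..<b + 2]))
     (on_tape ip wk i ([1] @ replicate m 3 @ ?post) (m + 1))
     (on_tape ip wk i (enc (inc_digs ds)) (m + 1))"
  proof (cases rest)
    case Nil
    then show ?thesis
      using dexec_Upd[OF i wk, of "m + 1" "[1] @ replicate m 3 @ ?post"
          "(2, 2, Stay) # map (\<lambda>a. (a, a + 1, Stay)) [3..<b + 2]" 2 Stay w] ds assms inc_digs_leading[of m "[]"]
      by (simp add: nth_append enc_def list_update_append del: upt_Suc upt_rec_numeral)
  next
    case (Cons d r)
    then have "d < b - 1" using assms(1) ds by auto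
    then show ?thesis
      using dexec_Upd[OF i wk, of "m + 1" "[1] @ replicate m 3 @ ?post"
          "(2, 2, Stay) # map (\<lambda>a. (a, a + 1, Stay)) [3..<b + 2]" "4 + d" Stay w] ds assms Cons
        inc_digs_leading[of m rest]
      by (simp add: nth_append enc_def map_of_map_restrict list_update_append
        del: upt_Suc upt_rec_numeral)
  qed
  have len: "length (inc_digs ds) = length ds" "set (inc_digs ds) \<subseteq> {..<b}"
    using assms(1) b2 by (induction ds) (auto split: if_splits)
  have 4: "dexec w n (return i) (on_tape ip wk i (enc (inc_digs ds)) (m + 1)) (on_tape ip wk i (enc (inc_digs ds)) 0)"
  proof (rule dexec_return)
    fix j assume "0 < j" "j \<le> m + 1"
    moreover have "inc_digs ds ! (j - 1) < b" if "j - 1 < length ds"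
      using len that by (metis lessThan_iff nth_mem subsetD)
    moreover have "m \<le> length ds" by (simp add: ds(1))
    ultimately show "enc (inc_digs ds) ! j \<in> {2..<b + 3}"
      using len(1) b2 by (auto simp: enc_def nth_append nth_Cons')
  qed (use len ds assms in \<open>auto simp: enc_def\<close>)
  show ?thesis unfolding inc_com_def
    by (rule dx_Seq[OF 1 dx_Seq[OF 2 dx_Seq[OF 3 4 dexec_heads[OF 3]] dexec_heads[OF 2]]
          dexec_heads[OF 1]])
qed

lemma dexec_dec:
  assumes "set ds \<subseteq> {..<b}" "length ds < n"
  shows "dexec w n (dec_com i) (on_tape ip wk i (enc ds) 0) (on_tape ip wk i (enc (dec_digs ds)) 0)"
proof -
  obtain m rest where ds: "ds = replicate m 0 @ rest" "rest = [] \<or> hd rest \<noteq> 0"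
    using split_leading by blast
  let ?post = "map (\<lambda>d. d + 3) rest @ [2]"
  have 1: "dexec w n (Upd i [(1, 1, MoveRight)]) (on_tape ip wk i (enc ds) 0) (on_tape ip wk i (enc ds) 1)"
    by (rule dexec_first) (auto simp: enc_def)
  have e: "enc ds = [1] @ replicate m 3 @ ?post" by (simp add: enc_def ds)
  have 2: "dexec w n (While (Tape_In i [3]) (Upd i (map (\<lambda>a. (a, b + 2, MoveRight)) [3])))
     (on_tape ip wk i (enc ds) 1)
     (on_tape ip wk i ([1] @ replicate m (b + 2) @ ?post) (m + 1))"
    using dexec_sweep_right[OF i wk, of "replicate m 3" "[3]" "[1]" ?post w "\<lambda>a. b + 2"]
      ds(2) assms(2) b2 unfolding e
    by (cases rest) (auto simp: tp_def nth_append ds(1) set_replicate_conv_if)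
  have 3: "dexec w n (Upd i ((2, 2, Stay) # map (\<lambda>a. (a, a - 1, Stay)) [4..<b + 3]))
     (on_tape ip wk i ([1] @ replicate m (b + 2) @ ?post) (m + 1))
     (on_tape ip wk i (enc (dec_digs ds)) (m + 1))"
  proof (cases rest)
    case Nil
    then show ?thesis
      using dexec_Upd[OF i wk, of "m + 1" "[1] @ replicate m (b + 2) @ ?post"
          "(2, 2, Stay) # map (\<lambda>a. (a, a - 1, Stay)) [4..<b + 3]" 2 Stay w] ds assms b2 dec_digs_leading[of m "[]"]
      by (simp add: nth_append enc_def list_update_append del: upt_Suc upt_rec_numeral)
  next
    case (Cons d r)
    then have "0 < d" "d < b" using assms(1) ds by auto
    then show ?thesis
      using dexec_Upd[OF i wk, of "m + 1" "[1] @ replicate m (b + 2) @ ?post"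
          "(2, 2, Stay) # map (\<lambda>a. (a, a - 1, Stay)) [4..<b + 3]" "d + 2" Stay w] ds assms Cons b2
        dec_digs_leading[of m rest]
      by (simp add: nth_append enc_def map_of_map_restrict list_update_append
        del: upt_Suc upt_rec_numeral)
  qed
  have len: "length (dec_digs ds) = length ds" "set (dec_digs ds) \<subseteq> {..<b}"
    using assms(1) b2 by (induction ds) (auto split: if_splits)
  have 4: "dexec w n (return i) (on_tape ip wk i (enc (dec_digs ds)) (m + 1)) (on_tape ip wk i (enc (dec_digs ds)) 0)"
  proof (rule dexec_return)
    fix j assume "0 < j" "j \<le> m + 1"
    moreover have "dec_digs ds ! (j - 1) < b" if "j - 1 < length ds"
      using len that by (metis lessThan_iff nth_mem subsetD)
    moreover have "m \<le> length ds" by (simp add: ds(1))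
    ultimately show "enc (dec_digs ds) ! j \<in> {2..<b + 3}"
      using len(1) b2 by (auto simp: enc_def nth_append nth_Cons')
  qed (use len ds assms in \<open>auto simp: enc_def\<close>)
  show ?thesis unfolding dec_com_def
    by (rule dx_Seq[OF 1 dx_Seq[OF 2 dx_Seq[OF 3 4 dexec_heads[OF 3]] dexec_heads[OF 2]]
          dexec_heads[OF 1]])
qed

lemma dexec_test:
  assumes "set ds \<subseteq> {..<b}" "length ds < n"
  shows "dexec w n (test_com i) (on_tape ip wk i (enc ds) 0) (on_tape ip wk i (enc ds) (Suc (lead ds)))"
    and "holds w (nonzero i) (on_tape ip wk i (enc ds) (Suc (lead ds))) \<longleftrightarrow> ds \<noteq> replicate (length ds) 0"
    and "dexec w n (return i) (on_tape ip wk i (enc ds) (Suc (lead ds))) (on_tape ip wk i (enc ds) 0)"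
proof -
  obtain m rest where ds: "ds = replicate m 0 @ rest" "rest = [] \<or> hd rest \<noteq> 0"
    using split_leading by blast
  then have m: "lead ds = m" by (cases rest) (auto simp: lead_def takeWhile_tail)
  let ?post = "map (\<lambda>d. d + 3) rest @ [2]"
  have 1: "dexec w n (Upd i [(1, 1, MoveRight)]) (on_tape ip wk i (enc ds) 0) (on_tape ip wk i (enc ds) 1)"
    by (rule dexec_first) (auto simp: enc_def)
  have e: "enc ds = [1] @ replicate m 3 @ ?post" by (simp add: enc_def ds)
  have 2: "dexec w n (While (Tape_In i [3]) (Upd i (map (\<lambda>a. (a, a, MoveRight)) [3])))
     (on_tape ip wk i (enc ds) 1) (on_tape ip wk i (enc ds) (m + 1))"
    using dexec_sweep_right[OF i wk, of "replicate m 3" "[3]" "[1]" ?post w "\<lambda>a. a"]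
      ds(2) assms(2) b2 unfolding e
    by (cases rest) (auto simp: tp_def nth_append ds(1) set_replicate_conv_if)
  show "dexec w n (test_com i) (on_tape ip wk i (enc ds) 0) (on_tape ip wk i (enc ds) (Suc (lead ds)))"
    unfolding test_com_def m using dx_Seq[OF 1 2] by (auto intro: dexec_heads 1)
  show "dexec w n (return i) (on_tape ip wk i (enc ds) (Suc (lead ds))) (on_tape ip wk i (enc ds) 0)"
  proof (rule dexec_return)
    fix j assume "0 < j" "j \<le> Suc (lead ds)"
    then show "enc ds ! j \<in> {2..<b + 3}"
      using assms(1) b2 ds(1) nth_mem[of "j - 1" ds] m
      by (cases "j - 1 < length ds") (auto simp: enc_def nth_append nth_Cons' le_Suc_eq)
  qed (use ds assms m in \<open>auto simp: enc_def\<close>)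
  show "holds w (nonzero i) (on_tape ip wk i (enc ds) (Suc (lead ds))) \<longleftrightarrow> ds \<noteq> replicate (length ds) 0"
  proof (cases rest)
    case Nil
    then show ?thesis using ds m
      by (simp add: nonzero_def reads_on_tape[OF i wk] tp_def enc_def nth_append)
  next
    case (Cons d r)
    then have "0 < d" "d < b" using assms(1) ds by auto
    then have "replicate m 0 @ d # r \<noteq> replicate (length (replicate m 0 @ d # r)) 0"
      by (metis in_set_conv_decomp in_set_replicate less_numeral_extra(3))
    then show ?thesis using ds m Cons \<open>0 < d\<close> \<open>d < b\<close>
      by (simp add: nonzero_def reads_on_tape[OF i wk] tp_def enc_def nth_append)
  qed
qed

lemma dexec_grow:
  assumes "set ds \<subseteq> {0, 1}" "length (bin_inc ds) \<le> n"
  shows "dexec w n (grow_com i) (on_tape ip wk i (1 # map (\<lambda>d. d + 3) ds) 0)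
    (on_tape ip wk i (1 # map (\<lambda>d. d + 3) (bin_inc ds)) 0)"
proof -
  obtain m rest where ds: "ds = replicate m 1 @ rest" "rest = [] \<or> hd rest \<noteq> 1"
    using split_leading by blast
  let ?post = "map (\<lambda>d. d + 3) rest"
  let ?tbl = "[(3, 4, Stay), (0, 4, Stay)]"
  have len: "length (bin_inc ds) = (if rest = [] then Suc m else m + length rest)"
    using ds unfolding ds(1) bin_inc_leading by (cases rest) auto
  then have mn: "m < n" using assms(2) by (cases rest) auto
  have 1: "dexec w n (Upd i [(1, 1, MoveRight)]) (on_tape ip wk i (1 # map (\<lambda>d. d + 3) ds) 0)
     (on_tape ip wk i (1 # map (\<lambda>d. d + 3) ds) 1)"
    by (rule dexec_first) auto
  have e: "1 # map (\<lambda>d. d + 3) ds = [1] @ replicate m 4 @ ?post" by (simp add: ds)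
  have 2: "dexec w n (While (Tape_In i [4]) (Upd i (map (\<lambda>a. (a, 3, MoveRight)) [4])))
     (on_tape ip wk i (1 # map (\<lambda>d. d + 3) ds) 1)
     (on_tape ip wk i ([1] @ replicate m 3 @ ?post) (m + 1))"
    using dexec_sweep_right[OF i wk, of "replicate m 4" "[4]" "[1]" ?post w "\<lambda>a. 3"] ds(2) mn unfolding e
    by (cases rest) (auto simp: tp_def nth_append ds(1) set_replicate_conv_if)
  have 3: "dexec w n (Upd i ?tbl)
     (on_tape ip wk i ([1] @ replicate m 3 @ ?post) (m + 1))
     (on_tape ip wk i (1 # map (\<lambda>d. d + 3) (bin_inc ds)) (m + 1))"
  proof (cases rest)
    case Nil
    then show ?thesis
      using dexec_Upd_end[OF i wk, of "[1] @ replicate m 3" ?tbl 4 Stay w] mn bin_inc_leading[of m "[]"]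
      by (simp add: ds(1))
  next
    case (Cons d r)
    then have "d = 0" using assms(1) ds by auto
    then show ?thesis
      using dexec_Upd[OF i wk, of "m + 1" "[1] @ replicate m 3 @ ?post" ?tbl 4 Stay w] mn Cons
        bin_inc_leading[of m rest]
      by (simp add: nth_append ds(1) list_update_append)
  qed
  have s: "set (bin_inc ds) \<subseteq> {0, 1}"
    using assms(1) by (induction ds) (auto split: if_splits)
  have 4: "dexec w n (return i) (on_tape ip wk i (1 # map (\<lambda>d. d + 3) (bin_inc ds)) (m + 1))
     (on_tape ip wk i (1 # map (\<lambda>d. d + 3) (bin_inc ds)) 0)"
  proof (rule dexec_return)
    show "m + 1 < length (1 # map (\<lambda>d. d + 3) (bin_inc ds))" using len ds by (cases rest) auto
    fix j assume j: "0 < j" "j \<le> m + 1"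
    then have "bin_inc ds ! (j - 1) \<in> set (bin_inc ds)" using len by (intro nth_mem) (cases rest; auto)
    then have "bin_inc ds ! (j - 1) \<in> {0, 1}" using s by blast
    moreover have "j - 1 < length (bin_inc ds)" using j len by (cases rest) auto
    ultimately show "(1 # map (\<lambda>d. d + 3) (bin_inc ds)) ! j \<in> {2..<b + 3}"
      using b2 j by (auto simp: nth_Cons')
  qed (use mn in auto)
  show ?thesis unfolding grow_com_def
    by (rule dx_Seq[OF 1 dx_Seq[OF 2 dx_Seq[OF 3 4 dexec_heads[OF 3]] dexec_heads[OF 2]]
          dexec_heads[OF 1]])
qed

lemma dexec_finish:
  assumes "set ds \<subseteq> {0, 1}" "length ds < n"
  shows "dexec w n (finish_com i) (on_tape ip wk i (1 # map (\<lambda>d. d + 3) ds) 0)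
    (on_tape ip wk i (enc (replicate (length ds) 0)) 0)"
proof -
  let ?l = "length ds"
  have 1: "dexec w n (Upd i [(1, 1, MoveRight)]) (on_tape ip wk i (1 # map (\<lambda>d. d + 3) ds) 0)
     (on_tape ip wk i (1 # map (\<lambda>d. d + 3) ds) 1)"
    by (rule dexec_first) auto
  have m: "map (\<lambda>a. 3) ds = replicate ?l 3" by (simp add: map_replicate_const)
  have s: "set (map (\<lambda>d. d + 3) ds) \<subseteq> set [3, 4]" using assms(1) by auto
  have 2: "dexec w n (While (Tape_In i [3, 4]) (Upd i (map (\<lambda>a. (a, 3, MoveRight)) [3, 4])))
     (on_tape ip wk i (1 # map (\<lambda>d. d + 3) ds) 1) (on_tape ip wk i (1 # replicate ?l 3) (?l + 1))"
    using dexec_sweep_right[OF i wk s, of "[1]" "[]" w "\<lambda>a. 3"] assms(2)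
    by (simp add: tp_def m comp_def)
  have 3: "dexec w n (Upd i [(0, 2, Stay)]) (on_tape ip wk i (1 # replicate ?l 3) (?l + 1))
     (on_tape ip wk i (enc (replicate ?l 0)) (?l + 1))"
    using dexec_Upd_end[OF i wk, of "1 # replicate ?l 3" "[(0, 2, Stay)]" 2 Stay w] assms
    by (simp add: enc_def)
  have 4: "dexec w n (return i) (on_tape ip wk i (enc (replicate ?l 0)) (?l + 1))
     (on_tape ip wk i (enc (replicate ?l 0)) 0)"
  proof (rule dexec_return)
    fix j assume "0 < j" "j \<le> ?l + 1"
    then show "enc (replicate ?l 0) ! j \<in> {2..<b + 3}"
      using b2 by (auto simp: enc_def nth_append nth_Cons')
  qed (use assms in \<open>auto simp: enc_def\<close>)
  show ?thesis unfolding finish_com_def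
    by (rule dx_Seq[OF 1 dx_Seq[OF 2 dx_Seq[OF 3 4 dexec_heads[OF 3]] dexec_heads[OF 2]]
          dexec_heads[OF 1]])
qed

end

section \<open>Initialisation of the work tapes\<close>

definition init_one :: "nat \<Rightarrow> com" where
  "init_one i = Seq (Upd i [(0, 1, Stay)]) (Seq (grow_com i)
     (Seq (While (Input_In [LeftEnd, Bit True, Bit False]) (Seq (Input_Move MoveRight) (grow_com i)))
     (Seq (finish_com i)
       (While (Input_In [RightEnd, Bit True, Bit False]) (Input_Move MoveLeft)))))"

lemma input_cell_left: "input_cell w j \<in> {LeftEnd, Bit True, Bit False} \<longleftrightarrow> j \<le> length w"
  by (auto simp: input_cell_def)

lemma input_cell_right: "input_cell w j \<in> {RightEnd, Bit True, Bit False} \<longleftrightarrow> j \<noteq> 0"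
  by (auto simp: input_cell_def)

lemma dexec_rewind:
  "j \<le> length w + 1 \<Longrightarrow> heads_le n (j, wk) \<Longrightarrow>
    dexec w n (While (Input_In [RightEnd, Bit True, Bit False]) (Input_Move MoveLeft)) (j, wk) (0, wk)"
proof (induction j)
  case (Suc j)
  have "dexec w n (Input_Move MoveLeft) (Suc j, wk) (j, wk)"
    using dx_Move[OF Suc.prems(2), of j MoveLeft w] Suc.prems(1) by simp
  moreover have "heads_le n (j, wk)" using Suc.prems(2) by (simp add: heads_le_def)
  ultimately show ?case
    using Suc.IH Suc.prems input_cell_right[of w "Suc j"]
    by (intro dx_While_True[of n "(Suc j, wk)" w _ _ "(j, wk)"]) simp_all
qed (auto intro!: dx_While_False simp: input_cell_def)

lemma dexec_init_one:
  assumes i: "i < length wk" and wk: "heads_le n (0, wk)" and n: "n = tape_len w + 1"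
    and blank: "wk ! i = (\<lambda>_. 0, 0)"
  shows "dexec w n (init_one i) (0, wk) (0, wk[i := (tp (enc (replicate (tape_len w) 0)), 0)])"
proof -
  let ?s = "\<lambda>j m. on_tape j wk i (1 # map (\<lambda>d. d + 3) (bits m)) 0"
  have wk': "heads_le n (j, wk)" for j using wk by (simp add: heads_le_def)
  have grow: "dexec w n (grow_com i) (?s j m) (?s j (Suc m))" if "m < length w + 2" for j m
  proof -
    have "length (bin_inc (bits m)) \<le> n"
      using length_bits_mono[of "Suc m" "length w + 2"] that n by (simp add: tape_len_def)
    then show ?thesis using dexec_grow[OF i wk', of "bits m" w j] bits_props[of m] by simp
  qed
  have hs: "heads_le n (?s j m)" for j m
    by (rule heads_on_tape[OF i wk']) simp
  have 1: "dexec w n (Upd i [(0, 1, Stay)]) (0, wk) (?s 0 0)"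
    using dexec_Upd_end[OF i wk, of "[]" "[(0, 1, Stay)]" 1 Stay w] n blank list_update_id[of wk i]
    by (simp add: on_tape_def)
  \<comment> \<open>On input cell \<open>j\<close> the number has been incremented
    \<open>j + 1\<close> times, because cell 0 is counted before the loop.\<close>
  have 3: "j \<le> length w + 1 \<Longrightarrow> dexec w n
      (While (Input_In [LeftEnd, Bit True, Bit False]) (Seq (Input_Move MoveRight) (grow_com i)))
      (?s j (Suc j)) (?s (length w + 1) (length w + 2))" for j
  proof (induction j rule: inc_induct)
    case base
    have nh: "\<not> holds w (Input_In [LeftEnd, Bit True, Bit False]) (?s (length w + 1) (length w + 2))"
      by (simp add: on_tape_def input_cell_def)
    show ?case using dx_While_False[OF hs nh] by simp
  next
    case (step j)
    have "dexec w n (Input_Move MoveRight) (?s j (Suc j)) (?s (Suc j) (Suc j))"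
      using dx_Move[OF hs[of j "Suc j"], of "Suc j" MoveRight w] step by (simp add: on_tape_def)
    moreover have "dexec w n (grow_com i) (?s (Suc j) (Suc j)) (?s (Suc j) (Suc (Suc j)))"
      using grow[of "Suc j" "Suc j"] step by simp
    moreover have "holds w (Input_In [LeftEnd, Bit True, Bit False]) (?s j (Suc j))"
      using step input_cell_left[of w j] by (simp add: on_tape_def)
    ultimately show ?case using step hs by (blast intro: dx_While_True dx_Seq)
  qed
  have 4: "dexec w n (finish_com i) (?s (length w + 1) (length w + 2))
      (on_tape (length w + 1) wk i (enc (replicate (tape_len w) 0)) 0)"
    using dexec_finish[OF i wk', of "bits (length w + 2)" w "length w + 1"]
      bits_props[of "length w + 2"] n unfolding tape_len_def by simp
  have 5: "dexec w n (While (Input_In [RightEnd, Bit True, Bit False]) (Input_Move MoveLeft))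
      (on_tape (length w + 1) wk i (enc (replicate (tape_len w) 0)) 0)
      (0, wk[i := (tp (enc (replicate (tape_len w) 0)), 0)])"
    unfolding on_tape_def
    using heads_on_tape[OF i wk', of 0 "length w + 1"] by (intro dexec_rewind) (auto simp: on_tape_def)
  have 2: "dexec w n (grow_com i) (?s 0 0) (?s 0 (Suc 0))" by (rule grow) simp
  have 3: "dexec w n (While (Input_In [LeftEnd, Bit True, Bit False]) (Seq (Input_Move MoveRight) (grow_com i)))
      (?s 0 (Suc 0)) (?s (length w + 1) (length w + 2))"
    by (rule 3) simp
  show ?thesis unfolding init_one_def
    by (rule dx_Seq[OF 1 dx_Seq[OF 2 dx_Seq[OF 3 dx_Seq[OF 4 5 dexec_heads[OF 4]] dexec_heads[OF 3]]
          dexec_heads[OF 2]] dexec_heads[OF 1]])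
qed

primrec init_com :: "nat \<Rightarrow> com" where
  "init_com 0 = Out []"
| "init_com (Suc k) = Seq (init_com k) (init_one k)"

text \<open>The machine state between two instructions: heads are parked at the left end.\<close>

definition store :: "bool list \<Rightarrow> nat \<Rightarrow> nat \<Rightarrow> (nat \<Rightarrow> nat) \<Rightarrow> tm_state" where
  "store w k ip \<sigma> = (ip, map (\<lambda>x. (tp (enc (digs (tape_len w) (\<sigma> x))), 0)) [0..<k])"

lemma dexec_init:
  "dexec w (tape_len w + 1) (init_com k) (0, replicate k (\<lambda>_. 0, 0)) (store w k 0 (\<lambda>_. 0))"
proof -
  let ?n = "tape_len w + 1"
  let ?z = "(tp (enc (replicate (tape_len w) 0)), 0) :: tape"
  have "j \<le> k \<Longrightarrow> dexec w ?n (init_com j) (0, replicate k (\<lambda>_. 0, 0))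
     (0, replicate j ?z @ replicate (k - j) (\<lambda>_. 0, 0))" for j
  proof (induction j)
    case 0
    have "heads_le ?n (0, replicate k (\<lambda>_. 0, 0))" by (auto simp: heads_le_def)
    then show ?case by (auto intro: dx_Skip)
  next
    case (Suc j)
    let ?wk = "replicate j ?z @ replicate (k - j) (\<lambda>_. 0, 0)"
    have "dexec w ?n (init_one j) (0, ?wk) (0, ?wk[j := ?z])"
      using Suc.prems by (intro dexec_init_one) (auto simp: heads_le_def nth_append)
    moreover have "?wk[j := ?z] = replicate (Suc j) ?z @ replicate (k - Suc j) (\<lambda>_. 0, 0)"
      using Suc.prems
      by (intro nth_equalityI) (auto simp: nth_append nth_list_update less_Suc_eq simp del: replicate_Suc)
    ultimately have step: "dexec w ?n (init_one j) (0, ?wk)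
        (0, replicate (Suc j) ?z @ replicate (k - Suc j) (\<lambda>_. 0, 0))" by (simp only:)
    have h: "heads_le ?n (0, replicate k (\<lambda>_. 0, 0))" by (auto simp: heads_le_def)
    show ?case unfolding init_com.simps
      by (rule dx_Seq[OF Suc.IH[OF Suc_leD[OF Suc.prems]] step h])
  qed
  from this[of k] show ?thesis
    by (simp add: store_def digs_zero map_replicate_const)
qed

end

section \<open>Programs with bounded counters\<close>

datatype prog =
    PInc nat
  | PDec nat
  | PRead nat
  | POut "bool list"
  | PSeq prog prog
  | PIfZ nat prog prog
  | PWhile nat prog
  | PChoice prog prog
  | PStar prog
  | PFail

text \<open>\<open>PFail\<close> is compiled to an update of tape 0 with an empty table, hence the
  demand for at least one tape.\<close>

primrec vars_below :: "nat \<Rightarrow> prog \<Rightarrow> bool" where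
  "vars_below k (PInc x) \<longleftrightarrow> x < k"
| "vars_below k (PDec x) \<longleftrightarrow> x < k"
| "vars_below k (PRead x) \<longleftrightarrow> x < k"
| "vars_below k (POut bs) \<longleftrightarrow> True"
| "vars_below k (PSeq p q) \<longleftrightarrow> vars_below k p \<and> vars_below k q"
| "vars_below k (PIfZ x p q) \<longleftrightarrow> x < k \<and> vars_below k p \<and> vars_below k q"
| "vars_below k (PWhile x p) \<longleftrightarrow> x < k \<and> vars_below k p"
| "vars_below k (PChoice p q) \<longleftrightarrow> vars_below k p \<and> vars_below k q"
| "vars_below k (PStar p) \<longleftrightarrow> vars_below k p"
| "vars_below k PFail \<longleftrightarrow> 0 < k"

lemma vars_below_mono: "vars_below k p \<Longrightarrow> k \<le> l \<Longrightarrow> vars_below l p"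
  by (induction p) auto

lemma vars_below_ex: "\<exists>k. vars_below k p"
proof (induction p)
  case (PSeq p q)
  then obtain k l where "vars_below k p" "vars_below l q" by blast
  then show ?case using vars_below_mono by (intro exI[of _ "max k l"]) auto
next
  case (PIfZ x p q)
  then obtain k l where "vars_below k p" "vars_below l q" by blast
  then show ?case using vars_below_mono by (intro exI[of _ "max (Suc x) (max k l)"]) auto
next
  case (PWhile x p)
  then obtain k where "vars_below k p" by blast
  then show ?case using vars_below_mono by (intro exI[of _ "max (Suc x) k"]) auto
next
  case (PChoice p q)
  then obtain k l where "vars_below k p" "vars_below l q" by blast
  then show ?case using vars_below_mono by (intro exI[of _ "max k l"]) auto
qed auto

primrec det_prog :: "prog \<Rightarrow> bool" where
  "det_prog (PInc x) \<longleftrightarrow> True"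
| "det_prog (PDec x) \<longleftrightarrow> True"
| "det_prog (PRead x) \<longleftrightarrow> True"
| "det_prog (POut bs) \<longleftrightarrow> True"
| "det_prog (PSeq p q) \<longleftrightarrow> det_prog p \<and> det_prog q"
| "det_prog (PIfZ x p q) \<longleftrightarrow> det_prog p \<and> det_prog q"
| "det_prog (PWhile x p) \<longleftrightarrow> det_prog p"
| "det_prog (PChoice p q) \<longleftrightarrow> False"
| "det_prog (PStar p) \<longleftrightarrow> False"
| "det_prog PFail \<longleftrightarrow> True"

definition read_val :: "bool list \<Rightarrow> nat \<Rightarrow> nat" where
  "read_val w v = (if v < length w then if w ! v then 2 else 1 else 0)"

section \<open>Semantics of counter programs and their compilation\<close>

context base
begin

definition bound :: "bool list \<Rightarrow> nat" where
  "bound w = b ^ tape_len w"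

lemma bound_gt: "length w + 2 < bound w"
proof -
  have "2 ^ tape_len w \<le> b ^ tape_len w" using b2 by (rule power_mono) simp
  then show ?thesis using tape_len_bounds(2)[of w] unfolding bound_def by linarith
qed

lemma bound_pos [simp]: "0 < bound w" using bound_gt[of w] by linarith

lemma bound_ge_b: "b \<le> bound w"
proof -
  have "b ^ 1 \<le> b ^ tape_len w" using b2 tape_len_bounds(3)[of w] by (intro power_increasing) auto
  then show ?thesis by (simp add: bound_def)
qed

type_synonym vals = "nat \<Rightarrow> nat"

text \<open>Arithmetic modulo \<open>bound w\<close> mirrors the fixed number of digits. Several
  programs below exploit it: an exhaustive loop recognises its end by the return of its counter to
  0.\<close>

primrec den :: "bool list \<Rightarrow> prog \<Rightarrow> vals \<Rightarrow> (bool list \<times> vals) set" where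
  "den w (PInc x) = (\<lambda>\<sigma>. {([], \<sigma>(x := Suc (\<sigma> x) mod bound w))})"
| "den w (PDec x) = (\<lambda>\<sigma>. {([], \<sigma>(x := (\<sigma> x + (bound w - 1)) mod bound w))})"
| "den w (PRead x) = (\<lambda>\<sigma>. {([], \<sigma>(x := read_val w (\<sigma> x)))})"
| "den w (POut bs) = (\<lambda>\<sigma>. {(bs, \<sigma>)})"
| "den w (PSeq p q) = rseq (den w p) (den w q)"
| "den w (PIfZ x p q) = (\<lambda>\<sigma>. if \<sigma> x = 0 then den w p \<sigma> else den w q \<sigma>)"
| "den w (PWhile x p) = while_rel (\<lambda>\<sigma>. \<sigma> x \<noteq> 0) (den w p)"
| "den w (PChoice p q) = (\<lambda>\<sigma>. den w p \<sigma> \<union> den w q \<sigma>)"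
| "den w (PStar p) = star_rel (den w p)"
| "den w PFail = (\<lambda>\<sigma>. {})"

definition ok :: "bool list \<Rightarrow> vals \<Rightarrow> bool" where
  "ok w \<sigma> \<longleftrightarrow> (\<forall>x. \<sigma> x < bound w)"

lemma ok_iters:
  "iters T R s out t \<Longrightarrow> ok w s \<Longrightarrow> (\<And>s o1 t. ok w s \<Longrightarrow> (o1, t) \<in> R s \<Longrightarrow> ok w t) \<Longrightarrow> ok w t"
  by (induction rule: iters.induct) blast+

lemma ok_den: "(out, t) \<in> den w p s \<Longrightarrow> ok w s \<Longrightarrow> ok w t"
proof (induction p arbitrary: out s t)
  case (PRead x)
  then show ?case using bound_gt[of w] by (auto simp: ok_def read_val_def)
next
  case (PWhile x p)
  then show ?case using ok_iters unfolding den.simps while_rel_def by blast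
next
  case (PStar p)
  then show ?case using ok_iters unfolding den.simps star_rel_def by blast
next
  case (PSeq p q)
  then show ?case unfolding den.simps rseq_def by blast
next
  case (PIfZ x p q)
  then show ?case unfolding den.simps by (metis (mono_tags))
next
  case (PChoice p q)
  then show ?case unfolding den.simps by blast
qed (auto simp: ok_def)

text \<open>Random access to the input: the address is consumed while the input head advances, the
  emptied counter then receives the value read, and the input head is rewound.\<close>

definition read_com :: "nat \<Rightarrow> com" where
  "read_com i = Seq (test_com i)
     (Seq (While (nonzero i) (Seq (return i) (Seq (dec_com i) (Seq (Input_Move MoveRight) (test_com i)))))
     (Seq (return i) (Seq (Input_Move MoveRight)
     (Seq (Cond (Input_In [Bit True]) (Seq (inc_com i) (inc_com i))
             (Cond (Input_In [Bit False]) (inc_com i) (Out [])))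
       (While (Input_In [RightEnd, Bit True, Bit False]) (Input_Move MoveLeft))))))"

primrec comp :: "prog \<Rightarrow> com" where
  "comp (PInc x) = inc_com x"
| "comp (PDec x) = dec_com x"
| "comp (PRead x) = read_com x"
| "comp (POut bs) = Out bs"
| "comp (PSeq p q) = Seq (comp p) (comp q)"
| "comp (PIfZ x p q) = Seq (test_com x)
     (Cond (nonzero x) (Seq (return x) (comp q)) (Seq (return x) (comp p)))"
| "comp (PWhile x p) = Seq (test_com x)
     (Seq (While (nonzero x) (Seq (return x) (Seq (comp p) (test_com x)))) (return x))"
| "comp (PChoice p q) = Choice (comp p) (comp q)"
| "comp (PStar p) = Star (comp p)"
| "comp PFail = Upd 0 []"

lemma wf_macros [simp]:
  "i < k \<Longrightarrow> wf_com k (b + 3) (return i)" "i < k \<Longrightarrow> wf_com k (b + 3) (inc_com i)"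
  "i < k \<Longrightarrow> wf_com k (b + 3) (dec_com i)" "i < k \<Longrightarrow> wf_com k (b + 3) (test_com i)"
  "i < k \<Longrightarrow> wf_com k (b + 3) (grow_com i)" "i < k \<Longrightarrow> wf_com k (b + 3) (finish_com i)"
  "i < k \<Longrightarrow> wf_com k (b + 3) (read_com i)" "i < k \<Longrightarrow> wf_com k (b + 3) (init_one i)"
  using b2 by (auto simp: return_def inc_com_def dec_com_def test_com_def grow_com_def
      finish_com_def read_com_def init_one_def)

lemma bounded_macros [simp]:
  "bounded_com (return i)" "bounded_com (inc_com i)" "bounded_com (dec_com i)"
  "bounded_com (test_com i)" "bounded_com (read_com i)"
  using b2 by (auto simp: return_def inc_com_def dec_com_def test_com_def read_com_def)

lemma det_macros [simp]:
  "det_com (return i)" "det_com (inc_com i)" "det_com (dec_com i)" "det_com (test_com i)"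
  "det_com (read_com i)" "det_com (init_one i)"
  by (auto simp: return_def inc_com_def dec_com_def test_com_def read_com_def init_one_def
      grow_com_def finish_com_def)

lemma wf_init: "j \<le> k \<Longrightarrow> wf_com k (b + 3) (init_com j)"
  by (induction j) auto

lemma det_init: "det_com (init_com j)"
  by (induction j) auto

lemma wf_comp: "vars_below k p \<Longrightarrow> wf_com k (b + 3) (comp p)"
  by (induction p) auto

lemma bounded_comp: "bounded_com (comp p)"
  by (induction p) auto

lemma det_comp: "det_prog p \<Longrightarrow> det_com (comp p)"
  by (induction p) auto

context
  fixes w :: "bool list" and k :: nat
begin

abbreviation "hd_max \<equiv> tape_len w + 1"

text \<open>The state after \<open>test_com\<close>, with the head of tape \<open>x\<close> parked
  where the scan stopped.\<close>

definition tested :: "nat \<Rightarrow> vals \<Rightarrow> nat \<Rightarrow> tm_state" where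
  "tested ip \<sigma> x = on_tape ip (snd (store w k ip \<sigma>)) x (enc (digs (tape_len w) (\<sigma> x)))
     (Suc (lead (digs (tape_len w) (\<sigma> x))))"

lemma heads_store: "heads_le n (store w k ip \<sigma>)"
  by (auto simp: heads_le_def store_def)

lemma length_store [simp]: "length (snd (store w k ip \<sigma>)) = k"
  by (simp add: store_def)

lemma fst_store [simp]: "fst (store w k ip \<sigma>) = ip"
  by (simp add: store_def)

lemma on_tape_store:
  "x < k \<Longrightarrow> on_tape ip (snd (store w k ip \<sigma>)) x (enc (digs (tape_len w) v)) 0 = store w k ip (\<sigma>(x := v))"
  by (auto simp: on_tape_def store_def intro!: nth_equalityI simp: nth_list_update)

lemma store_heads': "heads_le n (ip, snd (store w k ip \<sigma>))"
  using heads_store[of n ip \<sigma>] by (simp add: store_def)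

lemma dexec_inc_store:
  assumes "x < k"
  shows "dexec w hd_max (inc_com x) (store w k ip \<sigma>) (store w k ip (\<sigma>(x := Suc (\<sigma> x) mod bound w)))"
  using dexec_inc[of x "snd (store w k ip \<sigma>)" hd_max ip "digs (tape_len w) (\<sigma> x)" w] set_digs assms
  by (simp add: store_heads' inc_digs on_tape_store bound_def digs_mod
      flip: on_tape_store[OF assms, of ip \<sigma> "Suc (\<sigma> x) mod b ^ tape_len w"])

lemma dexec_dec_store:
  assumes "x < k"
  shows "dexec w hd_max (dec_com x) (store w k ip \<sigma>)
    (store w k ip (\<sigma>(x := (\<sigma> x + (bound w - 1)) mod bound w)))"
  using dexec_dec[of x "snd (store w k ip \<sigma>)" hd_max ip "digs (tape_len w) (\<sigma> x)" w] set_digs assms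
  by (simp add: store_heads' dec_digs on_tape_store bound_def)

lemma dexec_test_store:
  assumes "x < k" "\<sigma> x < bound w"
  shows "dexec w hd_max (test_com x) (store w k ip \<sigma>) (tested ip \<sigma> x)"
    and "holds w (nonzero x) (tested ip \<sigma> x) \<longleftrightarrow> \<sigma> x \<noteq> 0"
    and "dexec w hd_max (return x) (tested ip \<sigma> x) (store w k ip \<sigma>)"
  using dexec_test[of x "snd (store w k ip \<sigma>)" hd_max ip "digs (tape_len w) (\<sigma> x)" w] set_digs assms
    digs_eq_zero[of "\<sigma> x" "tape_len w"]
  by (simp_all add: store_heads' on_tape_store tested_def bound_def)

lemma dexec_move_store:
  "dexec w hd_max (Input_Move d) (store w k ip \<sigma>)
    (store w k (min (move_head d ip) (length w + 1)) \<sigma>)"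
proof -
  have "dexec w hd_max (Input_Move d) (store w k ip \<sigma>)
      (min (move_head d ip) (length w + 1), snd (store w k ip \<sigma>))"
    by (rule dx_Move[OF heads_store]) simp
  then show ?thesis by (simp add: store_def)
qed

lemma dexec_read_loop:
  assumes "x < k"
  shows "v = \<sigma> x \<Longrightarrow> v < bound w \<Longrightarrow> dexec w hd_max
    (While (nonzero x) (Seq (return x) (Seq (dec_com x) (Seq (Input_Move MoveRight) (test_com x)))))
    (tested ip \<sigma> x) (tested (if v = 0 then ip else min (ip + v) (length w + 1)) (\<sigma>(x := 0)) x)"
proof (induction v arbitrary: ip \<sigma>)
  case 0
  then have "\<sigma>(x := 0) = \<sigma>" by auto
  then show ?case using 0 dexec_test_store[of x \<sigma> ip, OF assms] by (auto intro: dx_While_False dexec_heads)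
next
  case (Suc v)
  let ?\<tau> = "\<sigma>(x := v)" and ?ip = "min (Suc ip) (length w + 1)"
  have t: "\<sigma> x < bound w" "?\<tau> x < bound w" using Suc.prems by auto
  note T = dexec_test_store[of x \<sigma> ip, OF assms t(1)]
  have e: "(\<sigma> x + (bound w - 1)) mod bound w = v"
  proof -
    have "\<sigma> x + (bound w - 1) = v + bound w" using Suc.prems by simp
    then show ?thesis using Suc.prems by simp
  qed
  have d: "dexec w hd_max (dec_com x) (store w k ip \<sigma>) (store w k ip ?\<tau>)"
    using dexec_dec_store[OF assms, of ip \<sigma>] unfolding e .
  have m: "dexec w hd_max (Input_Move MoveRight) (store w k ip ?\<tau>) (store w k ?ip ?\<tau>)"
    using dexec_move_store[of MoveRight ip ?\<tau>] by simp
  note body = dx_Seq[OF T(3) dx_Seq[OF d dx_Seq[OF m dexec_test_store(1)[of x ?\<tau>, OF assms t(2)] heads_store]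
        heads_store] dexec_heads[OF T(3)]]
  have "dexec w hd_max
    (While (nonzero x) (Seq (return x) (Seq (dec_com x) (Seq (Input_Move MoveRight) (test_com x)))))
    (tested ?ip ?\<tau> x) (tested (if v = 0 then ?ip else min (?ip + v) (length w + 1)) (?\<tau>(x := 0)) x)"
    using Suc.prems by (intro Suc.IH) auto
  moreover have "(if v = 0 then ?ip else min (?ip + v) (length w + 1)) = min (ip + Suc v) (length w + 1)"
    by auto
  ultimately have "dexec w hd_max
    (While (nonzero x) (Seq (return x) (Seq (dec_com x) (Seq (Input_Move MoveRight) (test_com x)))))
    (tested ?ip ?\<tau> x) (tested (min (ip + Suc v) (length w + 1)) (\<sigma>(x := 0)) x)"
    by simp
  note loop = this
  have "\<sigma> x \<noteq> 0" using Suc.prems(1) by simp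
  then have "holds w (nonzero x) (tested ip \<sigma> x)" using T(2) by blast
  from dx_While_True[OF dexec_heads[OF T(3)] this body loop]
  show ?case by (simp only: nat.distinct if_False)
qed

lemma dexec_read_store:
  assumes "x < k" "\<sigma> x < bound w"
  shows "dexec w hd_max (read_com x) (store w k 0 \<sigma>) (store w k 0 (\<sigma>(x := read_val w (\<sigma> x))))"
proof -
  let ?v = "\<sigma> x" and ?\<tau> = "\<sigma>(x := 0)"
  \<comment> \<open>Bit \<open>v\<close> lies in input cell \<open>v + 1\<close>, so one move more
    is made than there are decrements; both positions are clamped at the right end.\<close>
  let ?ip = "min ?v (length w + 1)" and ?jp = "min (Suc ?v) (length w + 1)"
  have \<tau>: "?\<tau> x < bound w" by simp
  note 1 = dexec_test_store(1)[of x \<sigma> 0, OF assms]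
  have 2: "dexec w hd_max
    (While (nonzero x) (Seq (return x) (Seq (dec_com x) (Seq (Input_Move MoveRight) (test_com x)))))
    (tested 0 \<sigma> x) (tested ?ip ?\<tau> x)"
    using dexec_read_loop[of x ?v \<sigma> 0, OF assms(1) refl assms(2)] by (simp split: if_splits)
  note 3 = dexec_test_store(3)[of x ?\<tau> ?ip, OF assms(1) \<tau>]
  have 4: "dexec w hd_max (Input_Move MoveRight) (store w k ?ip ?\<tau>) (store w k ?jp ?\<tau>)"
    using dexec_move_store[of MoveRight ?ip ?\<tau>]
    by (cases "?v \<le> length w") (simp_all add: min_def split: if_splits)
  have cell: "input_cell w ?jp = (if ?v < length w then Bit (w ! ?v) else RightEnd)"
    by (auto simp: input_cell_def min_def)
  have big: "2 < bound w" using bound_gt[of w] by linarith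
  let ?c = "Cond (Input_In [Bit True]) (Seq (inc_com x) (inc_com x))
             (Cond (Input_In [Bit False]) (inc_com x) (Out []))"
  have i1: "dexec w hd_max (inc_com x) (store w k ?jp ?\<tau>) (store w k ?jp (\<sigma>(x := 1)))"
    using dexec_inc_store[OF assms(1), of ?jp ?\<tau>] big by simp
  have i2: "dexec w hd_max (inc_com x) (store w k ?jp (\<sigma>(x := 1))) (store w k ?jp (\<sigma>(x := 2)))"
    using dexec_inc_store[OF assms(1), of ?jp "\<sigma>(x := 1)"] big by (simp add: numeral_2_eq_2)
  have 5: "dexec w hd_max ?c (store w k ?jp ?\<tau>) (store w k ?jp (\<sigma>(x := read_val w ?v)))"
  proof (cases "?v < length w")
    case True
    show ?thesis
    proof (cases "w ! ?v")
      case True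
      then show ?thesis using \<open>?v < length w\<close> cell dx_Seq[OF i1 i2 heads_store]
        by (intro dx_Cond[OF _ heads_store]) (simp add: read_val_def)
    next
      case False
      then show ?thesis using \<open>?v < length w\<close> cell i1
        by (intro dx_Cond[OF _ heads_store], simp, intro dx_Cond[OF _ heads_store])
          (simp add: read_val_def)
    qed
  next
    case False
    then show ?thesis using cell dx_Skip[OF heads_store]
      by (intro dx_Cond[OF _ heads_store], simp, intro dx_Cond[OF _ heads_store])
        (simp add: read_val_def)
  qed
  have 6: "dexec w hd_max (While (Input_In [RightEnd, Bit True, Bit False]) (Input_Move MoveLeft))
     (store w k ?jp \<rho>) (store w k 0 \<rho>)" for \<rho>
    unfolding store_def by (rule dexec_rewind) (auto simp: heads_le_def)
  show ?thesis unfolding read_com_def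
    by (rule dx_Seq[OF 1 dx_Seq[OF 2 dx_Seq[OF 3 dx_Seq[OF 4 dx_Seq[OF 5 6 heads_store] heads_store]
            dexec_heads[OF 3]] dexec_heads[OF 2]] heads_store])
qed

abbreviation "st \<equiv> store w k 0"

abbreviation lift :: "(vals \<Rightarrow> tm_state) \<Rightarrow> (bool list \<times> vals) set \<Rightarrow> (bool list \<times> tm_state) set" where
  "lift f R \<equiv> (\<lambda>(out, t). (out, f t)) ` R"

lemma lift_iff: "(out, u) \<in> lift f R \<longleftrightarrow> (\<exists>t. (out, t) \<in> R \<and> u = f t)"
  by auto

lemma rseq_lift:
  assumes "R' (f s) = lift g (R s)" "\<And>out t. (out, t) \<in> R s \<Longrightarrow> Q' (g t) = lift h (Q t)"
  shows "rseq R' Q' (f s) = lift h (rseq R Q s)"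
proof (intro set_eqI iffI)
  fix y assume "y \<in> rseq R' Q' (f s)"
  then obtain o1 t' o2 u' where y: "y = (o1 @ o2, u')" "(o1, t') \<in> R' (f s)" "(o2, u') \<in> Q' t'"
    by (auto simp: rseq_def)
  then obtain t where t: "t' = g t" "(o1, t) \<in> R s" using assms(1) by auto
  then obtain u where u: "u' = h u" "(o2, u) \<in> Q t" using assms(2)[OF t(2)] y(3) by auto
  show "y \<in> lift h (rseq R Q s)"
    using rseqI[of o1 t R s o2 u Q] t u y(1) by (intro image_eqI[of _ _ "(o1 @ o2, u)"]) auto
next
  fix y assume "y \<in> lift h (rseq R Q s)"
  then obtain o1 t o2 u where y: "y = (o1 @ o2, h u)" "(o1, t) \<in> R s" "(o2, u) \<in> Q t"
    by (auto simp: rseq_def)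
  have "(o1, g t) \<in> R' (f s)" unfolding assms(1) using y(2) by force
  moreover have "(o2, h u) \<in> Q' (g t)" unfolding assms(2)[OF y(2)] using y(3) by force
  ultimately show "y \<in> rseq R' Q' (f s)" unfolding y(1) by (rule rseqI)
qed

text \<open>The arithmetic and reading macros are deterministic, so \<open>dexec_cden\<close> gives
  their denotations; sequences pass through \<open>rseq_lift\<close> and loops through
  \<open>iters_image\<close> with \<open>ok\<close> as invariant.\<close>

lemma comp_den: "vars_below k p \<Longrightarrow> ok w \<sigma> \<Longrightarrow> cden w (comp p) (st \<sigma>) = lift st (den w p \<sigma>)"
proof (induction p arbitrary: \<sigma>)
  case (PInc x)
  then show ?case using dexec_cden[OF dexec_inc_store] by simp
next
  case (PDec x)
  then show ?case using dexec_cden[OF dexec_dec_store] by simp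
next
  case (PRead x)
  then show ?case using dexec_cden[OF dexec_read_store] by (simp add: ok_def)
next
  case (PSeq p q)
  then show ?case
    unfolding comp.simps cden.simps den.simps vars_below.simps
    using ok_den by (intro rseq_lift[of _ st _ st]) blast+
next
  case (PIfZ x p q)
  then have x: "x < k" "\<sigma> x < bound w" by (auto simp: ok_def)
  note T = dexec_test_store[of x \<sigma> 0, OF x]
  have r: "rseq (cden w (return x)) R (tested 0 \<sigma> x) = R (st \<sigma>)" for R
    by (rule rseq_single_nil) (rule dexec_cden[OF T(3)])
  have "cden w (comp (PIfZ x p q)) (st \<sigma>) = (if \<sigma> x = 0 then cden w (comp p) (st \<sigma>) else cden w (comp q) (st \<sigma>))"
    unfolding comp.simps cden.simps using T(2) rseq_single_nil[of "cden w (test_com x)", OF dexec_cden[OF T(1)]]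
    by (simp add: r)
  then show ?case using PIfZ by simp
next
  case (PWhile x p)
  then have x: "x < k" by auto
  note T = dexec_test_store[of x _ 0, OF x]
  \<comment> \<open>A compiled loop enters each round with the test already made, so its states
    correspond to \<open>tested\<close> states instead of \<open>store\<close> states.\<close>
  let ?f = "\<lambda>\<tau>. tested 0 \<tau> x"
  let ?body = "Seq (return x) (Seq (comp p) (test_com x))"
  have body: "cden w ?body (?f \<tau>) = lift ?f (den w p \<tau>)" if "ok w \<tau>" for \<tau>
  proof -
    have t: "\<tau> x < bound w" using that by (simp add: ok_def)
    have "cden w ?body (?f \<tau>) = rseq (cden w (comp p)) (cden w (test_com x)) (st \<tau>)"
      unfolding cden.simps by (rule rseq_single_nil) (rule dexec_cden[OF T(3)[of \<tau>, OF t]])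
    also have "\<dots> = lift ?f (rseq (den w p) (\<lambda>t. {([], t)}) \<tau>)"
    proof (rule rseq_lift[of _ st _ st])
      show "cden w (comp p) (st \<tau>) = lift st (den w p \<tau>)" using PWhile that by simp
      fix out t assume "(out, t) \<in> den w p \<tau>"
      then have "t x < bound w" using ok_den that by (auto simp: ok_def)
      then show "cden w (test_com x) (st t) = lift ?f {([], t)}"
        using dexec_cden[OF T(1)[of t]] by simp
    qed
    also have "rseq (den w p) (\<lambda>t. {([], t)}) \<tau> = den w p \<tau>" by (auto simp: rseq_def)
    finally show ?thesis .
  qed
  have it: "{(out, t). iters (holds w (nonzero x)) (cden w ?body) (?f \<sigma>) out t} =
    lift ?f {(out, t). iters (\<lambda>\<sigma>. \<sigma> x \<noteq> 0) (den w p) \<sigma> out t \<and> ok w t}"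
  proof (rule iters_image)
    show "ok w \<tau> \<Longrightarrow> holds w (nonzero x) (?f \<tau>) \<longleftrightarrow> \<tau> x \<noteq> 0" for \<tau>
      by (rule T(2)) (simp add: ok_def)
    show "ok w s \<Longrightarrow> s x \<noteq> 0 \<Longrightarrow> (out, t) \<in> den w p s \<Longrightarrow> ok w t" for s out t
      using ok_den by blast
  qed (use body PWhile.prems in auto)
  have nz: "holds w (nonzero x) (?f \<tau>) \<longleftrightarrow> \<tau> x \<noteq> 0" if "ok w \<tau>" for \<tau>
    by (rule T(2)) (use that in \<open>simp add: ok_def\<close>)
  have loop: "cden w (While (nonzero x) ?body) (?f \<sigma>) = lift ?f (den w (PWhile x p) \<sigma> \<inter> {y. ok w (snd y)})"
  proof (rule set_eqI)
    fix y :: "bool list \<times> tm_state"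
    obtain out u where y: "y = (out, u)" by (cases y)
    have "iters (holds w (nonzero x)) (cden w ?body) (?f \<sigma>) out u \<longleftrightarrow>
      (\<exists>t. u = ?f t \<and> iters (\<lambda>\<sigma>. \<sigma> x \<noteq> 0) (den w p) \<sigma> out t \<and> ok w t)"
      using arg_cong[OF it, of "\<lambda>S. (out, u) \<in> S"] by (auto simp del: cden.simps)
    then show "y \<in> cden w (While (nonzero x) ?body) (?f \<sigma>) \<longleftrightarrow>
      y \<in> lift ?f (den w (PWhile x p) \<sigma> \<inter> {y. ok w (snd y)})"
      unfolding y cden.simps(6) den.simps(7) while_rel_def lift_iff using nz
      by (auto simp del: cden.simps den.simps)
  qed
  have "den w (PWhile x p) \<sigma> \<inter> {y. ok w (snd y)} = den w (PWhile x p) \<sigma>"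
    using ok_den PWhile.prems(2) by fastforce
  with loop have loop: "cden w (While (nonzero x) ?body) (?f \<sigma>) = lift ?f (den w (PWhile x p) \<sigma>)"
    by simp
  have "cden w (comp (PWhile x p)) (st \<sigma>) = rseq (cden w (While (nonzero x) ?body)) (cden w (return x)) (?f \<sigma>)"
    unfolding comp.simps cden.simps
    by (rule rseq_single_nil) (rule dexec_cden[OF T(1)], use PWhile.prems in \<open>simp add: ok_def\<close>)
  also have "\<dots> = lift st (rseq (den w (PWhile x p)) (\<lambda>t. {([], t)}) \<sigma>)"
  proof (rule rseq_lift[of _ ?f _ ?f])
    fix out t assume "(out, t) \<in> den w (PWhile x p) \<sigma>"
    then have "ok w t" using ok_den PWhile.prems(2) by blast
    then have "t x < bound w" by (simp add: ok_def)
    then show "cden w (return x) (?f t) = lift st {([], t)}"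
      using dexec_cden[OF T(3)[of t]] by simp
  qed (rule loop)
  also have "rseq (den w (PWhile x p)) (\<lambda>t. {([], t)}) \<sigma> = den w (PWhile x p) \<sigma>" by (auto simp: rseq_def)
  finally show ?case .
next
  case (PStar p)
  have "{(out, t). iters (\<lambda>_. True) (cden w (comp p)) (st \<sigma>) out t} =
    lift st {(out, t). iters (\<lambda>_. True) (den w p) \<sigma> out t \<and> ok w t}"
    by (rule iters_image) (use PStar ok_den in auto)
  also have "{(out, t). iters (\<lambda>_. True) (den w p) \<sigma> out t \<and> ok w t} = den w (PStar p) \<sigma>"
    using ok_den[of _ _ w "PStar p" \<sigma>] PStar.prems by (auto simp: star_rel_def)
  finally show ?case by (simp add: star_rel_def)
qed (auto simp: image_Un)

end

section \<open>The Turing machine of a counter program\<close>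

definition tm :: "nat \<Rightarrow> prog \<Rightarrow> machine" where
  "tm k p = machine_of k (b + 3) (Seq (init_com k) (comp p))"

lemma wf_tm_com: "vars_below k p \<Longrightarrow> wf_com k (b + 3) (Seq (init_com k) (comp p))"
  by (simp add: wf_init wf_comp)

lemma initial_tm: "initial (tm k p) = cfg [Seq (init_com k) (comp p)] (0, replicate k (\<lambda>_. 0, 0))"
  by (simp add: initial_def tm_def machine_of_def cfg_def)

lemma valid_initial:
  assumes "vars_below k p"
  shows "valid k (b + 3) (Seq (init_com k) (comp p)) w [Seq (init_com k) (comp p)]
    (0, replicate k (\<lambda>_. 0, 0))"
  by (simp add: valid_def[OF wf_tm_com[OF assms]] good_def del: conts.simps)

lemma run_tm:
  assumes "vars_below k p" "run (tm k p) w (initial (tm k p)) out x"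
  obtains K s where "x = cfg K s"
    "heads_le (tape_len w + 1) s \<and> K \<noteq> [] \<or> cruns w [comp p] (store w k 0 (\<lambda>_. 0)) out K s"
proof -
  obtain K s where x: "x = cfg K s" and
    r: "cruns w [Seq (init_com k) (comp p)] (0, replicate k (\<lambda>_. 0, 0)) out K s"
    using run_to_cruns[OF wf_tm_com[OF assms(1)] assms(2)[unfolded initial_tm, unfolded tm_def] refl valid_initial[OF assms(1)]]
    by blast
  have h: "heads_le (tape_len w + 1) (0, replicate k (\<lambda>_. 0, 0))" by (auto simp: heads_le_def)
  from r have "heads_le (tape_len w + 1) s \<and> K \<noteq> [] \<or>
      cruns w [init_com k, comp p] (0, replicate k (\<lambda>_. 0, 0)) out K s"
    by (cases rule: cruns_cases) (use h in \<open>auto simp: cstep_simps\<close>)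
  then show ?thesis using that[OF x] dexec_cruns[OF dexec_init, of w k "[comp p]"] by blast
qed

lemma marked_store: "marked (tape_len w + 1) (store w k 0 \<sigma>)"
  by (auto simp: marked_def store_def tp_def enc_def nth_append)

text \<open>Until the end markers are written the heads are bounded through \<open>dexec\<close>,
  afterwards by the markers themselves.\<close>

lemma log_space_tm: "vars_below k p \<Longrightarrow> log_space (tm k p)"
  unfolding log_space_def
proof (intro exI[of _ 4] allI impI)
  fix w out x assume p: "vars_below k p" and r: "run (tm k p) w (initial (tm k p)) out x"
  obtain K s where x: "x = cfg K s" and
    "heads_le (tape_len w + 1) s \<and> K \<noteq> [] \<or> cruns w [comp p] (store w k 0 (\<lambda>_. 0)) out K s"
    using run_tm[OF p r] .
  moreover have "heads_le (tape_len w + 1) s" if "cruns w [comp p] (store w k 0 (\<lambda>_. 0)) out K s"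
  proof -
    have "marked (tape_len w + 1) s"
      using marked_cruns[OF that _ marked_store] bounded_comp by simp
    then show ?thesis by (auto simp: marked_def heads_le_def)
  qed
  ultimately have "heads_le (tape_len w + 1) s" by blast
  moreover have "real (h + 1) \<le> real 4 * log 2 (real (length w + 2))" if "h \<le> tape_len w + 1" for h
    using tape_len_log[of w] that by simp
  ultimately show "\<forall>(t, h) \<in> set (work x). real (h + 1) \<le> real 4 * log 2 (real (length w + 2))"
    unfolding x cfg_def heads_le_def by auto
qed

lemma state_cfg: "state (cfg K s) = accept (tm k p) \<longleftrightarrow> K = []"
  by (simp add: cfg_def tm_def machine_of_def)

lemma run_tm_accept_iff:
  assumes "vars_below k p"
  shows "(\<exists>x. run (tm k p) w (initial (tm k p)) out x \<and> state x = accept (tm k p)) \<longleftrightarrow>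
    (\<exists>\<sigma>. (out, \<sigma>) \<in> den w p (\<lambda>_. 0))"
proof -
  have ok: "ok w (\<lambda>_. 0)" by (simp add: ok_def)
  have 1: "(\<exists>\<sigma>. (out, \<sigma>) \<in> den w p (\<lambda>_. 0)) \<longleftrightarrow> (\<exists>t. cruns w [comp p] (store w k 0 (\<lambda>_. 0)) out [] t)"
    unfolding cden_iff_cruns[symmetric] comp_den[OF assms ok]
  proof
    assume "\<exists>\<sigma>. (out, \<sigma>) \<in> den w p (\<lambda>_. 0)"
    then obtain \<sigma> where "(out, \<sigma>) \<in> den w p (\<lambda>_. 0)" ..
    then show "\<exists>t. (out, t) \<in> (\<lambda>(out, t). (out, store w k 0 t)) ` den w p (\<lambda>_. 0)"
      by (intro exI[of _ "store w k 0 \<sigma>"] image_eqI[of _ _ "(out, \<sigma>)"]) auto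
  qed auto
  show ?thesis
  proof
    assume "\<exists>x. run (tm k p) w (initial (tm k p)) out x \<and> state x = accept (tm k p)"
    then obtain x where x: "run (tm k p) w (initial (tm k p)) out x" "state x = accept (tm k p)" by blast
    from run_tm[OF assms x(1)] obtain K s where K: "x = cfg K s"
      "heads_le (tape_len w + 1) s \<and> K \<noteq> [] \<or> cruns w [comp p] (store w k 0 (\<lambda>_. 0)) out K s" .
    then have "K = []" using x(2) state_cfg by blast
    then show "\<exists>\<sigma>. (out, \<sigma>) \<in> den w p (\<lambda>_. 0)" using 1 K by blast
  next
    assume "\<exists>\<sigma>. (out, \<sigma>) \<in> den w p (\<lambda>_. 0)"
    then obtain t where "cruns w [comp p] (store w k 0 (\<lambda>_. 0)) out [] t" using 1 by blast
    moreover have "cruns w [init_com k, comp p] (0, replicate k (\<lambda>_. 0, 0)) [] [comp p] (store w k 0 (\<lambda>_. 0))"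
      using cden_cruns dexec_cden[OF dexec_init] by blast
    ultimately have "cruns w [init_com k, comp p] (0, replicate k (\<lambda>_. 0, 0)) out [] t"
      using cruns_trans by fastforce
    then have "cruns w [Seq (init_com k) (comp p)] (0, replicate k (\<lambda>_. 0, 0)) out [] t"
      using cruns_step[OF cs_Seq] by fastforce
    from cruns_to_run[OF wf_tm_com[OF assms] this valid_initial[OF assms]]
    show "\<exists>x. run (tm k p) w (initial (tm k p)) out x \<and> state x = accept (tm k p)"
      unfolding initial_tm using state_cfg unfolding tm_def by blast
  qed
qed

lemma NL_I:
  assumes "\<And>w. w \<in> L \<longleftrightarrow> den w p (\<lambda>_. 0) \<noteq> {}"
  shows "L \<in> NL"
proof -
  obtain k where k: "vars_below k p" using vars_below_ex by blast
  have "L = {w. accepts (tm k p) w}"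
    unfolding accepts_def using run_tm_accept_iff[OF k] assms by fast
  then show ?thesis
    unfolding NL_def using log_space_tm[OF k] machine_of_wf unfolding tm_def by blast
qed

lemma log_space_computableI:
  assumes "det_prog p" "\<And>w. \<exists>\<sigma>. (f w, \<sigma>) \<in> den w p (\<lambda>_. 0)"
  shows "log_space_computable f"
proof -
  obtain k where k: "vars_below k p" using vars_below_ex by blast
  have "computes (tm k p) f"
    unfolding computes_def using run_tm_accept_iff[OF k] assms(2) by blast
  moreover have "deterministic (tm k p)"
    unfolding tm_def by (rule machine_of_deterministic) (simp add: det_init det_comp assms(1))
  ultimately show ?thesis
    unfolding log_space_computable_def using log_space_tm[OF k] machine_of_wf unfolding tm_def by blast
qed

end

section \<open>Predicates decidable by programs\<close>

context base
begin

text \<open>Variables from \<open>k\<close> on are free for use; programs find and leave them at zero.\<close>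

definition clean :: "bool list \<Rightarrow> nat \<Rightarrow> vals \<Rightarrow> bool" where
  "clean w k \<sigma> \<longleftrightarrow> ok w \<sigma> \<and> (\<forall>x \<ge> k. \<sigma> x = 0)"

lemma clean_less: "clean w k \<sigma> \<Longrightarrow> \<sigma> x < bound w"
  by (simp add: clean_def ok_def)

lemma clean_zero: "clean w k \<sigma> \<Longrightarrow> k \<le> x \<Longrightarrow> \<sigma> x = 0"
  by (simp add: clean_def)

lemma clean_upd: "clean w k \<sigma> \<Longrightarrow> v < bound w \<Longrightarrow> k \<le> l \<Longrightarrow> x < l \<Longrightarrow> clean w l (\<sigma>(x := v))"
  by (auto simp: clean_def ok_def)

text \<open>The answer is left in variable \<open>k\<close>, the first free one. A decider for
  \<open>Suc k\<close> may instead treat \<open>k\<close> as a parameter, which is how quantifiers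
  bind variables.\<close>

definition ddec :: "nat \<Rightarrow> (bool list \<Rightarrow> vals \<Rightarrow> bool) \<Rightarrow> bool" where
  "ddec k P \<longleftrightarrow> (\<exists>p. det_prog p \<and>
     (\<forall>w \<sigma>. clean w k \<sigma> \<longrightarrow> den w p \<sigma> = {([], \<sigma>(k := of_bool (P w \<sigma>)))}))"

text \<open>Success returns the state unchanged and failure has no outcome, so verifiers can be
  composed in sequence. Nothing is said about the complement, which requires a program of its
  own.\<close>

definition nd :: "nat \<Rightarrow> (bool list \<Rightarrow> vals \<Rightarrow> bool) \<Rightarrow> bool" where
  "nd k P \<longleftrightarrow> (\<exists>p. \<forall>w \<sigma>. clean w k \<sigma> \<longrightarrow> den w p \<sigma> = (if P w \<sigma> then {([], \<sigma>)} else {}))"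

abbreviation skip :: prog where "skip \<equiv> POut []"

text \<open>A deterministic loop is described by the sequence \<open>s\<close> of its states at the
  start of each round, with the exit at round \<open>n\<close>.\<close>

lemma while_fn:
  assumes "\<And>i. i < n \<Longrightarrow> s i x \<noteq> 0 \<and> den w p (s i) = {([], s (Suc i))}" "s n x = 0"
  shows "den w (PWhile x p) (s 0) = {([], s n)}"
  using assms
proof (induction n arbitrary: s)
  case 0
  then show ?case by (simp add: while_rel_False)
next
  case (Suc n)
  have "den w (PWhile x p) (s (Suc 0)) = {([], s (Suc n))}"
    using Suc.IH[of "\<lambda>i. s (Suc i)"] Suc.prems by simp
  moreover have "den w (PWhile x p) (s 0) = den w (PWhile x p) (s (Suc 0))"
    unfolding den.simps using Suc.prems(1)[of 0]
    by (simp add: while_rel_True[of _ "s 0"] rseq_single_nil)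
  ultimately show ?case by simp
qed

lemma den_seq: "den w p \<sigma> = {([], \<tau>)} \<Longrightarrow> den w (PSeq p q) \<sigma> = den w q \<tau>"
  by (simp add: rseq_single_nil)

lemma den_inc: "Suc (\<sigma> x) < bound w \<Longrightarrow> den w (PInc x) \<sigma> = {([], \<sigma>(x := Suc (\<sigma> x)))}"
  by simp

lemma den_dec: "\<sigma> x < bound w \<Longrightarrow> \<sigma> x \<noteq> 0 \<Longrightarrow> den w (PDec x) \<sigma> = {([], \<sigma>(x := \<sigma> x - 1))}"
proof -
  assume "\<sigma> x < bound w" "\<sigma> x \<noteq> 0"
  then have "\<sigma> x + (bound w - 1) = (\<sigma> x - 1) + bound w" "\<sigma> x - 1 < bound w" by auto
  then have "(\<sigma> x + (bound w - 1)) mod bound w = \<sigma> x - 1"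
    by (simp only: mod_add_self2 mod_less)
  then show ?thesis by simp
qed

lemma den_ifz:
  "\<sigma> x = 0 \<Longrightarrow> den w (PIfZ x p q) \<sigma> = den w p \<sigma>"
  "\<sigma> x \<noteq> 0 \<Longrightarrow> den w (PIfZ x p q) \<sigma> = den w q \<sigma>"
  by simp_all

section \<open>Clearing, moving and copying counters\<close>

definition zero_prog :: "nat \<Rightarrow> prog" where
  "zero_prog x = PWhile x (PDec x)"

lemma den_zero: "\<sigma> x < bound w \<Longrightarrow> den w (zero_prog x) \<sigma> = {([], \<sigma>(x := 0))}"
proof -
  assume less: "\<sigma> x < bound w"
  let ?s = "\<lambda>i. \<sigma>(x := \<sigma> x - i)"
  have "den w (PWhile x (PDec x)) (?s 0) = {([], ?s (\<sigma> x))}"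
  proof (rule while_fn[where s = ?s])
    fix i assume "i < \<sigma> x"
    then show "?s i x \<noteq> 0 \<and> den w (PDec x) (?s i) = {([], ?s (Suc i))}"
      using less by (subst den_dec) auto
  qed simp
  then show ?thesis by (simp add: zero_prog_def del: den.simps)
qed

definition move_prog :: "nat \<Rightarrow> nat \<Rightarrow> prog" where
  "move_prog x y = PWhile x (PSeq (PDec x) (PInc y))"

lemma den_move:
  assumes "\<sigma> x < bound w" "\<sigma> y = 0" "x \<noteq> y"
  shows "den w (move_prog x y) \<sigma> = {([], \<sigma>(x := 0, y := \<sigma> x))}"
proof -
  let ?s = "\<lambda>i. \<sigma>(x := \<sigma> x - i, y := i)"
  have "den w (PWhile x (PSeq (PDec x) (PInc y))) (?s 0) = {([], ?s (\<sigma> x))}"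
  proof (rule while_fn[where s = ?s])
    fix i assume i: "i < \<sigma> x"
    have "den w (PDec x) (?s i) = {([], \<sigma>(x := \<sigma> x - Suc i, y := i))}"
      using assms i by (subst den_dec) (auto simp: fun_eq_iff)
    then have "den w (PSeq (PDec x) (PInc y)) (?s i) = den w (PInc y) (\<sigma>(x := \<sigma> x - Suc i, y := i))"
      by (rule den_seq)
    then show "?s i x \<noteq> 0 \<and> den w (PSeq (PDec x) (PInc y)) (?s i) = {([], ?s (Suc i))}"
      using assms i by (simp add: den_inc del: den.simps)
  qed (use assms in auto)
  moreover have "?s 0 = \<sigma>" "?s (\<sigma> x) = \<sigma>(x := 0, y := \<sigma> x)" using assms by auto
  ultimately show ?thesis unfolding move_prog_def by metis
qed

definition copy_prog :: "nat \<Rightarrow> nat \<Rightarrow> nat \<Rightarrow> prog" where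
  "copy_prog x y t = PSeq (PWhile x (PSeq (PDec x) (PSeq (PInc y) (PInc t)))) (move_prog t x)"

lemma den_copy:
  assumes "\<sigma> x < bound w" "\<sigma> y = 0" "\<sigma> t = 0" "distinct [x, y, t]"
  shows "den w (copy_prog x y t) \<sigma> = {([], \<sigma>(y := \<sigma> x))}"
proof -
  let ?s = "\<lambda>i. \<sigma>(x := \<sigma> x - i, y := i, t := i)"
  have "den w (PWhile x (PSeq (PDec x) (PSeq (PInc y) (PInc t)))) (?s 0) = {([], ?s (\<sigma> x))}"
  proof (rule while_fn[where s = ?s])
    fix i assume i: "i < \<sigma> x"
    have "den w (PDec x) (?s i) = {([], \<sigma>(x := \<sigma> x - Suc i, y := i, t := i))}"
      using assms i by (subst den_dec) (auto simp: fun_eq_iff)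
    then have "den w (PSeq (PDec x) (PSeq (PInc y) (PInc t))) (?s i) =
      den w (PSeq (PInc y) (PInc t)) (\<sigma>(x := \<sigma> x - Suc i, y := i, t := i))"
      by (rule den_seq)
    also have "\<dots> = den w (PInc t) (\<sigma>(x := \<sigma> x - Suc i, y := Suc i, t := i))"
      using assms i by (intro den_seq, subst den_inc) (auto simp: fun_eq_iff)
    also have "\<dots> = {([], ?s (Suc i))}"
      using assms i by (subst den_inc) (auto simp: fun_eq_iff)
    finally show "?s i x \<noteq> 0 \<and> den w (PSeq (PDec x) (PSeq (PInc y) (PInc t))) (?s i) = {([], ?s (Suc i))}"
      using assms i by simp
  qed (use assms in auto)
  moreover have "?s 0 = \<sigma>" using assms by auto
  ultimately have "den w (copy_prog x y t) \<sigma> = den w (move_prog t x) (?s (\<sigma> x))"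
    unfolding copy_prog_def by (metis den_seq)
  also have "\<dots> = {([], \<sigma>(y := \<sigma> x))}"
    using assms by (subst den_move) (auto simp: fun_eq_iff)
  finally show ?thesis .
qed

lemma det_macro_progs [simp]:
  "det_prog (zero_prog x)" "det_prog (move_prog x y)" "det_prog (copy_prog x y t)"
  by (simp_all add: zero_prog_def move_prog_def copy_prog_def)

subsection \<open>Deterministic predicates\<close>

lemma ddec_bit:
  assumes "x < k"
  shows "ddec k (\<lambda>w \<sigma>. \<sigma> x < length w \<and> w ! \<sigma> x)" and "ddec k (\<lambda>w \<sigma>. \<sigma> x < length w)"
proof -
  have c: "den w (PSeq (copy_prog x k (Suc k)) (PSeq (PRead k) q)) \<sigma> = den w q (\<sigma>(k := read_val w (\<sigma> x)))"
    if "clean w k \<sigma>" for w \<sigma> q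
    using that assms
    by (subst den_seq[OF den_copy])
       (auto simp: clean_less clean_zero rseq_single_nil)
  have b: "2 < bound w" for w using bound_gt[of w] by linarith
  show "ddec k (\<lambda>w \<sigma>. \<sigma> x < length w \<and> w ! \<sigma> x)"
    unfolding ddec_def
  proof (intro exI conjI allI impI)
    fix w \<sigma> assume cl: "clean w k \<sigma>"
    show "den w (PSeq (copy_prog x k (Suc k)) (PSeq (PRead k) (PIfZ k skip (PDec k)))) \<sigma> =
        {([], \<sigma>(k := of_bool (\<sigma> x < length w \<and> w ! \<sigma> x)))}"
      unfolding c[OF cl] den.simps(6) using b[of w]
      by (simp add: den_dec read_val_def del: den.simps(2))
  qed simp
  show "ddec k (\<lambda>w \<sigma>. \<sigma> x < length w)"
    unfolding ddec_def
  proof (intro exI conjI allI impI)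
    fix w \<sigma> assume cl: "clean w k \<sigma>"
    show "den w (PSeq (copy_prog x k (Suc k)) (PSeq (PRead k) (PIfZ k skip (PSeq (zero_prog k) (PInc k))))) \<sigma> =
        {([], \<sigma>(k := of_bool (\<sigma> x < length w)))}"
      unfolding c[OF cl] den.simps(6) using b[of w]
      by (simp add: den_zero read_val_def rseq_single_nil)
  qed simp
qed

text \<open>Subtracting one by one from a copy of \<open>z\<close>, with a flag for underflow, decides
  \<open>x * y + u = z\<close> without leaving the range of the counters.\<close>

lemma ddec_mult_add:
  assumes "x < k" "y < k" "u < k" "z < k"
  shows "ddec k (\<lambda>w \<sigma>. \<sigma> x * \<sigma> y + \<sigma> u = \<sigma> z)"
proof -
  let ?a = k and ?f = "k + 1" and ?t = "k + 2" and ?r = "k + 3" and ?c = "k + 4"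
  let ?tick = "PIfZ ?a (PIfZ ?f (PInc ?f) skip) (PDec ?a)"
  let ?ticks = "PWhile ?r (PSeq (PDec ?r) ?tick)"
  let ?body = "PSeq (PDec ?t) (PSeq (copy_prog y ?r ?c) ?ticks)"
  \<comment> \<open>The answer is 1 exactly if the copy of \<open>z\<close> came out at zero without
    underflow.\<close>
  let ?fin = "PIfZ ?f (PIfZ ?a (PInc ?a) (zero_prog ?a)) (PSeq (PDec ?f) (zero_prog ?a))"
  let ?p = "PSeq (copy_prog z ?a ?t) (PSeq (copy_prog x ?t ?r) (PSeq (PWhile ?t ?body)
     (PSeq (copy_prog u ?r ?c) (PSeq ?ticks ?fin))))"
  have "den w ?p \<sigma> = {([], \<sigma>(k := of_bool (\<sigma> x * \<sigma> y + \<sigma> u = \<sigma> z)))}" if cl: "clean w k \<sigma>" for w \<sigma>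
  proof -
    note less = clean_less[OF cl] and zero = clean_zero[OF cl]
    have two: "2 < bound w" using bound_gt[of w] by linarith
    \<comment> \<open>The state after \<open>n\<close> unit subtractions: a truncated difference and
      a flag telling whether the subtractions went beyond \<open>z\<close>.\<close>
    let ?g = "\<lambda>n t r. \<sigma>(?a := \<sigma> z - n, ?f := of_bool (\<sigma> z < n), ?t := t, ?r := r)"
    have tick: "den w ?tick (?g n t r) = {([], ?g (Suc n) t r)}" for n t r
    proof -
      consider "n < \<sigma> z" | "n = \<sigma> z" | "\<sigma> z < n" by linarith
      then show ?thesis
      proof cases
        case 1
        then show ?thesis using less[of z]
          by (simp add: den_dec del: den.simps(2)) (auto simp: fun_eq_iff)
      next
        case 2
        then show ?thesis using two by (auto simp: fun_eq_iff)
      next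
        case 3
        then show ?thesis by (auto simp: fun_eq_iff)
      qed
    qed
    have ticks: "den w ?ticks (?g n t r) = {([], ?g (n + r) t 0)}" if "r < bound w" for n t r
    proof -
      have "den w ?ticks (?g (n + 0) t (r - 0)) = {([], ?g (n + r) t (r - r))}"
      proof (rule while_fn[where s = "\<lambda>i. ?g (n + i) t (r - i)" and n = r])
        fix i assume i: "i < r"
        have "den w (PDec ?r) (?g (n + i) t (r - i)) = {([], ?g (n + i) t (r - Suc i))}"
          using i that by (subst den_dec) (auto simp: fun_eq_iff)
        then have "den w (PSeq (PDec ?r) ?tick) (?g (n + i) t (r - i)) = den w ?tick (?g (n + i) t (r - Suc i))"
          by (rule den_seq)
        then show "?g (n + i) t (r - i) ?r \<noteq> 0 \<and>
            den w (PSeq (PDec ?r) ?tick) (?g (n + i) t (r - i)) = {([], ?g (n + Suc i) t (r - Suc i))}"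
          using i tick by simp
      qed simp
      then show ?thesis by simp
    qed
    have copy: "den w (copy_prog v ?r ?c) (?g n t 0) = {([], ?g n t (\<sigma> v))}" if "v < k" for v n t
      using that less[of v] zero[of ?c] by (subst den_copy) (auto simp: fun_eq_iff)
    have loop: "den w (PWhile ?t ?body) (?g (0 * \<sigma> y) (\<sigma> x - 0) 0) = {([], ?g (\<sigma> x * \<sigma> y) (\<sigma> x - \<sigma> x) 0)}"
    proof (rule while_fn[where s = "\<lambda>i. ?g (i * \<sigma> y) (\<sigma> x - i) 0" and n = "\<sigma> x"])
      fix i assume i: "i < \<sigma> x"
      have "den w (PDec ?t) (?g (i * \<sigma> y) (\<sigma> x - i) 0) = {([], ?g (i * \<sigma> y) (\<sigma> x - Suc i) 0)}"
        using i less[of x] by (subst den_dec) (auto simp: fun_eq_iff)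
      then have "den w ?body (?g (i * \<sigma> y) (\<sigma> x - i) 0) =
          den w (PSeq (copy_prog y ?r ?c) ?ticks) (?g (i * \<sigma> y) (\<sigma> x - Suc i) 0)"
        by (rule den_seq)
      also have "\<dots> = den w ?ticks (?g (i * \<sigma> y) (\<sigma> x - Suc i) (\<sigma> y))"
        by (rule den_seq[OF copy]) (rule assms)
      also have "\<dots> = {([], ?g (i * \<sigma> y + \<sigma> y) (\<sigma> x - Suc i) 0)}"
        by (rule ticks) (rule less)
      finally show "?g (i * \<sigma> y) (\<sigma> x - i) 0 ?t \<noteq> 0 \<and>
          den w ?body (?g (i * \<sigma> y) (\<sigma> x - i) 0) = {([], ?g (Suc i * \<sigma> y) (\<sigma> x - Suc i) 0)}"
        using i by (simp add: add.commute)
    qed simp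
    let ?n = "\<sigma> x * \<sigma> y + \<sigma> u"
    have c: "den w (copy_prog z ?a ?t) \<sigma> = {([], \<sigma>(?a := \<sigma> z))}"
      using less[of z] zero assms by (subst den_copy) auto
    have e: "\<sigma>(?a := \<sigma> z) = ?g 0 0 0" using zero by (auto simp: fun_eq_iff)
    from den_seq[OF back_subst[of "\<lambda>\<tau>. den w (copy_prog z ?a ?t) \<sigma> = {([], \<tau>)}", OF c e]] have "den w ?p \<sigma> = den w (PSeq (copy_prog x ?t ?r) (PSeq (PWhile ?t ?body)
       (PSeq (copy_prog u ?r ?c) (PSeq ?ticks ?fin)))) (?g 0 0 0)" .
    also have "\<dots> = den w (PSeq (PWhile ?t ?body) (PSeq (copy_prog u ?r ?c) (PSeq ?ticks ?fin)))
        (?g (0 * \<sigma> y) (\<sigma> x - 0) 0)"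
      using less[of x] zero[of ?r] assms by (intro den_seq, subst den_copy) (auto simp: fun_eq_iff)
    also have "\<dots> = den w (PSeq (copy_prog u ?r ?c) (PSeq ?ticks ?fin)) (?g (\<sigma> x * \<sigma> y) 0 0)"
      by (rule den_seq) (use loop in simp)
    also have "\<dots> = den w (PSeq ?ticks ?fin) (?g (\<sigma> x * \<sigma> y) 0 (\<sigma> u))"
      by (rule den_seq[OF copy]) (rule assms)
    also have "\<dots> = den w ?fin (?g ?n 0 0)"
      by (rule den_seq[OF ticks]) (rule less)
    also have "\<dots> = {([], \<sigma>(k := of_bool (?n = \<sigma> z)))}"
    proof -
      have z: "\<sigma> (k + 1) = 0" "\<sigma> (k + 2) = 0" "\<sigma> (k + 3) = 0" using zero by auto
      consider "?n < \<sigma> z" | "?n = \<sigma> z" | "\<sigma> z < ?n" by linarith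
      then show ?thesis
      proof cases
        case 1
        then show ?thesis using less[of z] z
          by (simp add: den_zero) (auto simp: fun_eq_iff)
      next
        case 2
        then show ?thesis using two z by (auto simp: fun_eq_iff)
      next
        case 3
        then have "den w (PDec ?f) (?g ?n 0 0) = {([], (?g ?n 0 0)(?f := 0))}"
          using two by (subst den_dec) auto
        from den_seq[OF this, of "zero_prog ?a"] show ?thesis using 3 z
          by (simp add: den_zero del: den.simps(2,5)) (auto simp: fun_eq_iff)
      qed
    qed
    finally show ?thesis .
  qed
  then show ?thesis unfolding ddec_def by (intro exI[of _ ?p]) simp
qed

lemma ddec_cong: "ddec k P \<Longrightarrow> (\<And>w \<sigma>. clean w k \<sigma> \<Longrightarrow> P w \<sigma> \<longleftrightarrow> Q w \<sigma>) \<Longrightarrow> ddec k Q"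
  unfolding ddec_def by simp

lemma ddec_const: "ddec k (\<lambda>w \<sigma>. c)"
proof -
  have "den w (if c then PInc k else skip) \<sigma> = {([], \<sigma>(k := of_bool c))}" if "clean w k \<sigma>" for w \<sigma>
    using clean_zero[OF that, of k] bound_gt[of w] by auto
  then show ?thesis unfolding ddec_def by (intro exI[of _ "if c then PInc k else skip"]) simp
qed

lemma ddec_not:
  assumes "ddec k P"
  shows "ddec k (\<lambda>w \<sigma>. \<not> P w \<sigma>)"
proof -
  obtain p where p: "det_prog p" "\<And>w \<sigma>. clean w k \<sigma> \<Longrightarrow> den w p \<sigma> = {([], \<sigma>(k := of_bool (P w \<sigma>)))}"
    using assms unfolding ddec_def by blast
  have "den w (PSeq p (PIfZ k (PInc k) (PDec k))) \<sigma> = {([], \<sigma>(k := of_bool (\<not> P w \<sigma>)))}"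
    if "clean w k \<sigma>" for w \<sigma>
    using bound_gt[of w] clean_zero[OF that, of k] by (simp add: den_seq[OF p(2)[OF that]] fun_eq_iff del: den.simps(5))
  then show ?thesis unfolding ddec_def
    by (intro exI[of _ "PSeq p (PIfZ k (PInc k) (PDec k))"]) (simp add: p(1))
qed

lemma ddec_conj:
  assumes "ddec k P" "ddec k Q"
  shows "ddec k (\<lambda>w \<sigma>. P w \<sigma> \<and> Q w \<sigma>)"
proof -
  obtain p where p: "det_prog p" "\<And>w \<sigma>. clean w k \<sigma> \<Longrightarrow> den w p \<sigma> = {([], \<sigma>(k := of_bool (P w \<sigma>)))}"
    using assms unfolding ddec_def by blast
  obtain q where q: "det_prog q" "\<And>w \<sigma>. clean w k \<sigma> \<Longrightarrow> den w q \<sigma> = {([], \<sigma>(k := of_bool (Q w \<sigma>)))}"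
    using assms unfolding ddec_def by blast
  have "den w (PSeq p (PIfZ k skip (PSeq (PDec k) q))) \<sigma> = {([], \<sigma>(k := of_bool (P w \<sigma> \<and> Q w \<sigma>)))}"
    if "clean w k \<sigma>" for w \<sigma>
  proof (cases "P w \<sigma>")
    case True
    have "den w (PDec k) (\<sigma>(k := 1)) = {([], \<sigma>)}"
      using bound_gt[of w] clean_zero[OF that, of k] by (subst den_dec) (auto simp: fun_eq_iff)
    then have "den w (PSeq (PDec k) q) (\<sigma>(k := 1)) = den w q \<sigma>" by (rule den_seq)
    then show ?thesis using True by (simp add: den_seq[OF p(2)[OF that]] q(2)[OF that] del: den.simps(5))
  next
    case False
    then show ?thesis by (simp add: den_seq[OF p(2)[OF that]] del: den.simps(5))
  qed
  then show ?thesis unfolding ddec_def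
    by (intro exI[of _ "PSeq p (PIfZ k skip (PSeq (PDec k) q))"]) (simp add: p(1) q(1))
qed

lemma ddec_disj: "ddec k P \<Longrightarrow> ddec k Q \<Longrightarrow> ddec k (\<lambda>w \<sigma>. P w \<sigma> \<or> Q w \<sigma>)"
  by (rule ddec_cong[OF ddec_not[OF ddec_conj[OF ddec_not ddec_not]]]) auto

lemma ddec_imp: "ddec k P \<Longrightarrow> ddec k Q \<Longrightarrow> ddec k (\<lambda>w \<sigma>. P w \<sigma> \<longrightarrow> Q w \<sigma>)"
  by (rule ddec_cong[OF ddec_disj[OF ddec_not]]) auto

text \<open>Exhaustive search in increasing order. \<open>?r\<close> receives the answer for the
  current candidate and \<open>?c\<close> keeps the loop alive; after the last candidate the
  increment wraps to 0 and \<open>?c\<close> is not set again.\<close>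

lemma ddec_ex:
  assumes "ddec (Suc k) (\<lambda>w \<sigma>. P w \<sigma> (\<sigma> k))" "\<And>w \<sigma> v. P w (\<sigma>(k := v)) = P w \<sigma>"
  shows "ddec k (\<lambda>w \<sigma>. \<exists>a < bound w. P w \<sigma> a)"
proof -
  obtain p where p: "det_prog p" "\<And>w \<sigma>. clean w (Suc k) \<sigma> \<Longrightarrow>
      den w p \<sigma> = {([], \<sigma>(Suc k := of_bool (P w \<sigma> (\<sigma> k))))}"
    using assms(1) unfolding ddec_def by blast
  let ?r = "k + 1" and ?c = "k + 2"
  let ?test = "PIfZ ?r (PSeq (PInc k) (PIfZ k skip (PInc ?c))) skip"
  let ?body = "PSeq (PDec ?c) (PSeq p ?test)"
  let ?fin = "PIfZ ?r (zero_prog k) (PSeq (PDec ?r) (PSeq (zero_prog k) (PInc k)))"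
  let ?p = "PSeq (PInc ?c) (PSeq (PWhile ?c ?body) ?fin)"
  have "den w ?p \<sigma> = {([], \<sigma>(k := of_bool (\<exists>a < bound w. P w \<sigma> a)))}" if cl: "clean w k \<sigma>" for w \<sigma>
  proof -
    note zero = clean_zero[OF cl]
    have two: "2 < bound w" using bound_gt[of w] by linarith
    let ?s = "\<lambda>a. \<sigma>(k := a, ?c := 1)"
    have body: "den w ?body (?s a) = {([], if P w \<sigma> a then \<sigma>(k := a, ?r := 1)
        else if Suc a < bound w then ?s (Suc a) else \<sigma>)}" if a: "a < bound w" for a
    proof -
      let ?t = "\<sigma>(k := a)"
      have "den w (PDec ?c) (?s a) = {([], ?t)}"
        using two zero[of ?c] by (subst den_dec) (auto simp: fun_eq_iff)
      from den_seq[OF this] have "den w ?body (?s a) = den w (PSeq p ?test) ?t" .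
      also have "\<dots> = den w ?test (?t(?r := of_bool (P w \<sigma> a)))"
        using p(2)[OF clean_upd[OF cl a, of "Suc k" k]] assms(2) by (intro den_seq) simp
      also have "\<dots> = {([], if P w \<sigma> a then \<sigma>(k := a, ?r := 1)
        else if Suc a < bound w then ?s (Suc a) else \<sigma>)}"
      proof -
        have "?t(?r := 0) = ?t" using zero[of ?r] by (auto simp: fun_eq_iff)
        moreover have "den w (PIfZ k skip (PInc ?c)) (\<sigma>(k := Suc a)) = {([], ?s (Suc a))}"
          using two zero[of ?c] by (simp add: fun_eq_iff)
        moreover have "den w (PInc k) ?t = {([], \<sigma>(k := Suc a))}" if "Suc a < bound w"
          using that by simp
        moreover have "den w (PInc k) ?t = {([], \<sigma>)}" if "\<not> Suc a < bound w"
        proof -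
          have "Suc a = bound w" using that a by simp
          then show ?thesis using zero[of k] by (auto simp: fun_eq_iff)
        qed
        ultimately show ?thesis using zero[of k] zero[of ?r]
          by (cases "Suc a < bound w") (auto simp: rseq_single_nil)
      qed
      finally show ?thesis .
    qed
    have start: "den w (PInc ?c) \<sigma> = {([], ?s 0)}"
      using two zero[of ?c] zero[of k] by (auto simp: fun_eq_iff)
    show ?thesis
    proof (cases "\<exists>a < bound w. P w \<sigma> a")
      case True
      define m where "m = (LEAST a. P w \<sigma> a)"
      obtain a where a: "a < bound w" "P w \<sigma> a" using True by blast
      have m: "P w \<sigma> m" "m < bound w" "\<And>i. i < m \<Longrightarrow> \<not> P w \<sigma> i"
        using LeastI[of "P w \<sigma>" a] Least_le[of "P w \<sigma>" a] a not_less_Least unfolding m_def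
        by (auto intro: le_less_trans)
      let ?S = "\<lambda>i. if i \<le> m then ?s i else \<sigma>(k := m, ?r := 1)"
      have "den w (PWhile ?c ?body) (?S 0) = {([], ?S (Suc m))}"
      proof (rule while_fn[where s = ?S])
        fix i assume "i < Suc m"
        then show "?S i ?c \<noteq> 0 \<and> den w ?body (?S i) = {([], ?S (Suc i))}"
          using body[of i] m by (cases "i = m") auto
      qed (use zero[of ?c] in simp)
      then have "den w (PWhile ?c ?body) (?s 0) = {([], \<sigma>(k := m, ?r := 1))}" by simp
      then have "den w ?p \<sigma> = den w ?fin (\<sigma>(k := m, ?r := 1))"
        using den_seq[OF start] den_seq by metis
      also have "\<dots> = den w (PSeq (zero_prog k) (PInc k)) (\<sigma>(k := m))"
      proof -
        have "den w (PDec ?r) (\<sigma>(k := m, ?r := 1)) = {([], \<sigma>(k := m))}"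
          using two zero[of ?r] by (subst den_dec) (auto simp: fun_eq_iff)
        from den_seq[OF this] show ?thesis by (simp add: den_ifz(2) del: den.simps)
      qed
      also have "\<dots> = {([], \<sigma>(k := 1))}"
        using m two by (subst den_seq[OF den_zero]) auto
      finally show ?thesis using True by simp
    next
      case False
      let ?S = "\<lambda>i. if i < bound w then ?s i else \<sigma>"
      have "den w (PWhile ?c ?body) (?S 0) = {([], ?S (bound w))}"
      proof (rule while_fn[where s = ?S])
        fix i assume "i < bound w"
        then show "?S i ?c \<noteq> 0 \<and> den w ?body (?S i) = {([], ?S (Suc i))}"
          using body[of i] False by auto
      qed (use zero[of ?c] in simp)
      then have "den w (PWhile ?c ?body) (?s 0) = {([], \<sigma>)}" using two by simp
      then have "den w ?p \<sigma> = den w ?fin \<sigma>"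
        using den_seq[OF start] den_seq by metis
      also have "\<dots> = {([], \<sigma>(k := 0))}" using zero[of ?r] zero[of k] by (simp add: den_zero)
      finally show ?thesis unfolding of_bool_def by (simp only: False if_False)
    qed
  qed
  then show ?thesis unfolding ddec_def by (intro exI[of _ ?p]) (simp add: p(1))
qed

lemma ddec_all:
  assumes "ddec (Suc k) (\<lambda>w \<sigma>. P w \<sigma> (\<sigma> k))" "\<And>w \<sigma> v. P w (\<sigma>(k := v)) = P w \<sigma>"
  shows "ddec k (\<lambda>w \<sigma>. \<forall>a < bound w. P w \<sigma> a)"
proof -
  have "ddec k (\<lambda>w \<sigma>. \<exists>a < bound w. \<not> P w \<sigma> a)"
    using assms by (intro ddec_ex ddec_not) auto
  then show ?thesis by (rule ddec_cong[OF ddec_not]) auto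
qed

end

text \<open>Chains over pairs of counters: a step index together with a node, a count or an input
  position.\<close>

definition rel2 :: "nat \<Rightarrow> (nat \<Rightarrow> nat \<Rightarrow> nat \<Rightarrow> nat \<Rightarrow> bool) \<Rightarrow> nat \<times> nat \<Rightarrow> nat \<times> nat \<Rightarrow> bool" where
  "rel2 D E = (\<lambda>(a, b) (a', b'). a < D \<and> b < D \<and> a' < D \<and> b' < D \<and> E a b a' b')"

context base
begin

subsection \<open>Nondeterministically verifiable predicates\<close>

lemma nd_cong: "nd k P \<Longrightarrow> (\<And>w \<sigma>. clean w k \<sigma> \<Longrightarrow> P w \<sigma> \<longleftrightarrow> Q w \<sigma>) \<Longrightarrow> nd k Q"
  unfolding nd_def by simp

lemma nd_ddec:
  assumes "ddec k P"
  shows "nd k P"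
proof -
  obtain p where p: "\<And>w \<sigma>. clean w k \<sigma> \<Longrightarrow> den w p \<sigma> = {([], \<sigma>(k := of_bool (P w \<sigma>)))}"
    using assms unfolding ddec_def by blast
  have "den w (PSeq p (PIfZ k PFail (PDec k))) \<sigma> = (if P w \<sigma> then {([], \<sigma>)} else {})"
    if "clean w k \<sigma>" for w \<sigma>
    using clean_zero[OF that, of k] bound_gt[of w]
    by (simp add: den_seq[OF p[OF that]] fun_eq_iff del: den.simps(5))
  then show ?thesis unfolding nd_def by (intro exI[of _ "PSeq p (PIfZ k PFail (PDec k))"]) simp
qed

lemma nd_conj:
  assumes "nd k P" "nd k Q"
  shows "nd k (\<lambda>w \<sigma>. P w \<sigma> \<and> Q w \<sigma>)"
proof -
  obtain p where p: "\<And>w \<sigma>. clean w k \<sigma> \<Longrightarrow> den w p \<sigma> = (if P w \<sigma> then {([], \<sigma>)} else {})"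
    using assms unfolding nd_def by blast
  obtain q where q: "\<And>w \<sigma>. clean w k \<sigma> \<Longrightarrow> den w q \<sigma> = (if Q w \<sigma> then {([], \<sigma>)} else {})"
    using assms unfolding nd_def by blast
  have "den w (PSeq p q) \<sigma> = (if P w \<sigma> \<and> Q w \<sigma> then {([], \<sigma>)} else {})" if "clean w k \<sigma>" for w \<sigma>
    using p[OF that] q[OF that] by (auto simp: rseq_def)
  then show ?thesis unfolding nd_def by (intro exI[of _ "PSeq p q"]) simp
qed

lemma nd_disj:
  assumes "nd k P" "nd k Q"
  shows "nd k (\<lambda>w \<sigma>. P w \<sigma> \<or> Q w \<sigma>)"
proof -
  obtain p where p: "\<And>w \<sigma>. clean w k \<sigma> \<Longrightarrow> den w p \<sigma> = (if P w \<sigma> then {([], \<sigma>)} else {})"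
    using assms unfolding nd_def by blast
  obtain q where q: "\<And>w \<sigma>. clean w k \<sigma> \<Longrightarrow> den w q \<sigma> = (if Q w \<sigma> then {([], \<sigma>)} else {})"
    using assms unfolding nd_def by blast
  show ?thesis unfolding nd_def by (intro exI[of _ "PChoice p q"]) (simp add: p q)
qed

lemma nd_finite_ex:
  "finite A \<Longrightarrow> (\<And>a. a \<in> A \<Longrightarrow> nd k (P a)) \<Longrightarrow> nd k (\<lambda>w \<sigma>. \<exists>a\<in>A. P a w \<sigma>)"
proof (induction A rule: finite_induct)
  case empty
  then show ?case using nd_ddec[OF ddec_const[of k False]] by simp
next
  case (insert a A)
  then have "nd k (\<lambda>w \<sigma>. P a w \<sigma> \<or> (\<exists>a\<in>A. P a w \<sigma>))" by (intro nd_disj) auto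
  then show ?case by simp
qed

text \<open>Because of the wrap-around, an arbitrary number of increments produces exactly the
  values in range.\<close>

definition guess_prog :: "nat \<Rightarrow> prog" where
  "guess_prog x = PStar (PInc x)"

lemma den_guess:
  assumes "\<sigma> x = 0"
  shows "den w (guess_prog x) \<sigma> = {([], \<sigma>(x := v)) | v. v < bound w}"
proof -
  let ?R = "den w (PInc x)"
  have 1: "out = [] \<and> (\<exists>v < bound w. t = \<sigma>(x := v))"
    if "iters (\<lambda>_. True) ?R s out t" "\<exists>v < bound w. s = \<sigma>(x := v)" for s out t
    using that
  proof (induction rule: iters.induct)
    case (iters_step s o1 t o2 u)
    then obtain v where "v < bound w" "s = \<sigma>(x := v)" by blast
    then have "o1 = []" "t = \<sigma>(x := Suc v mod bound w)" using iters_step.hyps(2) by auto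
    moreover from this have "\<exists>v < bound w. t = \<sigma>(x := v)" using bound_pos mod_less_divisor by blast
    ultimately show ?case using iters_step.IH by blast
  qed auto
  have 2: "iters (\<lambda>_. True) ?R (\<sigma>(x := u)) [] (\<sigma>(x := v))" if "u \<le> v" "v < bound w" for u v
    using that
  proof (induction u rule: inc_induct)
    case (step u)
    have "([], \<sigma>(x := Suc u)) \<in> ?R (\<sigma>(x := u))" using step by simp
    from iters_step[OF _ this step.IH] step show ?case by simp
  qed (rule iters_refl)
  have e: "\<sigma>(x := 0) = \<sigma>" using assms by auto
  have "\<exists>v < bound w. \<sigma> = \<sigma>(x := v)" using e by (intro exI[of _ 0]) simp
  then have "iters (\<lambda>_. True) ?R \<sigma> out t \<longleftrightarrow> out = [] \<and> (\<exists>v < bound w. t = \<sigma>(x := v))" for out t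
    using 1[of \<sigma> out t] 2[of 0] unfolding e by blast
  then show ?thesis
    unfolding guess_prog_def den.simps(9) star_rel_def by auto
qed

lemma den_guess_seq:
  "\<sigma> x = 0 \<Longrightarrow> den w (PSeq (guess_prog x) p) \<sigma> = (\<Union>v \<in> {..<bound w}. den w p (\<sigma>(x := v)))"
  unfolding den.simps(5) rseq_def by (subst den_guess) auto

lemma nd_ex:
  assumes "nd (Suc k) (\<lambda>w \<sigma>. P w \<sigma> (\<sigma> k))" "\<And>w \<sigma> v. P w (\<sigma>(k := v)) = P w \<sigma>"
  shows "nd k (\<lambda>w \<sigma>. \<exists>a < bound w. P w \<sigma> a)"
proof -
  obtain p where p: "\<And>w \<sigma>. clean w (Suc k) \<sigma> \<Longrightarrow> den w p \<sigma> = (if P w \<sigma> (\<sigma> k) then {([], \<sigma>)} else {})"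
    using assms unfolding nd_def by blast
  let ?p = "PSeq (guess_prog k) (PSeq p (zero_prog k))"
  have "den w ?p \<sigma> = (if \<exists>a < bound w. P w \<sigma> a then {([], \<sigma>)} else {})" if cl: "clean w k \<sigma>" for w \<sigma>
  proof -
    have k: "\<sigma> k = 0" using clean_zero[OF cl] by simp
    then have e: "\<sigma>(k := 0) = \<sigma>" by auto
    have "den w (PSeq p (zero_prog k)) (\<sigma>(k := a)) = (if P w \<sigma> a then {([], \<sigma>)} else {})" if "a < bound w" for a
    proof -
      have "den w p (\<sigma>(k := a)) = (if P w \<sigma> a then {([], \<sigma>(k := a))} else {})"
        using p[OF clean_upd[OF cl that, of "Suc k" k]] assms(2) by simp
      then show ?thesis using that e by (auto simp: rseq_single_nil den_zero)
    qed
    then have "den w ?p \<sigma> = (\<Union>a\<in>{..<bound w}. if P w \<sigma> a then {([], \<sigma>)} else {})"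
      by (simp add: den_guess_seq[of \<sigma> k, OF k] del: den.simps)
    then show ?thesis by auto
  qed
  then show ?thesis unfolding nd_def by blast
qed

text \<open>Either passes over the current element, or verifies it and lowers the number still owed,
  which stays at zero once nothing is owed.\<close>

definition tick_prog :: "nat \<Rightarrow> prog \<Rightarrow> prog" where
  "tick_prog x p = PChoice skip (PSeq p (PIfZ x skip (PDec x)))"

text \<open>Elements are visited in increasing order and each one counted at most once.\<close>

lemma nd_card:
  assumes "nd (k + 2) (\<lambda>w \<sigma>. P w \<sigma> (\<sigma> (k + 1)))" "x < k"
    and indep: "\<And>w \<sigma> v. P w (\<sigma>(k := v)) = P w \<sigma>" "\<And>w \<sigma> v. P w (\<sigma>(k + 1 := v)) = P w \<sigma>"
  shows "nd k (\<lambda>w \<sigma>. \<sigma> x \<le> card {a. a < bound w \<and> P w \<sigma> a})"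
proof -
  obtain p where p: "\<And>w \<sigma>. clean w (k + 2) \<sigma> \<Longrightarrow>
      den w p \<sigma> = (if P w \<sigma> (\<sigma> (k + 1)) then {([], \<sigma>)} else {})"
    using assms(1) unfolding nd_def by blast
  let ?a = "k + 1"
  let ?tick = "tick_prog k p"
  let ?step = "PSeq ?tick (PSeq (PInc ?a) (PIfZ ?a PFail skip))"
  let ?fin = "PIfZ k (zero_prog ?a) PFail"
  \<comment> \<open>Stepping beyond the last value would wrap to 0 and is blocked by
    \<open>PFail\<close>, so the element on which the loop is left has its turn after the
    loop.\<close>
  let ?p = "PSeq (copy_prog x k ?a) (PSeq (PStar ?step) (PSeq ?tick ?fin))"
  have "den w ?p \<sigma> = (if \<sigma> x \<le> card {a. a < bound w \<and> P w \<sigma> a} then {([], \<sigma>)} else {})"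
    if cl: "clean w k \<sigma>" for w \<sigma>
  proof -
    note less = clean_less[OF cl] and zero = clean_zero[OF cl]
    let ?g = "\<lambda>r a. \<sigma>(k := r, ?a := a)"
    let ?C = "\<lambda>a. card {i. i < a \<and> P w \<sigma> i}"
    have C_Suc: "?C (Suc a) = (if P w \<sigma> a then Suc (?C a) else ?C a)" for a
    proof -
      have "{i. i < Suc a \<and> P w \<sigma> i} = (if P w \<sigma> a then insert a {i. i < a \<and> P w \<sigma> i} else {i. i < a \<and> P w \<sigma> i})"
        using less_Suc_eq by auto
      then show ?thesis by simp
    qed
    have p': "den w p (?g r a) = (if P w \<sigma> a then {([], ?g r a)} else {})" if "r < bound w" "a < bound w" for r a
    proof -
      have "clean w (k + 2) (?g r a)"
        using clean_upd[OF clean_upd[OF cl that(1), of "k + 2" k] that(2), of "k + 2" ?a] by simp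
      from p[OF this] show ?thesis using indep by simp
    qed
    have tick: "den w ?tick (?g r a) = insert ([], ?g r a) (if P w \<sigma> a then {([], ?g (r - 1) a)} else {})"
      if "r < bound w" "a < bound w" for r a
    proof (cases "P w \<sigma> a")
      case True
      then have "den w p (?g r a) = {([], ?g r a)}" using p'[OF that] by simp
      from den_seq[OF this, of "PIfZ k skip (PDec k)"]
      have "den w (PSeq p (PIfZ k skip (PDec k))) (?g r a) = {([], ?g (r - 1) a)}"
        using that by (cases "r = 0") (auto simp: den_dec fun_upd_twist simp del: den.simps(2,5))
      then show ?thesis using True by (simp add: tick_prog_def del: den.simps(5,6))
    next
      case False
      then have "den w p (?g r a) = {}" using p'[OF that] by simp
      then show ?thesis using False by (simp add: tick_prog_def)
    qed
    have next_one: "den w (PSeq (PInc ?a) (PIfZ ?a PFail skip)) (?g r a) =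
        (if Suc a < bound w then {([], ?g r (Suc a))} else {})" if "a < bound w" for r a
    proof (cases "Suc a < bound w")
      case True
      then show ?thesis by (simp add: rseq_single_nil)
    next
      case False
      then have "Suc a = bound w" using that by simp
      then show ?thesis by (simp add: rseq_single_nil)
    qed
    have den_step: "den w ?step (?g r a) = (if Suc a < bound w then
        insert ([], ?g r (Suc a)) (if P w \<sigma> a then {([], ?g (r - 1) (Suc a))} else {}) else {})"
      if "r < bound w" "a < bound w" for r a
    proof -
      have "den w ?step (?g r a) = (\<Union>(o1, t)\<in>den w ?tick (?g r a).
          (\<lambda>(o2, u). (o1 @ o2, u)) ` den w (PSeq (PInc ?a) (PIfZ ?a PFail skip)) t)"
        unfolding den.simps(5)[of w ?tick] rseq_def by fastforce
      then show ?thesis unfolding tick[OF that]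
        using next_one[OF that(2), of r] next_one[OF that(2), of "r - 1"] by (simp del: den.simps)
    qed
    \<comment> \<open>The number owed plus the number of satisfying elements already passed never
      falls below \<open>\<sigma> x\<close>; passing over an element only makes the inequality
      strict.\<close>
    have sound: "out = [] \<and> (\<exists>r a. t = ?g r a \<and> r < bound w \<and> a < bound w \<and> \<sigma> x \<le> r + ?C a)"
      if "iters (\<lambda>_. True) (den w ?step) s out t"
        "\<exists>r a. s = ?g r a \<and> r < bound w \<and> a < bound w \<and> \<sigma> x \<le> r + ?C a" for s out t
      using that
    proof (induction rule: iters.induct)
      case (iters_step s o1 t o2 u)
      then obtain r a where s: "s = ?g r a" "r < bound w" "a < bound w" "\<sigma> x \<le> r + ?C a" by blast
      have "(o1, t) \<in> den w ?step (?g r a)" using iters_step.hyps s by blast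
      then have "o1 = []" and t: "Suc a < bound w"
        "t = ?g r (Suc a) \<or> P w \<sigma> a \<and> t = ?g (r - 1) (Suc a)"
        unfolding den_step[OF s(2,3)] by (auto split: if_splits simp del: fun_upd_apply)
      have E: "\<exists>r a. t = ?g r a \<and> r < bound w \<and> a < bound w \<and> \<sigma> x \<le> r + ?C a"
        using t(2)
      proof
        assume "t = ?g r (Suc a)"
        then show ?thesis using s t(1) C_Suc[of a] by (intro exI[of _ r] exI[of _ "Suc a"]) auto
      next
        assume "P w \<sigma> a \<and> t = ?g (r - 1) (Suc a)"
        then show ?thesis using s t(1) C_Suc[of a] by (intro exI[of _ "r - 1"] exI[of _ "Suc a"]) auto
      qed
      show ?case unfolding \<open>o1 = []\<close> append_Nil by (rule iters_step.IH[OF E])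
    qed auto
    \<comment> \<open>The greedy run counts every satisfying element.\<close>
    have complete: "iters (\<lambda>_. True) (den w ?step) (?g (\<sigma> x - ?C a) a) [] (?g (\<sigma> x - ?C e) e)"
      if "a \<le> e" "e < bound w" for a e
      using that
    proof (induction a rule: inc_induct)
      case (step a)
      have r: "\<sigma> x - ?C a < bound w" using less[of x] by simp
      have a: "a < bound w" "Suc a < bound w" using step by auto
      have "([], ?g (\<sigma> x - ?C (Suc a)) (Suc a)) \<in> den w ?step (?g (\<sigma> x - ?C a) a)"
        unfolding den_step[OF r a(1)] C_Suc using a(2) by (simp del: fun_upd_apply)
      from iters_step[where T = "\<lambda>_. True", OF TrueI this step.IH[OF step.prems]]
      show ?case by (simp only: append_Nil)
    qed (rule iters_refl)
    have fin: "den w (PSeq ?tick ?fin) (?g r a) = (if r = 0 \<or> r = 1 \<and> P w \<sigma> a then {([], \<sigma>)} else {})"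
      if "r < bound w" "a < bound w" for r a
    proof -
      have f: "den w ?fin (?g r a) = (if r = 0 then {([], \<sigma>)} else {})" for r
        using that(2) zero[of k] zero[of ?a] by (simp add: den_zero) (auto simp: fun_eq_iff)
      have "(out, t) \<in> den w (PSeq ?tick ?fin) (?g r a) \<longleftrightarrow>
          (\<exists>o1 s o2. out = o1 @ o2 \<and> (o1, s) \<in> den w ?tick (?g r a) \<and> (o2, t) \<in> den w ?fin s)" for out t
        unfolding den.simps(5)[of w ?tick] rseq_def by blast
      then have "(out, t) \<in> den w (PSeq ?tick ?fin) (?g r a) \<longleftrightarrow>
          (out, t) \<in> den w ?fin (?g r a) \<or> P w \<sigma> a \<and> (out, t) \<in> den w ?fin (?g (r - 1) a)" for out t
        unfolding tick[OF that] by (cases "P w \<sigma> a") (simp_all del: den.simps fun_upd_apply, metis append_Nil)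
      then have "(out, t) \<in> den w (PSeq ?tick ?fin) (?g r a) \<longleftrightarrow>
          (out, t) \<in> (if r = 0 \<or> r = 1 \<and> P w \<sigma> a then {([], \<sigma>)} else {})" for out t
        unfolding f by (cases "P w \<sigma> a"; cases "r = 0"; cases "r = 1") simp_all
      then show ?thesis by (auto simp del: den.simps fun_upd_apply)
    qed
    have copy: "den w (copy_prog x k ?a) \<sigma> = {([], ?g (\<sigma> x) 0)}"
    proof -
      have "\<sigma>(k := \<sigma> x) = ?g (\<sigma> x) 0" using zero[of ?a] by (auto simp: fun_eq_iff)
      moreover have "den w (copy_prog x k ?a) \<sigma> = {([], \<sigma>(k := \<sigma> x))}"
        using less[of x] zero assms(2) by (subst den_copy) auto
      ultimately show ?thesis by metis
    qed
    have mem: "(out, t) \<in> den w ?p \<sigma> \<longleftrightarrow> (\<exists>o1 s o2. out = o1 @ o2 \<and>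
        iters (\<lambda>_. True) (den w ?step) (?g (\<sigma> x) 0) o1 s \<and> (o2, t) \<in> den w (PSeq ?tick ?fin) s)" for out t
      unfolding den_seq[OF copy] den.simps(5)[of w "PStar ?step"] den.simps(9) star_rel_def rseq_def by blast
    have 1: "out = [] \<and> t = \<sigma> \<and> \<sigma> x \<le> ?C (bound w)" if "(out, t) \<in> den w ?p \<sigma>" for out t
    proof -
      from iffD1[OF mem that] obtain o1 s o2 where o: "out = o1 @ o2"
        "iters (\<lambda>_. True) (den w ?step) (?g (\<sigma> x) 0) o1 s" "(o2, t) \<in> den w (PSeq ?tick ?fin) s"
        by (elim exE conjE)
      have "\<exists>r a. ?g (\<sigma> x) 0 = ?g r a \<and> r < bound w \<and> a < bound w \<and> \<sigma> x \<le> r + ?C a"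
        using less[of x] by (intro exI[of _ "\<sigma> x"] exI[of _ 0]) auto
      from sound[OF o(2) this] obtain r a where s: "o1 = []" "s = ?g r a" "r < bound w" "a < bound w"
        "\<sigma> x \<le> r + ?C a" by blast
      have "(o2, t) \<in> den w (PSeq ?tick ?fin) (?g r a)" using o(3) s(2) by blast
      then have f: "o2 = [] \<and> t = \<sigma> \<and> (r = 0 \<or> r = 1 \<and> P w \<sigma> a)"
        unfolding fin[OF s(3,4)] by (auto split: if_splits)
      have "\<sigma> x \<le> ?C (Suc a)" using f s(5) C_Suc[of a] by auto
      also have "\<dots> \<le> ?C (bound w)" using s(4) by (intro card_mono) auto
      finally show ?thesis using o(1) s(1) f by simp
    qed
    have 2: "([], \<sigma>) \<in> den w ?p \<sigma>" if "\<sigma> x \<le> ?C (bound w)"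
    proof -
      let ?e = "bound w - 1"
      have e: "?e < bound w" "Suc ?e = bound w" using bound_gt[of w] by auto
      have r: "\<sigma> x - ?C ?e < bound w" using less[of x] by simp
      have "iters (\<lambda>_. True) (den w ?step) (?g (\<sigma> x) 0) [] (?g (\<sigma> x - ?C ?e) ?e)"
        using complete[of 0 ?e] e(1) by simp
      moreover have "([], \<sigma>) \<in> den w (PSeq ?tick ?fin) (?g (\<sigma> x - ?C ?e) ?e)"
        unfolding fin[OF r e(1)] using that C_Suc[of ?e] unfolding e(2) by (auto split: if_splits)
      ultimately show ?thesis by (intro iffD2[OF mem] exI conjI) (rule append_Nil[symmetric])
    qed
    show ?thesis using 1 2 by auto
  qed
  then show ?thesis unfolding nd_def by blast
qed

subsection \<open>Arithmetic\<close>

lemma ddec_zero: "x < k \<Longrightarrow> ddec k (\<lambda>w \<sigma>. \<sigma> x = 0)"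
  by (rule ddec_cong[OF ddec_mult_add[of x k x x x]]) auto

lemma ddec_eq:
  assumes "x < k" "y < k"
  shows "ddec k (\<lambda>w \<sigma>. \<sigma> x = \<sigma> y)"
proof -
  have "ddec k (\<lambda>w \<sigma>. \<exists>a < bound w. a = 0 \<and> a * a + \<sigma> x = \<sigma> y)"
    by (intro ddec_ex ddec_conj ddec_mult_add ddec_zero) (use assms in auto)
  then show ?thesis by (rule ddec_cong) auto
qed

lemma ddec_mult:
  assumes "x < k" "y < k" "z < k"
  shows "ddec k (\<lambda>w \<sigma>. \<sigma> x * \<sigma> y = \<sigma> z)"
proof -
  have "ddec k (\<lambda>w \<sigma>. \<exists>a < bound w. a = 0 \<and> \<sigma> x * \<sigma> y + a = \<sigma> z)"
    by (intro ddec_ex ddec_conj ddec_mult_add ddec_zero) (use assms in auto)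
  then show ?thesis by (rule ddec_cong) auto
qed

lemma ddec_one: "x < k \<Longrightarrow> ddec k (\<lambda>w \<sigma>. \<sigma> x = 1)"
  by (rule ddec_cong[OF ddec_conj[OF ddec_mult[of x k x x] ddec_not[OF ddec_zero[of x k]]]]) auto

lemma one_less_bound: "1 < bound w" "Suc 0 < bound w"
  using bound_gt[of w] by auto

lemma ddec_add:
  assumes "x < k" "y < k" "z < k"
  shows "ddec k (\<lambda>w \<sigma>. \<sigma> x + \<sigma> y = \<sigma> z)"
proof -
  have "ddec k (\<lambda>w \<sigma>. \<exists>a < bound w. a = 1 \<and> a * \<sigma> x + \<sigma> y = \<sigma> z)"
    by (intro ddec_ex ddec_conj ddec_mult_add ddec_one) (use assms in auto)
  then show ?thesis by (rule ddec_cong) (auto simp: one_less_bound)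
qed

lemma ddec_le:
  assumes "x < k" "y < k"
  shows "ddec k (\<lambda>w \<sigma>. \<sigma> x \<le> \<sigma> y)"
proof -
  have "ddec k (\<lambda>w \<sigma>. \<exists>a < bound w. \<sigma> x + a = \<sigma> y)"
    by (intro ddec_ex ddec_add) (use assms in auto)
  then show ?thesis
  proof (rule ddec_cong)
    fix w \<sigma> assume "clean w k \<sigma>"
    then have "\<sigma> y < bound w" by (rule clean_less)
    then show "(\<exists>a < bound w. \<sigma> x + a = \<sigma> y) \<longleftrightarrow> \<sigma> x \<le> \<sigma> y"
      by (auto intro: exI[of _ "\<sigma> y - \<sigma> x"])
  qed
qed

lemma ddec_less:
  assumes "x < k" "y < k"
  shows "ddec k (\<lambda>w \<sigma>. \<sigma> x < \<sigma> y)"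
  by (rule ddec_cong[OF ddec_not[OF ddec_le[of y k x]]]) (use assms in auto)

lemma ddec_Suc:
  assumes "x < k" "y < k"
  shows "ddec k (\<lambda>w \<sigma>. \<sigma> y = Suc (\<sigma> x))"
proof -
  have "ddec k (\<lambda>w \<sigma>. \<exists>a < bound w. a = 1 \<and> a + \<sigma> x = \<sigma> y)"
    by (intro ddec_ex ddec_conj ddec_add ddec_one) (use assms in auto)
  then show ?thesis by (rule ddec_cong) (auto simp: one_less_bound)
qed

lemma ddec_eq_const: "x < k \<Longrightarrow> ddec k (\<lambda>w \<sigma>. \<sigma> x = c)"
proof (induction c arbitrary: x k)
  case 0
  then show ?case by (rule ddec_zero)
next
  case (Suc c)
  have "ddec k (\<lambda>w \<sigma>. \<exists>a < bound w. a = c \<and> \<sigma> x = Suc a)"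
    by (intro ddec_ex ddec_conj ddec_Suc Suc.IH) (use Suc.prems in auto)
  then show ?case
    by (rule ddec_cong) (auto dest!: clean_less[of _ _ _ x])
qed

text \<open>\<open>bound w\<close> itself does not fit into a counter; the last value is recognised
  as the greatest one.\<close>

lemma ddec_last:
  assumes "x < k"
  shows "ddec k (\<lambda>w \<sigma>. Suc (\<sigma> x) = bound w)"
proof -
  have "ddec k (\<lambda>w \<sigma>. \<forall>a < bound w. a \<le> \<sigma> x)"
    by (intro ddec_all ddec_le) (use assms in auto)
  then show ?thesis
  proof (rule ddec_cong)
    fix w \<sigma> assume "clean w k \<sigma>"
    then have "\<sigma> x < bound w" by (rule clean_less)
    then show "(\<forall>a < bound w. a \<le> \<sigma> x) \<longleftrightarrow> Suc (\<sigma> x) = bound w"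
      by (auto simp: less_Suc_eq_le) (metis Suc_leI Suc_lessI not_less_eq_eq order_refl)
  qed
qed

subsection \<open>Iteration\<close>

text \<open>Walks along the relation by guessing the next pair, verifying the link and overwriting
  the current pair, so that the length of the walk costs no space.\<close>

lemma nd_rtc2:
  assumes "nd (k + 4) (\<lambda>w \<sigma>. E w \<sigma> (\<sigma> k) (\<sigma> (k + 1)) (\<sigma> (k + 2)) (\<sigma> (k + 3)))"
    and vars: "x < k" "y < k" "z < k" "u < k"
    and indep: "\<And>w \<sigma> j v. k \<le> j \<Longrightarrow> E w (\<sigma>(j := v)) = E w \<sigma>"
  shows "nd k (\<lambda>w \<sigma>. (rel2 (bound w) (E w \<sigma>))\<^sup>*\<^sup>* (\<sigma> x, \<sigma> y) (\<sigma> z, \<sigma> u))"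
proof -
  obtain p where p: "\<And>w \<sigma>. clean w (k + 4) \<sigma> \<Longrightarrow> den w p \<sigma> =
      (if E w \<sigma> (\<sigma> k) (\<sigma> (k + 1)) (\<sigma> (k + 2)) (\<sigma> (k + 3)) then {([], \<sigma>)} else {})"
    using assms unfolding nd_def by blast
  have "nd (k + 2) (\<lambda>w \<sigma>. \<sigma> k = \<sigma> z \<and> \<sigma> (k + 1) = \<sigma> u)"
    by (intro nd_ddec ddec_conj ddec_eq) (use vars in auto)
  then obtain q where q: "\<And>w \<sigma>. clean w (k + 2) \<sigma> \<Longrightarrow> den w q \<sigma> =
      (if \<sigma> k = \<sigma> z \<and> \<sigma> (k + 1) = \<sigma> u then {([], \<sigma>)} else {})"
    unfolding nd_def by blast
  let ?b = "k + 1" and ?a' = "k + 2" and ?b' = "k + 3"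
  let ?upd = "PSeq (zero_prog k) (PSeq (zero_prog ?b) (PSeq (move_prog ?a' k) (move_prog ?b' ?b)))"
  let ?step = "PSeq (guess_prog ?a') (PSeq (guess_prog ?b') (PSeq p ?upd))"
  let ?fin = "PSeq q (PSeq (zero_prog k) (zero_prog ?b))"
  let ?p = "PSeq (copy_prog x k ?a') (PSeq (copy_prog y ?b ?a') (PSeq (PStar ?step) ?fin))"
  have "den w ?p \<sigma> = (if (rel2 (bound w) (E w \<sigma>))\<^sup>*\<^sup>* (\<sigma> x, \<sigma> y) (\<sigma> z, \<sigma> u) then {([], \<sigma>)} else {})"
    if cl: "clean w k \<sigma>" for w \<sigma>
  proof -
    note less = clean_less[OF cl] and zero = clean_zero[OF cl]
    let ?R = "rel2 (bound w) (E w \<sigma>)"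
    define g where "g = (\<lambda>(a, b). \<sigma>(k := a, ?b := b))"
    have upd: "den w (PSeq p ?upd) (\<sigma>(k := a, ?b := b, ?a' := a', ?b' := b')) =
        (if E w \<sigma> a b a' b' then {([], g (a', b'))} else {})"
      if v: "a < bound w" "b < bound w" "a' < bound w" "b' < bound w" for a b a' b'
    proof -
      let ?t = "\<sigma>(k := a, ?b := b, ?a' := a', ?b' := b')"
      have "clean w (k + 4) ?t"
        using cl v by (auto simp: clean_def ok_def)
      from p[OF this] have pp: "den w p ?t = (if E w \<sigma> a b a' b' then {([], ?t)} else {})"
        using indep by simp
      have "den w ?upd ?t = den w (PSeq (zero_prog ?b) (PSeq (move_prog ?a' k) (move_prog ?b' ?b))) (?t(k := 0))"
        using v by (intro den_seq den_zero) simp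
      also have "\<dots> = den w (PSeq (move_prog ?a' k) (move_prog ?b' ?b)) (?t(k := 0, ?b := 0))"
        using v by (intro den_seq den_zero) simp
      also have "\<dots> = den w (move_prog ?b' ?b) (?t(k := 0, ?b := 0, ?a' := 0, k := a'))"
        using v by (intro den_seq) (subst den_move, auto)
      also have "\<dots> = {([], g (a', b'))}"
        using v zero[of ?a'] zero[of ?b'] by (subst den_move) (auto simp: g_def fun_eq_iff)
      finally show ?thesis using pp by (simp add: rseq_single_nil)
    qed
    have den_step: "(out, t) \<in> den w ?step (g ab) \<longleftrightarrow> out = [] \<and> (\<exists>ab'. t = g ab' \<and> ?R ab ab')"
      if ab: "fst ab < bound w" "snd ab < bound w" for ab out t
    proof -
      obtain a b where [simp]: "ab = (a, b)" by (cases ab)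
      have z: "g (a, b) ?a' = 0" using zero[of ?a'] by (simp add: g_def)
      have z': "((g (a, b))(?a' := a')) ?b' = 0" for a' using zero[of ?b'] by (simp add: g_def)
      have 2: "den w (PSeq (guess_prog ?b') (PSeq p ?upd)) ((g (a, b))(?a' := a')) =
          {([], g (a', b')) | b'. b' < bound w \<and> E w \<sigma> a b a' b'}" if "a' < bound w" for a'
      proof -
        have "den w (PSeq p ?upd) ((g (a, b))(?a' := a', ?b' := b')) =
            (if E w \<sigma> a b a' b' then {([], g (a', b'))} else {})" if "b' < bound w" for b'
          using upd[of a b a' b'] ab that \<open>a' < bound w\<close> by (simp add: g_def del: den.simps)
        then show ?thesis unfolding den_guess_seq[of "(g (a, b))(?a' := a')" ?b', OF z']
          by (auto simp del: den.simps split: if_splits)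
      qed
      show ?thesis
      proof -
        have "den w ?step (g (a, b)) = (\<Union>a' \<in> {..<bound w}.
            {([], g (a', b')) | b'. b' < bound w \<and> E w \<sigma> a b a' b'})"
          unfolding den_guess_seq[of "g (a, b)" ?a', OF z] by (intro SUP_cong refl 2) simp
        then show ?thesis using ab unfolding \<open>ab = (a, b)\<close> by (auto simp: rel2_def simp del: den.simps)
      qed
    qed
    have R_less: "?R\<^sup>*\<^sup>* ab ab' \<Longrightarrow> fst ab < bound w \<Longrightarrow> snd ab < bound w \<Longrightarrow>
        fst ab' < bound w \<and> snd ab' < bound w" for ab ab'
      by (induction rule: rtranclp_induct) (auto simp: rel2_def)
    have 1: "iters (\<lambda>_. True) (den w ?step) s out t \<Longrightarrow> s = g ab \<Longrightarrow> fst ab < bound w \<Longrightarrow> snd ab < bound w \<Longrightarrow>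
        out = [] \<and> (\<exists>ab'. t = g ab' \<and> ?R\<^sup>*\<^sup>* ab ab')" for s out t ab
    proof (induction arbitrary: ab rule: iters.induct)
      case (iters_step s o1 t o2 u)
      have "(o1, t) \<in> den w ?step (g ab)" using iters_step.hyps iters_step.prems(1) by blast
      then obtain cd where cd: "o1 = []" "t = g cd" "?R ab cd"
        unfolding den_step[OF iters_step.prems(2,3)] by blast
      then have "fst cd < bound w" "snd cd < bound w" by (auto simp: rel2_def)
      from iters_step.IH[OF cd(2) this] obtain ef where ef: "o2 = []" "u = g ef" "?R\<^sup>*\<^sup>* cd ef" by blast
      have "?R\<^sup>*\<^sup>* ab ef" by (rule converse_rtranclp_into_rtranclp[of ?R, OF cd(3) ef(3)])
      then show ?case using cd(1) ef(1,2) by blast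
    qed auto
    have 2: "?R\<^sup>*\<^sup>* ab ab' \<Longrightarrow> fst ab < bound w \<Longrightarrow> snd ab < bound w \<Longrightarrow>
        iters (\<lambda>_. True) (den w ?step) (g ab) [] (g ab')" for ab ab'
    proof (induction rule: converse_rtranclp_induct)
      case (step ab cd)
      then have "fst cd < bound w" "snd cd < bound w" by (auto simp: rel2_def)
      moreover have "([], g cd) \<in> den w ?step (g ab)"
        using den_step[OF step.prems] step.hyps by blast
      ultimately show ?case using iters_step[of "\<lambda>_. True" "g ab" "[]" "g cd" "den w ?step" "[]"] step.IH by simp
    qed (rule iters_refl)
    have fin: "den w ?fin (g (a, b)) = (if a = \<sigma> z \<and> b = \<sigma> u then {([], \<sigma>)} else {})"
      if "a < bound w" "b < bound w" for a b
    proof -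
      have "clean w (k + 2) (g (a, b))" using cl that by (auto simp: clean_def ok_def g_def)
      from q[OF this] have qq: "den w q (g (a, b)) = (if a = \<sigma> z \<and> b = \<sigma> u then {([], g (a, b))} else {})"
        using vars by (simp add: g_def)
      have "den w (PSeq (zero_prog k) (zero_prog ?b)) (g (a, b)) = den w (zero_prog ?b) ((g (a, b))(k := 0))"
        using that by (intro den_seq den_zero) (simp add: g_def)
      also have "\<dots> = {([], \<sigma>)}"
        using that zero[of k] zero[of ?b] by (subst den_zero) (auto simp: g_def fun_eq_iff)
      finally have zz: "den w (PSeq (zero_prog k) (zero_prog ?b)) (g (a, b)) = {([], \<sigma>)}" .
      show ?thesis
      proof (cases "a = \<sigma> z \<and> b = \<sigma> u")
        case True
        then have "den w q (g (a, b)) = {([], g (a, b))}" using qq by simp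
        from den_seq[OF this] zz show ?thesis using True by (simp del: den.simps)
      next
        case False
        then have "den w q (g (a, b)) = {}" using qq by simp
        then show ?thesis using False by simp
      qed
    qed
    have start: "den w ?p \<sigma> = den w (PSeq (PStar ?step) ?fin) (g (\<sigma> x, \<sigma> y))"
    proof -
      have "den w (copy_prog x k ?a') \<sigma> = {([], \<sigma>(k := \<sigma> x))}"
        using less[of x] zero vars by (subst den_copy) auto
      from den_seq[OF this] have "den w ?p \<sigma> =
        den w (PSeq (copy_prog y ?b ?a') (PSeq (PStar ?step) ?fin)) (\<sigma>(k := \<sigma> x))" .
      also have "\<dots> = den w (PSeq (PStar ?step) ?fin) (g (\<sigma> x, \<sigma> y))"
        using less[of y] zero vars by (intro den_seq, subst den_copy) (auto simp: g_def)
      finally show ?thesis .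
    qed
    have mem: "(out, t) \<in> den w ?p \<sigma> \<longleftrightarrow> (\<exists>o1 s o2. out = o1 @ o2 \<and>
        iters (\<lambda>_. True) (den w ?step) (g (\<sigma> x, \<sigma> y)) o1 s \<and> (o2, t) \<in> den w ?fin s)" for out t
      unfolding start den.simps(5)[of w "PStar ?step"] den.simps(9) star_rel_def rseq_def by blast
    have xy: "fst (\<sigma> x, \<sigma> y) < bound w" "snd (\<sigma> x, \<sigma> y) < bound w" using less by auto
    have 3: "out = [] \<and> t = \<sigma> \<and> ?R\<^sup>*\<^sup>* (\<sigma> x, \<sigma> y) (\<sigma> z, \<sigma> u)" if "(out, t) \<in> den w ?p \<sigma>" for out t
    proof -
      from iffD1[OF mem that] obtain o1 s o2 where o: "out = o1 @ o2"
        "iters (\<lambda>_. True) (den w ?step) (g (\<sigma> x, \<sigma> y)) o1 s" "(o2, t) \<in> den w ?fin s"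
        by (elim exE conjE)
      obtain a b where s: "o1 = []" "s = g (a, b)" "?R\<^sup>*\<^sup>* (\<sigma> x, \<sigma> y) (a, b)" using 1[OF o(2) refl xy] by auto
      have ab: "a < bound w" "b < bound w" using R_less[OF s(3) xy] by auto
      have "(o2, t) \<in> den w ?fin (g (a, b))" using o(3) s(2) by blast
      then have "o2 = [] \<and> t = \<sigma> \<and> a = \<sigma> z \<and> b = \<sigma> u"
        unfolding fin[OF ab] by (auto split: if_splits)
      then show ?thesis using o(1) s by simp
    qed
    have 4: "([], \<sigma>) \<in> den w ?p \<sigma>" if "?R\<^sup>*\<^sup>* (\<sigma> x, \<sigma> y) (\<sigma> z, \<sigma> u)"
    proof (rule iffD2[OF mem], intro exI conjI)
      show "iters (\<lambda>_. True) (den w ?step) (g (\<sigma> x, \<sigma> y)) [] (g (\<sigma> z, \<sigma> u))" by (rule 2[OF that xy])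
      show "([], \<sigma>) \<in> den w ?fin (g (\<sigma> z, \<sigma> u))" using fin[OF less less, of z u] by simp
    qed simp
    show ?thesis using 3 4 by auto
  qed
  then show ?thesis unfolding nd_def by blast
qed

end

section \<open>Closure under complement of reachability\<close>

context
  fixes D :: nat and E :: "nat \<Rightarrow> nat \<Rightarrow> bool"
begin

definition edge :: "nat \<Rightarrow> nat \<Rightarrow> bool" where
  "edge a b \<longleftrightarrow> a < D \<and> b < D \<and> E a b"

definition steps_to :: "nat \<Rightarrow> nat \<Rightarrow> nat \<Rightarrow> bool" where
  "steps_to i s v \<longleftrightarrow> (\<exists>m \<le> i. (edge ^^ m) s v)"

lemma steps_to_0: "steps_to 0 s v \<longleftrightarrow> s = v"
  by (auto simp: steps_to_def)

lemma steps_to_Suc: "steps_to (Suc i) s v \<longleftrightarrow> steps_to i s v \<or> (\<exists>u. steps_to i s u \<and> edge u v)"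
proof
  assume "steps_to (Suc i) s v"
  then obtain m where m: "m \<le> Suc i" "(edge ^^ m) s v" by (auto simp: steps_to_def)
  show "steps_to i s v \<or> (\<exists>u. steps_to i s u \<and> edge u v)"
  proof (cases m)
    case (Suc m')
    then obtain u where "(edge ^^ m') s u" "edge u v" using m(2) by auto
    then show ?thesis using Suc m(1) unfolding steps_to_def by (metis Suc_le_mono)
  qed (use m in \<open>auto simp: steps_to_def\<close>)
next
  assume "steps_to i s v \<or> (\<exists>u. steps_to i s u \<and> edge u v)"
  then show "steps_to (Suc i) s v"
  proof
    assume "\<exists>u. steps_to i s u \<and> edge u v"
    then obtain u m where "m \<le> i" "(edge ^^ m) s u" "edge u v" by (auto simp: steps_to_def)
    then have "(edge ^^ Suc m) s v" by auto
    then show ?thesis using \<open>m \<le> i\<close> unfolding steps_to_def by (metis Suc_le_mono)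
  qed (auto simp: steps_to_def intro: le_SucI)
qed

lemma steps_to_mono: "steps_to i s v \<Longrightarrow> i \<le> j \<Longrightarrow> steps_to j s v"
  unfolding steps_to_def by (meson order_trans)

lemma steps_to_less: "steps_to i s v \<Longrightarrow> s < D \<Longrightarrow> v < D"
  by (induction i arbitrary: v) (auto simp: steps_to_0 steps_to_Suc edge_def)

text \<open>The index advances even when the node is kept; walks of length at most \<open>i\<close>
  thereby become chains with exactly \<open>i\<close> links.\<close>

lemma steps_to_rtc2:
  assumes "s < D" "i < D"
  shows "(rel2 D (\<lambda>i a j b. j = Suc i \<and> (a = b \<or> E a b)))\<^sup>*\<^sup>* (0, s) (i, v) \<longleftrightarrow> steps_to i s v"
    (is "?R\<^sup>*\<^sup>* _ _ \<longleftrightarrow> _")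
proof
  have "?R\<^sup>*\<^sup>* (0, s) iv \<Longrightarrow> steps_to (fst iv) s (snd iv)" for iv
    by (induction rule: rtranclp_induct) (auto simp: steps_to_0 steps_to_Suc rel2_def edge_def)
  then show "?R\<^sup>*\<^sup>* (0, s) (i, v) \<Longrightarrow> steps_to i s v" by fastforce
  show "steps_to i s v \<Longrightarrow> ?R\<^sup>*\<^sup>* (0, s) (i, v)" using assms(2)
  proof (induction i arbitrary: v)
    case (Suc i)
    then obtain u where u: "steps_to i s u" "u = v \<or> edge u v" by (auto simp: steps_to_Suc)
    then have "?R (i, u) (Suc i, v)"
      using Suc.prems assms steps_to_less[OF u(1)] steps_to_less[OF Suc.prems(1)] by (auto simp: rel2_def edge_def)
    then show ?case using Suc.IH[OF u(1)] Suc.prems by (meson Suc_lessD rtranclp.rtrancl_into_rtrancl)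
  qed (simp add: steps_to_0)
qed

text \<open>Shortest paths do not repeat nodes.\<close>

lemma reach_steps_to:
  assumes "s < D"
  shows "edge\<^sup>*\<^sup>* s v \<longleftrightarrow> steps_to (D - 1) s v"
proof
  assume "edge\<^sup>*\<^sup>* s v"
  then obtain n0 where "(edge ^^ n0) s v" by (auto dest: rtranclp_imp_relpowp)
  then obtain n where n: "(edge ^^ n) s v" "\<And>m. m < n \<Longrightarrow> \<not> (edge ^^ m) s v"
    using exists_least_iff[of "\<lambda>n. (edge ^^ n) s v"] by blast
  then obtain f where f: "f 0 = s" "f n = v" "\<And>i. i < n \<Longrightarrow> edge (f i) (f (Suc i))"
    unfolding relpowp_fun_conv by blast
  have seg: "(edge ^^ (j - i)) (f i) (f j)" if "i \<le> j" "j \<le> n" for i j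
    unfolding relpowp_fun_conv using that f(3) by (intro exI[of _ "\<lambda>m. f (i + m)"]) auto
  have "inj_on f {..n}"
  proof (rule linorder_inj_onI)
    fix i j assume ij: "i < j" "i \<in> {..n}" "j \<in> {..n}"
    show "f i \<noteq> f j"
    proof
      assume "f i = f j"
      then have "(edge ^^ i) s (f j)" "(edge ^^ (n - j)) (f j) v"
        using seg[of 0 i] seg[of j n] f ij by auto
      then have "(edge ^^ (i + (n - j))) s v" unfolding relpowp_add by blast
      moreover have "i + (n - j) < n" using ij by auto
      ultimately show False using n(2) by blast
    qed
  qed auto
  moreover have "f ` {..n} \<subseteq> {..<D}"
  proof
    fix a assume "a \<in> f ` {..n}"
    then obtain i where i: "i \<le> n" "a = f i" by auto
    show "a \<in> {..<D}"
    proof (cases i)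
      case 0
      then show ?thesis using f(1) i assms by simp
    next
      case (Suc i')
      then show ?thesis using f(3)[of i'] i by (simp add: edge_def)
    qed
  qed
  ultimately have "card {..n} \<le> card {..<D}" by (intro card_inj_on_le) auto
  then have "n \<le> D - 1" by auto
  then show "steps_to (D - 1) s v" using n(1) by (auto simp: steps_to_def)
next
  assume "steps_to (D - 1) s v"
  then show "edge\<^sup>*\<^sup>* s v" by (auto simp: steps_to_def dest: relpowp_imp_rtranclp)
qed

text \<open>Inductive counting (Immerman, Szelepcsenyi). The source is not counted, so that the counts
  stay below \<open>D\<close>.\<close>

definition count :: "nat \<Rightarrow> nat \<Rightarrow> nat" where
  "count s i = card {v. v < D \<and> v \<noteq> s \<and> steps_to i s v}"

text \<open>Evidence that \<open>u\<close> is out of reach in \<open>i + 1\<close> steps, provided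
  that \<open>c\<close> is the true count: that many nodes reached within \<open>i\<close> steps,
  none of them equal to \<open>u\<close> or with an edge to \<open>u\<close>. The source, which is
  not counted, is examined separately.\<close>

definition cert :: "nat \<Rightarrow> nat \<Rightarrow> nat \<Rightarrow> nat \<Rightarrow> bool" where
  "cert s i c u \<longleftrightarrow> u \<noteq> s \<and> \<not> E s u \<and>
     c \<le> card {v. v < D \<and> v \<noteq> s \<and> steps_to i s v \<and> v \<noteq> u \<and> \<not> E v u}"

text \<open>The new count is secured from both sides: at least \<open>c'\<close> nodes are reached,
  and at least \<open>d = D - 1 - c'\<close> nodes are certified to be out of reach.\<close>

definition count_step :: "nat \<Rightarrow> nat \<Rightarrow> nat \<Rightarrow> nat \<Rightarrow> nat \<Rightarrow> bool" where
  "count_step s i c j c' \<longleftrightarrow> j = Suc i \<and> c' \<le> card {u. u < D \<and> u \<noteq> s \<and> steps_to j s u} \<and>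
     (\<exists>m < D. Suc m = D \<and> (\<exists>d < D. d + c' = m \<and> d \<le> card {u. u < D \<and> cert s i c u}))"

text \<open>If the count is exact, the nodes exhibited in a certificate are all the counted ones, so
  no predecessor of \<open>u\<close> can have been withheld.\<close>

lemma cert_count:
  assumes "s < D" "u < D"
  shows "cert s i (count s i) u \<longleftrightarrow> \<not> steps_to (Suc i) s u"
proof -
  let ?A = "{v. v < D \<and> v \<noteq> s \<and> steps_to i s v}"
  let ?B = "{v. v < D \<and> v \<noteq> s \<and> steps_to i s v \<and> v \<noteq> u \<and> \<not> E v u}"
  have "count s i \<le> card ?B \<longleftrightarrow> ?B = ?A"
  proof
    assume "count s i \<le> card ?B"
    then show "?B = ?A" by (intro card_seteq) (auto simp: count_def)
  qed (simp add: count_def)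
  moreover have "steps_to i s s" using steps_to_mono[of 0 s s i] by (simp add: steps_to_0)
  ultimately show ?thesis
    unfolding cert_def steps_to_Suc using assms by (auto simp: edge_def dest: steps_to_less)
qed

text \<open>Reached and certified nodes partition the \<open>D - 1\<close> nodes other than the
  source, so the two lower bounds together force equality.\<close>

lemma count_step_count:
  assumes "s < D"
  shows "count_step s i (count s i) j c' \<longleftrightarrow> j = Suc i \<and> c' = count s j"
proof (cases "j = Suc i")
  case True
  let ?C = "{u. u < D \<and> cert s i (count s i) u}"
  have C: "?C = {u. u < D \<and> u \<noteq> s \<and> \<not> steps_to (Suc i) s u}"
    using cert_count[OF assms] steps_to_mono[of 0 s s "Suc i"] by (auto simp: steps_to_0)
  have "{u. u < D \<and> u \<noteq> s \<and> steps_to (Suc i) s u} \<union> ?C = {..<D} - {s}" unfolding C by auto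
  moreover have "{u. u < D \<and> u \<noteq> s \<and> steps_to (Suc i) s u} \<inter> ?C = {}" unfolding C by auto
  ultimately have "count s (Suc i) + card ?C = D - 1"
    using card_Un_disjoint[of "{u. u < D \<and> u \<noteq> s \<and> steps_to (Suc i) s u}" ?C] assms
    by (simp add: count_def)
  moreover have "count_step s i (count s i) j c' \<longleftrightarrow> c' \<le> count s (Suc i) \<and>
      (\<exists>m < D. Suc m = D \<and> (\<exists>d < D. d + c' = m \<and> d \<le> card ?C))"
    by (simp add: count_step_def count_def[symmetric] True)
  moreover have "(\<exists>m < D. Suc m = D \<and> (\<exists>d < D. d + c' = m \<and> d \<le> K)) \<longleftrightarrow> c' \<le> D - 1 \<and> D - 1 - c' \<le> K" for K
  proof
    assume "c' \<le> D - 1 \<and> D - 1 - c' \<le> K"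
    then show "\<exists>m < D. Suc m = D \<and> (\<exists>d < D. d + c' = m \<and> d \<le> K)"
      using assms by (intro exI[of _ "D - 1"] conjI exI[of _ "D - 1 - c'"]) auto
  qed auto
  ultimately have "count_step s i (count s i) j c' \<longleftrightarrow> c' = count s (Suc i)" by auto
  then show ?thesis using True by simp
qed (simp add: count_step_def)

lemma count_less: "s < D \<Longrightarrow> count s i < D"
proof -
  assume "s < D"
  then have "count s i \<le> card ({..<D} - {s})" unfolding count_def by (intro card_mono) auto
  then show ?thesis using \<open>s < D\<close> by simp
qed

lemma count_chain:
  assumes "s < D"
  shows "(rel2 D (count_step s))\<^sup>*\<^sup>* (0, 0) (i, c) \<Longrightarrow> c = count s i"
    and "i < D \<Longrightarrow> (rel2 D (count_step s))\<^sup>*\<^sup>* (0, 0) (i, count s i)"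
proof -
  have 0: "count s 0 = 0" by (simp add: count_def steps_to_0)
  have "(rel2 D (count_step s))\<^sup>*\<^sup>* (0, 0) ic \<Longrightarrow> snd ic = count s (fst ic)" for ic
    by (induction rule: rtranclp_induct) (auto simp: 0 rel2_def count_step_count[OF assms])
  then show "(rel2 D (count_step s))\<^sup>*\<^sup>* (0, 0) (i, c) \<Longrightarrow> c = count s i" by fastforce
  show "i < D \<Longrightarrow> (rel2 D (count_step s))\<^sup>*\<^sup>* (0, 0) (i, count s i)"
  proof (induction i)
    case (Suc i)
    have "rel2 D (count_step s) (i, count s i) (Suc i, count s (Suc i))"
      using Suc.prems count_less[OF assms] by (simp add: rel2_def count_step_count[OF assms])
    then show ?case using Suc by (meson Suc_lessD rtranclp.rtrancl_into_rtrancl)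
  qed (simp add: 0)
qed

text \<open>Everything reachable is reached within \<open>D - 1\<close> steps, so a certificate
  built on the last count, which speaks about one step more, settles reachability.\<close>

lemma not_reach_iff:
  assumes "s < D" "t < D"
  shows "\<not> edge\<^sup>*\<^sup>* s t \<longleftrightarrow> (\<exists>m < D. Suc m = D \<and> (\<exists>c < D. (rel2 D (count_step s))\<^sup>*\<^sup>* (0, 0) (m, c) \<and> cert s m c t))"
proof -
  have "edge\<^sup>*\<^sup>* s t \<longleftrightarrow> steps_to (Suc (D - 1)) s t"
    using reach_steps_to[OF assms(1)] steps_to_mono[of "D - 1" s t "Suc (D - 1)"]
    by (auto simp: steps_to_def dest: relpowp_imp_rtranclp)
  also have "\<dots> \<longleftrightarrow> \<not> cert s (D - 1) (count s (D - 1)) t"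
    using cert_count[OF assms] by blast
  finally have reach: "edge\<^sup>*\<^sup>* s t \<longleftrightarrow> \<not> cert s (D - 1) (count s (D - 1)) t" .
  show ?thesis
  proof
    assume "\<not> edge\<^sup>*\<^sup>* s t"
    then have "cert s (D - 1) (count s (D - 1)) t" using reach by blast
    then show "\<exists>m < D. Suc m = D \<and> (\<exists>c < D. (rel2 D (count_step s))\<^sup>*\<^sup>* (0, 0) (m, c) \<and> cert s m c t)"
      using count_chain(2)[OF assms(1), of "D - 1"] count_less[OF assms(1), of "D - 1"] assms
      by (intro exI[of _ "D - 1"] conjI exI[of _ "count s (D - 1)"]) auto
  next
    assume "\<exists>m < D. Suc m = D \<and> (\<exists>c < D. (rel2 D (count_step s))\<^sup>*\<^sup>* (0, 0) (m, c) \<and> cert s m c t)"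
    then obtain m c where m: "Suc m = D" "(rel2 D (count_step s))\<^sup>*\<^sup>* (0, 0) (m, c)" "cert s m c t" by blast
    then have "c = count s m" using count_chain(1)[OF assms(1)] by blast
    moreover have "m = D - 1" using m(1) by simp
    ultimately show "\<not> edge\<^sup>*\<^sup>* s t" using reach m(3) by blast
  qed
qed

end

section \<open>Universal quantification and unreachability as verifiable predicates\<close>

context base
begin

text \<open>Quantification by counting: with \<open>m\<close> the last value, \<open>P\<close> holds
  everywhere iff it holds at \<open>m\<close> and at no fewer than \<open>m\<close> other values.
  Splitting off \<open>m\<close> keeps the number to be compared within the range of the
  counters.\<close>

lemma nd_all:
  assumes P: "\<And>l i. k \<le> l \<Longrightarrow> i < l \<Longrightarrow> nd l (\<lambda>w \<sigma>. P w \<sigma> (\<sigma> i))"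
    and indep: "\<And>w \<sigma> j v. k \<le> j \<Longrightarrow> P w (\<sigma>(j := v)) = P w \<sigma>"
  shows "nd k (\<lambda>w \<sigma>. \<forall>a < bound w. P w \<sigma> a)"
proof -
  have "nd k (\<lambda>w \<sigma>. \<exists>m < bound w. Suc m = bound w \<and> P w \<sigma> m \<and>
      m \<le> card {a. a < bound w \<and> (a \<noteq> m \<and> P w \<sigma> a)})"
    by (intro nd_ex nd_conj nd_ddec[OF ddec_last] nd_card nd_ddec[OF ddec_not] ddec_eq P)
      (auto simp: indep)
  then show ?thesis
  proof (rule nd_cong)
    fix w \<sigma>
    have all: "(\<forall>a < bound w. P w \<sigma> a) \<longleftrightarrow> P w \<sigma> m \<and> m \<le> card {a. a < bound w \<and> (a \<noteq> m \<and> P w \<sigma> a)}"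
      if m: "Suc m = bound w" for m
    proof -
      let ?A = "{a. a < bound w \<and> (a \<noteq> m \<and> P w \<sigma> a)}"
      have A: "?A \<subseteq> {..<m}" using m by auto
      have "m \<le> card ?A \<longleftrightarrow> ?A = {..<m}"
      proof
        assume "m \<le> card ?A"
        then show "?A = {..<m}" by (intro card_seteq[OF _ A]) simp_all
      next
        assume "?A = {..<m}"
        then have "card ?A = card {..<m}" by (rule arg_cong)
        then show "m \<le> card ?A" by simp
      qed
      also have "\<dots> \<longleftrightarrow> (\<forall>a < m. P w \<sigma> a)" using m by auto
      finally have "m \<le> card ?A \<longleftrightarrow> (\<forall>a < m. P w \<sigma> a)" .
      moreover have "a < bound w \<longleftrightarrow> a < m \<or> a = m" for a using m by linarith
      ultimately show ?thesis by blast
    qed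
    define m where "m = bound w - 1"
    have m: "Suc m = bound w" using bound_pos[of w] by (simp add: m_def)
    have last: "(\<exists>x < bound w. Suc x = bound w \<and> Q x) \<longleftrightarrow> Q m" for Q
    proof
      assume "\<exists>x < bound w. Suc x = bound w \<and> Q x"
      then obtain x where "Suc x = bound w" "Q x" by (elim exE conjE)
      then have "x = m" "Q x" using m by simp_all
      then show "Q m" by (rule subst)
    next
      assume "Q m"
      then show "\<exists>x < bound w. Suc x = bound w \<and> Q x"
        using m by (intro exI[of _ m] conjI) simp_all
    qed
    show "(\<exists>m < bound w. Suc m = bound w \<and> P w \<sigma> m \<and>
      m \<le> card {a. a < bound w \<and> (a \<noteq> m \<and> P w \<sigma> a)}) \<longleftrightarrow> (\<forall>a < bound w. P w \<sigma> a)"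
      unfolding last by (rule all[OF m, symmetric])
  qed
qed

context
  fixes k :: nat and E :: "bool list \<Rightarrow> vals \<Rightarrow> nat \<Rightarrow> nat \<Rightarrow> bool"
  assumes pos: "\<And>l i j. k \<le> l \<Longrightarrow> i < l \<Longrightarrow> j < l \<Longrightarrow> nd l (\<lambda>w \<sigma>. E w \<sigma> (\<sigma> i) (\<sigma> j))"
    and neg: "\<And>l i j. k \<le> l \<Longrightarrow> i < l \<Longrightarrow> j < l \<Longrightarrow> nd l (\<lambda>w \<sigma>. \<not> E w \<sigma> (\<sigma> i) (\<sigma> j))"
    and indep: "\<And>w \<sigma> j v. k \<le> j \<Longrightarrow> E w (\<sigma>(j := v)) = E w \<sigma>"
begin

lemma nd_steps_to:
  assumes "k \<le> l" "s < l" "i < l" "v < l"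
  shows "nd l (\<lambda>w \<sigma>. steps_to (bound w) (E w \<sigma>) (\<sigma> i) (\<sigma> s) (\<sigma> v))"
proof -
  \<comment> \<open>\<open>nd_rtc2\<close> has variables at both ends of the chain, so the constant
    0 is given a name.\<close>
  have "nd l (\<lambda>w \<sigma>. \<exists>z < bound w. z = 0 \<and>
      (rel2 (bound w) (\<lambda>i a j b. j = Suc i \<and> (a = b \<or> E w \<sigma> a b)))\<^sup>*\<^sup>* (z, \<sigma> s) (\<sigma> i, \<sigma> v))"
    by (intro nd_ex nd_conj nd_ddec[OF ddec_zero] nd_rtc2 nd_ddec[OF ddec_Suc] nd_disj nd_ddec[OF ddec_eq] pos)
      (use assms in \<open>auto simp: indep\<close>)
  then show ?thesis
    by (rule nd_cong) (simp add: steps_to_rtc2[OF clean_less clean_less])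
qed

lemma nd_reach:
  assumes "k \<le> l" "s < l" "v < l"
  shows "nd l (\<lambda>w \<sigma>. (edge (bound w) (E w \<sigma>))\<^sup>*\<^sup>* (\<sigma> s) (\<sigma> v))"
proof -
  have "nd l (\<lambda>w \<sigma>. \<exists>m < bound w. Suc m = bound w \<and> steps_to (bound w) (E w \<sigma>) m (\<sigma> s) (\<sigma> v))"
    by (intro nd_ex nd_conj nd_ddec[OF ddec_last] nd_steps_to) (use assms in \<open>auto simp: indep\<close>)
  then show ?thesis
  proof (rule nd_cong)
    fix w \<sigma> assume cl: "clean w l \<sigma>"
    have "m < bound w \<and> Suc m = bound w \<longleftrightarrow> m = bound w - 1" for m using bound_pos[of w] by auto
    then show "(\<exists>m < bound w. Suc m = bound w \<and> steps_to (bound w) (E w \<sigma>) m (\<sigma> s) (\<sigma> v)) \<longleftrightarrow>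
        (edge (bound w) (E w \<sigma>))\<^sup>*\<^sup>* (\<sigma> s) (\<sigma> v)"
      using reach_steps_to[OF clean_less[OF cl]] by (metis (no_types, lifting))
  qed
qed

text \<open>Certificates assert the absence of edges, which is where the verifier for the complement
  of \<open>E\<close> enters.\<close>

lemma nd_cert:
  assumes "k \<le> l" "s < l" "i < l" "c < l" "u < l"
  shows "nd l (\<lambda>w \<sigma>. cert (bound w) (E w \<sigma>) (\<sigma> s) (\<sigma> i) (\<sigma> c) (\<sigma> u))"
  unfolding cert_def
  by (intro nd_conj nd_card nd_steps_to neg nd_ddec[OF ddec_not] ddec_eq)
    (use assms in \<open>auto simp: indep\<close>)

lemma nd_count_step:
  assumes "k \<le> l" "s < l" "i < l" "c < l" "j < l" "d < l"
  shows "nd l (\<lambda>w \<sigma>. count_step (bound w) (E w \<sigma>) (\<sigma> s) (\<sigma> i) (\<sigma> c) (\<sigma> j) (\<sigma> d))"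
  unfolding count_step_def
  by (intro nd_conj nd_ex nd_ddec[OF ddec_Suc] nd_ddec[OF ddec_last] nd_ddec[OF ddec_add]
      nd_card nd_steps_to nd_ddec[OF ddec_not] ddec_eq nd_cert)
    (use assms in \<open>auto simp: indep\<close>)

theorem nd_not_reach:
  assumes "k \<le> l" "s < l" "v < l"
  shows "nd l (\<lambda>w \<sigma>. \<not> (edge (bound w) (E w \<sigma>))\<^sup>*\<^sup>* (\<sigma> s) (\<sigma> v))"
proof -
  have "nd l (\<lambda>w \<sigma>. \<exists>z < bound w. z = 0 \<and> (\<exists>m < bound w. Suc m = bound w \<and> (\<exists>c < bound w.
      (rel2 (bound w) (count_step (bound w) (E w \<sigma>) (\<sigma> s)))\<^sup>*\<^sup>* (z, z) (m, c) \<and>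
      cert (bound w) (E w \<sigma>) (\<sigma> s) m c (\<sigma> v))))"
    by (intro nd_ex nd_conj nd_ddec[OF ddec_zero] nd_ddec[OF ddec_last] nd_rtc2 nd_count_step nd_cert)
      (use assms in \<open>auto simp: indep\<close>)
  then show ?thesis
    by (rule nd_cong) (simp add: not_reach_iff[OF clean_less clean_less])
qed

end

end

section \<open>Paths and unary operators\<close>

lemma path_suffix: "\<rho> \<in> paths K q \<Longrightarrow> (\<lambda>i. \<rho> (i + n)) \<in> paths K (\<rho> n)"
  by (auto simp: paths_def)

lemma path_cons: "r \<in> succ K q \<Longrightarrow> \<rho> \<in> paths K r \<Longrightarrow> case_nat q \<rho> \<in> paths K q"
  by (auto simp: paths_def split: nat.splits)

lemma path_reach: "\<rho> \<in> paths K q \<Longrightarrow> (\<lambda>a b. b \<in> succ K a)\<^sup>*\<^sup>* q (\<rho> n)"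
  by (induction n) (auto simp: paths_def intro: rtranclp.rtrancl_into_rtrancl)

lemma path_through:
  "(\<lambda>a b. b \<in> succ K a)\<^sup>*\<^sup>* q r \<Longrightarrow> \<rho> \<in> paths K r \<Longrightarrow>
    \<exists>\<rho>' \<in> paths K q. \<exists>n. \<forall>i. \<rho>' (i + n) = \<rho> i"
proof (induction rule: converse_rtranclp_induct)
  case base
  then show ?case by (intro bexI[of _ \<rho>] exI[of _ 0]) auto
next
  case (step q q')
  then obtain \<rho>' n where "\<rho>' \<in> paths K q'" "\<forall>i. \<rho>' (i + n) = \<rho> i" by blast
  then show ?case using path_cons[OF step(1)]
    by (intro bexI[of _ "case_nat q \<rho>'"] exI[of _ "Suc n"]) auto
qed

lemma path_in_set:
  assumes "q \<in> X" "\<And>x. x \<in> X \<Longrightarrow> \<exists>y \<in> X. y \<in> succ K x"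
  shows "\<exists>\<rho> \<in> paths K q. \<forall>i. \<rho> i \<in> X"
proof -
  define nxt where "nxt x = (SOME y. y \<in> X \<and> y \<in> succ K x)" for x
  have nxt: "nxt x \<in> X \<and> nxt x \<in> succ K x" if "x \<in> X" for x
    unfolding nxt_def using someI_ex[of "\<lambda>y. y \<in> X \<and> y \<in> succ K x"] assms(2)[OF that] by blast
  have "(nxt ^^ i) q \<in> X" for i by (induction i) (use assms(1) nxt in auto)
  then show ?thesis
    using nxt by (intro bexI[of _ "\<lambda>i. (nxt ^^ i) q"]) (auto simp: paths_def)
qed

lemma path_states:
  assumes "kripke_structure K" "q \<in> states K" "\<rho> \<in> paths K q"
  shows "\<rho> i \<in> states K"
proof (induction i)
  case (Suc i)
  moreover have "\<rho> (Suc i) \<in> succ K (\<rho> i)" using assms(3) by (auto simp: paths_def)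
  ultimately show ?case using assms(1) unfolding kripke_structure_def by blast
qed (use assms in \<open>auto simp: paths_def\<close>)

lemma path_exists:
  assumes "kripke_structure K" "q \<in> states K"
  shows "\<exists>\<rho>. \<rho> \<in> paths K q"
proof -
  have "\<exists>y \<in> states K. y \<in> succ K x" if "x \<in> states K" for x
    using assms(1) that unfolding kripke_structure_def by blast
  from path_in_set[OF assms(2) this] show ?thesis by blast
qed

text \<open>A finite walk extends to an infinite path because successor sets are nonempty.\<close>

lemma EF_iff_reach:
  assumes "kripke_structure K" "q \<in> states K"
  shows "(\<exists>\<rho> \<in> paths K q. \<exists>i. \<rho> i \<in> X) \<longleftrightarrow> (\<exists>r \<in> X. (\<lambda>a b. b \<in> succ K a)\<^sup>*\<^sup>* q r)"
proof
  assume "\<exists>r \<in> X. (\<lambda>a b. b \<in> succ K a)\<^sup>*\<^sup>* q r"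
  then obtain r where r: "r \<in> X" "(\<lambda>a b. b \<in> succ K a)\<^sup>*\<^sup>* q r" by blast
  have "r \<in> states K" using r(2)
    by (induction rule: rtranclp_induct) (use assms in \<open>auto simp: kripke_structure_def\<close>)
  then obtain \<rho> where \<rho>: "\<rho> \<in> paths K r" using path_exists[OF assms(1)] by blast
  then have "\<rho> 0 = r" by (simp add: paths_def)
  then show "\<exists>\<rho> \<in> paths K q. \<exists>i. \<rho> i \<in> X"
    using path_through[OF r(2) \<rho>] r(1) by (metis add_0)
qed (use path_reach in fastforce)

text \<open>An infinite path through finitely many states repeats one of them. Conversely, each
  state from which \<open>r\<close> is reached inside \<open>X\<close> has a successor of the same
  kind, so the walk can go on forever.\<close>

lemma EG_iff_lasso:
  fixes X :: "'q set"
  assumes "kripke_structure K" "q \<in> states K"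
  defines "E \<equiv> \<lambda>a b. b \<in> succ K a \<and> a \<in> X \<and> b \<in> X"
  shows "(\<exists>\<rho> \<in> paths K q. \<forall>i. \<rho> i \<in> X) \<longleftrightarrow> (\<exists>r. E\<^sup>+\<^sup>+ q r \<and> E\<^sup>+\<^sup>+ r r)"
proof
  assume "\<exists>\<rho> \<in> paths K q. \<forall>i. \<rho> i \<in> X"
  then obtain \<rho> where \<rho>: "\<rho> \<in> paths K q" "\<And>i. \<rho> i \<in> X" by blast
  have seg: "i < j \<Longrightarrow> E\<^sup>+\<^sup>+ (\<rho> i) (\<rho> j)" for i j
  proof (induction j)
    case (Suc j)
    have "E (\<rho> j) (\<rho> (Suc j))" using \<rho> by (auto simp: E_def paths_def)
    then show ?case using Suc by (cases "i = j") auto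
  qed simp
  have "range \<rho> \<subseteq> states K" using path_states[OF assms(1,2) \<rho>(1)] by auto
  then have "finite (range \<rho>)" using assms(1) finite_subset by (auto simp: kripke_structure_def)
  \<comment> \<open>Position 0 is left out, so that the repeated state is reached from
    \<open>q\<close> by at least one step.\<close>
  moreover have "range \<rho> = range (\<lambda>i. \<rho> (Suc i)) \<union> {\<rho> 0}"
    by (auto simp: image_iff) (metis not0_implies_Suc)
  ultimately have "finite (range (\<lambda>i. \<rho> (Suc i)))" by simp
  then have "\<not> inj (\<lambda>i. \<rho> (Suc i))" using finite_imageD infinite_UNIV_nat by blast
  then obtain i j where "\<rho> (Suc i) = \<rho> (Suc j)" "i < j"
    unfolding inj_def by (metis linorder_neqE_nat)
  then have "E\<^sup>+\<^sup>+ (\<rho> (Suc i)) (\<rho> (Suc i))" "E\<^sup>+\<^sup>+ (\<rho> 0) (\<rho> (Suc i))"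
    using seg[of "Suc i" "Suc j"] seg[of 0 "Suc i"] by auto
  moreover have "\<rho> 0 = q" using \<rho>(1) by (simp add: paths_def)
  ultimately show "\<exists>r. E\<^sup>+\<^sup>+ q r \<and> E\<^sup>+\<^sup>+ r r" by auto
next
  assume "\<exists>r. E\<^sup>+\<^sup>+ q r \<and> E\<^sup>+\<^sup>+ r r"
  then obtain r where r: "E\<^sup>+\<^sup>+ q r" "E\<^sup>+\<^sup>+ r r" by blast
  have *: "\<exists>y \<in> {x. E\<^sup>+\<^sup>+ x r}. y \<in> succ K x" if "E\<^sup>+\<^sup>+ x r" for x
  proof -
    from that obtain y where y: "E x y" "E\<^sup>*\<^sup>* y r" by (auto dest: tranclpD)
    then have "E\<^sup>+\<^sup>+ y r" using r(2) by (metis rtranclp_tranclp_tranclp)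
    then show ?thesis using y(1) by (auto simp: E_def)
  qed
  have "E\<^sup>+\<^sup>+ x r \<Longrightarrow> x \<in> X" for x by (auto dest!: tranclpD simp: E_def)
  then show "\<exists>\<rho> \<in> paths K q. \<forall>i. \<rho> i \<in> X"
    using path_in_set[of q "{x. E\<^sup>+\<^sup>+ x r}" K] r(1) * by blast
qed

section \<open>Temporal operators as closures and interiors on truth sets\<close>

definition truth :: "('q, 'p) kripke \<Rightarrow> 'p ctl \<Rightarrow> 'q set" where
  "truth K \<phi> = {q \<in> states K. sat K \<phi> q}"

text \<open>\<open>cl K True\<close> and \<open>cl K False\<close> are EF and AF; \<open>itr K True\<close> and \<open>itr K False\<close> are EG and AG.\<close>

definition quant :: "bool \<Rightarrow> quantifier" where
  "quant b = (if b then Exists_Path else All_Paths)"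

definition cl :: "('q, 'p) kripke \<Rightarrow> bool \<Rightarrow> 'q set \<Rightarrow> 'q set" where
  "cl K b X = {q \<in> states K. quantifier_sem (quant b) (paths K q) (\<lambda>\<rho>. \<exists>i. \<rho> i \<in> X)}"

definition itr :: "('q, 'p) kripke \<Rightarrow> bool \<Rightarrow> 'q set \<Rightarrow> 'q set" where
  "itr K b X = {q \<in> states K. quantifier_sem (quant b) (paths K q) (\<lambda>\<rho>. \<forall>i. \<rho> i \<in> X)}"

lemma quantifier_sem_cong:
  "(\<And>\<rho>. \<rho> \<in> R \<Longrightarrow> T \<rho> = T' \<rho>) \<Longrightarrow> quantifier_sem Q R T = quantifier_sem Q R T'"
  by (cases Q) auto

lemma truth_simps:
  assumes "kripke_structure K"
  shows "truth K (Neg \<phi>) = states K - truth K \<phi>"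
    and "truth K (Quant (quant b) Eventually \<phi>) = cl K b (truth K \<phi>)"
    and "truth K (Quant (quant b) Globally \<phi>) = itr K b (truth K \<phi>)"
    and "truth K (Bin c \<phi> \<psi>) = {q \<in> states K. binop_sem c (q \<in> truth K \<phi>) (q \<in> truth K \<psi>)}"
  using path_states[OF assms] unfolding truth_def cl_def itr_def
  by (auto intro!: Collect_cong conj_cong quantifier_sem_cong simp: quant_def) blast+

lemma quant_surj: "\<exists>b. Q = quant b"
  by (cases Q) (auto simp: quant_def)

context
  fixes K :: "('q, 'p) kripke"
  assumes K: "kripke_structure K"
begin

lemma cl_states: "cl K b X \<subseteq> states K" by (auto simp: cl_def)

lemma int_states: "itr K b X \<subseteq> states K" by (auto simp: itr_def)

lemma cl_mono: "X \<subseteq> Y \<Longrightarrow> cl K b X \<subseteq> cl K b Y"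
  by (cases b) (auto simp: cl_def quant_def, blast+)

lemma cl_ext: "X \<subseteq> states K \<Longrightarrow> X \<subseteq> cl K b X"
proof
  fix q assume q: "X \<subseteq> states K" "q \<in> X"
  then obtain \<rho> where "\<rho> \<in> paths K q" using path_exists[OF K] by blast
  moreover have "\<rho> \<in> paths K q \<Longrightarrow> \<rho> 0 = q" for \<rho> by (simp add: paths_def)
  ultimately show "q \<in> cl K b X" using q by (cases b) (force simp: cl_def quant_def)+
qed

lemma AF_subset_EF: "cl K False X \<subseteq> cl K True X"
  using path_exists[OF K] by (auto simp: cl_def quant_def)

lemma EF_reach: "cl K True X = {q \<in> states K. \<exists>r \<in> X. (\<lambda>a b. b \<in> succ K a)\<^sup>*\<^sup>* q r}"
  unfolding cl_def quant_def if_True quantifier_sem.simps using EF_iff_reach[OF K] by blast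

lemma cl_idem_EF: "cl K True (cl K True X) \<subseteq> cl K True X"
  unfolding EF_reach by (auto intro: rtranclp_trans)

lemma cl_idem_AF: "cl K False (cl K False X) \<subseteq> cl K False X"
proof
  fix q assume q: "q \<in> cl K False (cl K False X)"
  have "\<exists>i. \<rho> i \<in> X" if "\<rho> \<in> paths K q" for \<rho>
  proof -
    obtain n where "\<rho> n \<in> cl K False X" using q \<open>\<rho> \<in> paths K q\<close> by (auto simp: cl_def quant_def)
    then show ?thesis using path_suffix[OF that, of n] by (auto simp: cl_def quant_def)
  qed
  then show "q \<in> cl K False X" using q by (simp add: cl_def quant_def)
qed

text \<open>Both closures are monotone, extensive and idempotent, and AF lies below EF; the larger
  one therefore absorbs the other on either side.\<close>

lemma cl_cl:
  assumes "X \<subseteq> states K"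
  shows "cl K b (cl K b' X) = cl K (b \<or> b') X"
proof -
  have up: "cl K b (cl K b' X) \<subseteq> cl K (b \<or> b') X"
  proof (cases "b \<or> b'")
    case True
    have "cl K b Y \<subseteq> cl K True Y" for b Y using AF_subset_EF[of Y] by (cases b) auto
    then have "cl K b (cl K b' X) \<subseteq> cl K True (cl K True X)"
      using cl_mono by (meson order_trans)
    then show ?thesis using cl_idem_EF True by auto
  next
    case False
    then show ?thesis using cl_idem_AF by simp
  qed
  have "cl K b X \<subseteq> cl K b (cl K b' X)" by (rule cl_mono[OF cl_ext[OF assms]])
  moreover have "cl K b' X \<subseteq> cl K b (cl K b' X)" by (rule cl_ext[OF cl_states])
  ultimately show ?thesis using up by (cases b; cases b') auto
qed

lemma int_dual: "itr K b X = states K - cl K (\<not> b) (states K - X)"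
  using path_states[OF K] by (cases b) (auto simp: itr_def cl_def quant_def, blast+)

lemma cl_dual: "X \<subseteq> states K \<Longrightarrow> cl K b X = states K - itr K (\<not> b) (states K - X)"
  unfolding int_dual using cl_states[of b X] by (simp add: double_diff)

lemma int_mono: "X \<subseteq> Y \<Longrightarrow> itr K b X \<subseteq> itr K b Y"
  by (cases b) (auto simp: itr_def quant_def)

lemma int_sub: "X \<subseteq> states K \<Longrightarrow> itr K b X \<subseteq> X"
  unfolding int_dual using cl_ext[of "states K - X" "\<not> b"] by blast

lemma int_int: "X \<subseteq> states K \<Longrightarrow> itr K b (itr K b' X) = itr K (b \<and> b') X"
  unfolding int_dual using cl_states[of "\<not> b'" "states K - X"]
  by (simp add: double_diff cl_cl)

text \<open>Kuratowski's identity with operators of different strength: the inner closure and the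
  inner interior lie below the outer ones. From left to right the outer interior is dropped and the
  closures merge; conversely \<open>itr K d' X\<close> is its own \<open>d\<close>-interior, and
  extensivity inserts the closure.\<close>

lemma cl_int_cl_int:
  assumes X: "X \<subseteq> states K" and "b' \<longrightarrow> b" "d' \<longrightarrow> d"
  shows "cl K b (itr K d (cl K b' (itr K d' X))) = cl K b (itr K d' X)"
proof
  have "cl K b (itr K d (cl K b' (itr K d' X))) \<subseteq> cl K b (cl K b' (itr K d' X))"
    by (intro cl_mono int_sub cl_states)
  also have "\<dots> = cl K b (itr K d' X)" using assms by (cases b') (auto simp: cl_cl int_states)
  finally show "cl K b (itr K d (cl K b' (itr K d' X))) \<subseteq> cl K b (itr K d' X)" .
  have "itr K d' X = itr K d (itr K d' X)" using assms by (cases d') (auto simp: int_int)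
  also have "\<dots> \<subseteq> itr K d (cl K b' (itr K d' X))" by (intro int_mono cl_ext int_states)
  finally show "cl K b (itr K d' X) \<subseteq> cl K b (itr K d (cl K b' (itr K d' X)))" by (rule cl_mono)
qed

text \<open>The dual identity; here the inner operators lie above the outer ones.\<close>

lemma int_cl_int_cl:
  assumes X: "X \<subseteq> states K" and "b \<longrightarrow> b'" "d \<longrightarrow> d'"
  shows "itr K d (cl K b (itr K d' (cl K b' X))) = itr K d (cl K b' X)"
proof
  have "cl K b (itr K d' (cl K b' X)) \<subseteq> cl K b (cl K b' X)"
    by (intro cl_mono int_sub cl_states)
  also have "\<dots> = cl K b' X" using assms by (cases b) (auto simp: cl_cl)
  finally show "itr K d (cl K b (itr K d' (cl K b' X))) \<subseteq> itr K d (cl K b' X)" by (rule int_mono)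
  have "itr K d (cl K b' X) = itr K d (itr K d' (cl K b' X))"
    using assms by (cases d) (auto simp: int_int cl_states)
  also have "\<dots> \<subseteq> itr K d (cl K b (itr K d' (cl K b' X)))" by (intro int_mono cl_ext int_states)
  finally show "itr K d (cl K b' X) \<subseteq> itr K d (cl K b (itr K d' (cl K b' X)))" .
qed

end

section \<open>Words of unary operators\<close>

text \<open>A letter \<open>(True, b)\<close> stands for \<open>cl K b\<close> and \<open>(False, b)\<close> for \<open>itr K b\<close>.\<close>

primrec word_sem :: "('q, 'p) kripke \<Rightarrow> (bool \<times> bool) list \<Rightarrow> 'q set \<Rightarrow> 'q set" where
  "word_sem K [] X = X"
| "word_sem K (l # ws) X = (if fst l then cl K else itr K) (snd l) (word_sem K ws X)"

lemma word_sem_states: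
  "kripke_structure K \<Longrightarrow> X \<subseteq> states K \<Longrightarrow> word_sem K ws X \<subseteq> states K"
  by (cases ws) (auto dest: cl_states[THEN subsetD] int_states[THEN subsetD])

lemma word_sem_compl:
  assumes "kripke_structure K"
  shows "X \<subseteq> states K \<Longrightarrow> states K - word_sem K ws X =
    word_sem K (map (\<lambda>(k, b). (\<not> k, \<not> b)) ws) (states K - X)"
proof (induction ws)
  case (Cons l ws)
  obtain k b where l: "l = (k, b)" by (cases l)
  note sub = word_sem_states[OF assms Cons.prems, of ws]
  have "states K - cl K b (word_sem K ws X) = itr K (\<not> b) (states K - word_sem K ws X)"
    using int_states[OF assms] by (simp add: cl_dual[OF assms sub] double_diff)
  moreover have "states K - itr K b (word_sem K ws X) = cl K (\<not> b) (states K - word_sem K ws X)"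
    using cl_states[OF assms] by (simp add: int_dual[OF assms] double_diff)
  ultimately show ?case using Cons by (auto simp: l)
qed simp

text \<open>The type tokens fix the types of states and propositions over which all structures
  range.\<close>

definition shortens :: "'q itself \<Rightarrow> 'p itself \<Rightarrow> (bool \<times> bool) list \<Rightarrow> bool" where
  "shortens Q P ws \<longleftrightarrow> (\<exists>ws'. length ws' < length ws \<and>
     (\<forall>(K :: ('q, 'p) kripke) X. kripke_structure K \<longrightarrow> X \<subseteq> states K \<longrightarrow> word_sem K ws X = word_sem K ws' X))"

lemma shortens_Cons: "shortens Q P ws \<Longrightarrow> shortens Q P (l # ws)"
  unfolding shortens_def
proof (elim exE conjE)
  fix ws' assume "length ws' < length ws" and
    "\<forall>(K :: ('a, 'b) kripke) X. kripke_structure K \<longrightarrow> X \<subseteq> states K \<longrightarrow> word_sem K ws X = word_sem K ws' X"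
  then show "\<exists>ws'. length ws' < length (l # ws) \<and> (\<forall>(K :: ('a, 'b) kripke) X. kripke_structure K \<longrightarrow>
      X \<subseteq> states K \<longrightarrow> word_sem K (l # ws) X = word_sem K ws' X)"
    by (intro exI[of _ "l # ws'"]) simp
qed

lemma shortens_same: "shortens Q P ((k, b) # (k, b') # ws)"
proof (cases k)
  case True
  then show ?thesis unfolding shortens_def
    by (intro exI[of _ "(k, b \<or> b') # ws"]) (simp add: cl_cl word_sem_states)
next
  case False
  then show ?thesis unfolding shortens_def
    by (intro exI[of _ "(k, b \<and> b') # ws"]) (simp add: int_int word_sem_states)
qed

lemma shortens_alternating:
  "b' \<longrightarrow> b \<Longrightarrow> d' \<longrightarrow> d \<Longrightarrow> shortens Q P ((True, b) # (False, d) # (True, b') # (False, d') # ws)"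
  "b \<longrightarrow> b' \<Longrightarrow> d \<longrightarrow> d' \<Longrightarrow> shortens Q P ((False, d) # (True, b) # (False, d') # (True, b') # ws)"
proof -
  assume "b' \<longrightarrow> b" "d' \<longrightarrow> d"
  then show "shortens Q P ((True, b) # (False, d) # (True, b') # (False, d') # ws)"
    unfolding shortens_def
    by (intro exI[of _ "(True, b) # (False, d') # ws"]) (simp add: cl_int_cl_int word_sem_states)
next
  assume "b \<longrightarrow> b'" "d \<longrightarrow> d'"
  then show "shortens Q P ((False, d) # (True, b) # (False, d') # (True, b') # ws)"
    unfolding shortens_def
    by (intro exI[of _ "(False, d) # (True, b') # ws"]) (simp add: int_cl_int_cl word_sem_states)
qed

text \<open>Eight alternating letters offer five windows for the two four-letter identities. Were
  the word irreducible, all five side conditions would fail, which is propositionally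
  impossible.\<close>

lemma shortens_eight:
  "shortens Q P ((True, b1) # (False, d1) # (True, b2) # (False, d2) # (True, b3) # (False, d3) #
     (True, b4) # (False, d4) # ws)"
proof (rule ccontr)
  let ?w4 = "(True, b4) # (False, d4) # ws"
  let ?w3 = "(True, b3) # (False, d3) # ?w4"
  let ?w2 = "(True, b2) # (False, d2) # ?w3"
  assume n: "\<not> shortens Q P ((True, b1) # (False, d1) # ?w2)"
  then have n1: "\<not> shortens Q P ((False, d1) # ?w2)" using shortens_Cons by blast
  then have n2: "\<not> shortens Q P ?w2" using shortens_Cons by blast
  then have n3: "\<not> shortens Q P ((False, d2) # ?w3)" using shortens_Cons by blast
  then have n4: "\<not> shortens Q P ?w3" using shortens_Cons by blast
  have "\<not> ((b2 \<longrightarrow> b1) \<and> (d2 \<longrightarrow> d1))" "\<not> ((b2 \<longrightarrow> b3) \<and> (d1 \<longrightarrow> d2))"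
    "\<not> ((b3 \<longrightarrow> b2) \<and> (d3 \<longrightarrow> d2))" "\<not> ((b3 \<longrightarrow> b4) \<and> (d2 \<longrightarrow> d3))" "\<not> ((b4 \<longrightarrow> b3) \<and> (d4 \<longrightarrow> d3))"
    using shortens_alternating[of b2 b1 d2 d1 Q P] shortens_alternating[of b3 b2 d3 d2 Q P]
      shortens_alternating[of b4 b3 d4 d3 Q P] shortens_alternating(2)[of b2 b3 d1 d2 Q P]
      shortens_alternating(2)[of b3 b4 d2 d3 Q P] n n1 n2 n3 n4 by blast+
  then show False by blast
qed

text \<open>An irreducible word alternates. If it starts with an interior, the first letter is
  dropped to reach the pattern of \<open>shortens_eight\<close>; this accounts for nine instead of
  eight.\<close>

lemma shortens_long:
  assumes "length ws \<ge> 9"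
  shows "shortens Q P ws"
proof (rule ccontr)
  assume n: "\<not> shortens Q P ws"
  have alt: "\<not> shortens Q P us \<Longrightarrow> Suc m \<le> length us \<Longrightarrow> fst (hd us) = k \<Longrightarrow>
      \<exists>b vs. us = (k, b) # vs \<and> \<not> shortens Q P vs \<and> m \<le> length vs \<and> (0 < m \<longrightarrow> fst (hd vs) = (\<not> k))" for us m k
  proof -
    assume a: "\<not> shortens Q P us" "Suc m \<le> length us" "fst (hd us) = k"
    then obtain b vs where us: "us = (k, b) # vs" by (cases us) auto
    have "\<not> shortens Q P vs" using a(1) shortens_Cons us by blast
    moreover have "fst (hd vs) = (\<not> k)" if pos: "0 < m"
    proof -
      obtain k' b' vs' where "vs = (k', b') # vs'" using pos a(2) us by (cases vs) auto
      then show ?thesis using shortens_same[of Q P k b b' vs'] a(1) us by (cases "k = k'") auto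
    qed
    ultimately show ?thesis using us a(2) by auto
  qed
  have eight: False if u: "\<not> shortens Q P us" "8 \<le> length us" "fst (hd us) = True" for us
  proof -
    obtain b1 v1 where 1: "us = (True, b1) # v1" "\<not> shortens Q P v1" "7 \<le> length v1" "fst (hd v1) = False"
      using alt[of us 7 True] u by auto
    obtain d1 v2 where 2: "v1 = (False, d1) # v2" "\<not> shortens Q P v2" "6 \<le> length v2" "fst (hd v2) = True"
      using alt[of v1 6 False] 1 by auto
    obtain b2 v3 where 3: "v2 = (True, b2) # v3" "\<not> shortens Q P v3" "5 \<le> length v3" "fst (hd v3) = False"
      using alt[of v2 5 True] 2 by auto
    obtain d2 v4 where 4: "v3 = (False, d2) # v4" "\<not> shortens Q P v4" "4 \<le> length v4" "fst (hd v4) = True"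
      using alt[of v3 4 False] 3 by auto
    obtain b3 v5 where 5: "v4 = (True, b3) # v5" "\<not> shortens Q P v5" "3 \<le> length v5" "fst (hd v5) = False"
      using alt[of v4 3 True] 4 by auto
    obtain d3 v6 where 6: "v5 = (False, d3) # v6" "\<not> shortens Q P v6" "2 \<le> length v6" "fst (hd v6) = True"
      using alt[of v5 2 False] 5 by auto
    obtain b4 v7 where 7: "v6 = (True, b4) # v7" "\<not> shortens Q P v7" "1 \<le> length v7" "fst (hd v7) = False"
      using alt[of v6 1 True] 6 by auto
    obtain d4 v8 where 8: "v7 = (False, d4) # v8"
      using alt[of v7 0 False] 7 by auto
    show False using shortens_eight[of Q P b1 d1 b2 d2 b3 d3 b4 d4 v8] u(1) 1 2 3 4 5 6 7 8 by simp
  qed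
  show False
  proof (cases "fst (hd ws)")
    case True
    then show ?thesis using eight[of ws] n assms by simp
  next
    case False
    then obtain b vs where "ws = (False, b) # vs" "\<not> shortens Q P vs" "8 \<le> length vs" "fst (hd vs) = True"
      using alt[of ws 8 False] n assms by auto
    then show ?thesis using eight by blast
  qed
qed

lemma short_word:
  "\<exists>ws'. length ws' \<le> 8 \<and> (\<forall>(K :: ('q, 'p) kripke) X. kripke_structure K \<longrightarrow> X \<subseteq> states K \<longrightarrow>
     word_sem K ws X = word_sem K ws' X)"
proof (induction "length ws" arbitrary: ws rule: less_induct)
  case less
  show ?case
  proof (cases "length ws \<ge> 9")
    case True
    obtain us where us: "length us < length ws" "\<forall>(K :: ('q, 'p) kripke) X. kripke_structure K \<longrightarrow>
        X \<subseteq> states K \<longrightarrow> word_sem K ws X = word_sem K us X"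
      using shortens_long[OF True, of "TYPE('q)" "TYPE('p)"] unfolding shortens_def by blast
    obtain vs where vs: "length vs \<le> 8" "\<forall>(K :: ('q, 'p) kripke) X. kripke_structure K \<longrightarrow>
        X \<subseteq> states K \<longrightarrow> word_sem K us X = word_sem K vs X"
      using less[OF us(1)] by blast
    show ?thesis using us(2) vs by (intro exI[of _ vs]) simp
  qed (auto intro: exI[of _ ws])
qed

section \<open>Normal forms of unary prefixes\<close>

primrec core :: "'p ctl \<Rightarrow> 'p ctl" where
  "core (Atom p) = Atom p"
| "core (Neg \<phi>) = core \<phi>"
| "core (Bin b \<phi> \<psi>) = Bin b \<phi> \<psi>"
| "core (Quant Q t \<phi>) = core \<phi>"

lemma core_subformula: "core \<phi> \<in> subformulas \<phi>"
  by (induction \<phi>) auto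

lemma core_cases: "(\<exists>p. core \<phi> = Atom p) \<or> (\<exists>b \<psi>1 \<psi>2. core \<phi> = Bin b \<psi>1 \<psi>2)"
  by (induction \<phi>) auto

text \<open>By duality all negations move down to the core; the Boolean tells whether the core is
  used as it is or complemented.\<close>

definition normal_sem :: "('q, 'p) kripke \<Rightarrow> (bool \<times> bool) list \<times> bool \<Rightarrow> 'q set \<Rightarrow> 'q set" where
  "normal_sem K x X = word_sem K (fst x) (if snd x then X else states K - X)"

text \<open>Eight is the length bound of \<open>short_word\<close>.\<close>

definition normals :: "((bool \<times> bool) list \<times> bool) set" where
  "normals = {ws. length ws \<le> 8} \<times> UNIV"

lemma finite_normals: "finite normals"
proof -
  have "{ws :: (bool \<times> bool) list. length ws \<le> 8} = {ws. set ws \<subseteq> UNIV \<and> length ws \<le> 8}" by auto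
  then have "finite {ws :: (bool \<times> bool) list. length ws \<le> 8}"
    using finite_lists_length_le[of "UNIV :: (bool \<times> bool) set" 8] by simp
  then show ?thesis by (simp add: normals_def)
qed

lemma truth_states: "truth K \<phi> \<subseteq> states K"
  by (auto simp: truth_def)

text \<open>The normal form is chosen before the structure, so it depends on the formula alone and
  is valid in all structures at once.\<close>

lemma normal_form:
  "\<exists>x \<in> normals. \<forall>K :: ('q, 'p) kripke. kripke_structure K \<longrightarrow> truth K \<phi> = normal_sem K x (truth K (core \<phi>))"
proof (induction \<phi>)
  case (Neg \<phi>)
  then obtain ws p where x: "length ws \<le> 8" "\<forall>K :: ('q, 'p) kripke. kripke_structure K \<longrightarrow>
      truth K \<phi> = normal_sem K (ws, p) (truth K (core \<phi>))" by (auto simp: normals_def)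
  have "truth K (Neg \<phi>) = normal_sem K (map (\<lambda>(k, b). (\<not> k, \<not> b)) ws, \<not> p) (truth K (core \<phi>))"
    if K: "kripke_structure K" for K :: "('q, 'p) kripke"
    using x(2) K truth_states[of K "core \<phi>"]
    by (auto simp: truth_simps[OF K] normal_sem_def word_sem_compl[OF K] double_diff)
  then show ?case using x(1)
    by (intro bexI[of _ "(map (\<lambda>(k, b). (\<not> k, \<not> b)) ws, \<not> p)"]) (auto simp: normals_def)
next
  case (Quant Q t \<phi>)
  then obtain ws p where x: "length ws \<le> 8" "\<forall>K :: ('q, 'p) kripke. kripke_structure K \<longrightarrow>
      truth K \<phi> = normal_sem K (ws, p) (truth K (core \<phi>))" by (auto simp: normals_def)
  obtain b where b: "Q = quant b" using quant_surj by blast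
  let ?ws = "(t = Eventually, b) # ws"
  obtain vs where vs: "length vs \<le> 8" "\<And>(K :: ('q, 'p) kripke) X. kripke_structure K \<Longrightarrow>
      X \<subseteq> states K \<Longrightarrow> word_sem K ?ws X = word_sem K vs X"
    using short_word[of ?ws] by blast
  have "truth K (Quant Q t \<phi>) = normal_sem K (vs, p) (truth K (core \<phi>))"
    if K: "kripke_structure K" for K :: "('q, 'p) kripke"
  proof -
    have "truth K (Quant Q t \<phi>) = word_sem K ?ws (if p then truth K (core \<phi>) else states K - truth K (core \<phi>))"
      using x(2) K by (cases t) (simp_all add: b truth_simps[OF K] normal_sem_def)
    then show ?thesis using vs(2)[OF K] truth_states[of K "core \<phi>"] by (simp add: normal_sem_def del: word_sem.simps)
  qed
  then show ?case using vs(1) by (intro bexI[of _ "(vs, p)"]) (auto simp: normals_def)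
next
  case (Atom p)
  show ?case by (rule bexI[of _ "([], True)"]) (simp_all add: normals_def normal_sem_def)
next
  case (Bin c \<phi> \<psi>)
  show ?case by (rule bexI[of _ "([], True)"]) (simp_all add: normals_def normal_sem_def)
qed

section \<open>Solutions of bounded size\<close>

lemma finite_subformulas [simp]: "finite (subformulas \<phi>)"
  by (induction \<phi>) auto

lemma subformulas_self [simp]: "\<phi> \<in> subformulas \<phi>"
  by (cases \<phi>) auto

lemma subformulas_trans: "\<psi> \<in> subformulas \<phi> \<Longrightarrow> subformulas \<psi> \<subseteq> subformulas \<phi>"
  by (induction \<phi>) auto

lemma subformula_size: "\<psi> \<in> subformulas \<phi> \<Longrightarrow> \<psi> = \<phi> \<or> size \<psi> < size \<phi>"
  by (induction \<phi>) auto

lemma subformulas_antisym: "\<psi> \<in> subformulas \<phi> \<Longrightarrow> \<phi> \<in> subformulas \<psi> \<Longrightarrow> \<psi> = \<phi>"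
  by (metis less_asym subformula_size)

definition is_bin :: "'p ctl \<Rightarrow> bool" where
  "is_bin \<phi> \<longleftrightarrow> (\<exists>b \<psi>1 \<psi>2. \<phi> = Bin b \<psi>1 \<psi>2)"

lemma is_bin_simps [simp]:
  "\<not> is_bin (Atom p)" "\<not> is_bin (Neg \<phi>)" "is_bin (Bin b \<phi> \<psi>)" "\<not> is_bin (Quant Q t \<phi>)"
  by (auto simp: is_bin_def)

lemma ctl_bin_size_alt: "ctl_bin_size \<phi> = card {\<psi> \<in> subformulas \<phi>. is_bin \<psi>}"
  by (simp add: ctl_bin_size_def is_bin_def)

text \<open>Outermost occurrences of \<open>y\<close> are replaced, and the inserted
  \<open>x\<close> is not searched again.\<close>

primrec repl :: "'p ctl \<Rightarrow> 'p ctl \<Rightarrow> 'p ctl \<Rightarrow> 'p ctl" where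
  "repl y x (Atom p) = (if Atom p = y then x else Atom p)"
| "repl y x (Neg \<phi>) = (if Neg \<phi> = y then x else Neg (repl y x \<phi>))"
| "repl y x (Bin b \<phi> \<psi>) = (if Bin b \<phi> \<psi> = y then x else Bin b (repl y x \<phi>) (repl y x \<psi>))"
| "repl y x (Quant Q t \<phi>) = (if Quant Q t \<phi> = y then x else Quant Q t (repl y x \<phi>))"

lemma repl_same: "y \<notin> subformulas \<phi> \<Longrightarrow> repl y x \<phi> = \<phi>"
  by (induction \<phi>) auto

lemma is_bin_repl: "\<phi> \<noteq> y \<Longrightarrow> is_bin (repl y x \<phi>) \<longleftrightarrow> is_bin \<phi>"
  by (cases \<phi>) auto

lemma fragment_repl: "fragment AP Ut Bl \<phi> \<Longrightarrow> fragment AP Ut Bl x \<Longrightarrow> fragment AP Ut Bl (repl y x \<phi>)"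
  by (induction \<phi>) auto

lemma fragment_subformula: "fragment AP Ut Bl \<phi> \<Longrightarrow> \<psi> \<in> subformulas \<phi> \<Longrightarrow> fragment AP Ut Bl \<psi>"
  by (induction \<phi>) auto

lemma subformulas_repl: "subformulas (repl y x \<phi>) \<subseteq> repl y x ` (subformulas \<phi> - {y}) \<union> subformulas x"
proof (induction \<phi>)
  case (Atom p)
  show ?case by simp
next
  case (Neg \<phi>)
  show ?case
  proof (cases "Neg \<phi> = y")
    case True
    have "repl y x (Neg \<phi>) = x" unfolding repl.simps using True by (rule if_P)
    then show ?thesis by (simp only: Un_upper2)
  next
    case False
    then have "repl y x (Neg \<phi>) \<in> repl y x ` (subformulas (Neg \<phi>) - {y})" by (intro imageI) simp
    then show ?thesis using Neg False by auto
  qed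
next
  case (Bin b \<phi> \<psi>)
  show ?case
  proof (cases "Bin b \<phi> \<psi> = y")
    case True
    have "repl y x (Bin b \<phi> \<psi>) = x" unfolding repl.simps using True by (rule if_P)
    then show ?thesis by (simp only: Un_upper2)
  next
    case False
    then have "repl y x (Bin b \<phi> \<psi>) \<in> repl y x ` (subformulas (Bin b \<phi> \<psi>) - {y})" by (intro imageI) simp
    then show ?thesis using Bin False by auto
  qed
next
  case (Quant Q t \<phi>)
  show ?case
  proof (cases "Quant Q t \<phi> = y")
    case True
    have "repl y x (Quant Q t \<phi>) = x" unfolding repl.simps using True by (rule if_P)
    then show ?thesis by (simp only: Un_upper2)
  next
    case False
    then have "repl y x (Quant Q t \<phi>) \<in> repl y x ` (subformulas (Quant Q t \<phi>) - {y})" by (intro imageI) simp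
    then show ?thesis using Quant False by auto
  qed
qed

lemma truth_repl:
  assumes K: "kripke_structure K" and eq: "truth K x = truth K y"
  shows "truth K (repl y x \<phi>) = truth K \<phi>"
proof (induction \<phi>)
  case (Quant Q t \<phi>)
  obtain b where "Q = quant b" using quant_surj by blast
  then show ?case using Quant eq by (cases t) (auto simp: truth_simps[OF K])
qed (use eq in \<open>auto simp: truth_simps[OF K]\<close>)

lemma models_truth: "kripke_structure K \<Longrightarrow> models K \<phi> \<longleftrightarrow> init K \<subseteq> truth K \<phi>"
  by (auto simp: models_def truth_def kripke_structure_def)

text \<open>Each subformula of the result is the image of a subformula other than \<open>y\<close>,
  so at least one is lost; binary ones come from binary ones.\<close>

lemma repl_smaller:
  assumes x: "x \<in> subformulas \<phi>" and y: "y \<in> subformulas \<phi>" and "x \<noteq> y" and n: "y \<notin> subformulas x"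
  shows "ctl_size (repl y x \<phi>) < ctl_size \<phi>" and "ctl_bin_size (repl y x \<phi>) \<le> ctl_bin_size \<phi>"
proof -
  have "subformulas x \<subseteq> repl y x ` (subformulas \<phi> - {y})"
  proof
    fix z assume z: "z \<in> subformulas x"
    then have "y \<notin> subformulas z" using n subformulas_trans by blast
    \<comment> \<open>As \<open>y\<close> does not occur in \<open>z\<close>, replacement fixes
      \<open>z\<close>; thus the subformulas of \<open>x\<close> are images too and do not add to
      the count.\<close>
    then have "z = repl y x z" "z \<noteq> y" by (auto simp: repl_same)
    then show "z \<in> repl y x ` (subformulas \<phi> - {y})" using z subformulas_trans[OF x] by blast
  qed
  then have sub: "subformulas (repl y x \<phi>) \<subseteq> repl y x ` (subformulas \<phi> - {y})"
    using subformulas_repl by blast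
  have "ctl_size (repl y x \<phi>) \<le> card (subformulas \<phi> - {y})"
    unfolding ctl_size_def using sub by (intro surj_card_le) auto
  also have "\<dots> < ctl_size \<phi>"
    unfolding ctl_size_def by (intro psubset_card_mono) (use y in auto)
  finally show "ctl_size (repl y x \<phi>) < ctl_size \<phi>" .
  have "{\<psi> \<in> subformulas (repl y x \<phi>). is_bin \<psi>} \<subseteq> repl y x ` {\<psi> \<in> subformulas \<phi>. is_bin \<psi>}"
    using sub is_bin_repl by blast
  then show "ctl_bin_size (repl y x \<phi>) \<le> ctl_bin_size \<phi>"
    unfolding ctl_bin_size_alt by (intro surj_card_le) auto
qed

section \<open>Size of formulas without equivalent subformulas\<close>

definition atom_subs :: "'p ctl \<Rightarrow> 'p ctl set" where
  "atom_subs \<phi> = {\<psi> \<in> subformulas \<phi>. \<exists>p. \<psi> = Atom p}"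

text \<open>A binary formula is not among the subformulas of its operands, so these have fewer
  binary subformulas, and the number of atoms at most doubles.\<close>

lemma card_atoms: "card (atom_subs \<phi>) \<le> 2 ^ ctl_bin_size \<phi>"
proof (induction \<phi>)
  case (Atom p)
  have "atom_subs (Atom p) = {Atom p}" by (auto simp: atom_subs_def)
  then show ?case by simp
next
  case (Neg \<phi>)
  have "atom_subs (Neg \<phi>) = atom_subs \<phi>" "ctl_bin_size (Neg \<phi>) = ctl_bin_size \<phi>"
    by (auto simp: atom_subs_def ctl_bin_size_def intro!: arg_cong[where f = card])
  then show ?case using Neg by simp
next
  case (Quant Q t \<phi>)
  have "atom_subs (Quant Q t \<phi>) = atom_subs \<phi>" "ctl_bin_size (Quant Q t \<phi>) = ctl_bin_size \<phi>"
    by (auto simp: atom_subs_def ctl_bin_size_def intro!: arg_cong[where f = card])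
  then show ?case using Quant by simp
next
  case (Bin b \<phi> \<psi>)
  let ?B = "\<lambda>\<phi>. {\<chi> \<in> subformulas \<phi>. is_bin \<chi>}"
  let ?\<chi> = "Bin b \<phi> \<psi>"
  have "?\<chi> \<notin> subformulas \<phi>" "?\<chi> \<notin> subformulas \<psi>"
    using subformula_size[of ?\<chi> \<phi>] subformula_size[of ?\<chi> \<psi>] by auto
  then have "card (insert ?\<chi> (?B \<phi>)) = Suc (ctl_bin_size \<phi>)" "card (insert ?\<chi> (?B \<psi>)) = Suc (ctl_bin_size \<psi>)"
    by (simp_all add: ctl_bin_size_alt)
  moreover have "card (insert ?\<chi> (?B \<phi>)) \<le> ctl_bin_size ?\<chi>" "card (insert ?\<chi> (?B \<psi>)) \<le> ctl_bin_size ?\<chi>"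
    unfolding ctl_bin_size_alt by (intro card_mono; auto)+
  ultimately have s: "Suc (ctl_bin_size \<phi>) \<le> ctl_bin_size ?\<chi>" "Suc (ctl_bin_size \<psi>) \<le> ctl_bin_size ?\<chi>"
    by simp_all
  obtain m where m: "ctl_bin_size ?\<chi> = Suc m" using s(1) by (cases "ctl_bin_size ?\<chi>") auto
  have "atom_subs ?\<chi> = atom_subs \<phi> \<union> atom_subs \<psi>" by (auto simp: atom_subs_def)
  then have "card (atom_subs ?\<chi>) \<le> card (atom_subs \<phi>) + card (atom_subs \<psi>)" by (simp add: card_Un_le)
  also have "\<dots> \<le> 2 ^ ctl_bin_size \<phi> + 2 ^ ctl_bin_size \<psi>" using Bin by simp
  also have "\<dots> \<le> 2 ^ m + 2 ^ m" using s m by (intro add_mono power_increasing) auto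
  finally show ?case by (simp add: m)
qed

text \<open>With at most \<open>n\<close> binary subformulas there are at most \<open>2 ^ n\<close>
  atoms, hence \<open>2 ^ n + n\<close> possible cores, each below at most
  \<open>card normals\<close> inequivalent prefixes.\<close>

definition size_limit :: "nat \<Rightarrow> nat" where
  "size_limit n = (2 ^ n + n) * card normals"

text \<open>Core and normal form determine the truth sets of a subformula; if distinct subformulas
  are told apart by some structure, this pair identifies the subformula.\<close>

lemma ctl_size_le_limit:
  fixes Ks :: "('q, 'p) kripke set" and \<phi> :: "'p ctl"
  assumes K: "\<And>K. K \<in> Ks \<Longrightarrow> kripke_structure K"
    and ineq: "\<And>x y. x \<in> subformulas \<phi> \<Longrightarrow> y \<in> subformulas \<phi> \<Longrightarrow> x \<noteq> y \<Longrightarrow> \<exists>K \<in> Ks. truth K x \<noteq> truth K y"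
    and n: "ctl_bin_size \<phi> \<le> n"
  shows "ctl_size \<phi> \<le> size_limit n"
proof -
  have "\<forall>\<psi> :: 'p ctl. \<exists>x. x \<in> normals \<and> (\<forall>K :: ('q, 'p) kripke. kripke_structure K \<longrightarrow>
      truth K \<psi> = normal_sem K x (truth K (core \<psi>)))"
    using normal_form by blast
  then obtain nf where nf: "\<And>\<psi> :: 'p ctl. nf \<psi> \<in> normals" "\<And>\<psi> (K :: ('q, 'p) kripke). kripke_structure K \<Longrightarrow>
      truth K \<psi> = normal_sem K (nf \<psi>) (truth K (core \<psi>))"
    by metis
  let ?C = "atom_subs \<phi> \<union> {\<psi> \<in> subformulas \<phi>. is_bin \<psi>}"
  let ?f = "\<lambda>\<psi>. (core \<psi>, nf \<psi>)"
  have "inj_on ?f (subformulas \<phi>)"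
  proof (rule inj_onI)
    fix x y assume xy: "x \<in> subformulas \<phi>" "y \<in> subformulas \<phi>" "?f x = ?f y"
    then have "truth K x = truth K y" if "K \<in> Ks" for K
      using nf(2)[OF K[OF that], of x] nf(2)[OF K[OF that], of y] by simp
    then show "x = y" using ineq xy by blast
  qed
  moreover have "?f ` subformulas \<phi> \<subseteq> ?C \<times> normals"
  proof
    fix y assume "y \<in> ?f ` subformulas \<phi>"
    then obtain \<psi> where \<psi>: "\<psi> \<in> subformulas \<phi>" "y = ?f \<psi>" by blast
    have "core \<psi> \<in> subformulas \<phi>" using core_subformula subformulas_trans[OF \<psi>(1)] by blast
    then show "y \<in> ?C \<times> normals" using core_cases[of \<psi>] nf(1) \<psi>(2) by (auto simp: atom_subs_def is_bin_def)
  qed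
  ultimately have "ctl_size \<phi> \<le> card (?C \<times> normals)"
    unfolding ctl_size_def
    by (intro card_inj_on_le) (auto simp: finite_normals atom_subs_def)
  also have "\<dots> = card ?C * card normals" by (rule card_cartesian_product)
  also have "card ?C \<le> card (atom_subs \<phi>) + ctl_bin_size \<phi>"
    unfolding ctl_bin_size_alt by (rule card_Un_le)
  also have "\<dots> \<le> 2 ^ n + n"
    using card_atoms[of \<phi>] n power_increasing[of "ctl_bin_size \<phi>" n "2 :: nat"] by linarith
  finally show ?thesis by (simp add: size_limit_def)
qed

text \<open>Equivalence is only required on the given structures. Each replacement strictly lowers
  the size, so the process ends and the original bound \<open>B\<close> is kept.\<close>

lemma small_solution:
  assumes Ks: "\<And>K. K \<in> Ps \<union> Ns \<Longrightarrow> kripke_structure K"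
    and sol: "fragment AP Ut Bl \<phi>" "ctl_size \<phi> \<le> B" "ctl_bin_size \<phi> \<le> n"
      "\<forall>K \<in> Ps. models K \<phi>" "\<forall>K \<in> Ns. \<not> models K \<phi>"
  shows "\<exists>\<psi>. fragment AP Ut Bl \<psi> \<and> ctl_size \<psi> \<le> B \<and> ctl_size \<psi> \<le> size_limit n \<and> ctl_bin_size \<psi> \<le> n \<and>
    (\<forall>K \<in> Ps. models K \<psi>) \<and> (\<forall>K \<in> Ns. \<not> models K \<psi>)"
  using sol
proof (induction "ctl_size \<phi>" arbitrary: \<phi> rule: less_induct)
  case less
  show ?case
  proof (cases "\<exists>x y. x \<in> subformulas \<phi> \<and> y \<in> subformulas \<phi> \<and> x \<noteq> y \<and> (\<forall>K \<in> Ps \<union> Ns. truth K x = truth K y)")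
    case True
    then obtain u v where uv: "u \<in> subformulas \<phi>" "v \<in> subformulas \<phi>" "u \<noteq> v"
      "\<forall>K \<in> Ps \<union> Ns. truth K u = truth K v" by blast
    \<comment> \<open>Two distinct formulas cannot contain each other, so the replacement can be
      oriented towards one that does not contain the other.\<close>
    have "\<exists>x y. x \<in> subformulas \<phi> \<and> y \<in> subformulas \<phi> \<and> x \<noteq> y \<and> y \<notin> subformulas x \<and>
        (\<forall>K \<in> Ps \<union> Ns. truth K x = truth K y)"
    proof (cases "v \<in> subformulas u")
      case True
      then have "u \<notin> subformulas v" using subformulas_antisym uv(3) by blast
      then show ?thesis using uv by (intro exI[of _ v] exI[of _ u]) auto
    next
      case False
      then show ?thesis using uv by (intro exI[of _ u] exI[of _ v]) auto
    qed
    then obtain x y where xy: "x \<in> subformulas \<phi>" "y \<in> subformulas \<phi>" "x \<noteq> y" "y \<notin> subformulas x"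
      "\<forall>K \<in> Ps \<union> Ns. truth K x = truth K y"
      by blast
    have "truth K (repl y x \<phi>) = truth K \<phi>" if "K \<in> Ps \<union> Ns" for K
      using truth_repl[OF Ks[OF that]] xy(5) that by blast
    then have m: "models K (repl y x \<phi>) \<longleftrightarrow> models K \<phi>" if "K \<in> Ps \<union> Ns" for K
      using models_truth[OF Ks[OF that]] that by simp
    note small = repl_smaller[OF xy(1-4)]
    show ?thesis
    proof (rule less.hyps[OF small(1)])
      show "fragment AP Ut Bl (repl y x \<phi>)"
        by (rule fragment_repl[OF less.prems(1) fragment_subformula[OF less.prems(1) xy(1)]])
    qed (use small less.prems m in auto)
  next
    case False
    then have "ctl_size \<phi> \<le> size_limit n"
      using less.prems(3) Ks by (intro ctl_size_le_limit[of "Ps \<union> Ns"]) blast+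
    then show ?thesis using less.prems by blast
  qed
qed

subsection \<open>Shapes\<close>

text \<open>A shape is a formula whose atoms stand for propositions still to be chosen.\<close>

definition shapes :: "unop set \<Rightarrow> binop set \<Rightarrow> nat \<Rightarrow> nat ctl set" where
  "shapes Ut Bl n = {\<phi>. fragment {..<size_limit n} Ut Bl \<phi> \<and> ctl_size \<phi> \<le> size_limit n \<and> ctl_bin_size \<phi> \<le> n}"

text \<open>A measure that decreases along the syntax tree. Size counts shared subformulas once, but
  it still bounds the depth, and this makes the set of shapes finite.\<close>

primrec depth :: "'p ctl \<Rightarrow> nat" where
  "depth (Atom p) = 0"
| "depth (Neg \<phi>) = Suc (depth \<phi>)"
| "depth (Bin b \<phi> \<psi>) = Suc (max (depth \<phi>) (depth \<psi>))"
| "depth (Quant Q t \<phi>) = Suc (depth \<phi>)"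

lemma card_insert_subformulas:
  "size \<phi> < size \<psi> \<Longrightarrow> insert \<psi> (subformulas \<phi>) \<subseteq> subformulas \<psi> \<Longrightarrow> Suc (ctl_size \<phi>) \<le> ctl_size \<psi>"
proof -
  assume *: "size \<phi> < size \<psi>" "insert \<psi> (subformulas \<phi>) \<subseteq> subformulas \<psi>"
  then have "\<psi> \<notin> subformulas \<phi>" using subformula_size by fastforce
  then have "Suc (ctl_size \<phi>) = card (insert \<psi> (subformulas \<phi>))" by (simp add: ctl_size_def)
  also have "\<dots> \<le> ctl_size \<psi>" unfolding ctl_size_def by (rule card_mono[OF _ *(2)]) simp
  finally show ?thesis .
qed

lemma depth_le_size: "depth \<phi> \<le> ctl_size \<phi>"
proof (induction \<phi>)
  case (Neg \<phi>)
  then show ?case using card_insert_subformulas[of \<phi> "Neg \<phi>"] by auto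
next
  case (Quant Q t \<phi>)
  then show ?case using card_insert_subformulas[of \<phi> "Quant Q t \<phi>"] by auto
next
  case (Bin b \<phi> \<psi>)
  have "Suc (ctl_size \<phi>) \<le> ctl_size (Bin b \<phi> \<psi>)" "Suc (ctl_size \<psi>) \<le> ctl_size (Bin b \<phi> \<psi>)"
    by (rule card_insert_subformulas; auto)+
  then show ?case using Bin by simp
qed simp

lemma finite_binop: "finite (UNIV :: binop set)"
proof -
  have "c \<in> {Disj, Conj, Implies, ImpliedBy, Iff}" for c by (cases c) auto
  then have "(UNIV :: conn set) = {Disj, Conj, Implies, ImpliedBy, Iff}" by auto
  then have "finite (UNIV :: conn set)" by (metis finite.emptyI finite.insertI)
  moreover have "b \<in> range Plain \<union> range Negated" for b by (cases b) auto
  then have "(UNIV :: binop set) = range Plain \<union> range Negated" by auto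
  ultimately show ?thesis by (metis finite_Un finite_imageI)
qed

lemma finite_depth: "finite A \<Longrightarrow> finite {\<phi>. fragment A Ut Bl \<phi> \<and> depth \<phi> \<le> d}"
proof (induction d)
  case 0
  have "{\<phi>. fragment A Ut Bl \<phi> \<and> depth \<phi> \<le> 0} \<subseteq> Atom ` A"
  proof
    fix \<phi> :: "'a ctl" assume "\<phi> \<in> {\<phi>. fragment A Ut Bl \<phi> \<and> depth \<phi> \<le> 0}"
    then show "\<phi> \<in> Atom ` A" by (cases \<phi>) auto
  qed
  then show ?case using 0 finite_surj by blast
next
  case (Suc d)
  let ?S = "{\<phi>. fragment A Ut Bl \<phi> \<and> depth \<phi> \<le> d}"
  let ?Q = "{quant True, quant False} \<times> {Eventually, Globally}"
  have "{\<phi>. fragment A Ut Bl \<phi> \<and> depth \<phi> \<le> Suc d} \<subseteq> Atom ` A \<union> Neg ` ?S \<union>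
      (\<lambda>(b, \<phi>, \<psi>). Bin b \<phi> \<psi>) ` (UNIV \<times> ?S \<times> ?S) \<union> (\<lambda>((Q, t), \<phi>). Quant Q t \<phi>) ` (?Q \<times> ?S)"
  proof
    fix \<phi> assume "\<phi> \<in> {\<phi>. fragment A Ut Bl \<phi> \<and> depth \<phi> \<le> Suc d}"
    then show "\<phi> \<in> Atom ` A \<union> Neg ` ?S \<union>
      (\<lambda>(b, \<phi>, \<psi>). Bin b \<phi> \<psi>) ` (UNIV \<times> ?S \<times> ?S) \<union> (\<lambda>((Q, t), \<phi>). Quant Q t \<phi>) ` (?Q \<times> ?S)"
    proof (cases \<phi>)
      case (Quant Q t \<psi>)
      moreover have "Q \<in> {quant True, quant False}" by (cases Q) (auto simp: quant_def)
      moreover have "t \<in> {Eventually, Globally}" by (cases t) auto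
      ultimately show ?thesis using \<open>\<phi> \<in> _\<close>
        by (intro UnI2 image_eqI[of _ _ "((Q, t), \<psi>)"]) auto
    qed (force simp: image_iff)+
  qed
  moreover have "finite \<dots>" using Suc finite_binop by (intro finite_UnI finite_imageI finite_cartesian_product) auto
  ultimately show ?case by (rule finite_subset)
qed

lemma finite_shapes: "finite (shapes Ut Bl n)"
  by (rule finite_subset[OF _ finite_depth[of "{..<size_limit n}" Ut Bl "size_limit n"]])
    (auto simp: shapes_def intro: order_trans[OF depth_le_size])

lemma subformulas_map: "subformulas (map_ctl f \<phi>) = map_ctl f ` subformulas \<phi>"
  by (induction \<phi>) auto

lemma is_bin_map: "is_bin (map_ctl f \<phi>) \<longleftrightarrow> is_bin \<phi>"
  by (cases \<phi>) auto

lemma size_map: "ctl_size (map_ctl f \<phi>) \<le> ctl_size \<phi>" "ctl_bin_size (map_ctl f \<phi>) \<le> ctl_bin_size \<phi>"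
proof -
  show "ctl_size (map_ctl f \<phi>) \<le> ctl_size \<phi>"
    unfolding ctl_size_def subformulas_map by (rule card_image_le) simp
  have "{\<psi> \<in> subformulas (map_ctl f \<phi>). is_bin \<psi>} = map_ctl f ` {\<psi> \<in> subformulas \<phi>. is_bin \<psi>}"
    using is_bin_map[of f] by (auto simp: subformulas_map)
  then show "ctl_bin_size (map_ctl f \<phi>) \<le> ctl_bin_size \<phi>"
    unfolding ctl_bin_size_alt by (simp add: card_image_le)
qed

lemma fragment_map: "fragment A Ut Bl \<phi> \<Longrightarrow> f ` A \<subseteq> AP \<Longrightarrow> fragment AP Ut Bl (map_ctl f \<phi>)"
  by (induction \<phi>) auto

lemma fragment_set: "fragment A Ut Bl \<phi> \<longleftrightarrow> fragment UNIV Ut Bl \<phi> \<and> set_ctl \<phi> \<subseteq> A"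
  by (induction \<phi>) auto

lemma set_ctl_subformulas: "Atom ` set_ctl \<phi> \<subseteq> subformulas \<phi>"
  by (induction \<phi>) auto

lemma set_ctl_nonempty: "set_ctl \<phi> \<noteq> {}"
  by (induction \<phi>) auto

text \<open>A small solution has at most \<open>size_limit n\<close> atoms, which are renamed to
  numbers below that limit, with \<open>f\<close> undoing the renaming. In the other direction
  \<open>f\<close> may identify atoms, which can only lower the sizes.\<close>

lemma learnable_iff_shapes:
  assumes Ks: "\<And>K. K \<in> Ps \<union> Ns \<Longrightarrow> kripke_structure K"
  shows "learnable Ut Bl n {..<m} Ps Ns B \<longleftrightarrow>
    (\<exists>\<phi> \<in> shapes Ut Bl n. \<exists>f. (\<forall>i < size_limit n. f i < m) \<and> ctl_size \<phi> \<le> B \<and>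
       (\<forall>K \<in> Ps. models K (map_ctl f \<phi>)) \<and> (\<forall>K \<in> Ns. \<not> models K (map_ctl f \<phi>)))"
proof
  assume "learnable Ut Bl n {..<m} Ps Ns B"
  then obtain \<phi>0 where "fragment {..<m} Ut Bl \<phi>0" "ctl_size \<phi>0 \<le> B" "ctl_bin_size \<phi>0 \<le> n"
    "\<forall>K \<in> Ps. models K \<phi>0" "\<forall>K \<in> Ns. \<not> models K \<phi>0" by (auto simp: learnable_def)
  from small_solution[OF Ks this] obtain \<phi> where \<phi>: "fragment {..<m} Ut Bl \<phi>" "ctl_size \<phi> \<le> B"
    "ctl_size \<phi> \<le> size_limit n" "ctl_bin_size \<phi> \<le> n" "\<forall>K \<in> Ps. models K \<phi>" "\<forall>K \<in> Ns. \<not> models K \<phi>" by blast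
  let ?A = "set_ctl \<phi>"
  have fin: "finite ?A" using finite_subset[OF set_ctl_subformulas] by (rule finite_imageD) (auto simp: inj_on_def)
  have "card ?A = card (Atom ` ?A)" by (rule card_image[symmetric]) (auto simp: inj_on_def)
  also have "\<dots> \<le> ctl_size \<phi>" unfolding ctl_size_def by (rule card_mono[OF _ set_ctl_subformulas]) simp
  finally have c: "card ?A \<le> size_limit n" using \<phi>(3) by simp
  obtain h where h: "bij_betw h ?A {0..<card ?A}" using ex_bij_betw_finite_nat[OF fin] by blast
  obtain p0 where p0: "p0 \<in> ?A" using set_ctl_nonempty[of \<phi>] by blast
  \<comment> \<open>The default \<open>p0\<close> is an atom of the formula, so \<open>f\<close>
    takes values below \<open>m\<close> on all indices.\<close>
  define f where "f i = (if i < card ?A then inv_into ?A h i else p0)" for i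
  have fh: "f (h p) = p" if "p \<in> ?A" for p
    using h that by (auto simp: f_def bij_betw_def)
  have fA: "f i \<in> ?A" for i
    using h p0 by (auto simp: f_def bij_betw_def intro!: inv_into_into)
  have "map_ctl f (map_ctl h \<phi>) = map_ctl (\<lambda>p. p) \<phi>"
    unfolding ctl.map_comp by (rule ctl.map_cong0) (simp add: fh)
  then have inverse: "map_ctl f (map_ctl h \<phi>) = \<phi>" by (simp add: ctl.map_ident)
  have Am: "?A \<subseteq> {..<m}" "fragment UNIV Ut Bl \<phi>"
    using \<phi>(1) unfolding fragment_set[of "{..<m}"] by simp_all
  then have "fragment ?A Ut Bl \<phi>" unfolding fragment_set[of ?A] by simp
  then have "fragment {..<size_limit n} Ut Bl (map_ctl h \<phi>)"
    by (rule fragment_map) (use h c in \<open>auto simp: bij_betw_def\<close>)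
  then have "map_ctl h \<phi> \<in> shapes Ut Bl n"
    using \<phi> size_map[of h \<phi>] by (auto simp: shapes_def)
  moreover have "\<forall>i < size_limit n. f i < m" using fA Am by auto
  moreover have "ctl_size (map_ctl h \<phi>) \<le> B" using size_map(1)[of h \<phi>] \<phi>(2) by simp
  ultimately show "\<exists>\<phi> \<in> shapes Ut Bl n. \<exists>f. (\<forall>i < size_limit n. f i < m) \<and> ctl_size \<phi> \<le> B \<and>
       (\<forall>K \<in> Ps. models K (map_ctl f \<phi>)) \<and> (\<forall>K \<in> Ns. \<not> models K (map_ctl f \<phi>))"
    using \<phi>(5,6) inverse by (intro bexI[of _ "map_ctl h \<phi>"] exI[of _ f]) simp_all
next
  assume "\<exists>\<phi> \<in> shapes Ut Bl n. \<exists>f. (\<forall>i < size_limit n. f i < m) \<and> ctl_size \<phi> \<le> B \<and>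
       (\<forall>K \<in> Ps. models K (map_ctl f \<phi>)) \<and> (\<forall>K \<in> Ns. \<not> models K (map_ctl f \<phi>))"
  then obtain \<phi> f where "fragment {..<size_limit n} Ut Bl \<phi>" "ctl_bin_size \<phi> \<le> n"
    "\<forall>i < size_limit n. f i < m" "ctl_size \<phi> \<le> B"
    "\<forall>K \<in> Ps. models K (map_ctl f \<phi>)" "\<forall>K \<in> Ns. \<not> models K (map_ctl f \<phi>)"
    by (auto simp: shapes_def)
  then show "learnable Ut Bl n {..<m} Ps Ns B"
    unfolding learnable_def using size_map[of f \<phi>] fragment_map[of "{..<size_limit n}" Ut Bl \<phi> f "{..<m}"]
    by (intro exI[of _ "map_ctl f \<phi>"]) auto
qed

section \<open>Parsing inputs\<close>

definition occ :: "bool list \<Rightarrow> nat \<Rightarrow> bool list \<Rightarrow> nat \<Rightarrow> bool" where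
  "occ w s e t \<longleftrightarrow> (\<exists>xs ys. w = xs @ e @ ys \<and> length xs = s \<and> t = s + length e)"

lemma occ_append: "occ w s (e1 @ e2) t \<longleftrightarrow> (\<exists>u. occ w s e1 u \<and> occ w u e2 t)"
proof
  assume "occ w s (e1 @ e2) t"
  then obtain xs ys where "w = xs @ (e1 @ e2) @ ys" "length xs = s" "t = s + length (e1 @ e2)"
    by (auto simp: occ_def)
  then have "occ w s e1 (s + length e1)" "occ w (s + length e1) e2 t"
    unfolding occ_def by (auto intro: exI[of _ xs] exI[of _ "xs @ e1"])
  then show "\<exists>u. occ w s e1 u \<and> occ w u e2 t" by blast
next
  assume "\<exists>u. occ w s e1 u \<and> occ w u e2 t"
  then obtain u xs ys xs' ys' where 1: "w = xs @ e1 @ ys" "length xs = s" "u = s + length e1"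
    and 2: "w = xs' @ e2 @ ys'" "length xs' = u" "t = u + length e2"
    unfolding occ_def by blast
  have "(xs @ e1) @ ys = xs' @ e2 @ ys'" "length (xs @ e1) = length xs'" using 1 2 by auto
  then have "ys = e2 @ ys'" by (metis append_eq_append_conv)
  then show "occ w s (e1 @ e2) t" using 1 2 unfolding occ_def by (intro exI[of _ xs] exI[of _ ys']) auto
qed

lemma occ_all: "occ w 0 e (length w) \<longleftrightarrow> w = e"
  by (auto simp: occ_def)

lemma occ_nth:
  "occ w s e t \<longleftrightarrow> t = s + length e \<and> t \<le> length w \<and> (\<forall>i < length e. w ! (s + i) = e ! i)"
proof
  assume r: "t = s + length e \<and> t \<le> length w \<and> (\<forall>i < length e. w ! (s + i) = e ! i)"
  then have "e = take (length e) (drop s w)" by (intro nth_equalityI) auto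
  then have "w = take s w @ e @ drop (length e) (drop s w)" by (metis append_take_drop_id)
  then show "occ w s e t" using r unfolding occ_def
    by (intro exI[of _ "take s w"] exI[of _ "drop (length e) (drop s w)"]) auto
qed (auto simp: occ_def nth_append)

lemma occ_nil: "occ w s [] t \<longleftrightarrow> t = s \<and> s \<le> length w"
  unfolding occ_nth by auto

definition bit :: "bool list \<Rightarrow> nat \<Rightarrow> bool" where
  "bit w i \<longleftrightarrow> i < length w \<and> w ! i"

definition header :: "bool list \<Rightarrow> nat \<Rightarrow> nat \<Rightarrow> bool" where
  "header w s k \<longleftrightarrow> (\<forall>i < k. bit w (s + i)) \<and> s + k < length w \<and> \<not> bit w (s + k)"

lemma occ_unary: "occ w s (unary k) t \<longleftrightarrow> header w s k \<and> t = s + k + 1"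
proof -
  have "(\<forall>i < length (unary k). w ! (s + i) = unary k ! i) \<longleftrightarrow> (\<forall>i < k. w ! (s + i)) \<and> \<not> w ! (s + k)"
    by (auto simp: unary_def nth_append less_Suc_eq)
  then show ?thesis unfolding occ_nth by (auto simp: header_def bit_def unary_def)
qed

text \<open>Intermediate results are required to be less than \<open>D\<close>, the range of the counters.\<close>

definition block_bit :: "nat \<Rightarrow> bool list \<Rightarrow> nat \<Rightarrow> nat \<Rightarrow> nat \<Rightarrow> nat \<Rightarrow> nat \<Rightarrow> bool" where
  "block_bit D w c m k q j \<longleftrightarrow> (\<exists>e < D. m + k = e \<and> (\<exists>d < D. d = Suc e \<and> (\<exists>g < D. q * d = g \<and>
     (\<exists>h < D. c + g = h \<and> (\<exists>x < D. h + j = x \<and> bit w x)))))"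

definition decoded :: "nat \<Rightarrow> bool list \<Rightarrow> nat \<Rightarrow> nat \<Rightarrow> nat \<Rightarrow> (nat, nat) kripke" where
  "decoded D w c m k =
     \<lparr>states = {..<k}, init = {q. q < k \<and> block_bit D w c m k q 0}, props = {..<m},
      label = \<lambda>q. {p. p < m \<and> (\<exists>j < D. j = Suc p \<and> block_bit D w c m k q j)},
      succ = \<lambda>q. {r. r < k \<and> (\<exists>e < D. m + r = e \<and> (\<exists>j < D. j = Suc e \<and> block_bit D w c m k q j))}\<rparr>"

text \<open>\<open>s\<close> and \<open>t\<close> delimit the encoding, \<open>k\<close> is the
  number of states and \<open>c\<close> the position behind the unary header; the last conjunct says
  that each state has a successor. Each intermediate value has its own bounded quantifier, so that
  the closure rules for \<open>ddec\<close> apply directly.\<close>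

definition is_structure :: "nat \<Rightarrow> bool list \<Rightarrow> nat \<Rightarrow> nat \<Rightarrow> nat \<Rightarrow> nat \<Rightarrow> nat \<Rightarrow> bool" where
  "is_structure D w m s t k c \<longleftrightarrow> header w s k \<and> (\<exists>h < D. s + k = h \<and> c = Suc h) \<and>
     (\<exists>e < D. m + k = e \<and> (\<exists>d < D. d = Suc e \<and> (\<exists>g < D. k * d = g \<and> c + g = t))) \<and>
     (\<exists>l < D. l = length w \<and> t \<le> l) \<and>
     (\<forall>q < D. \<not> q < k \<or> (\<exists>r < D. r \<in> succ (decoded D w c m k) q))"

lemma block_bit_iff:
  assumes "m + k + 1 < D" "length w < D"
  shows "block_bit D w c m k q j \<longleftrightarrow> bit w (c + q * (1 + m + k) + j)"
  unfolding block_bit_def using assms by (auto simp: bit_def add.assoc add.commute)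

lemma decoded_iff:
  assumes "m + k + 1 < D" "length w < D"
  shows "q \<in> init (decoded D w c m k) \<longleftrightarrow> q < k \<and> bit w (c + q * (1 + m + k))"
    and "p \<in> label (decoded D w c m k) q \<longleftrightarrow> p < m \<and> bit w (c + q * (1 + m + k) + (1 + p))"
    and "r \<in> succ (decoded D w c m k) q \<longleftrightarrow> r < k \<and> bit w (c + q * (1 + m + k) + (1 + m + r))"
  using assms by (auto simp: decoded_def block_bit_iff)

lemma concat_blocks:
  assumes "\<And>q. q < k \<Longrightarrow> length (f q) = d"
  shows "length (concat (map f [0..<k])) = k * d"
    and "q < k \<Longrightarrow> j < d \<Longrightarrow> concat (map f [0..<k]) ! (q * d + j) = f q ! j"
proof -
  have "length (concat (map f [0..<k])) = k * d \<and>
    (\<forall>q < k. \<forall>j < d. concat (map f [0..<k]) ! (q * d + j) = f q ! j)"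
    using assms
  proof (induction k)
    case (Suc k)
    have IH: "length (concat (map f [0..<k])) = k * d"
      "\<And>q j. q < k \<Longrightarrow> j < d \<Longrightarrow> concat (map f [0..<k]) ! (q * d + j) = f q ! j"
      using Suc by auto
    have "concat (map f [0..<Suc k]) ! (q * d + j) = f q ! j" if "q < Suc k" "j < d" for q j
    proof (cases "q = k")
      case True
      then show ?thesis using IH(1) by (simp add: nth_append)
    next
      case False
      then have "q < k" using that by simp
      then have "Suc q * d \<le> k * d" by (intro mult_le_mono1) simp
      then have "q * d + j < k * d" using that by simp
      then show ?thesis using IH \<open>q < k\<close> that by (simp add: nth_append)
    qed
    then show ?case using IH(1) Suc.prems by simp
  qed simp
  then show "length (concat (map f [0..<k])) = k * d"
    "q < k \<Longrightarrow> j < d \<Longrightarrow> concat (map f [0..<k]) ! (q * d + j) = f q ! j" by auto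
qed

lemma block_index: "i < k * d \<Longrightarrow> \<exists>q < k. \<exists>j < d. i = q * d + j" for i k d :: nat
proof -
  assume i: "i < k * d"
  then have "0 < d" by (cases d) auto
  then show ?thesis using i
    by (intro exI[of _ "i div d"] conjI exI[of _ "i mod d"]) (auto simp: less_mult_imp_div_less)
qed

lemma length_encode_state [simp]: "length (encode_state m K q) = 1 + m + card (states K)"
  by (simp add: encode_state_def)

lemma nth_encode_state:
  "encode_state m K q ! 0 \<longleftrightarrow> q \<in> init K"
  "p < m \<Longrightarrow> encode_state m K q ! (1 + p) \<longleftrightarrow> p \<in> label K q"
  "r < card (states K) \<Longrightarrow> encode_state m K q ! (1 + m + r) \<longleftrightarrow> r \<in> succ K q"
  by (simp_all add: encode_state_def nth_append)

lemma occ_states: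
  "occ w c (concat (map (encode_state m K) [0..<card (states K)])) t \<longleftrightarrow>
     t = c + card (states K) * (1 + m + card (states K)) \<and> t \<le> length w \<and>
     (\<forall>q < card (states K). \<forall>j < 1 + m + card (states K).
        bit w (c + q * (1 + m + card (states K)) + j) \<longleftrightarrow> encode_state m K q ! j)"
proof -
  let ?k = "card (states K)"
  let ?d = "1 + m + ?k"
  let ?e = "concat (map (encode_state m K) [0..<?k])"
  have len: "length ?e = ?k * ?d" by (rule concat_blocks(1)) simp
  have nth: "?e ! (q * ?d + j) = encode_state m K q ! j" if "q < ?k" "j < ?d" for q j
    by (rule concat_blocks(2)) (use that in simp_all)
  have less: "q * ?d + j < ?k * ?d" if "q < ?k" "j < ?d" for q j
  proof -
    have "Suc q * ?d \<le> ?k * ?d" using that(1) by (intro mult_le_mono1) simp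
    then show ?thesis using that(2) by simp
  qed
  have "(\<forall>i < ?k * ?d. w ! (c + i) = ?e ! i) \<longleftrightarrow>
     (\<forall>q < ?k. \<forall>j < ?d. w ! (c + q * ?d + j) = encode_state m K q ! j)"
  proof (rule iffI; intro allI impI)
    fix q j assume a: "\<forall>i < ?k * ?d. w ! (c + i) = ?e ! i" "q < ?k" "j < ?d"
    then show "w ! (c + q * ?d + j) = encode_state m K q ! j"
      using less[OF a(2,3)] nth[OF a(2,3)] by (metis add.assoc)
  next
    fix i assume a: "\<forall>q < ?k. \<forall>j < ?d. w ! (c + q * ?d + j) = encode_state m K q ! j" "i < ?k * ?d"
    then obtain q j where "q < ?k" "j < ?d" "i = q * ?d + j" using block_index by blast
    then show "w ! (c + i) = ?e ! i" using a(1) nth by (metis add.assoc)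
  qed
  moreover have "bit w (c + q * ?d + j) \<longleftrightarrow> w ! (c + q * ?d + j)"
    if "c + ?k * ?d \<le> length w" "q < ?k" "j < ?d" for q j
    using less[OF that(2,3)] that(1) by (auto simp: bit_def)
  ultimately show ?thesis unfolding occ_nth len by blast
qed

text \<open>Labels and successors are total functions, and their values outside the state set leave
  no trace in an encoding. Structures are recovered only up to this relation.\<close>

definition agree :: "('q, 'p) kripke \<Rightarrow> ('q, 'p) kripke \<Rightarrow> bool" where
  "agree K K' \<longleftrightarrow> states K = states K' \<and> init K = init K' \<and>
     (\<forall>q \<in> states K. label K q = label K' q \<and> succ K q = succ K' q)"

lemma agree_paths:
  assumes "kripke_structure K" "agree K K'" "q \<in> states K"
  shows "paths K q = paths K' q"
proof -
  have "\<rho> \<in> paths K' q \<Longrightarrow> \<rho> i \<in> states K \<and> \<rho> (Suc i) \<in> succ K (\<rho> i)" for \<rho> i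
  proof (induction i)
    case 0
    then show ?case using assms by (auto simp: paths_def agree_def)
  next
    case (Suc i)
    then have "\<rho> (Suc i) \<in> states K" using assms(1) unfolding kripke_structure_def by blast
    then show ?case using Suc.prems assms(2) by (auto simp: paths_def agree_def)
  qed
  moreover have "\<rho> (Suc i) \<in> succ K' (\<rho> i)" if "\<rho> \<in> paths K q" for \<rho> i
  proof -
    have "\<rho> i \<in> states K" using path_states[OF assms(1,3) that] .
    moreover have "\<rho> (Suc i) \<in> succ K (\<rho> i)" using that by (simp add: paths_def)
    ultimately show ?thesis using assms(2) by (simp add: agree_def)
  qed
  ultimately show ?thesis by (auto simp: paths_def)
qed

lemma agree_sat:
  assumes "kripke_structure K" "agree K K'"
  shows "q \<in> states K \<Longrightarrow> sat K \<phi> q = sat K' \<phi> q"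
proof (induction \<phi> arbitrary: q)
  case (Quant Q t \<phi>)
  have "temporal_sem t (sat K \<phi>) \<rho> = temporal_sem t (sat K' \<phi>) \<rho>" if "\<rho> \<in> paths K q" for \<rho>
    using Quant.IH path_states[OF assms(1) Quant.prems that] by (cases t) auto
  then have "quantifier_sem Q (paths K q) (temporal_sem t (sat K \<phi>)) =
      quantifier_sem Q (paths K q) (temporal_sem t (sat K' \<phi>))"
    by (rule quantifier_sem_cong)
  then show ?case by (simp only: sat.simps agree_paths[OF assms Quant.prems])
next
  case (Atom p)
  then show ?case using assms(2) by (simp add: agree_def)
qed simp_all

lemma agree_models:
  assumes "kripke_structure K" "agree K K'"
  shows "models K \<phi> = models K' \<phi>"
proof -
  have "init K = init K'" "init K \<subseteq> states K"
    using assms unfolding agree_def kripke_structure_def by blast+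
  then show ?thesis unfolding models_def using agree_sat[OF assms] by (metis subsetD)
qed

text \<open>One link of the parsing chain, from \<open>i\<close> structures read up to position
  \<open>s\<close> to \<open>j\<close> structures read up to \<open>t\<close>. Only numbers and
  positions are remembered; each structure is consulted in place on the input.\<close>

definition struct_step :: "nat \<Rightarrow> bool list \<Rightarrow> nat \<Rightarrow> ((nat, nat) kripke \<Rightarrow> bool) \<Rightarrow> nat \<Rightarrow> nat \<Rightarrow> nat \<Rightarrow> nat \<Rightarrow> bool" where
  "struct_step D w m Q i s j t \<longleftrightarrow> j = Suc i \<and>
     (\<exists>k < D. \<exists>c < D. is_structure D w m s t k c \<and> Q (decoded D w c m k))"

context
  fixes D :: nat and w :: "bool list" and m :: nat
  assumes D: "length w < D"
begin

lemma is_structure_sound: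
  assumes "is_structure D w m s t k c"
  shows "input_structure m (decoded D w c m k) \<and> occ w s (encode_structure m (decoded D w c m k)) t"
proof -
  let ?K = "decoded D w c m k"
  from assms have h: "header w s k" "c = s + k + 1" "m + k + 1 < D" "t = c + k * (1 + m + k)" "t \<le> length w"
    unfolding is_structure_def by auto
  from assms have tot: "\<forall>q < D. \<not> q < k \<or> (\<exists>r < D. r \<in> succ ?K q)"
    unfolding is_structure_def by blast
  have total: "succ ?K q \<noteq> {}" if "q < k" for q
  proof -
    have "q < D" using that h(3) by simp
    then show ?thesis using tot that by blast
  qed
  note dec = decoded_iff[OF h(3) D]
  have st: "states ?K = {..<k}" "props ?K = {..<m}" by (simp_all add: decoded_def)
  have "succ ?K q \<noteq> {} \<and> succ ?K q \<subseteq> {..<k}" if "q < k" for q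
    using total[OF that] dec(3) by blast
  moreover have "init ?K \<subseteq> {..<k}" using dec(1) by auto
  moreover have "label ?K q \<subseteq> {..<m}" for q using dec(2) by auto
  ultimately have "input_structure m ?K"
    unfolding input_structure_def kripke_structure_def st by auto
  moreover have "bit w (c + q * (1 + m + k) + j) \<longleftrightarrow> encode_state m ?K q ! j"
    if qj: "q < k" "j < 1 + m + k" for q j
  proof -
    consider "j = 0" | p where "j = 1 + p" "p < m" | r where "j = 1 + m + r" "r < k"
    proof -
      assume a: "j = 0 \<Longrightarrow> thesis" "\<And>p. j = 1 + p \<Longrightarrow> p < m \<Longrightarrow> thesis" "\<And>r. j = 1 + m + r \<Longrightarrow> r < k \<Longrightarrow> thesis"
      show thesis
        using a(1) a(2)[of "j - 1"] a(3)[of "j - 1 - m"] qj(2) by (cases "j = 0"; cases "j - 1 < m") auto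
    qed
    then show ?thesis
      using qj(1) dec nth_encode_state[where m = m and K = ?K and q = q] st(1) by cases auto
  qed
  then have "occ w c (concat (map (encode_state m ?K) [0..<card (states ?K)])) t"
    unfolding occ_states using h st by simp
  then have "occ w s (encode_structure m ?K) t"
    unfolding encode_structure_def occ_append using h(1,2) st(1) by (auto simp: occ_unary)
  ultimately show ?thesis by blast
qed

end

context
  fixes D :: nat and w :: "bool list" and m :: nat
  assumes D: "length w < D" and m: "m + 1 < D"
begin

lemma is_structure_complete:
  assumes K: "input_structure m K" and o: "occ w s (encode_structure m K) t"
  shows "\<exists>k < D. \<exists>c < D. is_structure D w m s t k c \<and> agree K (decoded D w c m k)"
proof -
  obtain k where st: "states K = {..<k}" using K by (auto simp: input_structure_def)
  then have card: "card (states K) = k" by simp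
  let ?c = "s + k + 1"
  have h: "header w s k" and os: "occ w ?c (concat (map (encode_state m K) [0..<k])) t"
  proof -
    from o obtain u where "header w s k" "u = ?c" "occ w u (concat (map (encode_state m K) [0..<k])) t"
      unfolding encode_structure_def card occ_append occ_unary by (elim exE conjE)
    then show "header w s k" "occ w ?c (concat (map (encode_state m K) [0..<k])) t" by simp_all
  qed
  have t: "t = ?c + k * (1 + m + k)" "t \<le> length w"
    and bits: "\<And>q j. q < k \<Longrightarrow> j < 1 + m + k \<Longrightarrow> bit w (?c + q * (1 + m + k) + j) \<longleftrightarrow> encode_state m K q ! j"
    using os unfolding occ_states[of w _ m K t, unfolded card] by blast+
  \<comment> \<open>With at least one state, a block of \<open>1 + m + k\<close> bits fits into the
    input; without states only the bound on \<open>m\<close> remains.\<close>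
  have "m + k + 1 < D"
  proof (cases "k = 0")
    case False
    then have "1 * (1 + m + k) \<le> k * (1 + m + k)" by (intro mult_le_mono1) simp
    also have "\<dots> \<le> t" unfolding t(1) by (rule le_add2)
    finally show ?thesis using t(2) D by simp
  qed (use m in simp)
  note dec = decoded_iff[OF this D]
  let ?K = "decoded D w ?c m k"
  have KK: "kripke_structure K" "props K = {..<m}" using K by (auto simp: input_structure_def)
  have init: "init K = init ?K"
  proof -
    have "q \<in> init K \<longleftrightarrow> q < k \<and> q \<in> init K" for q
      using KK st unfolding kripke_structure_def by auto
    then show ?thesis using dec(1)[of _ ?c] bits[of _ 0] nth_encode_state(1)[of m K]
      by (intro set_eqI) (auto simp: )
  qed
  have ls: "label K q = label ?K q \<and> succ K q = succ ?K q" if q: "q < k" for q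
  proof -
    have sub: "label K q \<subseteq> {..<m}" "succ K q \<subseteq> {..<k}"
      using KK st q unfolding kripke_structure_def by blast+
    have "p \<in> label K q \<longleftrightarrow> p \<in> label ?K q" for p
      using sub(1) dec(2)[of p ?c q] bits[OF q, of "1 + p"] nth_encode_state(2)[of p m K q] by auto
    moreover have "r \<in> succ K q \<longleftrightarrow> r \<in> succ ?K q" for r
      using sub(2) dec(3)[of r ?c q] bits[OF q, of "1 + m + r"] nth_encode_state(3)[of r K m q] card by auto
    ultimately show ?thesis by blast
  qed
  have agr: "agree K ?K"
    unfolding agree_def
  proof (intro conjI ballI)
    show "states K = states ?K" using st by (simp add: decoded_def)
  qed (use init ls st in auto)
  have "\<exists>r < D. r \<in> succ ?K q" if "q < k" for q
  proof -
    have "succ K q \<noteq> {}" "succ K q \<subseteq> {..<k}" using KK st that unfolding kripke_structure_def by blast+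
    moreover have "k < D" using \<open>m + k + 1 < D\<close> by simp
    ultimately show ?thesis using ls[OF that] by fastforce
  qed
  then have "is_structure D w m s t k ?c"
    unfolding is_structure_def using h t D \<open>m + k + 1 < D\<close> by (auto simp: header_def)
  moreover have "k < D" "?c < D" using t D \<open>m + k + 1 < D\<close> by auto
  ultimately show ?thesis using agr by blast
qed

text \<open>The property \<open>Q\<close> must respect \<open>agree\<close>, since it is evaluated
  in the decoded structure and not in the one that was encoded.\<close>

lemma chain_iff:
  assumes Q: "\<And>K K'. kripke_structure K \<Longrightarrow> agree K K' \<Longrightarrow> Q K = Q K'"
    and s: "s \<le> length w" and n: "n < D"
  shows "(rel2 D (struct_step D w m Q))\<^sup>*\<^sup>* (0, s) (n, t) \<longleftrightarrow>
    (\<exists>Ks. length Ks = n \<and> (\<forall>K \<in> set Ks. input_structure m K \<and> Q K) \<and>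
       occ w s (concat (map (encode_structure m) Ks)) t)"
proof
  have "(rel2 D (struct_step D w m Q))\<^sup>*\<^sup>* (0, s) nt \<Longrightarrow> \<exists>Ks. length Ks = fst nt \<and>
       (\<forall>K \<in> set Ks. input_structure m K \<and> Q K) \<and> occ w s (concat (map (encode_structure m) Ks)) (snd nt)" for nt
  proof (induction rule: rtranclp_induct)
    case base
    then show ?case using s by (auto simp: occ_nil)
  next
    case (step nt nt')
    obtain n t n' t' where nt: "nt = (n, t)" "nt' = (n', t')" by (cases nt; cases nt')
    from step.IH obtain Ks where Ks: "length Ks = n" "\<forall>K \<in> set Ks. input_structure m K \<and> Q K"
      "occ w s (concat (map (encode_structure m) Ks)) t" by (auto simp: nt)
    from step.hyps(2) obtain k c where kc: "n' = Suc n" "is_structure D w m t t' k c" "Q (decoded D w c m k)"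
      by (auto simp: nt rel2_def struct_step_def)
    note snd = is_structure_sound[OF D kc(2)]
    show ?case
      using Ks kc snd by (intro exI[of _ "Ks @ [decoded D w c m k]"]) (auto simp: nt occ_append)
  qed
  then show "(rel2 D (struct_step D w m Q))\<^sup>*\<^sup>* (0, s) (n, t) \<Longrightarrow>
    \<exists>Ks. length Ks = n \<and> (\<forall>K \<in> set Ks. input_structure m K \<and> Q K) \<and>
       occ w s (concat (map (encode_structure m) Ks)) t" by fastforce
next
  assume "\<exists>Ks. length Ks = n \<and> (\<forall>K \<in> set Ks. input_structure m K \<and> Q K) \<and>
       occ w s (concat (map (encode_structure m) Ks)) t"
  then obtain Ks where "length Ks = n" "\<forall>K \<in> set Ks. input_structure m K \<and> Q K"
    "occ w s (concat (map (encode_structure m) Ks)) t" by blast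
  then show "(rel2 D (struct_step D w m Q))\<^sup>*\<^sup>* (0, s) (n, t)"
    using n
  proof (induction Ks arbitrary: n t rule: rev_induct)
    case Nil
    then show ?case by (simp add: occ_nil)
  next
    case (snoc K Ks)
    then obtain u where u: "occ w s (concat (map (encode_structure m) Ks)) u" "occ w u (encode_structure m K) t"
      by (auto simp: occ_append)
    have K: "input_structure m K" "Q K" using snoc.prems by auto
    obtain k c where kc: "k < D" "c < D" "is_structure D w m u t k c" "agree K (decoded D w c m k)"
      using is_structure_complete[OF K(1) u(2)] by blast
    have "Q (decoded D w c m k)" using Q[OF _ kc(4)] K by (auto simp: input_structure_def)
    then have "struct_step D w m Q (length Ks) u n t"
      using kc snoc.prems(1) by (auto simp: struct_step_def)
    moreover have "u < D" "t < D" using u D by (auto simp: occ_nth)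
    ultimately have "rel2 D (struct_step D w m Q) (length Ks, u) (n, t)"
      using snoc.prems by (auto simp: rel2_def)
    moreover have "(rel2 D (struct_step D w m Q))\<^sup>*\<^sup>* (0, s) (length Ks, u)"
      using snoc.IH[of "length Ks" u] snoc.prems u(1) by auto
    ultimately show ?case by (rule rtranclp.rtrancl_into_rtrancl[rotated])
  qed
qed

end

section \<open>The problem as a nest of bounded existential statements\<close>

lemma encode_input_iff:
  "w = encode_input m Ps Ns B \<longleftrightarrow> (\<exists>e. header w 0 m \<and> header w (Suc m) B \<and>
     header w (Suc (Suc m + B)) (length Ps) \<and>
     occ w (Suc (Suc (Suc m + B) + length Ps)) (concat (map (encode_structure m) Ps)) e \<and>
     header w e (length Ns) \<and>
     occ w (Suc (e + length Ns)) (concat (map (encode_structure m) Ns)) (length w))"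
  unfolding occ_all[symmetric] encode_input_def encode_structures_def append_assoc occ_append occ_unary
  by auto

lemma bex_conjI: "v < D \<Longrightarrow> P v \<Longrightarrow> Q v \<Longrightarrow> \<exists>v < D. P v \<and> Q v" for v D :: nat
  by blast

text \<open>Every position and sum is named by a quantifier bounded by \<open>D\<close>, ready for
  \<open>nd_ex\<close>. The names \<open>z\<close> and \<open>l\<close> for 0 and
  \<open>length w\<close> are there because chains run between variables.\<close>

lemma CTL_Learn_iff:
  assumes D: "length w + 2 < D"
  shows "w \<in> CTL_Learn Ut Bl n \<longleftrightarrow> (\<exists>\<phi> \<in> shapes Ut Bl n. \<exists>z < D. z = 0 \<and> (\<exists>l < D. l = length w \<and>
     (\<exists>m < D. header w z m \<and> (\<exists>a < D. a = Suc m \<and> (\<exists>B < D. header w a B \<and> ctl_size \<phi> \<le> B \<and>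
     (\<exists>x < D. a + B = x \<and> (\<exists>s < D. s = Suc x \<and> (\<exists>cP < D. header w s cP \<and>
     (\<exists>y < D. s + cP = y \<and> (\<exists>t < D. t = Suc y \<and> (\<exists>e < D. (\<exists>cN < D. header w e cN \<and>
     (\<exists>v < D. e + cN = v \<and> (\<exists>u < D. u = Suc v \<and>
     (\<exists>f. (\<forall>i < size_limit n. f i < D) \<and> ((\<forall>i \<in> {..<size_limit n}. f i < m) \<and>
       (rel2 D (struct_step D w m (\<lambda>K. models K (map_ctl f \<phi>))))\<^sup>*\<^sup>* (z, t) (cP, e) \<and>
       (rel2 D (struct_step D w m (\<lambda>K. \<not> models K (map_ctl f \<phi>))))\<^sup>*\<^sup>* (z, u) (cN, l)))))))))))))))))"
    (is "_ \<longleftrightarrow> ?R")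
proof
  assume "w \<in> CTL_Learn Ut Bl n"
  then obtain m Ps Ns B where w: "w = encode_input m Ps Ns B"
    and K: "\<And>K. K \<in> set Ps \<union> set Ns \<Longrightarrow> input_structure m K"
    and l: "learnable Ut Bl n {..<m} (set Ps) (set Ns) B"
    by (auto simp: CTL_Learn_def)
  have ks: "K \<in> set Ps \<union> set Ns \<Longrightarrow> kripke_structure K" for K using K by (auto simp: input_structure_def)
  obtain \<phi> f where \<phi>: "\<phi> \<in> shapes Ut Bl n" "\<And>i. i < size_limit n \<Longrightarrow> f i < m" "ctl_size \<phi> \<le> B"
    "\<And>K. K \<in> set Ps \<Longrightarrow> models K (map_ctl f \<phi>)" "\<And>K. K \<in> set Ns \<Longrightarrow> \<not> models K (map_ctl f \<phi>)"
    using iffD1[OF learnable_iff_shapes[of "set Ps" "set Ns", OF ks] l] by blast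
  obtain e where h: "header w 0 m" "header w (Suc m) B" "header w (Suc (Suc m + B)) (length Ps)"
    "occ w (Suc (Suc (Suc m + B) + length Ps)) (concat (map (encode_structure m) Ps)) e"
    "header w e (length Ns)" "occ w (Suc (e + length Ns)) (concat (map (encode_structure m) Ns)) (length w)"
    using w unfolding encode_input_iff by blast
  have D': "length w < D" "m + 1 < D" using h(1) D by (auto simp: header_def)
  have le: "Suc (Suc (Suc m + B) + length Ps) \<le> length w" "e + length Ns < length w"
    "length Ps < D" "length Ns < D" "Suc (e + length Ns) \<le> length w" "Suc m + B < length w" "e \<le> length w" "f i < m \<Longrightarrow> f i < D" for i
    using h D by (auto simp: header_def)
  have posQ: "models K (map_ctl f \<phi>) = models K' (map_ctl f \<phi>)"
    and negQ: "(\<not> models K (map_ctl f \<phi>)) = (\<not> models K' (map_ctl f \<phi>))"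
    if "kripke_structure K" "agree K K'" for K K' :: "(nat, nat) kripke"
    using agree_models[OF that] by simp_all
  have c1: "(rel2 D (struct_step D w m (\<lambda>K. models K (map_ctl f \<phi>))))\<^sup>*\<^sup>*
      (0, Suc (Suc (Suc m + B) + length Ps)) (length Ps, e)"
    by (rule iffD2[OF chain_iff[where Q = "\<lambda>K. models K (map_ctl f \<phi>)", OF D' posQ le(1,3)]])
      (use h(4) K \<phi>(4) in \<open>auto intro!: exI[of _ Ps]\<close>)
  have c2: "(rel2 D (struct_step D w m (\<lambda>K. \<not> models K (map_ctl f \<phi>))))\<^sup>*\<^sup>*
      (0, Suc (e + length Ns)) (length Ns, length w)"
    by (rule iffD2[OF chain_iff[where Q = "\<lambda>K. \<not> models K (map_ctl f \<phi>)", OF D' negQ le(5,4)]])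
      (use h(6) K \<phi>(5) in \<open>auto intro!: exI[of _ Ns]\<close>)
  note H = h(1-3,5) le D' \<phi>(1-3)
  show ?R
    apply (rule bexI[of _ \<phi>, OF _ \<phi>(1)])
    apply (rule bex_conjI[of "0"], (use H in simp; fail), (use H in simp; fail))
    apply (rule bex_conjI[of "length w"], (use H in simp; fail), (use H in simp; fail))
    apply (rule bex_conjI[of "m"], (use H in simp; fail), (use H in simp; fail))
    apply (rule bex_conjI[of "Suc m"], (use H in simp; fail), (use H in simp; fail))
    apply (rule bex_conjI[of "B"], (use H in simp; fail), (use H in simp; fail))
    apply (rule conjI, rule \<phi>(3))
    apply (rule bex_conjI[of "Suc m + B"], (use H in simp; fail), (use H in simp; fail))
    apply (rule bex_conjI[of "Suc (Suc m + B)"], (use H in simp; fail), (use H in simp; fail))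
    apply (rule bex_conjI[of "length Ps"], (use H in simp; fail), (use H in simp; fail))
    apply (rule bex_conjI[of "Suc (Suc m + B) + length Ps"], (use H in simp; fail), (use H in simp; fail))
    apply (rule bex_conjI[of "Suc (Suc (Suc m + B) + length Ps)"], (use H in simp; fail), (use H in simp; fail))
    apply (rule exI[of _ e], rule conjI, (use H in simp; fail))
    apply (rule bex_conjI[of "length Ns"], (use H in simp; fail), (use H in simp; fail))
    apply (rule bex_conjI[of "e + length Ns"], (use H in simp; fail), (use H in simp; fail))
    apply (rule bex_conjI[of "Suc (e + length Ns)"], (use H in simp; fail), (use H in simp; fail))
    apply (rule exI[of _ f])
    using \<phi>(2) le(8) c1 c2 apply simp
    done
next
  assume ?R
  then obtain \<phi> m B e cP cN f where \<phi>: "\<phi> \<in> shapes Ut Bl n" "ctl_size \<phi> \<le> B"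
    and h: "header w 0 m" "header w (Suc m) B" "header w (Suc (Suc m + B)) cP" "header w e cN"
    and f: "\<And>i. i < size_limit n \<Longrightarrow> f i < m"
    and c: "(rel2 D (struct_step D w m (\<lambda>K. models K (map_ctl f \<phi>))))\<^sup>*\<^sup>* (0, Suc (Suc (Suc m + B) + cP)) (cP, e)"
      "(rel2 D (struct_step D w m (\<lambda>K. \<not> models K (map_ctl f \<phi>))))\<^sup>*\<^sup>* (0, Suc (e + cN)) (cN, length w)"
    apply clarsimp
    subgoal premises prems for \<phi> m B cP e cN f
      by (rule prems(1)[of \<phi> B m cP e cN f]) (use prems in auto)
    done
  have lim: "cP < D" "cN < D" using h D by (auto simp: header_def)
  have D': "length w < D" "m + 1 < D" using h(1) D by (auto simp: header_def)
  have le: "Suc (Suc (Suc m + B) + cP) \<le> length w" "Suc (e + cN) \<le> length w"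
    using h by (auto simp: header_def)
  have posQ: "models K (map_ctl f \<phi>) = models K' (map_ctl f \<phi>)"
    and negQ: "(\<not> models K (map_ctl f \<phi>)) = (\<not> models K' (map_ctl f \<phi>))"
    if "kripke_structure K" "agree K K'" for K K' :: "(nat, nat) kripke"
    using agree_models[OF that] by simp_all
  obtain Ps where Ps: "length Ps = cP" "\<And>K. K \<in> set Ps \<Longrightarrow> input_structure m K \<and> models K (map_ctl f \<phi>)"
    "occ w (Suc (Suc (Suc m + B) + cP)) (concat (map (encode_structure m) Ps)) e"
    using iffD1[OF chain_iff[where Q = "\<lambda>K. models K (map_ctl f \<phi>)", OF D' posQ le(1) lim(1)] c(1)]
    by blast
  obtain Ns where Ns: "length Ns = cN" "\<And>K. K \<in> set Ns \<Longrightarrow> input_structure m K \<and> \<not> models K (map_ctl f \<phi>)"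
    "occ w (Suc (e + cN)) (concat (map (encode_structure m) Ns)) (length w)"
    using iffD1[OF chain_iff[where Q = "\<lambda>K. \<not> models K (map_ctl f \<phi>)", OF D' negQ le(2) lim(2)] c(2)]
    by blast
  have "w = encode_input m Ps Ns B"
    unfolding encode_input_iff using h Ps(1,3) Ns(1,3) by auto
  moreover have ks: "K \<in> set Ps \<union> set Ns \<Longrightarrow> kripke_structure K" for K
    using Ps(2) Ns(2) by (auto simp: input_structure_def)
  have "learnable Ut Bl n {..<m} (set Ps) (set Ns) B"
    by (rule iffD2[OF learnable_iff_shapes[of "set Ps" "set Ns", OF ks]]) (use \<phi> f Ps(2) Ns(2) in blast)+
  ultimately show "w \<in> CTL_Learn Ut Bl n"
    unfolding CTL_Learn_def using Ps(2) Ns(2) by blast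
qed

section \<open>Model checking in nondeterministic logarithmic space\<close>

definition check_EF :: "nat \<Rightarrow> (nat \<Rightarrow> nat \<Rightarrow> bool) \<Rightarrow> (nat \<Rightarrow> bool) \<Rightarrow> nat \<Rightarrow> bool" where
  "check_EF D S X q \<longleftrightarrow> (\<exists>r < D. (edge D S)\<^sup>*\<^sup>* q r \<and> X r)"

text \<open>The lasso criterion, with each transitive closure split into a first step and a
  reflexive closure of \<open>edge\<close>, the form that can be verified together with its
  complement.\<close>

definition check_EG :: "nat \<Rightarrow> (nat \<Rightarrow> nat \<Rightarrow> bool) \<Rightarrow> (nat \<Rightarrow> bool) \<Rightarrow> nat \<Rightarrow> bool" where
  "check_EG D S X q \<longleftrightarrow> (\<exists>r < D.
     (\<exists>y < D. (S q y \<and> X q \<and> X y) \<and> (edge D (\<lambda>a b. S a b \<and> X a \<and> X b))\<^sup>*\<^sup>* y r) \<and>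
     (\<exists>y < D. (S r y \<and> X r \<and> X y) \<and> (edge D (\<lambda>a b. S a b \<and> X a \<and> X b))\<^sup>*\<^sup>* y r))"

text \<open>AF and AG are expressed as complements of EG and EF, so that two kinds of search
  suffice.\<close>

primrec check :: "nat \<Rightarrow> (nat, nat) kripke \<Rightarrow> nat ctl \<Rightarrow> nat \<Rightarrow> bool" where
  "check D K (Atom p) = (\<lambda>q. p \<in> label K q)"
| "check D K (Neg \<phi>) = (\<lambda>q. \<not> check D K \<phi> q)"
| "check D K (Bin b \<phi> \<psi>) = (\<lambda>q. binop_sem b (check D K \<phi> q) (check D K \<psi> q))"
| "check D K (Quant Q t \<phi>) =
     (case Q of
        Exists_Path \<Rightarrow> (case t of
          Eventually \<Rightarrow> check_EF D (\<lambda>a b. b \<in> succ K a) (check D K \<phi>)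
        | Globally \<Rightarrow> check_EG D (\<lambda>a b. b \<in> succ K a) (check D K \<phi>))
      | All_Paths \<Rightarrow> (case t of
          Eventually \<Rightarrow> (\<lambda>q. \<not> check_EG D (\<lambda>a b. b \<in> succ K a) (\<lambda>r. \<not> check D K \<phi> r) q)
        | Globally \<Rightarrow> (\<lambda>q. \<not> check_EF D (\<lambda>a b. b \<in> succ K a) (\<lambda>r. \<not> check D K \<phi> r) q)))"

context
  fixes K :: "(nat, nat) kripke" and D :: nat
  assumes K: "kripke_structure K" and D: "states K \<subseteq> {..<D}"
begin

lemma edge_reach:
  assumes "\<And>a b. E a b \<Longrightarrow> b \<in> succ K a" "q \<in> states K"
  shows "(edge D E)\<^sup>*\<^sup>* q r \<longleftrightarrow> E\<^sup>*\<^sup>* q r" and "E\<^sup>*\<^sup>* q r \<Longrightarrow> r \<in> states K"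
proof -
  have *: "E\<^sup>*\<^sup>* q r \<Longrightarrow> (edge D E)\<^sup>*\<^sup>* q r \<and> r \<in> states K"
  proof (induction rule: rtranclp_induct)
    case (step y z)
    then have "z \<in> states K" using K assms(1) unfolding kripke_structure_def by blast
    then have "edge D E y z" using step D by (auto simp: edge_def)
    then show ?case using step \<open>z \<in> states K\<close> by auto
  qed (use assms in auto)
  moreover have "(edge D E)\<^sup>*\<^sup>* q r \<Longrightarrow> E\<^sup>*\<^sup>* q r"
    by (erule mono_rtranclp[rule_format, rotated]) (simp add: edge_def)
  ultimately show "(edge D E)\<^sup>*\<^sup>* q r \<longleftrightarrow> E\<^sup>*\<^sup>* q r" "E\<^sup>*\<^sup>* q r \<Longrightarrow> r \<in> states K" by blast+
qed

lemma check_EF_iff: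
  assumes "q \<in> states K" "\<And>r. r \<in> states K \<Longrightarrow> X r \<longleftrightarrow> r \<in> Y"
  shows "check_EF D (\<lambda>a b. b \<in> succ K a) X q \<longleftrightarrow> (\<exists>\<rho> \<in> paths K q. \<exists>i. \<rho> i \<in> Y)"
proof -
  note reach = edge_reach[of "\<lambda>a b. b \<in> succ K a", OF _ assms(1)]
  have "check_EF D (\<lambda>a b. b \<in> succ K a) X q \<longleftrightarrow> (\<exists>r < D. (\<lambda>a b. b \<in> succ K a)\<^sup>*\<^sup>* q r \<and> X r)"
    unfolding check_EF_def using reach(1) by simp
  also have "\<dots> \<longleftrightarrow> (\<exists>r \<in> Y. (\<lambda>a b. b \<in> succ K a)\<^sup>*\<^sup>* q r)"
    using reach(2) assms(2) D by blast
  finally show ?thesis using EF_iff_reach[OF K assms(1)] by simp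
qed

lemma check_EG_iff:
  assumes q: "q \<in> states K" and X: "\<And>r. r \<in> states K \<Longrightarrow> X r \<longleftrightarrow> r \<in> Y"
  shows "check_EG D (\<lambda>a b. b \<in> succ K a) X q \<longleftrightarrow> (\<exists>\<rho> \<in> paths K q. \<forall>i. \<rho> i \<in> Y)"
proof -
  let ?E = "\<lambda>a b. b \<in> succ K a \<and> X a \<and> X b"
  let ?F = "\<lambda>a b. b \<in> succ K a \<and> a \<in> Y \<and> b \<in> Y"
  have EF: "?E a b \<longleftrightarrow> ?F a b" if "a \<in> states K" for a b
    using that X K unfolding kripke_structure_def by blast
  have succ_states: "b \<in> states K" if "a \<in> states K" "b \<in> succ K a" for a b
    using that K unfolding kripke_structure_def by blast
  have star: "?E\<^sup>*\<^sup>* a b \<longleftrightarrow> ?F\<^sup>*\<^sup>* a b" if "a \<in> states K" for a b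
  proof
    assume "?E\<^sup>*\<^sup>* a b"
    then have "?F\<^sup>*\<^sup>* a b \<and> b \<in> states K"
    proof (induction rule: rtranclp_induct)
      case (step y z)
      then have y: "?F\<^sup>*\<^sup>* a y" "y \<in> states K" by simp_all
      then have "?F y z" using EF step.hyps(2) by blast
      then show ?case using rtranclp.rtrancl_into_rtrancl[of ?F, OF y(1)] succ_states[OF y(2)] by blast
    qed (use that in simp)
    then show "?F\<^sup>*\<^sup>* a b" ..
  next
    assume "?F\<^sup>*\<^sup>* a b"
    then have "?E\<^sup>*\<^sup>* a b \<and> b \<in> states K"
    proof (induction rule: rtranclp_induct)
      case (step y z)
      then have y: "?E\<^sup>*\<^sup>* a y" "y \<in> states K" by simp_all
      then have "?E y z" using EF step.hyps(2) by blast
      then show ?case using rtranclp.rtrancl_into_rtrancl[of ?E, OF y(1)] succ_states[OF y(2)] by blast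
    qed (use that in simp)
    then show "?E\<^sup>*\<^sup>* a b" ..
  qed
  have plus: "(\<exists>y < D. ?E a y \<and> (edge D ?E)\<^sup>*\<^sup>* y b) \<longleftrightarrow> ?F\<^sup>+\<^sup>+ a b" if a: "a \<in> states K" for a b
  proof -
    have "(\<exists>y < D. ?E a y \<and> (edge D ?E)\<^sup>*\<^sup>* y b) \<longleftrightarrow> (\<exists>y. ?F a y \<and> ?F\<^sup>*\<^sup>* y b)"
    proof (intro ex_cong1)
      fix y
      show "y < D \<and> ?E a y \<and> (edge D ?E)\<^sup>*\<^sup>* y b \<longleftrightarrow> ?F a y \<and> ?F\<^sup>*\<^sup>* y b"
        using EF[OF a] succ_states[OF a] star[of y b] edge_reach(1)[of ?E y b] D by blast
    qed
    also have "\<dots> \<longleftrightarrow> ?F\<^sup>+\<^sup>+ a b" by (metis (no_types, lifting) rtranclp_into_tranclp2 tranclpD)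
    finally show ?thesis .
  qed
  have plus_states: "?F\<^sup>+\<^sup>+ a b \<Longrightarrow> a \<in> states K \<Longrightarrow> b \<in> states K" for a b
    by (induction rule: tranclp_induct) (use succ_states in blast)+
  have "check_EG D (\<lambda>a b. b \<in> succ K a) X q \<longleftrightarrow> (\<exists>r. ?F\<^sup>+\<^sup>+ q r \<and> ?F\<^sup>+\<^sup>+ r r)"
  proof
    assume "check_EG D (\<lambda>a b. b \<in> succ K a) X q"
    then obtain r where r: "\<exists>y < D. ?E q y \<and> (edge D ?E)\<^sup>*\<^sup>* y r" "\<exists>y < D. ?E r y \<and> (edge D ?E)\<^sup>*\<^sup>* y r"
      unfolding check_EG_def by blast
    then have "?F\<^sup>+\<^sup>+ q r" using plus[OF q] by blast
    then show "\<exists>r. ?F\<^sup>+\<^sup>+ q r \<and> ?F\<^sup>+\<^sup>+ r r" using r(2) plus plus_states q by blast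
  next
    assume "\<exists>r. ?F\<^sup>+\<^sup>+ q r \<and> ?F\<^sup>+\<^sup>+ r r"
    then obtain r where r: "?F\<^sup>+\<^sup>+ q r" "?F\<^sup>+\<^sup>+ r r" by blast
    then have rs: "r \<in> states K" using plus_states q by blast
    then have "r < D" using D by auto
    moreover have "\<exists>y < D. ?E q y \<and> (edge D ?E)\<^sup>*\<^sup>* y r" using r(1) plus[OF q] by blast
    moreover have "\<exists>y < D. ?E r y \<and> (edge D ?E)\<^sup>*\<^sup>* y r" using r(2) plus[OF rs] by blast
    ultimately show "check_EG D (\<lambda>a b. b \<in> succ K a) X q" unfolding check_EG_def by blast
  qed
  also have "\<dots> \<longleftrightarrow> (\<exists>\<rho> \<in> paths K q. \<forall>i. \<rho> i \<in> Y)" using EG_iff_lasso[OF K q] by simp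
  finally show ?thesis .
qed

lemma check_sat: "q \<in> states K \<Longrightarrow> check D K \<phi> q \<longleftrightarrow> sat K \<phi> q"
proof (induction \<phi> arbitrary: q)
  case (Quant Q t \<phi>)
  have X: "\<And>r. r \<in> states K \<Longrightarrow> check D K \<phi> r \<longleftrightarrow> r \<in> {r. sat K \<phi> r}"
    and Y: "\<And>r. r \<in> states K \<Longrightarrow> \<not> check D K \<phi> r \<longleftrightarrow> r \<in> {r. \<not> sat K \<phi> r}"
    using Quant.IH by auto
  show ?case
    using check_EF_iff[OF Quant.prems X] check_EG_iff[OF Quant.prems X]
      check_EF_iff[OF Quant.prems Y] check_EG_iff[OF Quant.prems Y]
    by (cases Q; cases t) simp_all
qed auto

end

definition check_models :: "nat \<Rightarrow> (nat, nat) kripke \<Rightarrow> nat ctl \<Rightarrow> bool" where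
  "check_models D K \<phi> \<longleftrightarrow> (\<forall>q < D. \<not> q \<in> init K \<or> check D K \<phi> q)"

text \<open>The replacement takes place under \<open>is_structure\<close>, which ensures that the
  decoded structure is well-formed.\<close>

lemma struct_step_check:
  assumes "length w < D"
  shows "struct_step D w m (\<lambda>K. models K \<phi>) = struct_step D w m (\<lambda>K. check_models D K \<phi>)"
    and "struct_step D w m (\<lambda>K. \<not> models K \<phi>) = struct_step D w m (\<lambda>K. \<not> check_models D K \<phi>)"
proof -
  have *: "models (decoded D w c m k) \<phi> \<longleftrightarrow> check_models D (decoded D w c m k) \<phi>"
    if "is_structure D w m s t k c" "k < D" for s t k c
  proof -
    let ?K = "decoded D w c m k"
    have ks: "kripke_structure ?K" using is_structure_sound[OF assms that(1)] by (auto simp: input_structure_def)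
    have st: "states ?K = {..<k}" by (simp add: decoded_def)
    have i: "init ?K \<subseteq> states ?K" using ks by (auto simp: kripke_structure_def)
    have sub: "states ?K \<subseteq> {..<D}" using that(2) st by auto
    show ?thesis
      unfolding models_def check_models_def using check_sat[OF ks sub] i sub by blast
  qed
  show "struct_step D w m (\<lambda>K. models K \<phi>) = struct_step D w m (\<lambda>K. check_models D K \<phi>)"
    "struct_step D w m (\<lambda>K. \<not> models K \<phi>) = struct_step D w m (\<lambda>K. \<not> check_models D K \<phi>)"
    unfolding struct_step_def fun_eq_iff using * by blast+
qed

section \<open>Verifying programs for parsing and model checking\<close>

context base
begin

lemma ddec_bit': "x < k \<Longrightarrow> ddec k (\<lambda>w \<sigma>. bit w (\<sigma> x))"
  unfolding bit_def by (rule ddec_bit)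

lemma ddec_length:
  assumes "x < k"
  shows "ddec k (\<lambda>w \<sigma>. \<sigma> x = length w)"
proof -
  have "ddec k (\<lambda>w \<sigma>. \<not> \<sigma> x < length w \<and> (\<forall>a < bound w. a < \<sigma> x \<longrightarrow> a < length w))"
    by (intro ddec_conj ddec_not ddec_all ddec_imp ddec_bit(2) ddec_less) (use assms in auto)
  then show ?thesis
  proof (rule ddec_cong)
    fix w \<sigma> assume "clean w k \<sigma>"
    show "\<not> \<sigma> x < length w \<and> (\<forall>a < bound w. a < \<sigma> x \<longrightarrow> a < length w) \<longleftrightarrow> \<sigma> x = length w"
    proof
      assume h: "\<not> \<sigma> x < length w \<and> (\<forall>a < bound w. a < \<sigma> x \<longrightarrow> a < length w)"
      have "length w < bound w" using bound_gt[of w] by linarith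
      then have "\<not> length w < \<sigma> x" using h by blast
      then show "\<sigma> x = length w" using h by linarith
    qed simp
  qed
qed

lemma ddec_header:
  assumes "s < l" "k < l"
  shows "ddec l (\<lambda>w \<sigma>. header w (\<sigma> s) (\<sigma> k))"
proof -
  have "ddec l (\<lambda>w \<sigma>. (\<forall>i < bound w. i < \<sigma> k \<longrightarrow> (\<exists>x < bound w. \<sigma> s + i = x \<and> bit w x)) \<and>
      (\<exists>x < bound w. \<sigma> s + \<sigma> k = x \<and> x < length w \<and> \<not> bit w x))"
    by (intro ddec_conj ddec_not ddec_all ddec_ex ddec_imp ddec_bit(2) ddec_bit' ddec_less ddec_add)
      (use assms in auto)
  then show ?thesis
  proof (rule ddec_cong)
    fix w \<sigma> assume "clean w l \<sigma>"
    then have k: "\<sigma> k < bound w" by (rule clean_less)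
    have "bit w x \<Longrightarrow> x < bound w" for x using bound_gt[of w] by (auto simp: bit_def)
    then show "(\<forall>i < bound w. i < \<sigma> k \<longrightarrow> (\<exists>x < bound w. \<sigma> s + i = x \<and> bit w x)) \<and>
      (\<exists>x < bound w. \<sigma> s + \<sigma> k = x \<and> x < length w \<and> \<not> bit w x) \<longleftrightarrow> header w (\<sigma> s) (\<sigma> k)"
      using k bound_gt[of w] unfolding header_def by (auto dest: less_trans)
  qed
qed

lemma ddec_block_bit:
  assumes "c < l" "m < l" "k < l" "q < l" "j < l"
  shows "ddec l (\<lambda>w \<sigma>. block_bit (bound w) w (\<sigma> c) (\<sigma> m) (\<sigma> k) (\<sigma> q) (\<sigma> j))"
  unfolding block_bit_def
  by (intro ddec_ex ddec_conj ddec_add ddec_Suc ddec_mult ddec_bit') (use assms in auto)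

lemma ddec_decoded:
  assumes "c < l" "m < l" "k < l" "q < l"
  shows "ddec l (\<lambda>w \<sigma>. \<sigma> q \<in> init (decoded (bound w) w (\<sigma> c) (\<sigma> m) (\<sigma> k)))"
    and "p < l \<Longrightarrow> ddec l (\<lambda>w \<sigma>. \<sigma> p \<in> label (decoded (bound w) w (\<sigma> c) (\<sigma> m) (\<sigma> k)) (\<sigma> q))"
    and "r < l \<Longrightarrow> ddec l (\<lambda>w \<sigma>. \<sigma> r \<in> succ (decoded (bound w) w (\<sigma> c) (\<sigma> m) (\<sigma> k)) (\<sigma> q))"
proof -
  have "ddec l (\<lambda>w \<sigma>. \<sigma> q < \<sigma> k \<and> (\<exists>z < bound w. z = 0 \<and> block_bit (bound w) w (\<sigma> c) (\<sigma> m) (\<sigma> k) (\<sigma> q) z))"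
    by (intro ddec_ex ddec_conj ddec_less ddec_zero ddec_block_bit) (use assms in auto)
  then show "ddec l (\<lambda>w \<sigma>. \<sigma> q \<in> init (decoded (bound w) w (\<sigma> c) (\<sigma> m) (\<sigma> k)))"
    by (rule ddec_cong) (auto simp: decoded_def)
next
  assume "p < l"
  then show "ddec l (\<lambda>w \<sigma>. \<sigma> p \<in> label (decoded (bound w) w (\<sigma> c) (\<sigma> m) (\<sigma> k)) (\<sigma> q))"
    unfolding decoded_def kripke.select_convs mem_Collect_eq
    by (intro ddec_ex ddec_conj ddec_less ddec_Suc ddec_block_bit) (use assms in auto)
next
  assume "r < l"
  then show "ddec l (\<lambda>w \<sigma>. \<sigma> r \<in> succ (decoded (bound w) w (\<sigma> c) (\<sigma> m) (\<sigma> k)) (\<sigma> q))"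
    unfolding decoded_def kripke.select_convs mem_Collect_eq
    by (intro ddec_ex ddec_conj ddec_less ddec_add ddec_Suc ddec_block_bit) (use assms in auto)
qed

lemma ddec_is_structure:
  assumes "m < l" "s < l" "t < l" "k < l" "c < l"
  shows "ddec l (\<lambda>w \<sigma>. is_structure (bound w) w (\<sigma> m) (\<sigma> s) (\<sigma> t) (\<sigma> k) (\<sigma> c))"
  unfolding is_structure_def
  by (intro ddec_conj ddec_header ddec_ex ddec_all ddec_add ddec_Suc ddec_mult ddec_length ddec_le ddec_disj
      ddec_not ddec_less ddec_decoded(3)) (use assms in auto)

text \<open>The induction hypothesis for formulas: predicate and complement are verifiable with any
  larger supply of variables in use, and the predicate ignores the variables from \<open>k\<close>
  on, which serve as scratch space.\<close>

definition both :: "nat \<Rightarrow> (bool list \<Rightarrow> vals \<Rightarrow> nat \<Rightarrow> bool) \<Rightarrow> bool" where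
  "both k P \<longleftrightarrow> (\<forall>l i. k \<le> l \<longrightarrow> i < l \<longrightarrow> nd l (\<lambda>w \<sigma>. P w \<sigma> (\<sigma> i)) \<and> nd l (\<lambda>w \<sigma>. \<not> P w \<sigma> (\<sigma> i))) \<and>
     (\<forall>w \<sigma> j v. k \<le> j \<longrightarrow> P w (\<sigma>(j := v)) = P w \<sigma>)"

lemma bothD:
  assumes "both k P"
  shows "k \<le> l \<Longrightarrow> i < l \<Longrightarrow> nd l (\<lambda>w \<sigma>. P w \<sigma> (\<sigma> i))"
    and "k \<le> l \<Longrightarrow> i < l \<Longrightarrow> nd l (\<lambda>w \<sigma>. \<not> P w \<sigma> (\<sigma> i))"
    and "k \<le> j \<Longrightarrow> P w (\<sigma>(j := v)) = P w \<sigma>"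
  using assms by (auto simp: both_def)

lemma both_not: "both k P \<Longrightarrow> both k (\<lambda>w \<sigma> q. \<not> P w \<sigma> q)"
  by (simp add: both_def)

text \<open>Disjunctive normal form of an arbitrary Boolean function \<open>g\<close>, covering all
  ten connectives at once.\<close>

lemma both_bool:
  assumes P: "both k P" and Q: "both k Q"
  shows "both k (\<lambda>w \<sigma> q. g (P w \<sigma> q) (Q w \<sigma> q))"
proof -
  have *: "nd l (\<lambda>w \<sigma>. g (P w \<sigma> (\<sigma> i)) (Q w \<sigma> (\<sigma> i)))" if "k \<le> l" "i < l" for l i g
  proof -
    note p = bothD(1,2)[OF P, OF that] and q = bothD(1,2)[OF Q, OF that]
    have c: "nd l (\<lambda>w \<sigma>. c)" for c by (rule nd_ddec[OF ddec_const])
    have "nd l (\<lambda>w \<sigma>. (g True True \<and> P w \<sigma> (\<sigma> i) \<and> Q w \<sigma> (\<sigma> i)) \<or> (g True False \<and> P w \<sigma> (\<sigma> i) \<and> \<not> Q w \<sigma> (\<sigma> i)) \<or>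
      (g False True \<and> \<not> P w \<sigma> (\<sigma> i) \<and> Q w \<sigma> (\<sigma> i)) \<or> (g False False \<and> \<not> P w \<sigma> (\<sigma> i) \<and> \<not> Q w \<sigma> (\<sigma> i)))"
      by (intro nd_disj nd_conj c p q)
    then show ?thesis
    proof (rule nd_cong)
      fix w \<sigma>
      show "(g True True \<and> P w \<sigma> (\<sigma> i) \<and> Q w \<sigma> (\<sigma> i)) \<or> (g True False \<and> P w \<sigma> (\<sigma> i) \<and> \<not> Q w \<sigma> (\<sigma> i)) \<or>
      (g False True \<and> \<not> P w \<sigma> (\<sigma> i) \<and> Q w \<sigma> (\<sigma> i)) \<or> (g False False \<and> \<not> P w \<sigma> (\<sigma> i) \<and> \<not> Q w \<sigma> (\<sigma> i)) \<longleftrightarrow>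
        g (P w \<sigma> (\<sigma> i)) (Q w \<sigma> (\<sigma> i))"
        by (cases "P w \<sigma> (\<sigma> i)"; cases "Q w \<sigma> (\<sigma> i)") simp_all
    qed
  qed
  show ?thesis
    unfolding both_def using *[of _ _ g] *[of _ _ "\<lambda>a b. \<not> g a b"] bothD(3)[OF P] bothD(3)[OF Q] by simp
qed

context
  fixes k :: nat and S :: "bool list \<Rightarrow> vals \<Rightarrow> nat \<Rightarrow> nat \<Rightarrow> bool" and P :: "bool list \<Rightarrow> vals \<Rightarrow> nat \<Rightarrow> bool"
  assumes S: "\<And>l i j. k \<le> l \<Longrightarrow> i < l \<Longrightarrow> j < l \<Longrightarrow> ddec l (\<lambda>w \<sigma>. S w \<sigma> (\<sigma> i) (\<sigma> j))"
    and S_indep: "\<And>w \<sigma> j v. k \<le> j \<Longrightarrow> S w (\<sigma>(j := v)) = S w \<sigma>"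
    and P: "both k P"
begin

lemma both_EF: "both k (\<lambda>w \<sigma>. check_EF (bound w) (S w \<sigma>) (P w \<sigma>))"
proof -
  have Sp: "nd l (\<lambda>w \<sigma>. S w \<sigma> (\<sigma> i) (\<sigma> j))" and Sn: "nd l (\<lambda>w \<sigma>. \<not> S w \<sigma> (\<sigma> i) (\<sigma> j))"
    if "k \<le> l" "i < l" "j < l" for l i j
    using nd_ddec[OF S[OF that]] nd_ddec[OF ddec_not[OF S[OF that]]] by blast+
  have reach: "nd l (\<lambda>w \<sigma>. (edge (bound w) (S w \<sigma>))\<^sup>*\<^sup>* (\<sigma> i) (\<sigma> j))"
    and nreach: "nd l (\<lambda>w \<sigma>. \<not> (edge (bound w) (S w \<sigma>))\<^sup>*\<^sup>* (\<sigma> i) (\<sigma> j))" if "k \<le> l" "i < l" "j < l" for l i j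
    by (rule nd_reach[of k S] nd_not_reach[of k S]; use that Sp Sn S_indep in blast)+
  have 1: "nd l (\<lambda>w \<sigma>. check_EF (bound w) (S w \<sigma>) (P w \<sigma>) (\<sigma> i))" if "k \<le> l" "i < l" for l i
    unfolding check_EF_def
    by (intro nd_ex nd_conj reach bothD(1)[OF P]) (use that in \<open>auto simp: S_indep bothD(3)[OF P]\<close>)
  have 2: "nd l (\<lambda>w \<sigma>. \<not> check_EF (bound w) (S w \<sigma>) (P w \<sigma>) (\<sigma> i))" if "k \<le> l" "i < l" for l i
  proof -
    have "nd l (\<lambda>w \<sigma>. \<forall>r < bound w. \<not> (edge (bound w) (S w \<sigma>))\<^sup>*\<^sup>* (\<sigma> i) r \<or> \<not> P w \<sigma> r)"
      by (intro nd_all nd_disj nreach bothD(2)[OF P]) (use that in \<open>auto simp: S_indep bothD(3)[OF P]\<close>)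
    then show ?thesis by (rule nd_cong) (auto simp: check_EF_def)
  qed
  show ?thesis
    unfolding both_def using 1 2 S_indep bothD(3)[OF P] by simp
qed

text \<open>Edges of the restricted graph are themselves only verifiable, since they involve
  \<open>P\<close>; inductive counting still applies because non-edges are verifiable as
  well.\<close>

lemma both_EG: "both k (\<lambda>w \<sigma>. check_EG (bound w) (S w \<sigma>) (P w \<sigma>))"
proof -
  let ?E = "\<lambda>w \<sigma> a b. S w \<sigma> a b \<and> P w \<sigma> a \<and> P w \<sigma> b"
  have E: "nd l (\<lambda>w \<sigma>. ?E w \<sigma> (\<sigma> i) (\<sigma> j))" if "k \<le> l" "i < l" "j < l" for l i j
    by (intro nd_conj nd_ddec[OF S] bothD(1)[OF P]) (use that in auto)
  have nE: "nd l (\<lambda>w \<sigma>. \<not> ?E w \<sigma> (\<sigma> i) (\<sigma> j))" if "k \<le> l" "i < l" "j < l" for l i j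
  proof -
    have "nd l (\<lambda>w \<sigma>. \<not> S w \<sigma> (\<sigma> i) (\<sigma> j) \<or> \<not> P w \<sigma> (\<sigma> i) \<or> \<not> P w \<sigma> (\<sigma> j))"
      by (intro nd_disj nd_ddec[OF ddec_not] S bothD(2)[OF P]) (use that in auto)
    then show ?thesis by (rule nd_cong) auto
  qed
  have indep: "?E w (\<sigma>(j := v)) = ?E w \<sigma>" if "k \<le> j" for w \<sigma> j v
    using that by (simp add: S_indep bothD(3)[OF P])
  have reach: "nd l (\<lambda>w \<sigma>. (edge (bound w) (?E w \<sigma>))\<^sup>*\<^sup>* (\<sigma> i) (\<sigma> j))" if "k \<le> l" "i < l" "j < l" for l i j
    by (rule nd_reach[of k ?E]) (use that E nE indep in auto)
  have nreach: "nd l (\<lambda>w \<sigma>. \<not> (edge (bound w) (?E w \<sigma>))\<^sup>*\<^sup>* (\<sigma> i) (\<sigma> j))" if "k \<le> l" "i < l" "j < l" for l i j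
    by (rule nd_not_reach[of k ?E]) (use that E nE indep in auto)
  let ?T = "\<lambda>w \<sigma> a r. \<exists>y < bound w. ?E w \<sigma> a y \<and> (edge (bound w) (?E w \<sigma>))\<^sup>*\<^sup>* y r"
  have T: "nd l (\<lambda>w \<sigma>. ?T w \<sigma> (\<sigma> i) (\<sigma> j))" if "k \<le> l" "i < l" "j < l" for l i j
    by (rule nd_ex, rule nd_conj[OF E reach]) (use that in \<open>auto simp: S_indep bothD(3)[OF P]\<close>)
  have nT: "nd l (\<lambda>w \<sigma>. \<not> ?T w \<sigma> (\<sigma> i) (\<sigma> j))" if "k \<le> l" "i < l" "j < l" for l i j
  proof -
    have "nd l (\<lambda>w \<sigma>. \<forall>y < bound w. \<not> ?E w \<sigma> (\<sigma> i) y \<or> \<not> (edge (bound w) (?E w \<sigma>))\<^sup>*\<^sup>* y (\<sigma> j))"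
      by (rule nd_all, rule nd_disj[OF nE nreach]) (use that in \<open>auto simp: S_indep bothD(3)[OF P]\<close>)
    then show ?thesis by (rule nd_cong) blast
  qed
  have Ti: "?T w (\<sigma>(j := v)) = ?T w \<sigma>" if "k \<le> j" for w \<sigma> j v
    using that by (simp add: S_indep bothD(3)[OF P])
  have eq: "check_EG (bound w) (S w \<sigma>) (P w \<sigma>) q \<longleftrightarrow> (\<exists>r < bound w. ?T w \<sigma> q r \<and> ?T w \<sigma> r r)" for w \<sigma> q
    by (simp only: check_EG_def)
  have 1: "nd l (\<lambda>w \<sigma>. check_EG (bound w) (S w \<sigma>) (P w \<sigma>) (\<sigma> i))" if "k \<le> l" "i < l" for l i
    unfolding eq by (rule nd_ex, rule nd_conj[OF T T]) (use that in \<open>auto simp: S_indep bothD(3)[OF P]\<close>)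
  have 2: "nd l (\<lambda>w \<sigma>. \<not> check_EG (bound w) (S w \<sigma>) (P w \<sigma>) (\<sigma> i))" if "k \<le> l" "i < l" for l i
  proof -
    have "nd l (\<lambda>w \<sigma>. \<forall>r < bound w. \<not> ?T w \<sigma> (\<sigma> i) r \<or> \<not> ?T w \<sigma> r r)"
      by (rule nd_all, rule nd_disj[OF nT nT]) (use that in \<open>auto simp: S_indep bothD(3)[OF P]\<close>)
    then show ?thesis by (rule nd_cong) (simp only: eq, blast)
  qed
  show ?thesis
    unfolding both_def using 1 2 S_indep bothD(3)[OF P] by simp
qed

end

text \<open>The recursion is over a fixed shape, so the nested programs have a fixed size.
  \<open>F\<close> reads the proposition chosen for each atom from some variable.\<close>

lemma both_check:
  assumes "c < k" "m < k" "kk < k"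
    and F: "\<And>w \<sigma> j v. k \<le> j \<Longrightarrow> F (\<sigma>(j := v)) = F \<sigma>"
    and set: "\<And>i. i \<in> set_ctl \<phi> \<Longrightarrow> \<exists>x < k. \<forall>\<sigma>. F \<sigma> i = \<sigma> x"
  shows "both k (\<lambda>w \<sigma>. check (bound w) (decoded (bound w) w (\<sigma> c) (\<sigma> m) (\<sigma> kk)) (map_ctl (F \<sigma>) \<phi>))"
  using set
proof (induction \<phi>)
  case (Atom p)
  then obtain x where x: "x < k" "\<And>\<sigma>. F \<sigma> p = \<sigma> x" by auto
  have "ddec l (\<lambda>w \<sigma>. \<sigma> x \<in> label (decoded (bound w) w (\<sigma> c) (\<sigma> m) (\<sigma> kk)) (\<sigma> i))" if "k \<le> l" "i < l" for l i
    using ddec_decoded(2)[of c l m kk i x] assms x(1) that by simp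
  then show ?case
    unfolding both_def using assms x(1) by (auto simp: x(2) intro!: nd_ddec ddec_not)
next
  case (Neg \<phi>)
  then show ?case using both_not by fastforce
next
  case (Bin b \<phi> \<psi>)
  then show ?case using both_bool[of k _ _ "binop_sem b"] by fastforce
next
  case (Quant Q t \<phi>)
  let ?P = "\<lambda>w \<sigma>. check (bound w) (decoded (bound w) w (\<sigma> c) (\<sigma> m) (\<sigma> kk)) (map_ctl (F \<sigma>) \<phi>)"
  let ?S = "\<lambda>w \<sigma> a b. b \<in> succ (decoded (bound w) w (\<sigma> c) (\<sigma> m) (\<sigma> kk)) a"
  have P: "both k ?P" using Quant by simp
  have S: "ddec l (\<lambda>w \<sigma>. ?S w \<sigma> (\<sigma> i) (\<sigma> j))" if "k \<le> l" "i < l" "j < l" for l i j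
    using ddec_decoded(3)[of c l m kk i j] assms that by simp
  have Si: "?S w (\<sigma>(j := v)) = ?S w \<sigma>" if "k \<le> j" for w \<sigma> j v
    using that assms by simp
  have EF: "both k (\<lambda>w \<sigma>. check_EF (bound w) (?S w \<sigma>) (P w \<sigma>))"
    and EG: "both k (\<lambda>w \<sigma>. check_EG (bound w) (?S w \<sigma>) (P w \<sigma>))" if "both k P" for P
    by (rule both_EF[of k ?S] both_EG[of k ?S]; use S Si that in blast)+
  show ?case
    using EF[OF P] EG[OF P] both_not[OF EF[OF both_not[OF P]]] both_not[OF EG[OF both_not[OF P]]]
    by (cases Q; cases t) simp_all
qed

end

section \<open>The learning problem as a verifiable predicate\<close>

context base
begin

lemma nd_finite_all:
  "finite A \<Longrightarrow> (\<And>a. a \<in> A \<Longrightarrow> nd k (P a)) \<Longrightarrow> nd k (\<lambda>w \<sigma>. \<forall>a\<in>A. P a w \<sigma>)"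
proof (induction A rule: finite_induct)
  case empty
  then show ?case using nd_ddec[OF ddec_const[of k True]] by simp
next
  case (insert a A)
  then have "nd k (\<lambda>w \<sigma>. P a w \<sigma> \<and> (\<forall>a\<in>A. P a w \<sigma>))" by (intro nd_conj) auto
  then show ?case by simp
qed

text \<open>The function is guessed as \<open>n\<close> consecutive variables; the induction runs
  downwards over the number of values already stored. Beyond \<open>n\<close> the value 0 is a mere
  default.\<close>

lemma nd_ex_vec:
  assumes P: "nd (k + n) (\<lambda>w \<sigma>. P w \<sigma> (\<lambda>i. if i < n then \<sigma> (k + i) else 0))"
    and dep: "\<And>w \<sigma> f g. (\<And>i. i < n \<Longrightarrow> f i = g i) \<Longrightarrow> P w \<sigma> f = P w \<sigma> g"
    and indep: "\<And>w \<sigma> j v. k \<le> j \<Longrightarrow> P w (\<sigma>(j := v)) = P w \<sigma>"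
  shows "nd k (\<lambda>w \<sigma>. \<exists>f. (\<forall>i < n. f i < bound w) \<and> P w \<sigma> f)"
proof -
  let ?Q = "\<lambda>j w \<sigma>. \<exists>f. (\<forall>i < n. f i < bound w) \<and> (\<forall>i < j. f i = \<sigma> (k + i)) \<and> P w \<sigma> f"
  have "j \<le> n \<Longrightarrow> nd (k + j) (?Q j)" for j
  proof (induction j rule: inc_induct)
    case base
    show ?case
    proof (rule nd_cong[OF P])
      fix w \<sigma> assume cl: "clean w (k + n) \<sigma>"
      let ?f = "\<lambda>i. if i < n then \<sigma> (k + i) else 0"
      have "P w \<sigma> f = P w \<sigma> ?f" if "\<forall>i < n. f i = \<sigma> (k + i)" for f
        by (rule dep) (use that in simp)
      moreover have "\<forall>i < n. ?f i < bound w" using clean_less[OF cl] by simp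
      ultimately show "P w \<sigma> ?f \<longleftrightarrow> ?Q n w \<sigma>"
        by (intro iffI exI[of _ ?f] conjI) (auto simp only: if_True)
    qed
  next
    case (step j)
    have "nd (k + j) (\<lambda>w \<sigma>. \<exists>a < bound w. \<exists>f. (\<forall>i < n. f i < bound w) \<and>
        (\<forall>i < j. f i = \<sigma> (k + i)) \<and> f j = a \<and> P w \<sigma> f)"
    proof (rule nd_ex)
      show "nd (Suc (k + j)) (\<lambda>w \<sigma>. \<exists>f. (\<forall>i < n. f i < bound w) \<and>
          (\<forall>i < j. f i = \<sigma> (k + i)) \<and> f j = \<sigma> (k + j) \<and> P w \<sigma> f)"
        using step.IH by (simp add: less_Suc_eq all_conj_distrib imp_conjR disj_imp conj_ac cong: conj_cong)
          (auto elim!: nd_cong)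
    qed (simp add: indep)
    then show ?case
    proof (rule nd_cong)
      fix w \<sigma>
      show "(\<exists>a < bound w. \<exists>f. (\<forall>i < n. f i < bound w) \<and> (\<forall>i < j. f i = \<sigma> (k + i)) \<and> f j = a \<and> P w \<sigma> f) \<longleftrightarrow>
          ?Q j w \<sigma>"
        using step.hyps by blast
    qed
  qed
  from this[of 0] show ?thesis by simp
qed

lemma ddec_ge_const:
  assumes "x < k"
  shows "ddec k (\<lambda>w \<sigma>. c \<le> \<sigma> x)"
proof -
  have "ddec k (\<lambda>w \<sigma>. \<exists>a < bound w. a = c \<and> a \<le> \<sigma> x)"
    by (intro ddec_ex ddec_conj ddec_eq_const ddec_le) (use assms in auto)
  then show ?thesis
  proof (rule ddec_cong)
    fix w \<sigma> assume "clean w k \<sigma>"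
    then have "\<sigma> x < bound w" by (rule clean_less)
    then show "(\<exists>a < bound w. a = c \<and> a \<le> \<sigma> x) \<longleftrightarrow> c \<le> \<sigma> x" by auto
  qed
qed

lemma nd_struct_step:
  assumes vars: "m < k" "i < l" "s < l" "j < l" "t < l" "k \<le> l"
    and F: "\<And>w \<sigma> j v. k \<le> j \<Longrightarrow> F (\<sigma>(j := v)) = F \<sigma>"
    and set: "\<And>i. i \<in> set_ctl \<phi> \<Longrightarrow> \<exists>x < k. \<forall>\<sigma>. F \<sigma> i = \<sigma> x"
  shows "nd l (\<lambda>w \<sigma>. struct_step (bound w) w (\<sigma> m) (\<lambda>K. check_models (bound w) K (map_ctl (F \<sigma>) \<phi>))
       (\<sigma> i) (\<sigma> s) (\<sigma> j) (\<sigma> t))"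
    and "nd l (\<lambda>w \<sigma>. struct_step (bound w) w (\<sigma> m) (\<lambda>K. \<not> check_models (bound w) K (map_ctl (F \<sigma>) \<phi>))
       (\<sigma> i) (\<sigma> s) (\<sigma> j) (\<sigma> t))"
proof -
  \<comment> \<open>Variables \<open>l\<close> and \<open>Suc l\<close> hold the number of states
    and the position behind the header, as bound by the two quantifiers of
    \<open>struct_step\<close>.\<close>
  let ?P = "\<lambda>w \<sigma>. check (bound w) (decoded (bound w) w (\<sigma> (Suc l)) (\<sigma> m) (\<sigma> l)) (map_ctl (F \<sigma>) \<phi>)"
  have P: "both (Suc (Suc l)) ?P"
  proof (rule both_check)
    fix i assume "i \<in> set_ctl \<phi>"
    from set[OF this] show "\<exists>x < Suc (Suc l). \<forall>\<sigma>. F \<sigma> i = \<sigma> x" using vars(6) by (metis less_SucI less_le_trans)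
  qed (use vars F in auto)
  have init: "ddec l' (\<lambda>w \<sigma>. \<sigma> q \<in> init (decoded (bound w) w (\<sigma> (Suc l)) (\<sigma> m) (\<sigma> l)))"
    if "Suc (Suc l) \<le> l'" "q < l'" for l' q
    by (rule ddec_decoded(1)) (use that vars in auto)
  have 1: "nd (Suc (Suc l)) (\<lambda>w \<sigma>. check_models (bound w) (decoded (bound w) w (\<sigma> (Suc l)) (\<sigma> m) (\<sigma> l)) (map_ctl (F \<sigma>) \<phi>))"
    unfolding check_models_def
    by (intro nd_all nd_disj nd_ddec[OF ddec_not] init bothD(1)[OF P]) (use vars F in auto)
  have "nd (Suc (Suc l)) (\<lambda>w \<sigma>. \<exists>q < bound w. q \<in> init (decoded (bound w) w (\<sigma> (Suc l)) (\<sigma> m) (\<sigma> l)) \<and> \<not> ?P w \<sigma> q)"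
    by (intro nd_ex nd_conj nd_ddec[OF init] bothD(2)[OF P]) (use vars F in auto)
  then have 2: "nd (Suc (Suc l)) (\<lambda>w \<sigma>. \<not> check_models (bound w) (decoded (bound w) w (\<sigma> (Suc l)) (\<sigma> m) (\<sigma> l)) (map_ctl (F \<sigma>) \<phi>))"
    by (rule nd_cong) (auto simp: check_models_def)
  have str: "nd (Suc (Suc l)) (\<lambda>w \<sigma>. is_structure (bound w) w (\<sigma> m) (\<sigma> s) (\<sigma> t) (\<sigma> l) (\<sigma> (Suc l)))"
    by (rule nd_ddec[OF ddec_is_structure]) (use vars in auto)
  show "nd l (\<lambda>w \<sigma>. struct_step (bound w) w (\<sigma> m) (\<lambda>K. check_models (bound w) K (map_ctl (F \<sigma>) \<phi>))
       (\<sigma> i) (\<sigma> s) (\<sigma> j) (\<sigma> t))"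
    unfolding struct_step_def
    by (intro nd_conj nd_ddec[OF ddec_Suc] nd_ex str 1) (use vars F in auto)
  show "nd l (\<lambda>w \<sigma>. struct_step (bound w) w (\<sigma> m) (\<lambda>K. \<not> check_models (bound w) K (map_ctl (F \<sigma>) \<phi>))
       (\<sigma> i) (\<sigma> s) (\<sigma> j) (\<sigma> t))"
    unfolding struct_step_def
    by (intro nd_conj nd_ddec[OF ddec_Suc] nd_ex str 2) (use vars F in auto)
qed

lemma nd_chain:
  assumes vars: "m < k" "z < k" "t < k" "c < k" "e < k"
    and F: "\<And>w \<sigma> j v. k \<le> j \<Longrightarrow> F (\<sigma>(j := v)) = F \<sigma>"
    and set: "\<And>i. i \<in> set_ctl \<phi> \<Longrightarrow> \<exists>x < k. \<forall>\<sigma>. F \<sigma> i = \<sigma> x"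
  shows "nd k (\<lambda>w \<sigma>. (rel2 (bound w) (struct_step (bound w) w (\<sigma> m) (\<lambda>K. check_models (bound w) K (map_ctl (F \<sigma>) \<phi>))))\<^sup>*\<^sup>*
       (\<sigma> z, \<sigma> t) (\<sigma> c, \<sigma> e))"
    and "nd k (\<lambda>w \<sigma>. (rel2 (bound w) (struct_step (bound w) w (\<sigma> m) (\<lambda>K. \<not> check_models (bound w) K (map_ctl (F \<sigma>) \<phi>))))\<^sup>*\<^sup>*
       (\<sigma> z, \<sigma> t) (\<sigma> c, \<sigma> e))"
  by (rule nd_rtc2, rule nd_struct_step[where k = k]; use vars F set in auto)+

text \<open>The shape is chosen in the control of the program, among finitely many; only the
  propositions at its atoms occupy counters.\<close>

lemma nd_CTL_Learn: "nd 0 (\<lambda>w \<sigma>. w \<in> CTL_Learn Ut Bl n)"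
proof -
  let ?Q = "\<lambda>\<phi> w. \<exists>z < bound w. z = 0 \<and> (\<exists>l < bound w. l = length w \<and>
     (\<exists>m < bound w. header w z m \<and> (\<exists>a < bound w. a = Suc m \<and> (\<exists>B < bound w. header w a B \<and> ctl_size \<phi> \<le> B \<and>
     (\<exists>x < bound w. a + B = x \<and> (\<exists>s < bound w. s = Suc x \<and> (\<exists>cP < bound w. header w s cP \<and>
     (\<exists>y < bound w. s + cP = y \<and> (\<exists>t < bound w. t = Suc y \<and> (\<exists>e < bound w. (\<exists>cN < bound w. header w e cN \<and>
     (\<exists>v < bound w. e + cN = v \<and> (\<exists>u < bound w. u = Suc v \<and>
     (\<exists>f. (\<forall>i < size_limit n. f i < bound w) \<and> ((\<forall>i \<in> {..<size_limit n}. f i < m) \<and>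
       (rel2 (bound w) (struct_step (bound w) w m (\<lambda>K. check_models (bound w) K (map_ctl f \<phi>))))\<^sup>*\<^sup>* (z, t) (cP, e) \<and>
       (rel2 (bound w) (struct_step (bound w) w m (\<lambda>K. \<not> check_models (bound w) K (map_ctl f \<phi>))))\<^sup>*\<^sup>* (z, u) (cN, l))))))))))))))))"
  have "nd 0 (\<lambda>w \<sigma>. ?Q \<phi> w)" if "\<phi> \<in> shapes Ut Bl n" for \<phi>
  proof -
    have \<phi>: "i \<in> set_ctl \<phi> \<Longrightarrow> i < size_limit n" for i
      using that fragment_set[of "{..<size_limit n}"] by (auto simp: shapes_def)
    have dep: "map_ctl f \<phi> = map_ctl g \<phi>" if "\<And>i. i < size_limit n \<Longrightarrow> f i = g i" for f g :: "nat \<Rightarrow> nat"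
      using that \<phi> by (intro ctl.map_cong0) blast
    have vec: "nd k (\<lambda>w \<sigma>. \<exists>f. (\<forall>i < size_limit n. f i < bound w) \<and> ((\<forall>i \<in> {..<size_limit n}. f i < \<sigma> m) \<and>
       (rel2 (bound w) (struct_step (bound w) w (\<sigma> m) (\<lambda>K. check_models (bound w) K (map_ctl f \<phi>))))\<^sup>*\<^sup>* (\<sigma> z, \<sigma> t) (\<sigma> cP, \<sigma> e) \<and>
       (rel2 (bound w) (struct_step (bound w) w (\<sigma> m) (\<lambda>K. \<not> check_models (bound w) K (map_ctl f \<phi>))))\<^sup>*\<^sup>* (\<sigma> z, \<sigma> u) (\<sigma> cN, \<sigma> l)))"
      if v: "m < k" "z < k" "t < k" "cP < k" "e < k" "u < k" "cN < k" "l < k" for k m z t cP e u cN l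
    proof (rule nd_ex_vec)
      show "nd (k + size_limit n) (\<lambda>w \<sigma>.
          (\<forall>i \<in> {..<size_limit n}. (if i < size_limit n then \<sigma> (k + i) else 0) < \<sigma> m) \<and>
          (rel2 (bound w) (struct_step (bound w) w (\<sigma> m) (\<lambda>K. check_models (bound w) K
            (map_ctl (\<lambda>i. if i < size_limit n then \<sigma> (k + i) else 0) \<phi>))))\<^sup>*\<^sup>* (\<sigma> z, \<sigma> t) (\<sigma> cP, \<sigma> e) \<and>
          (rel2 (bound w) (struct_step (bound w) w (\<sigma> m) (\<lambda>K. \<not> check_models (bound w) K
            (map_ctl (\<lambda>i. if i < size_limit n then \<sigma> (k + i) else 0) \<phi>))))\<^sup>*\<^sup>* (\<sigma> z, \<sigma> u) (\<sigma> cN, \<sigma> l))"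
      proof (intro nd_conj nd_finite_all nd_chain)
        fix i assume "i \<in> {..<size_limit n}"
        then show "nd (k + size_limit n) (\<lambda>w \<sigma>. (if i < size_limit n then \<sigma> (k + i) else 0) < \<sigma> m)"
          using nd_ddec[OF ddec_less[of "k + i" "k + size_limit n" m]] v(1) by simp
      next
        fix i assume i: "i \<in> set_ctl \<phi>"
        show "\<exists>x < k + size_limit n. \<forall>\<sigma>. (if i < size_limit n then \<sigma> (k + i) else 0) = \<sigma> x"
          using \<phi>[OF i] by (intro exI[of _ "k + i"]) simp
        show "\<exists>x < k + size_limit n. \<forall>\<sigma>. (if i < size_limit n then \<sigma> (k + i) else 0) = \<sigma> x"
          using \<phi>[OF i] by (intro exI[of _ "k + i"]) simp
      qed (use v in auto)
    next
      fix w \<sigma> and f g :: "nat \<Rightarrow> nat" assume fg: "\<And>i. i < size_limit n \<Longrightarrow> f i = g i"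
      have e: "map_ctl f \<phi> = map_ctl g \<phi>" by (rule dep[OF fg])
      have e': "(\<forall>i \<in> {..<size_limit n}. f i < \<sigma> m) = (\<forall>i \<in> {..<size_limit n}. g i < \<sigma> m)" using fg by simp
      show "((\<forall>i \<in> {..<size_limit n}. f i < \<sigma> m) \<and>
       (rel2 (bound w) (struct_step (bound w) w (\<sigma> m) (\<lambda>K. check_models (bound w) K (map_ctl f \<phi>))))\<^sup>*\<^sup>* (\<sigma> z, \<sigma> t) (\<sigma> cP, \<sigma> e) \<and>
       (rel2 (bound w) (struct_step (bound w) w (\<sigma> m) (\<lambda>K. \<not> check_models (bound w) K (map_ctl f \<phi>))))\<^sup>*\<^sup>* (\<sigma> z, \<sigma> u) (\<sigma> cN, \<sigma> l)) =
        ((\<forall>i \<in> {..<size_limit n}. g i < \<sigma> m) \<and>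
       (rel2 (bound w) (struct_step (bound w) w (\<sigma> m) (\<lambda>K. check_models (bound w) K (map_ctl g \<phi>))))\<^sup>*\<^sup>* (\<sigma> z, \<sigma> t) (\<sigma> cP, \<sigma> e) \<and>
       (rel2 (bound w) (struct_step (bound w) w (\<sigma> m) (\<lambda>K. \<not> check_models (bound w) K (map_ctl g \<phi>))))\<^sup>*\<^sup>* (\<sigma> z, \<sigma> u) (\<sigma> cN, \<sigma> l))"
        unfolding e e' ..
    qed (use v in auto)
    show ?thesis
      by (intro nd_ex nd_conj vec
            nd_ddec[OF ddec_zero] nd_ddec[OF ddec_length] nd_ddec[OF ddec_header] nd_ddec[OF ddec_Suc]
            nd_ddec[OF ddec_add] nd_ddec[OF ddec_ge_const]) simp_all
  qed
  then have "nd 0 (\<lambda>w \<sigma>. \<exists>\<phi> \<in> shapes Ut Bl n. ?Q \<phi> w)"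
    by (rule nd_finite_ex[OF finite_shapes])
  then show ?thesis
  proof (rule nd_cong)
    fix w \<sigma>
    have "length w < bound w" using bound_gt[of w] by linarith
    from struct_step_check[OF this]
    show "(\<exists>\<phi> \<in> shapes Ut Bl n. ?Q \<phi> w) \<longleftrightarrow> w \<in> CTL_Learn Ut Bl n"
      unfolding CTL_Learn_iff[OF bound_gt] by (simp only:)
  qed
qed

end

lemma CTL_Learn_in_NL: "CTL_Learn Ut Bl n \<in> NL"
proof -
  \<comment> \<open>Counters in base 2 already exceed \<open>length w + 2\<close>, hence all
    positions on the input.\<close>
  interpret base 2 by standard simp
  obtain p where p: "\<And>w \<sigma>. clean w 0 \<sigma> \<Longrightarrow>
      den w p \<sigma> = (if w \<in> CTL_Learn Ut Bl n then {([], \<sigma>)} else {})"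
    using nd_CTL_Learn[of Ut Bl n] unfolding nd_def by blast
  have "clean w 0 (\<lambda>_. 0)" for w by (simp add: clean_def ok_def)
  then show ?thesis by (intro NL_I[of _ p]) (simp add: p)
qed

section \<open>Configurations as numbers\<close>

text \<open>Squares of consecutive sums are more than \<open>x\<close> apart, so the sum, and then
  \<open>x\<close>, can be recovered. No halving is involved, which suits
  \<open>ddec_mult_add\<close>.\<close>

definition pair :: "nat \<Rightarrow> nat \<Rightarrow> nat" where
  "pair x y = (x + y) * (x + y) + x"

lemma pair_ge: "x + y \<le> pair x y"
proof -
  have "x + y \<le> (x + y) * (x + y)" by (cases "x + y") auto
  then show ?thesis unfolding pair_def by linarith
qed

lemma pair_sum_le: "pair x y \<le> pair x' y' \<Longrightarrow> x + y \<le> x' + y'"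
proof (rule ccontr)
  assume le: "pair x y \<le> pair x' y'" and "\<not> x + y \<le> x' + y'"
  then have "Suc (x' + y') \<le> x + y" by simp
  then have "Suc (x' + y') * Suc (x' + y') \<le> (x + y) * (x + y)" by (intro mult_le_mono)
  then show False using le by (simp add: pair_def)
qed

lemma pair_eq [simp]: "pair x y = pair x' y' \<longleftrightarrow> x = x' \<and> y = y'"
proof
  assume e: "pair x y = pair x' y'"
  then have "x + y = x' + y'" using pair_sum_le[of x y x' y'] pair_sum_le[of x' y' x y] by simp
  then show "x = x' \<and> y = y'" using e by (simp add: pair_def)
qed simp

text \<open>The cells to the left of the head, and those from the head on, are the digits of two numbers in
  base \<open>S\<close>. The leading digit 1 of the first number marks the left end of the tape; of the infinite
  right part only the first \<open>n\<close> cells are recorded.\<close>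

primrec left_num :: "nat \<Rightarrow> (nat \<Rightarrow> nat) \<Rightarrow> nat \<Rightarrow> nat" where
  "left_num S t 0 = 1"
| "left_num S t (Suc h) = t h + S * left_num S t h"

primrec right_num :: "nat \<Rightarrow> (nat \<Rightarrow> nat) \<Rightarrow> nat \<Rightarrow> nat \<Rightarrow> nat" where
  "right_num S t h 0 = 0"
| "right_num S t h (Suc n) = t h + S * right_num S t (Suc h) n"

lemma left_num_upd: "h \<le> j \<Longrightarrow> left_num S (t(j := b)) h = left_num S t h"
  by (induction h) auto

lemma right_num_upd: "j < h \<Longrightarrow> right_num S (t(j := b)) h n = right_num S t h n"
  by (induction n arbitrary: h) auto

lemma left_num_pos: "0 < S \<Longrightarrow> 0 < left_num S t h"
  by (induction h) auto

lemma left_num_eq_one: "2 \<le> S \<Longrightarrow> left_num S t h = 1 \<longleftrightarrow> h = 0"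
proof (cases h)
  case (Suc g)
  assume S: "2 \<le> S"
  then have "2 * 1 \<le> S * left_num S t g" using left_num_pos[of S t g] by (intro mult_le_mono) auto
  then show ?thesis using Suc by simp
qed simp

definition tape_code :: "nat \<Rightarrow> nat \<Rightarrow> tape \<Rightarrow> nat \<times> nat" where
  "tape_code S Z = (\<lambda>(t, h). (left_num S t h, right_num S t h (Z - h)))"

text \<open>A move transfers one digit between the two numbers, after the scanned digit
  \<open>R mod S\<close> has been overwritten by \<open>b\<close>. \<open>L = 1\<close> means that
  only the leading marker digit is left: the head is at the left end and stays there on a move to
  the left.\<close>

definition tape_next :: "nat \<Rightarrow> nat \<Rightarrow> move \<Rightarrow> nat \<times> nat \<Rightarrow> nat \<times> nat" where
  "tape_next S b d = (\<lambda>(L, R). case d of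
     Stay \<Rightarrow> (L, b + S * (R div S))
   | MoveRight \<Rightarrow> (b + S * L, R div S)
   | MoveLeft \<Rightarrow> if L = 1 then (L, b + S * (R div S))
       else (L div S, L mod S + S * (b + S * (R div S))))"

definition fits :: "nat \<Rightarrow> nat \<Rightarrow> tape \<Rightarrow> bool" where
  "fits S Z = (\<lambda>(t, h). (\<forall>j. t j < S) \<and> h < Z)"

lemma tape_code_act:
  assumes "2 \<le> S" "fits S Z (t, h)"
  shows "tape_code S Z (act (b, d) (t, h)) = tape_next S b d (tape_code S Z (t, h))"
    and "snd (tape_code S Z (t, h)) mod S = t h"
proof -
  have t: "t j < S" for j using assms by (simp add: fits_def)
  \<comment> \<open>The scanned cell is among the recorded ones because
    \<open>h < Z\<close>.\<close>
  obtain n where n: "Z - h = Suc n" "Z - Suc h = n" using assms by (auto simp: fits_def gr0_conv_Suc dest!: less_imp_Suc_add)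
  have dv: "(t j + S * x) div S = x" for j x using t[of j] by simp
  show "snd (tape_code S Z (t, h)) mod S = t h" using t by (simp add: tape_code_def n)
  show "tape_code S Z (act (b, d) (t, h)) = tape_next S b d (tape_code S Z (t, h))"
  proof (cases d)
    case MoveLeft
    show ?thesis
    proof (cases h)
      case 0
      then show ?thesis using t[of 0] MoveLeft n
        by (simp add: tape_code_def tape_next_def act_def right_num_upd)
    next
      case (Suc g)
      moreover have "Z - g = Suc (Suc n)" using n Suc by simp
      moreover have "left_num S t (Suc g) \<noteq> 1" using left_num_eq_one[OF assms(1)] by blast
      ultimately show ?thesis using t MoveLeft n
        by (simp add: tape_code_def tape_next_def act_def right_num_upd left_num_upd dv)
    qed
  qed (use t n in \<open>simp_all add: tape_code_def tape_next_def act_def right_num_upd left_num_upd dv\<close>)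
qed

primrec tapes_code :: "(nat \<times> nat) list \<Rightarrow> nat" where
  "tapes_code [] = 0"
| "tapes_code (x # xs) = pair (pair (fst x) (snd x)) (tapes_code xs)"

primrec tapes_step :: "nat \<Rightarrow> (nat \<times> nat \<times> move) list \<Rightarrow> nat \<Rightarrow> nat \<Rightarrow> bool" where
  "tapes_step S [] a a' \<longleftrightarrow> a = 0 \<and> a' = 0"
| "tapes_step S (x # xs) a a' \<longleftrightarrow> (\<exists>l r u l' r' u'. a = pair (pair l r) u \<and> a' = pair (pair l' r') u' \<and>
     r mod S = fst x \<and> (l', r') = tape_next S (fst (snd x)) (snd (snd x)) (l, r) \<and> tapes_step S xs u u')"

lemma tapes_step_iff:
  assumes S: "2 \<le> S"
  shows "length rs = length acts \<Longrightarrow> length acts = length wk \<Longrightarrow> list_all (fits S Z) wk \<Longrightarrow>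
    tapes_step S (zip rs acts) (tapes_code (map (tape_code S Z) wk)) a' \<longleftrightarrow>
    reads wk = rs \<and> a' = tapes_code (map (tape_code S Z) (map2 act acts wk))"
proof (induction rs acts wk arbitrary: a' rule: list_induct3)
  case Nil
  then show ?case by (simp add: reads_def)
next
  case (Cons r rs bd acts th wk)
  obtain t h where th: "th = (t, h)" by (cases th)
  obtain b d where bd: "bd = (b, d)" by (cases bd)
  have f: "fits S Z (t, h)" using Cons.prems th by simp
  have 1: "snd (tape_code S Z (t, h)) mod S = t h" by (rule tape_code_act(2)[OF S f])
  have 2: "tape_next S b d (tape_code S Z (t, h)) = tape_code S Z (act (b, d) (t, h))"
    using tape_code_act(1)[OF S f] by simp
  obtain l r' where lr: "tape_code S Z (t, h) = (l, r')" by (cases "tape_code S Z (t, h)")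
  obtain l2 r2 where lr2: "tape_code S Z (act (b, d) (t, h)) = (l2, r2)" by (cases "tape_code S Z (act (b, d) (t, h))")
  have "tapes_step S (zip rs acts) (tapes_code (map (tape_code S Z) wk)) u' \<longleftrightarrow>
      reads wk = rs \<and> u' = tapes_code (map (tape_code S Z) (map2 act acts wk))" for u'
    using Cons by simp
  then show ?case using 1 2 unfolding th bd lr lr2 by (auto simp: reads_def lr lr2)
qed

definition code :: "nat \<Rightarrow> nat \<Rightarrow> config \<Rightarrow> nat" where
  "code S Z c = pair (state c) (pair (input_pos c) (tapes_code (map (tape_code S Z) (work c))))"

definition rule_step :: "nat \<Rightarrow> bool list \<Rightarrow> rule \<Rightarrow> nat \<Rightarrow> nat \<Rightarrow> bool" where
  "rule_step S w r a a' \<longleftrightarrow> (\<exists>i u i' u'. a = pair (source r) (pair i u) \<and> a' = pair (target r) (pair i' u') \<and>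
     input_cell w i = input_read r \<and> i' = min (move_head (input_move r) i) (length w + 1) \<and>
     tapes_step S (zip (work_read r) (work_action r)) u u')"

lemma rule_step_iff:
  assumes "2 \<le> S" "length (work_read r) = length (work_action r)" "length (work_action r) = length (work c)"
    "list_all (fits S Z) (work c)"
  shows "rule_step S w r (code S Z c) a' \<longleftrightarrow> enabled w r c \<and> a' = code S Z (fire w r c)"
  unfolding rule_step_def enabled_def code_def
  by (auto simp: tapes_step_iff[OF assms] fire_def reads_def)

section \<open>Reachable configurations and bounds on their codes\<close>

definition step :: "machine \<Rightarrow> bool list \<Rightarrow> config \<Rightarrow> config \<Rightarrow> bool" where
  "step M w c c' \<longleftrightarrow> (\<exists>r \<in> rules M. enabled w r c \<and> c' = fire w r c)"

lemma run_iff_steps: "(\<exists>out. run M w c out c') \<longleftrightarrow> (step M w)\<^sup>*\<^sup>* c c'"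
proof
  assume "\<exists>out. run M w c out c'"
  then obtain out where "run M w c out c'" ..
  then show "(step M w)\<^sup>*\<^sup>* c c'"
  proof induction
    case (run_step r c out c')
    then have "step M w c (fire w r c)" by (auto simp: step_def)
    then show ?case using run_step.IH by (rule converse_rtranclp_into_rtranclp)
  qed simp
next
  assume "(step M w)\<^sup>*\<^sup>* c c'"
  then show "\<exists>out. run M w c out c'"
  proof (induction rule: converse_rtranclp_induct)
    case (step c d)
    then show ?case using run_step unfolding step_def by blast
  qed (use run_refl in blast)
qed

lemma steps_invariant:
  assumes wf: "machine_wf M" and S: "\<And>r b d. r \<in> rules M \<Longrightarrow> (b, d) \<in> set (work_action r) \<Longrightarrow> b < S" "0 < S"
    and "(step M w)\<^sup>*\<^sup>* (initial M) c"
  shows "length (work c) = tapes M \<and> input_pos c \<le> length w + 1 \<and>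
    state c \<in> insert (start M) (target ` rules M) \<and> (\<forall>(t, h) \<in> set (work c). \<forall>j. t j < S)"
  using assms(4)
proof (induction rule: rtranclp_induct)
  case base
  then show ?case using S(2) by (auto simp: initial_def)
next
  case (step c c')
  then obtain r where r: "r \<in> rules M" "c' = fire w r c" by (auto simp: step_def)
  have len: "length (work_action r) = tapes M" using wf r(1) by (simp add: machine_wf_def)
  have sym: "t j < S" if th: "(t, h) \<in> set (work c')" for t h j
  proof -
    have w: "work c' = map2 act (work_action r) (work c)" using r(2) by (simp add: fire_def)
    obtain i where "i < length (work c')" "(t, h) = work c' ! i"
      using th unfolding in_set_conv_nth by metis
    then have i: "i < tapes M" "(t, h) = act (work_action r ! i) (work c ! i)"
      using len step.IH unfolding w by auto
    obtain b d where bd: "work_action r ! i = (b, d)" by (cases "work_action r ! i")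
    obtain t0 h0 where t0: "work c ! i = (t0, h0)" by (cases "work c ! i")
    have "(b, d) \<in> set (work_action r)" using bd i(1) len nth_mem by metis
    then have "b < S" by (rule S(1)[OF r(1)])
    moreover have "(t0, h0) \<in> set (work c)" using t0 i(1) step.IH nth_mem by metis
    then have "t0 j < S" using step.IH by blast
    ultimately show ?thesis using i(2) bd t0 by (auto simp: act_def)
  qed
  have "length (work c') = tapes M" "input_pos c' \<le> length w + 1"
    "state c' \<in> insert (start M) (target ` rules M)"
    using r step.IH len by (auto simp: fire_def)
  then show ?case using sym by blast
qed

text \<open>The factor 2 accounts for the leading digit 1.\<close>

lemma left_num_bound: "(\<And>j. t j < S) \<Longrightarrow> left_num S t h < 2 * S ^ h"
proof (induction h)
  case (Suc h)
  have "left_num S t (Suc h) < S + S * left_num S t h" using Suc.prems[of h] by simp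
  also have "\<dots> = S * Suc (left_num S t h)" by simp
  also have "\<dots> \<le> S * (2 * S ^ h)" using Suc by (intro mult_le_mono) (auto simp: Suc_le_eq)
  finally show ?case by (simp add: ac_simps)
qed simp

lemma right_num_bound: "(\<And>j. t j < S) \<Longrightarrow> right_num S t h n < S ^ n"
proof (induction n arbitrary: h)
  case (Suc n)
  have "right_num S t h (Suc n) < S + S * right_num S t (Suc h) n" using Suc.prems[of h] by simp
  also have "\<dots> = S * Suc (right_num S t (Suc h) n)" by simp
  also have "\<dots> \<le> S * S ^ n" using Suc.IH[OF Suc.prems, of "Suc h"] by (intro mult_le_mono) (auto simp: Suc_le_eq)
  finally show ?case by simp
qed simp

text \<open>Pairing keeps bounds of the form base to the power \<open>l\<close>, changing only the
  base. With \<open>?m\<close> above both components, the square of the sum contributes four times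
  \<open>?m * ?m\<close> and the summand \<open>x\<close> once more.\<close>

lemma pair_bound:
  assumes "x \<le> E ^ l" "y \<le> F ^ l" "1 \<le> l"
  shows "pair x y \<le> (5 * (E + F) ^ 2) ^ l"
proof -
  let ?m = "(E + F) ^ l"
  have xy: "x \<le> ?m" "y \<le> ?m"
    using assms by (auto intro: order_trans[OF _ power_mono])
  have "x \<le> ?m * ?m" using xy(1) by (cases ?m) (auto intro: order_trans)
  then have "pair x y \<le> (?m + ?m) * (?m + ?m) + ?m * ?m"
    unfolding pair_def using xy by (intro add_le_mono mult_le_mono) auto
  also have "\<dots> = 5 * (?m * ?m)" by (simp add: algebra_simps)
  also have "\<dots> \<le> 5 ^ l * (?m * ?m)" using assms(3) by (intro mult_le_mono self_le_power) auto
  also have "\<dots> = (5 * (E + F) ^ 2) ^ l"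
    by (simp add: power_mult_distrib power_mult[symmetric] power_add[symmetric] mult.commute[of l] mult_2)
  finally show ?thesis .
qed

text \<open>A tape of \<open>C * l\<close> cells has codes of order \<open>(S ^ C) ^ l\<close>. The
  number of tapes is fixed, so iterated pairing affects the base but not the exponent.\<close>

lemma tapes_code_bound:
  "\<exists>E. \<forall>l wk. 1 \<le> l \<longrightarrow> length wk = k \<longrightarrow> list_all (fits S (C * l)) wk \<longrightarrow>
     tapes_code (map (tape_code S (C * l)) wk) \<le> E ^ l"
proof (induction k)
  case 0
  then show ?case by (intro exI[of _ 1]) simp
next
  case (Suc k)
  then obtain E where E: "\<And>l wk. 1 \<le> l \<Longrightarrow> length wk = k \<Longrightarrow> list_all (fits S (C * l)) wk \<Longrightarrow>
     tapes_code (map (tape_code S (C * l)) wk) \<le> E ^ l" by blast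
  let ?F = "2 * S ^ C"
  have tape: "left_num S t h \<le> ?F ^ l" "right_num S t h (C * l - h) \<le> ?F ^ l"
    if "1 \<le> l" "fits S (C * l) (t, h)" for l t h
  proof -
    have t: "\<And>j. t j < S" and h: "h < C * l" using that by (auto simp: fits_def)
    have S: "1 \<le> S" using t[of 0] by simp
    have p: "S ^ i \<le> S ^ (C * l)" if "i \<le> C * l" for i using S that by (intro power_increasing) auto
    have "left_num S t h \<le> 2 * S ^ h" using left_num_bound[of t S h, OF t] by simp
    also have "\<dots> \<le> 2 ^ l * S ^ (C * l)"
      using p[of h] h that(1) by (intro mult_le_mono self_le_power) auto
    finally show "left_num S t h \<le> ?F ^ l" by (simp add: power_mult_distrib power_mult)
    have "right_num S t h (C * l - h) \<le> S ^ (C * l - h)" 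
      using right_num_bound[of t S h "C * l - h", OF t] by simp
    also have "\<dots> \<le> 2 ^ l * S ^ (C * l)" using mult_le_mono[OF _ p[of "C * l - h"], of 1 "2 ^ l"] by simp
    finally show "right_num S t h (C * l - h) \<le> ?F ^ l" by (simp add: power_mult_distrib power_mult)
  qed
  show ?case
  proof (intro exI allI impI)
    fix l wk assume l: "1 \<le> l" and "length wk = Suc k" "list_all (fits S (C * l)) wk"
    then obtain t h wk' where wk: "wk = (t, h) # wk'" "length wk' = k" "fits S (C * l) (t, h)"
      "list_all (fits S (C * l)) wk'" by (cases wk) auto
    show "tapes_code (map (tape_code S (C * l)) wk) \<le> (5 * (5 * (?F + ?F) ^ 2 + E) ^ 2) ^ l"
      using pair_bound[OF pair_bound[OF tape[OF l wk(3)] l] E[OF l wk(2,4)] l]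
      by (simp add: wk(1) tape_code_def)
  qed
qed

lemma divmod_eq: "u < S \<Longrightarrow> x = u + S * y \<longleftrightarrow> y = x div S \<and> u = x mod S" for u S x y :: nat
  by auto

lemma concat_map_upt_Suc: "concat (map f [0..<Suc n]) = f 0 @ concat (map (\<lambda>i. f (Suc i)) [0..<n])"
  by (induction n) simp_all

context base
begin

subsection \<open>Steps between configurations\<close>

lemma ddec_finite_ex:
  "finite A \<Longrightarrow> (\<And>a. a \<in> A \<Longrightarrow> ddec k (P a)) \<Longrightarrow> ddec k (\<lambda>w \<sigma>. \<exists>a\<in>A. P a w \<sigma>)"
proof (induction A rule: finite_induct)
  case empty
  then show ?case using ddec_const[of k False] by simp
next
  case (insert a A)
  then have "ddec k (\<lambda>w \<sigma>. P a w \<sigma> \<or> (\<exists>a\<in>A. P a w \<sigma>))" by (intro ddec_disj) auto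
  then show ?case by simp
qed

lemma ddec_pair:
  assumes "x < k" "y < k" "z < k"
  shows "ddec k (\<lambda>w \<sigma>. \<sigma> z = pair (\<sigma> x) (\<sigma> y))"
proof -
  have "ddec k (\<lambda>w \<sigma>. \<exists>s < bound w. \<sigma> x + \<sigma> y = s \<and> s * s + \<sigma> x = \<sigma> z)"
    by (intro ddec_ex ddec_conj ddec_add ddec_mult_add) (use assms in auto)
  then show ?thesis
  proof (rule ddec_cong)
    fix w \<sigma> assume "clean w k \<sigma>"
    then have "\<sigma> z < bound w" by (rule clean_less)
    then show "(\<exists>s < bound w. \<sigma> x + \<sigma> y = s \<and> s * s + \<sigma> x = \<sigma> z) \<longleftrightarrow> \<sigma> z = pair (\<sigma> x) (\<sigma> y)"
      using pair_ge[of "\<sigma> x" "\<sigma> y"] by (auto simp: pair_def)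
  qed
qed

lemma ddec_affine:
  assumes "x < k" "y < k" "u < k" "S < b"
  shows "ddec k (\<lambda>w \<sigma>. \<sigma> x = \<sigma> u + S * \<sigma> y)"
proof -
  have "ddec k (\<lambda>w \<sigma>. \<exists>s < bound w. s = S \<and> s * \<sigma> y + \<sigma> u = \<sigma> x)"
    by (intro ddec_ex ddec_conj ddec_eq_const ddec_mult_add) (use assms in auto)
  then show ?thesis
  proof (rule ddec_cong)
    fix w \<sigma>
    have "S < bound w" using bound_ge_b[of w] assms(4) by simp
    then show "(\<exists>s < bound w. s = S \<and> s * \<sigma> y + \<sigma> u = \<sigma> x) \<longleftrightarrow> \<sigma> x = \<sigma> u + S * \<sigma> y"
      by auto
  qed
qed

text \<open>Quotient and remainder by \<open>S\<close> are introduced through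
  \<open>x = u + S * y\<close> with \<open>u < S\<close>.\<close>

lemma ddec_tape_next:
  assumes vars: "l < k" "r < k" "l' < k" "r' < k" and S: "S < b" "e < S" "c < S"
  shows "ddec k (\<lambda>w \<sigma>. \<sigma> r mod S = e \<and> (\<sigma> l', \<sigma> r') = tape_next S c d (\<sigma> l, \<sigma> r))"
proof -
  let ?N = "\<lambda>w \<sigma> v R. case d of
     Stay \<Rightarrow> \<sigma> l' = \<sigma> l \<and> \<sigma> r' = v + S * R
   | MoveRight \<Rightarrow> \<sigma> l' = v + S * \<sigma> l \<and> \<sigma> r' = R
   | MoveLeft \<Rightarrow> \<sigma> l = 1 \<and> \<sigma> l' = \<sigma> l \<and> \<sigma> r' = v + S * R \<or>
       \<not> \<sigma> l = 1 \<and> (\<exists>a < bound w. \<not> S \<le> a \<and> \<sigma> l = a + S * \<sigma> l' \<and> (\<exists>x < bound w. x = v + S * R \<and> \<sigma> r' = a + S * x))"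
  have "ddec (Suc (Suc (Suc k))) (\<lambda>w \<sigma>. ?N w \<sigma> (\<sigma> (Suc (Suc k))) (\<sigma> (Suc k)))"
  proof (cases d)
    case MoveLeft
    then show ?thesis unfolding move.case
      by (simp only: move.case) (intro ddec_disj ddec_ex ddec_conj ddec_not ddec_eq ddec_affine ddec_eq_const ddec_ge_const; use vars S in auto)
  next
    case Stay
    then show ?thesis
      by (simp only: move.case) (intro ddec_conj ddec_eq ddec_affine; use vars S in auto)
  next
    case MoveRight
    then show ?thesis
      by (simp only: move.case) (intro ddec_conj ddec_eq ddec_affine; use vars S in auto)
  qed
  then have "ddec k (\<lambda>w \<sigma>. \<exists>u < bound w. u = e \<and> (\<exists>R < bound w. \<sigma> r = u + S * R \<and> (\<exists>v < bound w. v = c \<and> ?N w \<sigma> v R)))"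
    by (intro ddec_ex ddec_conj ddec_eq_const ddec_affine) (use vars S in \<open>auto split: move.split\<close>)
  then show ?thesis
  proof (rule ddec_cong)
    fix w \<sigma> assume cl: "clean w k \<sigma>"
    have S': "S < bound w" using bound_ge_b[of w] S(1) by simp
    have div: "\<sigma> r div S < bound w" using clean_less[OF cl, of r] by (meson div_le_dividend le_less_trans)
    have "(\<exists>u < bound w. u = e \<and> (\<exists>R < bound w. \<sigma> r = u + S * R \<and> (\<exists>v < bound w. v = c \<and> ?N w \<sigma> v R))) \<longleftrightarrow>
        \<sigma> r mod S = e \<and> ?N w \<sigma> c (\<sigma> r div S)"
      using S S' div by (auto simp: divmod_eq)
    also have "?N w \<sigma> c (\<sigma> r div S) \<longleftrightarrow> (\<sigma> l', \<sigma> r') = tape_next S c d (\<sigma> l, \<sigma> r)"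
    proof (cases d)
      case MoveLeft
      have "(\<exists>a < bound w. \<not> S \<le> a \<and> \<sigma> l = a + S * \<sigma> l' \<and> (\<exists>x < bound w. x = c + S * (\<sigma> r div S) \<and> \<sigma> r' = a + S * x)) \<longleftrightarrow>
        \<sigma> l' = \<sigma> l div S \<and> \<sigma> r' = \<sigma> l mod S + S * (c + S * (\<sigma> r div S))" (is "?A \<longleftrightarrow> ?B")
      proof
        assume ?A
        then show ?B using divmod_eq[of _ S] by (auto simp: not_le)
      next
        assume B: ?B
        let ?x = "c + S * (\<sigma> r div S)"
        \<comment> \<open>The intermediate number is at most \<open>\<sigma> r'\<close> and thus
          stays within the range of the counters.\<close>
        have "1 * ?x \<le> S * ?x" using S(2) by (intro mult_le_mono1) simp
        also have "\<dots> \<le> \<sigma> r'" unfolding B[THEN conjunct2] by (rule le_add2)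
        finally have "?x < bound w" using clean_less[OF cl, of r'] by simp
        moreover have "\<sigma> l mod S < S" using S by simp
        ultimately show ?A using B S' by (intro exI[of _ "\<sigma> l mod S"] conjI exI[of _ ?x]) auto
      qed
      then show ?thesis using MoveLeft by (auto simp: tape_next_def)
    qed (auto simp: tape_next_def)
    finally show "(\<exists>u < bound w. u = e \<and> (\<exists>R < bound w. \<sigma> r = u + S * R \<and> (\<exists>v < bound w. v = c \<and> ?N w \<sigma> v R))) \<longleftrightarrow>
      \<sigma> r mod S = e \<and> (\<sigma> l', \<sigma> r') = tape_next S c d (\<sigma> l, \<sigma> r)" .
  qed
qed

lemma ddec_tapes_step:
  assumes "S < b"
  shows "\<forall>(e, c, d) \<in> set xs. e < S \<and> c < S \<Longrightarrow> x < k \<Longrightarrow> y < k \<Longrightarrow> ddec k (\<lambda>w \<sigma>. tapes_step S xs (\<sigma> x) (\<sigma> y))"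
proof (induction xs arbitrary: k x y)
  case Nil
  then show ?case by (simp add: ddec_conj ddec_zero)
next
  case (Cons h xs)
  obtain e c d where h: "h = (e, c, d)" by (cases h) auto
  have "e < S" "c < S" "\<forall>(e, c, d) \<in> set xs. e < S \<and> c < S" using Cons.prems(1) h by auto
  have "ddec k (\<lambda>w \<sigma>. \<exists>p < bound w. \<exists>u < bound w. \<sigma> x = pair p u \<and> (\<exists>p' < bound w. \<exists>u' < bound w. \<sigma> y = pair p' u' \<and>
      tapes_step S xs u u' \<and> (\<exists>l < bound w. \<exists>r < bound w. p = pair l r \<and> (\<exists>l' < bound w. \<exists>r' < bound w. p' = pair l' r' \<and>
        r mod S = e \<and> (l', r') = tape_next S c d (l, r)))))"
    by (intro ddec_ex ddec_conj[OF ddec_pair] ddec_conj[OF Cons.IH] ddec_tape_next) (use Cons.prems \<open>e < S\<close> \<open>c < S\<close> assms in auto)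
  then show ?case
  proof (rule ddec_cong)
    fix w \<sigma> assume cl: "clean w k \<sigma>"
    have lt: "p < bound w \<and> u < bound w" if "pair p u < bound w" for p u
      using pair_ge[of p u] that by linarith
    have x: "\<sigma> x < bound w" and y: "\<sigma> y < bound w" using clean_less[OF cl] by auto
    show "(\<exists>p < bound w. \<exists>u < bound w. \<sigma> x = pair p u \<and> (\<exists>p' < bound w. \<exists>u' < bound w. \<sigma> y = pair p' u' \<and>
      tapes_step S xs u u' \<and> (\<exists>l < bound w. \<exists>r < bound w. p = pair l r \<and> (\<exists>l' < bound w. \<exists>r' < bound w. p' = pair l' r' \<and>
        r mod S = e \<and> (l', r') = tape_next S c d (l, r))))) \<longleftrightarrow> tapes_step S (h # xs) (\<sigma> x) (\<sigma> y)" (is "?A \<longleftrightarrow> ?B")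
    proof
      assume ?A
      then show ?B unfolding tapes_step.simps h fst_conv snd_conv by blast
    next
      assume ?B
      then obtain l r u l' r' u' where a: "\<sigma> x = pair (pair l r) u" "\<sigma> y = pair (pair l' r') u'"
        "r mod S = e" "(l', r') = tape_next S c d (l, r)" "tapes_step S xs u u'"
        unfolding tapes_step.simps h fst_conv snd_conv by blast
      have 1: "pair l r < bound w" "u < bound w" using lt[of "pair l r" u] x a(1) by auto
      have 2: "pair l' r' < bound w" "u' < bound w" using lt[of "pair l' r'" u'] y a(2) by auto
      show ?A using 1 2 lt[OF 1(1)] lt[OF 2(1)] a(3,5) by (simp add: a(1,2) a(4)[symmetric])
    qed
  qed
qed

lemma ddec_input_cell:
  assumes "i < k"
  shows "ddec k (\<lambda>w \<sigma>. input_cell w (\<sigma> i) = x)"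
proof (cases x)
  case LeftEnd
  show ?thesis by (rule ddec_cong[OF ddec_zero[OF assms]]) (simp add: input_cell_def LeftEnd)
next
  case (Bit c)
  have "ddec (Suc k) (\<lambda>w \<sigma>. if c then \<sigma> k < length w \<and> w ! \<sigma> k else \<sigma> k < length w \<and> \<not> (\<sigma> k < length w \<and> w ! \<sigma> k))"
    using ddec_bit(1)[of k "Suc k"] ddec_conj[OF ddec_bit(2) ddec_not[OF ddec_bit(1)], of k "Suc k" k]
    by (cases c) (simp_all only: if_True if_False lessI simp_thms)
  then have "ddec k (\<lambda>w \<sigma>. \<exists>j < bound w. \<sigma> i = Suc j \<and> (if c then j < length w \<and> w ! j else j < length w \<and> \<not> (j < length w \<and> w ! j)))"
    by (intro ddec_ex ddec_conj ddec_Suc) (use assms in auto)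
  then show ?thesis
  proof (rule ddec_cong)
    fix w \<sigma> assume "clean w k \<sigma>"
    then have "\<sigma> i < bound w" by (rule clean_less)
    then show "(\<exists>j < bound w. \<sigma> i = Suc j \<and> (if c then j < length w \<and> w ! j else j < length w \<and> \<not> (j < length w \<and> w ! j))) \<longleftrightarrow>
        input_cell w (\<sigma> i) = x"
      by (cases "\<sigma> i") (auto simp: input_cell_def Bit)
  qed
next
  case RightEnd
  have "ddec k (\<lambda>w \<sigma>. \<not> \<sigma> i = 0 \<and> \<not> (\<exists>j < bound w. \<sigma> i = Suc j \<and> j < length w))"
    by (intro ddec_ex ddec_conj ddec_Suc ddec_not ddec_zero ddec_bit(2)) (use assms in auto)
  then show ?thesis
  proof (rule ddec_cong)
    fix w \<sigma> assume "clean w k \<sigma>"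
    then have "\<sigma> i < bound w" by (rule clean_less)
    then show "(\<not> \<sigma> i = 0 \<and> \<not> (\<exists>j < bound w. \<sigma> i = Suc j \<and> j < length w)) \<longleftrightarrow> input_cell w (\<sigma> i) = x"
      by (cases "\<sigma> i") (auto simp: input_cell_def RightEnd)
  qed
qed

lemma ddec_input_move:
  assumes "i < k" "j < k"
  shows "ddec k (\<lambda>w \<sigma>. \<sigma> j = min (move_head d (\<sigma> i)) (length w + 1))"
proof -
  let ?P = "\<lambda>w \<sigma> l. case d of
      Stay \<Rightarrow> \<sigma> i \<le> l \<and> \<sigma> j = \<sigma> i \<or> l \<le> \<sigma> i \<and> \<sigma> j = l
    | MoveRight \<Rightarrow> \<sigma> i < l \<and> \<sigma> j = Suc (\<sigma> i) \<or> l \<le> \<sigma> i \<and> \<sigma> j = l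
    | MoveLeft \<Rightarrow> \<sigma> i = 0 \<and> \<sigma> j = 0 \<or> (\<exists>x < bound w. \<sigma> i = Suc x \<and> (x \<le> l \<and> \<sigma> j = x \<or> l \<le> x \<and> \<sigma> j = l))"
  have "ddec (Suc (Suc k)) (\<lambda>w \<sigma>. ?P w \<sigma> (\<sigma> (Suc k)))"
    by (cases d; simp only: move.case; intro ddec_disj ddec_ex ddec_conj ddec_le ddec_less ddec_eq ddec_Suc ddec_zero)
      (use assms in auto)
  then have "ddec k (\<lambda>w \<sigma>. \<exists>n < bound w. n = length w \<and> (\<exists>l < bound w. l = Suc n \<and> ?P w \<sigma> l))"
    by (intro ddec_ex ddec_conj ddec_length ddec_Suc) (use assms in \<open>auto split: move.split\<close>)
  then show ?thesis
  proof (rule ddec_cong)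
    fix w \<sigma> assume cl: "clean w k \<sigma>"
    have l: "length w < bound w" "Suc (length w) < bound w" using bound_gt[of w] by auto
    then have "(\<exists>n < bound w. n = length w \<and> (\<exists>l < bound w. l = Suc n \<and> ?P w \<sigma> l)) \<longleftrightarrow> ?P w \<sigma> (Suc (length w))"
      by auto
    also have "\<dots> \<longleftrightarrow> \<sigma> j = min (move_head d (\<sigma> i)) (length w + 1)"
    proof (cases d)
      case MoveLeft
      then show ?thesis using clean_less[OF cl, of i] by (cases "\<sigma> i") auto
    qed auto
    finally show "(\<exists>n < bound w. n = length w \<and> (\<exists>l < bound w. l = Suc n \<and> ?P w \<sigma> l)) \<longleftrightarrow>
        \<sigma> j = min (move_head d (\<sigma> i)) (length w + 1)" .
  qed
qed

lemma ddec_rule_step: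
  assumes "S < b" "\<forall>(e, c, d) \<in> set (zip (work_read r) (work_action r)). e < S \<and> c < S" "x < k" "y < k"
  shows "ddec k (\<lambda>w \<sigma>. rule_step S w r (\<sigma> x) (\<sigma> y))"
proof -
  have "ddec k (\<lambda>w \<sigma>. \<exists>q < bound w. q = source r \<and> (\<exists>p < bound w. \<sigma> x = pair q p \<and>
      (\<exists>i < bound w. input_cell w i = input_read r \<and> (\<exists>u < bound w. p = pair i u \<and>
      (\<exists>q' < bound w. q' = target r \<and> (\<exists>p' < bound w. \<sigma> y = pair q' p' \<and>
      (\<exists>i' < bound w. i' = min (move_head (input_move r) i) (length w + 1) \<and> (\<exists>u' < bound w. p' = pair i' u' \<and>
        tapes_step S (zip (work_read r) (work_action r)) u u'))))))))"
    by (intro ddec_ex ddec_conj ddec_pair ddec_eq_const ddec_input_cell ddec_input_move ddec_tapes_step)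
      (use assms in auto)
  then show ?thesis
  proof (rule ddec_cong)
    fix w \<sigma> assume cl: "clean w k \<sigma>"
    have lt: "p < bound w \<and> u < bound w" if "pair p u < bound w" for p u
      using pair_ge[of p u] that by linarith
    have x: "\<sigma> x < bound w" and y: "\<sigma> y < bound w" using clean_less[OF cl] by auto
    show "(\<exists>q < bound w. q = source r \<and> (\<exists>p < bound w. \<sigma> x = pair q p \<and>
      (\<exists>i < bound w. input_cell w i = input_read r \<and> (\<exists>u < bound w. p = pair i u \<and>
      (\<exists>q' < bound w. q' = target r \<and> (\<exists>p' < bound w. \<sigma> y = pair q' p' \<and>
      (\<exists>i' < bound w. i' = min (move_head (input_move r) i) (length w + 1) \<and> (\<exists>u' < bound w. p' = pair i' u' \<and>
        tapes_step S (zip (work_read r) (work_action r)) u u')))))))) \<longleftrightarrow> rule_step S w r (\<sigma> x) (\<sigma> y)" (is "?A \<longleftrightarrow> ?B")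
    proof
      assume ?A
      then show ?B unfolding rule_step_def by blast
    next
      assume ?B
      then obtain i u i' u' where a: "\<sigma> x = pair (source r) (pair i u)" "\<sigma> y = pair (target r) (pair i' u')"
        "input_cell w i = input_read r" "i' = min (move_head (input_move r) i) (length w + 1)"
        "tapes_step S (zip (work_read r) (work_action r)) u u'"
        unfolding rule_step_def by blast
      have 1: "source r < bound w" "pair i u < bound w" using lt[of "source r" "pair i u"] x a(1) by auto
      have 2: "target r < bound w" "pair i' u' < bound w" using lt[of "target r" "pair i' u'"] y a(2) by auto
      show ?A using 1 2 lt[OF 1(2)] lt[OF 2(2)] a(3-5) by (simp add: a(1,2))
    qed
  qed
qed

subsection \<open>Printing\<close>

definition prints :: "nat \<Rightarrow> (bool list \<Rightarrow> vals \<Rightarrow> bool list) \<Rightarrow> bool" where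
  "prints k f \<longleftrightarrow> (\<exists>p. det_prog p \<and> (\<forall>w \<sigma>. clean w k \<sigma> \<longrightarrow> den w p \<sigma> = {(f w \<sigma>, \<sigma>)}))"

lemma prints_const: "prints k (\<lambda>w \<sigma>. bs)"
  unfolding prints_def by (intro exI[of _ "POut bs"]) simp

lemma prints_append:
  assumes "prints k f" "prints k g"
  shows "prints k (\<lambda>w \<sigma>. f w \<sigma> @ g w \<sigma>)"
proof -
  obtain p where p: "det_prog p" "\<And>w \<sigma>. clean w k \<sigma> \<Longrightarrow> den w p \<sigma> = {(f w \<sigma>, \<sigma>)}"
    using assms unfolding prints_def by blast
  obtain q where q: "det_prog q" "\<And>w \<sigma>. clean w k \<sigma> \<Longrightarrow> den w q \<sigma> = {(g w \<sigma>, \<sigma>)}"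
    using assms unfolding prints_def by blast
  show ?thesis unfolding prints_def
    by (intro exI[of _ "PSeq p q"]) (simp add: p q rseq_single)
qed

lemma prints_bit:
  assumes "ddec k P"
  shows "prints k (\<lambda>w \<sigma>. [P w \<sigma>])"
proof -
  obtain p where p: "det_prog p" "\<And>w \<sigma>. clean w k \<sigma> \<Longrightarrow> den w p \<sigma> = {([], \<sigma>(k := of_bool (P w \<sigma>)))}"
    using assms unfolding ddec_def by blast
  have "den w (PSeq p (PIfZ k (POut [False]) (PSeq (PDec k) (POut [True])))) \<sigma> = {([P w \<sigma>], \<sigma>)}"
    if "clean w k \<sigma>" for w \<sigma>
  proof -
    have z: "\<sigma> k = 0" using clean_zero[OF that] by simp
    show ?thesis
    proof (cases "P w \<sigma>")
      case True
      have "den w (PDec k) (\<sigma>(k := 1)) = {([], \<sigma>)}"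
        using one_less_bound z by (subst den_dec) (auto simp: fun_eq_iff)
      from den_seq[OF this, of "POut [True]"] have "den w (PSeq (PDec k) (POut [True])) (\<sigma>(k := 1)) = {([True], \<sigma>)}"
        by (simp del: den.simps(5))
      then show ?thesis using True by (simp add: den_seq[OF p(2)[OF that]] del: den.simps(5))
    next
      case False
      then show ?thesis using z by (simp add: den_seq[OF p(2)[OF that]] fun_eq_iff del: den.simps(5))
    qed
  qed
  then show ?thesis unfolding prints_def
    by (intro exI[of _ "PSeq p (PIfZ k (POut [False]) (PSeq (PDec k) (POut [True])))"]) (simp add: p(1))
qed

lemma while_output:
  assumes "\<And>i. i < n \<Longrightarrow> s i x \<noteq> 0 \<and> den w p (s i) = {(out i, s (Suc i))}" "s n x = 0"
  shows "den w (PWhile x p) (s 0) = {(concat (map out [0..<n]), s n)}"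
  using assms
proof (induction n arbitrary: s out)
  case 0
  then show ?case by (simp add: while_rel_False)
next
  case (Suc n)
  have "den w (PWhile x p) (s (Suc 0)) = {(concat (map (\<lambda>i. out (Suc i)) [0..<n]), s (Suc n))}"
    using Suc.IH[of "\<lambda>i. s (Suc i)" "\<lambda>i. out (Suc i)"] Suc.prems by simp
  moreover have "den w (PWhile x p) (s 0) = (\<lambda>(o2, u). (out 0 @ o2, u)) ` den w (PWhile x p) (s (Suc 0))"
    unfolding den.simps using Suc.prems(1)[of 0]
    by (simp add: while_rel_True[of _ "s 0"] rseq_single)
  ultimately show ?case by (simp add: concat_map_upt_Suc del: den.simps upt_Suc)
qed

text \<open>The body runs once before the loop, since the counter starts at 0; the wrap-around to 0
  after the last value ends the loop and restores the state.\<close>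

lemma prints_for:
  assumes "prints (Suc k) (\<lambda>w \<sigma>. f w \<sigma> (\<sigma> k))" and indep: "\<And>w \<sigma> v. f w (\<sigma>(k := v)) = f w \<sigma>"
  shows "prints k (\<lambda>w \<sigma>. concat (map (f w \<sigma>) [0..<bound w]))"
proof -
  obtain p where p: "det_prog p" "\<And>w \<sigma>. clean w (Suc k) \<sigma> \<Longrightarrow> den w p \<sigma> = {(f w \<sigma> (\<sigma> k), \<sigma>)}"
    using assms unfolding prints_def by blast
  let ?q = "PSeq p (PInc k)"
  have "den w (PSeq ?q (PWhile k ?q)) \<sigma> = {(concat (map (f w \<sigma>) [0..<bound w]), \<sigma>)}"
    if cl: "clean w k \<sigma>" for w \<sigma>
  proof -
    have z: "\<sigma>(k := 0) = \<sigma>" using clean_zero[OF cl, of k] by auto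
    obtain n where n: "bound w = Suc n" "0 < n" using one_less_bound(1)[of w] by (cases "bound w") auto
    have q: "den w ?q (\<sigma>(k := a)) = {(f w \<sigma> a, \<sigma>(k := Suc a mod bound w))}" if "a < bound w" for a
    proof -
      have "den w p (\<sigma>(k := a)) = {(f w \<sigma> a, \<sigma>(k := a))}"
        using p(2)[OF clean_upd[OF cl that, of "Suc k" k]] indep by simp
      then show ?thesis by (simp add: rseq_single)
    qed
    let ?s = "\<lambda>i. \<sigma>(k := Suc i mod bound w)"
    have "den w (PWhile k ?q) (?s 0) = {(concat (map (\<lambda>i. f w \<sigma> (Suc i)) [0..<n]), ?s n)}"
    proof (rule while_output[where s = ?s])
      fix i assume "i < n"
      then show "?s i k \<noteq> 0 \<and> den w ?q (?s i) = {(f w \<sigma> (Suc i), ?s (Suc i))}"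
        using q[of "Suc i"] n by (simp del: den.simps)
    qed (simp add: n)
    moreover have "den w (PSeq ?q (PWhile k ?q)) \<sigma> = (\<lambda>(o2, u). (f w \<sigma> 0 @ o2, u)) ` den w (PWhile k ?q) (?s 0)"
      using q[of 0] unfolding den.simps(5)[of w ?q] z by (subst rseq_single) auto
    moreover have "concat (map (f w \<sigma>) [0..<bound w]) = f w \<sigma> 0 @ concat (map (\<lambda>i. f w \<sigma> (Suc i)) [0..<n])"
      unfolding n(1) by (rule concat_map_upt_Suc)
    moreover have "?s n = \<sigma>" using n z by simp
    ultimately show ?thesis by simp
  qed
  then show ?thesis unfolding prints_def
    by (intro exI[of _ "PSeq ?q (PWhile k ?q)"]) (simp add: p(1))
qed

lemma prints_computable:
  assumes "prints 0 (\<lambda>w \<sigma>. f w)"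
  shows "log_space_computable f"
proof -
  obtain p where p: "det_prog p" "\<And>w \<sigma>. clean w 0 \<sigma> \<Longrightarrow> den w p \<sigma> = {(f w, \<sigma>)}"
    using assms unfolding prints_def by blast
  have "clean w 0 (\<lambda>_. 0)" for w by (simp add: clean_def ok_def)
  then show ?thesis by (intro log_space_computableI[OF p(1)]) (auto simp: p(2))
qed

end

section \<open>Hardness\<close>

lemma unary_append: "unary k @ x = unary k' @ y \<longleftrightarrow> k = k' \<and> x = y"
proof (induction k arbitrary: k')
  case 0
  then show ?case by (cases k') (auto simp: unary_def)
next
  case (Suc k)
  then show ?case by (cases k') (auto simp: unary_def)
qed

text \<open>The unary header determines the number of states, and with it the length of the block
  and the meaning of each bit.\<close>

lemma encode_structure_append:
  assumes "input_structure m K" "input_structure m K'" "encode_structure m K @ x = encode_structure m K' @ y"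
  shows "agree K K' \<and> x = y"
proof -
  let ?f = "\<lambda>K. concat (map (encode_state m K) [0..<card (states K)])"
  obtain k where k: "states K = {..<k}" using assms(1) by (auto simp: input_structure_def)
  obtain k' where k': "states K' = {..<k'}" using assms(2) by (auto simp: input_structure_def)
  have "k = k'" and e: "?f K @ x = ?f K' @ y"
    using assms(3) by (auto simp: encode_structure_def unary_append k k')
  have len: "length (?f K) = k * (1 + m + k)" "length (?f K') = k * (1 + m + k)"
    using concat_blocks(1)[of k "encode_state m K" "1 + m + k"]
      concat_blocks(1)[of k "encode_state m K'" "1 + m + k"] by (simp_all add: k k' \<open>k = k'\<close>)
  have f: "?f K = ?f K'" and "x = y" using e len by auto
  have s: "encode_state m K q ! j = encode_state m K' q ! j" if "q < k" "j < 1 + m + k" for q j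
    using concat_blocks(2)[of k "encode_state m K" "1 + m + k" q j]
      concat_blocks(2)[of k "encode_state m K'" "1 + m + k" q j] f that by (simp add: k k' \<open>k = k'\<close>)
  have inp: "init K \<subseteq> {..<k} \<and> (\<forall>q \<in> {..<k}. label K q \<subseteq> {..<m}) \<and> (\<forall>q \<in> {..<k}. succ K q \<noteq> {} \<and> succ K q \<subseteq> {..<k})"
    if "input_structure m K" "states K = {..<k}" for K :: "(nat, nat) kripke"
    using that by (simp add: input_structure_def kripke_structure_def) (elim conjE, simp)
  have "init K \<subseteq> {..<k}" "init K' \<subseteq> {..<k}"
    and K: "\<And>q. q < k \<Longrightarrow> label K q \<subseteq> {..<m} \<and> label K' q \<subseteq> {..<m} \<and> succ K q \<subseteq> {..<k} \<and> succ K' q \<subseteq> {..<k}"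
    using inp[OF assms(1) k] inp[OF assms(2) k'[folded \<open>k = k'\<close>]] by simp_all
  moreover have "q \<in> init K \<longleftrightarrow> q \<in> init K'" if "q < k" for q
    using s[OF that, of 0] by (simp add: nth_encode_state(1))
  ultimately have "init K = init K'" by blast
  moreover have "label K q = label K' q" if "q < k" for q
  proof -
    have "p \<in> label K q \<longleftrightarrow> p \<in> label K' q" if "p < m" for p
      using s[OF \<open>q < k\<close>, of "1 + p"] that nth_encode_state(2)[OF that] by simp
    then show ?thesis using K[OF that] by blast
  qed
  moreover have "succ K q = succ K' q" if "q < k" for q
  proof -
    have "r \<in> succ K q \<longleftrightarrow> r \<in> succ K' q" if "r < k" for r
      using s[OF \<open>q < k\<close>, of "1 + m + r"] that nth_encode_state(3)[of r K m q] nth_encode_state(3)[of r K' m q]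
      by (simp add: k k' \<open>k = k'\<close>)
    then show ?thesis using K[OF that] by blast
  qed
  ultimately show ?thesis using \<open>x = y\<close> by (simp add: agree_def k k' \<open>k = k'\<close>)
qed

lemma encode_structures_append:
  assumes "\<forall>K \<in> set Ks \<union> set Ks'. input_structure m K" "encode_structures m Ks @ x = encode_structures m Ks' @ y"
  shows "list_all2 agree Ks Ks' \<and> x = y"
proof -
  have "length Ks = length Ks'" and e: "concat (map (encode_structure m) Ks) @ x = concat (map (encode_structure m) Ks') @ y"
    using assms(2) by (auto simp: encode_structures_def unary_append)
  then show ?thesis using assms(1)
  proof (induction Ks Ks' rule: list_induct2)
    case (Cons K Ks K' Ks')
    then have "agree K K' \<and> concat (map (encode_structure m) Ks) @ x = concat (map (encode_structure m) Ks') @ y"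
      by (intro encode_structure_append) auto
    then show ?case using Cons by simp
  qed simp
qed

lemma list_all2_models:
  assumes "list_all2 agree Ks Ks'" "\<forall>K \<in> set Ks. input_structure m K"
  shows "(\<forall>K \<in> set Ks. Q (models K \<phi>)) \<longleftrightarrow> (\<forall>K \<in> set Ks'. Q (models K \<phi>))"
  using assms
proof (induction rule: list_all2_induct)
  case (Cons K Ks K' Ks')
  then have "models K \<phi> = models K' \<phi>" by (intro agree_models) (auto simp: input_structure_def)
  then show ?case using Cons by simp
qed simp

text \<open>\<open>CTL_Learn\<close> asks for some instance with the given encoding. Decoding is
  unique up to \<open>agree\<close>, so all such instances have the same answer.\<close>

lemma encode_input_mem:
  assumes "\<forall>K \<in> set Ps \<union> set Ns. input_structure m K"
  shows "encode_input m Ps Ns B \<in> CTL_Learn Ut Bl n \<longleftrightarrow> learnable Ut Bl n {..<m} (set Ps) (set Ns) B"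
proof
  assume "encode_input m Ps Ns B \<in> CTL_Learn Ut Bl n"
  then obtain m' Ps' Ns' B' where e: "encode_input m Ps Ns B = encode_input m' Ps' Ns' B'"
    and in': "\<forall>K \<in> set Ps' \<union> set Ns'. input_structure m' K"
    and l: "learnable Ut Bl n {..<m'} (set Ps') (set Ns') B'"
    unfolding CTL_Learn_def by blast
  have mB: "m' = m" "B' = B" and
    s: "encode_structures m Ps @ encode_structures m Ns = encode_structures m Ps' @ encode_structures m Ns'"
    using e by (auto simp: encode_input_def unary_append)
  have P: "list_all2 agree Ps Ps'" and "encode_structures m Ns @ [] = encode_structures m Ns' @ []"
    using encode_structures_append[OF _ s] assms in' mB by auto
  then have N: "list_all2 agree Ns Ns'"
    using encode_structures_append[of Ns Ns' m "[]" "[]"] assms in' mB by auto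
  show "learnable Ut Bl n {..<m} (set Ps) (set Ns) B"
    using l unfolding learnable_def mB
    using list_all2_models[OF P, of m "\<lambda>b. b"] list_all2_models[OF N, of m Not] assms by simp
qed (use assms in \<open>auto simp: CTL_Learn_def\<close>)

subsection \<open>Reachability as a learning problem\<close>

text \<open>Self-loops make the successor relation total without affecting reachability.\<close>

definition graph :: "nat \<Rightarrow> nat \<Rightarrow> (nat \<Rightarrow> bool) \<Rightarrow> (nat \<Rightarrow> nat \<Rightarrow> bool) \<Rightarrow> (nat, nat) kripke" where
  "graph D a P E = \<lparr>states = {..<D}, init = {a}, props = {..<1},
     label = (\<lambda>q. if P q then {0} else {}), succ = (\<lambda>q. {r. r < D \<and> (r = q \<or> E q r)})\<rparr>"

abbreviation loop :: "bool \<Rightarrow> (nat, nat) kripke" where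
  "loop v \<equiv> graph 1 0 (\<lambda>_. v) (\<lambda>_ _. False)"

lemma graph_simps [simp]:
  "states (graph D a P E) = {..<D}" "init (graph D a P E) = {a}" "props (graph D a P E) = {..<1}"
  "label (graph D a P E) q = (if P q then {0} else {})"
  "succ (graph D a P E) q = {r. r < D \<and> (r = q \<or> E q r)}"
  by (simp_all add: graph_def)

lemma graph_structure: "a < D \<Longrightarrow> input_structure 1 (graph D a P E)"
  by (auto simp: input_structure_def kripke_structure_def)

text \<open>When all reachable states carry the label \<open>A\<close>, temporal operators have no effect.\<close>

primrec const_value :: "'p set \<Rightarrow> 'p ctl \<Rightarrow> bool" where
  "const_value A (Atom p) \<longleftrightarrow> p \<in> A"
| "const_value A (Neg \<phi>) \<longleftrightarrow> \<not> const_value A \<phi>"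
| "const_value A (Bin b \<phi> \<psi>) \<longleftrightarrow> binop_sem b (const_value A \<phi>) (const_value A \<psi>)"
| "const_value A (Quant Q t \<phi>) \<longleftrightarrow> const_value A \<phi>"

text \<open>Paths stay in \<open>X\<close> and at least one exists, so either path quantifier ranges
  over a nonempty set on which the truth value is constant.\<close>

lemma sat_const_value:
  assumes X: "\<And>q. q \<in> X \<Longrightarrow> succ K q \<noteq> {} \<and> succ K q \<subseteq> X \<and> label K q = A"
  shows "q \<in> X \<Longrightarrow> sat K \<phi> q \<longleftrightarrow> const_value A \<phi>"
proof (induction \<phi> arbitrary: q)
  case (Quant Q t \<phi>)
  have "\<rho> i \<in> X" if "\<rho> \<in> paths K q" for \<rho> i
  proof (induction i)
    case 0
    then show ?case using Quant.prems that by (simp add: paths_def)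
  next
    case (Suc i)
    moreover have "\<rho> (Suc i) \<in> succ K (\<rho> i)" using that by (simp add: paths_def)
    ultimately show ?case using X by blast
  qed
  then have "temporal_sem t (sat K \<phi>) \<rho> = const_value A \<phi>" if "\<rho> \<in> paths K q" for \<rho>
    using Quant.IH that by (cases t) auto
  then have e: "quantifier_sem Q (paths K q) (temporal_sem t (sat K \<phi>)) =
      quantifier_sem Q (paths K q) (\<lambda>_. const_value A \<phi>)"
    by (rule quantifier_sem_cong)
  have "\<exists>y \<in> X. y \<in> succ K x" if "x \<in> X" for x using X[OF that] by blast
  from path_in_set[OF Quant.prems this] have "\<exists>\<rho>. \<rho> \<in> paths K q" by blast
  then have "quantifier_sem Q (paths K q) (\<lambda>_. const_value A \<phi>) = const_value A \<phi>" by (cases Q) auto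
  then show ?case using e by simp
qed (use X in auto)

lemma models_loop: "models (loop v) \<phi> \<longleftrightarrow> const_value (if v then {0} else {}) \<phi>"
proof -
  have "sat (loop v) \<phi> 0 \<longleftrightarrow> const_value (if v then {0} else {}) \<phi>"
    by (rule sat_const_value[where X = "{0}"]) auto
  then show ?thesis by (simp add: models_def)
qed

text \<open>Both structures evaluate all formulas by the same \<open>const_value\<close>, so no
  formula of any size separates them.\<close>

lemma models_unreachable:
  assumes "a < D" and r: "\<And>q. (\<lambda>q r. r < D \<and> (r = q \<or> E q r))\<^sup>*\<^sup>* a q \<Longrightarrow> P q = v"
  shows "models (graph D a P E) \<phi> \<longleftrightarrow> models (loop v) \<phi>"
proof -
  let ?R = "\<lambda>q r. r < D \<and> (r = q \<or> E q r)"
  let ?X = "{q. q < D \<and> ?R\<^sup>*\<^sup>* a q}"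
  have "sat (graph D a P E) \<phi> a \<longleftrightarrow> const_value (if v then {0} else {}) \<phi>"
  proof (rule sat_const_value[where X = ?X])
    fix q assume q: "q \<in> ?X"
    have "succ (graph D a P E) q \<subseteq> ?X"
    proof
      fix s assume "s \<in> succ (graph D a P E) q"
      then have "?R q s" by simp
      then show "s \<in> ?X" using q rtranclp.rtrancl_into_rtrancl[of ?R a q s] by blast
    qed
    moreover have "q \<in> succ (graph D a P E) q" using q by simp
    ultimately show "succ (graph D a P E) q \<noteq> {} \<and> succ (graph D a P E) q \<subseteq> ?X \<and>
        label (graph D a P E) q = (if v then {0} else {})"
      using q r[of q] by (auto simp del: graph_simps(5))
  qed (use assms in auto)
  then show ?thesis unfolding models_loop by (simp add: models_def)
qed

lemma quant_size: "ctl_size (Quant Q t (Atom p)) \<le> 2" "ctl_bin_size (Quant Q t (Atom p)) = 0"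
proof -
  have "subformulas (Quant Q t (Atom p)) = {Quant Q t (Atom p), Atom p}" by simp
  then show "ctl_size (Quant Q t (Atom p)) \<le> 2" unfolding ctl_size_def by (simp only: card_2_iff) simp
  have "{\<psi> \<in> subformulas (Quant Q t (Atom p)). \<exists>b \<psi>1 \<psi>2. \<psi> = Bin b \<psi>1 \<psi>2} = {}" by auto
  then show "ctl_bin_size (Quant Q t (Atom p)) = 0" unfolding ctl_bin_size_def by (simp only: card.empty)
qed

lemma graph_EF:
  assumes "a < D"
  shows "models (graph D a P E) (Quant Exists_Path Eventually (Atom 0)) \<longleftrightarrow>
    (\<exists>q. (\<lambda>q r. r < D \<and> (r = q \<or> E q r))\<^sup>*\<^sup>* a q \<and> P q)"
proof -
  have "kripke_structure (graph D a P E)" "a \<in> states (graph D a P E)"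
    using graph_structure[OF assms] assms by (auto simp: input_structure_def)
  from EF_iff_reach[OF this, of "Collect P"] show ?thesis by (auto simp: models_def)
qed

lemma graph_AG:
  assumes "a < D"
  shows "models (graph D a P E) (Quant All_Paths Globally (Atom 0)) \<longleftrightarrow>
    \<not> (\<exists>q. (\<lambda>q r. r < D \<and> (r = q \<or> E q r))\<^sup>*\<^sup>* a q \<and> \<not> P q)"
proof -
  have "kripke_structure (graph D a P E)" "a \<in> states (graph D a P E)"
    using graph_structure[OF assms] assms by (auto simp: input_structure_def)
  from EF_iff_reach[OF this, of "{q. \<not> P q}"] show ?thesis by (auto simp: models_def)
qed

text \<open>The budget 2 admits a quantified atom, here EF of the only proposition.\<close>

lemma learnable_F:
  assumes "a < D" "Temporal Eventually \<in> Ut"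
  shows "learnable Ut Bl n {..<1} {graph D a P E} {loop False} 2 \<longleftrightarrow>
    (\<exists>q. (\<lambda>q r. r < D \<and> (r = q \<or> E q r))\<^sup>*\<^sup>* a q \<and> P q)" (is "?L \<longleftrightarrow> ?R")
proof
  assume ?R
  let ?\<phi> = "Quant Exists_Path Eventually (Atom 0) :: nat ctl"
  have "models (graph D a P E) ?\<phi>" "\<not> models (loop False) ?\<phi>"
    using \<open>?R\<close> graph_EF[OF assms(1)] models_loop[of False ?\<phi>] by auto
  then show ?L unfolding learnable_def using assms(2) by (intro exI[of _ ?\<phi>]) (simp add: quant_size)
next
  assume ?L
  then show ?R unfolding learnable_def using models_unreachable[OF assms(1), of E P False] by auto
qed

text \<open>AG expresses that no target is reachable, so labels are complemented and the graph
  becomes the negative example.\<close>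

lemma learnable_G:
  assumes "a < D" "Temporal Globally \<in> Ut"
  shows "learnable Ut Bl n {..<1} {loop True} {graph D a (\<lambda>q. \<not> P q) E} 2 \<longleftrightarrow>
    (\<exists>q. (\<lambda>q r. r < D \<and> (r = q \<or> E q r))\<^sup>*\<^sup>* a q \<and> P q)" (is "?L \<longleftrightarrow> ?R")
proof
  assume ?R
  let ?\<phi> = "Quant All_Paths Globally (Atom 0) :: nat ctl"
  have "\<not> models (graph D a (\<lambda>q. \<not> P q) E) ?\<phi>" "models (loop True) ?\<phi>"
    using \<open>?R\<close> graph_AG[OF assms(1)] models_loop[of True ?\<phi>] by auto
  then show ?L unfolding learnable_def using assms(2) by (intro exI[of _ ?\<phi>]) (simp add: quant_size)
next
  assume ?L
  then show ?R unfolding learnable_def using models_unreachable[OF assms(1), of E "\<lambda>q. \<not> P q" True] by auto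
qed

text \<open>Brings the encoding into nested concatenations over the range of the counters, the form
  produced by \<open>prints_for\<close>.\<close>

lemma encode_graph:
  "encode_structure 1 (graph D a P E) = (concat (map (\<lambda>_. [True]) [0..<D]) @ [False]) @
     concat (map (\<lambda>q. [q = a] @ [P q] @ concat (map (\<lambda>r. [r = q \<or> E q r]) [0..<D])) [0..<D])"
proof -
  have 1: "encode_state 1 (graph D a P E) q = [q = a] @ [P q] @ map (\<lambda>r. r = q \<or> E q r) [0..<D]" for q
    by (simp add: encode_state_def)
  have 2: "map h [0..<D] = concat (map (\<lambda>r. [h r]) [0..<D])" for h :: "nat \<Rightarrow> bool" by simp
  have "encode_state 1 (graph D a P E) = (\<lambda>q. [q = a] @ [P q] @ concat (map (\<lambda>r. [r = q \<or> E q r]) [0..<D]))"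
    by (rule ext) (simp only: 1 2)
  moreover have "unary D = concat (map (\<lambda>_. [True]) [0..<D]) @ [False]"
    by (simp add: unary_def map_replicate_const)
  ultimately show ?thesis by (simp only: encode_structure_def graph_simps card_lessThan)
qed

context base
begin

lemma prints_graph:
  assumes "ddec 1 (\<lambda>w \<sigma>. P w (\<sigma> 0))" "ddec 2 (\<lambda>w \<sigma>. E w (\<sigma> 0) (\<sigma> 1))"
  shows "prints 0 (\<lambda>w \<sigma>. encode_structure 1 (graph (bound w) a (P w) (E w)))"
proof -
  have "prints 0 (\<lambda>w \<sigma>. (concat (map (\<lambda>_. [True]) [0..<bound w]) @ [False]) @
     concat (map (\<lambda>q. [q = a] @ [P w q] @ concat (map (\<lambda>r. [r = q \<or> E w q r]) [0..<bound w])) [0..<bound w]))"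
    by (intro prints_append prints_for prints_const prints_bit ddec_disj ddec_eq_const ddec_eq)
      (use assms in \<open>auto simp: numeral_2_eq_2\<close>)
  then show ?thesis by (simp only: encode_graph)
qed

end

section \<open>The configuration graph as an instance\<close>

lemma right_num_zero: "right_num S (\<lambda>_. 0) h n = 0"
  by (induction n arbitrary: h) auto

lemma code_initial:
  "code S Z (initial M) = pair (start M) (pair 0 (tapes_code (replicate (tapes M) (1, 0))))"
  by (simp add: code_def initial_def tape_code_def right_num_zero)

lemma code_bound:
  assumes wf: "machine_wf M" and fits: "\<And>w c. (step M w)\<^sup>*\<^sup>* (initial M) c \<Longrightarrow> list_all (fits S (C * tape_len w)) (work c)"
    and inv: "\<And>w c. (step M w)\<^sup>*\<^sup>* (initial M) c \<Longrightarrow> length (work c) = tapes M \<and> input_pos c \<le> length w + 1 \<and>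
      state c \<in> insert (start M) (target ` rules M)"
  shows "\<exists>E. \<forall>w c. (step M w)\<^sup>*\<^sup>* (initial M) c \<longrightarrow> code S (C * tape_len w) c \<le> E ^ tape_len w"
proof -
  have "finite (insert (start M) (target ` rules M))" using wf by (simp add: machine_wf_def)
  then obtain V where V: "\<And>q. q \<in> insert (start M) (target ` rules M) \<Longrightarrow> q < V"
    unfolding finite_nat_set_iff_bounded by blast
  obtain E where E: "\<And>l wk. 1 \<le> l \<Longrightarrow> length wk = tapes M \<Longrightarrow> list_all (fits S (C * l)) wk \<Longrightarrow>
      tapes_code (map (tape_code S (C * l)) wk) \<le> E ^ l"
    using tapes_code_bound[of "tapes M" S C] by blast
  have "code S (C * tape_len w) c \<le> (5 * (V + 5 * (2 + E) ^ 2) ^ 2) ^ tape_len w"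
    if r: "(step M w)\<^sup>*\<^sup>* (initial M) c" for w c
  proof -
    have l: "1 \<le> tape_len w" using tape_len_bounds(3)[of w] by linarith
    have v: "state c < V" using V inv[OF r] by blast
    then have "V \<le> V ^ tape_len w" using l by (intro self_le_power) auto
    then have s: "state c \<le> V ^ tape_len w" using v by linarith
    have i: "input_pos c \<le> 2 ^ tape_len w" using inv[OF r] tape_len_bounds(2)[of w] by linarith
    have t: "tapes_code (map (tape_code S (C * tape_len w)) (work c)) \<le> E ^ tape_len w"
      using E[OF l _ fits[OF r]] inv[OF r] by blast
    show ?thesis unfolding code_def by (rule pair_bound[OF s pair_bound[OF i t l] l])
  qed
  then show ?thesis by blast
qed

definition transitions :: "machine \<Rightarrow> nat \<Rightarrow> bool list \<Rightarrow> nat \<Rightarrow> nat \<Rightarrow> bool" where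
  "transitions M S w a a' \<longleftrightarrow> (\<exists>r \<in> rules M. rule_step S w r a a')"

text \<open>Many numbers below \<open>D\<close> code no reachable configuration, but no walk from
  the initial code ever arrives at one of them.\<close>

lemma reach_code_iff:
  assumes wf: "machine_wf M" and S: "2 \<le> S"
    and fits: "\<And>c. (step M w)\<^sup>*\<^sup>* (initial M) c \<Longrightarrow> list_all (fits S Z) (work c)"
    and len: "\<And>c. (step M w)\<^sup>*\<^sup>* (initial M) c \<Longrightarrow> length (work c) = tapes M"
    and D: "\<And>c. (step M w)\<^sup>*\<^sup>* (initial M) c \<Longrightarrow> code S Z c < D"
  shows "(\<lambda>q r. r < D \<and> (r = q \<or> transitions M S w q r))\<^sup>*\<^sup>* (code S Z (initial M)) a \<longleftrightarrow>
    (\<exists>c. (step M w)\<^sup>*\<^sup>* (initial M) c \<and> a = code S Z c)"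
proof -
  let ?R = "\<lambda>q r. r < D \<and> (r = q \<or> transitions M S w q r)"
  have iff: "rule_step S w r (code S Z c) a' \<longleftrightarrow> enabled w r c \<and> a' = code S Z (fire w r c)"
    if "r \<in> rules M" "(step M w)\<^sup>*\<^sup>* (initial M) c" for r c a'
    by (rule rule_step_iff[OF S]) (use wf that fits len in \<open>auto simp: machine_wf_def\<close>)
  have "\<exists>c. (step M w)\<^sup>*\<^sup>* (initial M) c \<and> a = code S Z c" if "?R\<^sup>*\<^sup>* (code S Z (initial M)) a"
    using that
  proof (induction rule: rtranclp_induct)
    case (step a a')
    then obtain c where c: "(step M w)\<^sup>*\<^sup>* (initial M) c" "a = code S Z c" by blast
    show ?case
    proof (cases "a' = a")
      case False
      then obtain r where r: "r \<in> rules M" "rule_step S w r a a'" using step.hyps(2) by (auto simp: transitions_def)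
      then have f: "enabled w r c" "a' = code S Z (fire w r c)" using iff[OF r(1) c(1)] c(2) by auto
      have "step M w c (fire w r c)" using r(1) f(1) by (auto simp: step_def)
      then have "(step M w)\<^sup>*\<^sup>* (initial M) (fire w r c)" using c(1) by (rule rtranclp.rtrancl_into_rtrancl[rotated])
      then show ?thesis using f(2) by blast
    qed (use c in blast)
  qed blast
  moreover have "?R\<^sup>*\<^sup>* (code S Z (initial M)) (code S Z c)" if "(step M w)\<^sup>*\<^sup>* (initial M) c" for c
    using that
  proof (induction rule: rtranclp_induct)
    case (step c c')
    then obtain r where r: "r \<in> rules M" "enabled w r c" "c' = fire w r c" by (auto simp: step_def)
    have "(step M w)\<^sup>*\<^sup>* (initial M) c'" by (rule rtranclp.rtrancl_into_rtrancl[OF step.hyps])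
    from D[OF this] have "?R (code S Z c) (code S Z c')"
      using iff[OF r(1) step.hyps(1)] r by (auto simp: transitions_def)
    then show ?case by (rule rtranclp.rtrancl_into_rtrancl[OF step.IH])
  qed simp
  ultimately show ?thesis by blast
qed

text \<open>The Boolean \<open>v\<close> selects the marking of accepting configurations or its
  complement, as required for F and for G.\<close>

lemma (in base) prints_machine_graph:
  assumes "machine_wf M" "S < b"
    and sym: "\<And>r. r \<in> rules M \<Longrightarrow> \<forall>(e, c, d) \<in> set (zip (work_read r) (work_action r)). e < S \<and> c < S"
  shows "prints 0 (\<lambda>w \<sigma>. encode_structure 1 (graph (bound w) a (\<lambda>q. (\<exists>x. q = pair (accept M) x) = v) (transitions M S w)))"
proof (rule prints_graph)
  have "ddec 1 (\<lambda>w \<sigma>. \<exists>y < bound w. y = accept M \<and> (\<exists>x < bound w. \<sigma> 0 = pair y x))"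
    by (intro ddec_ex ddec_conj ddec_eq_const ddec_pair) auto
  then have acc: "ddec 1 (\<lambda>w \<sigma>. \<exists>x. \<sigma> 0 = pair (accept M) x)"
  proof (rule ddec_cong)
    fix w \<sigma> assume "clean w 1 \<sigma>"
    then have "\<sigma> 0 < bound w" by (rule clean_less)
    moreover have "y < bound w \<and> x < bound w" if "pair y x < bound w" for x y
      using pair_ge[of y x] that by linarith
    ultimately show "(\<exists>y < bound w. y = accept M \<and> (\<exists>x < bound w. \<sigma> 0 = pair y x)) \<longleftrightarrow> (\<exists>x. \<sigma> 0 = pair (accept M) x)"
      by metis
  qed
  then show "ddec 1 (\<lambda>w \<sigma>. (\<exists>x. \<sigma> 0 = pair (accept M) x) = v)"
    using ddec_not[OF acc] by (cases v) simp_all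
  show "ddec 2 (\<lambda>w \<sigma>. transitions M S w (\<sigma> 0) (\<sigma> 1))"
    unfolding transitions_def
    by (intro ddec_finite_ex ddec_rule_step assms sym) (use assms(1) in \<open>auto simp: machine_wf_def\<close>)
qed

lemma NL_reducible:
  assumes "L \<in> NL" and FG: "Temporal Eventually \<in> Ut \<or> Temporal Globally \<in> Ut"
  shows "log_space_reducible L (CTL_Learn Ut Bl n)"
proof -
  obtain M where wf: "machine_wf M" and "log_space M" and L: "L = {w. accepts M w}"
    using assms(1) unfolding NL_def by blast
  then obtain C where C: "\<And>w out c t h. run M w (initial M) out c \<Longrightarrow> (t, h) \<in> set (work c) \<Longrightarrow>
      real (h + 1) \<le> real C * log 2 (real (length w + 2))"
    unfolding log_space_def by blast
  have "finite (\<Union>r \<in> rules M. set (work_read r) \<union> fst ` set (work_action r))"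
    using wf by (auto simp: machine_wf_def)
  then obtain S0 where "\<forall>x \<in> (\<Union>r \<in> rules M. set (work_read r) \<union> fst ` set (work_action r)). x < S0"
    unfolding finite_nat_set_iff_bounded ..
  note S0 = bspec[OF this]
  have S0_read: "e < S0" if "r \<in> rules M" "e \<in> set (work_read r)" for r e
    by (rule S0) (use that in blast)
  have S0_act: "c < S0" if "r \<in> rules M" "(c, d) \<in> set (work_action r)" for r c d
    by (rule S0) (use that in \<open>auto intro!: bexI[of _ r] rev_image_eqI\<close>)
  \<comment> \<open>\<open>S\<close> exceeds every symbol in the rules and is at least 2, so that
    the blank 0 and the leading 1 are digits.\<close>
  define S where "S = S0 + 2"
  have S: "2 \<le> S" by (simp add: S_def)
  have sym: "e < S \<and> c < S" if "r \<in> rules M" "(e, c, d) \<in> set (zip (work_read r) (work_action r))" for r e c d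
  proof -
    have "e \<in> set (work_read r)" "(c, d) \<in> set (work_action r)"
      using that(2) by (auto dest: set_zip_leftD set_zip_rightD)
    then show ?thesis using S0_read[OF that(1)] S0_act[OF that(1)] by (fastforce simp: S_def)
  qed
  have act: "c < S" if "r \<in> rules M" "(c, d) \<in> set (work_action r)" for r c d
    using S0_act[OF that] by (simp add: S_def)
  have inv: "length (work c) = tapes M \<and> input_pos c \<le> length w + 1 \<and>
    state c \<in> insert (start M) (target ` rules M) \<and> (\<forall>(t, h) \<in> set (work c). \<forall>j. t j < S)"
    if "(step M w)\<^sup>*\<^sup>* (initial M) c" for w c
    by (rule steps_invariant[OF wf act _ that]) (use S in auto)
  have fits: "list_all (fits S (C * tape_len w)) (work c)" if "(step M w)\<^sup>*\<^sup>* (initial M) c" for w c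
  proof -
    have "h < C * tape_len w" if th: "(t, h) \<in> set (work c)" for t h
    proof -
      obtain out where "run M w (initial M) out c"
        using \<open>(step M w)\<^sup>*\<^sup>* (initial M) c\<close> run_iff_steps by blast
      from C[OF this th] have "real (h + 1) \<le> real C * log 2 (real (length w + 2))" .
      \<comment> \<open>\<open>length w + 2\<close> is less than \<open>2 ^ tape_len w\<close>, so
        the space bound of \<open>M\<close> becomes a multiple of \<open>tape_len w\<close>.\<close>
      also have "log 2 (real (length w + 2)) \<le> real (tape_len w)"
        using log2_of_power_less[OF tape_len_bounds(2)[of w]] by simp
      then have "real C * log 2 (real (length w + 2)) \<le> real C * real (tape_len w)" by (intro mult_left_mono) auto
      finally have "real (h + 1) \<le> real (C * tape_len w)" by simp
      then show ?thesis unfolding of_nat_le_iff by simp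
    qed
    then show ?thesis using inv[OF that] by (auto simp: list_all_iff fits_def)
  qed
  obtain E where E: "\<And>w c. (step M w)\<^sup>*\<^sup>* (initial M) c \<Longrightarrow> code S (C * tape_len w) c \<le> E ^ tape_len w"
    using code_bound[where C = C and S = S, OF wf fits] inv by blast
  \<comment> \<open>The base exceeds \<open>E\<close>, so that all codes of reachable configurations
    are in range, and \<open>S\<close>, so that \<open>S\<close> is available as a counter
    value.\<close>
  interpret base "E + S + 1" by standard (use S in simp)
  have D: "code S (C * tape_len w) c < bound w" if "(step M w)\<^sup>*\<^sup>* (initial M) c" for w c
  proof -
    have "E ^ tape_len w < (E + S + 1) ^ tape_len w"
      using tape_len_bounds(3)[of w] by (intro power_strict_mono) auto
    then show ?thesis using E[OF that] unfolding bound_def by linarith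
  qed
  \<comment> \<open>The code of the initial configuration does not depend on the input or on
    \<open>Z\<close>, so it can be a constant of the printing program.\<close>
  define a where "a = pair (start M) (pair 0 (tapes_code (replicate (tapes M) (1, 0))))"
  have a: "code S Z (initial M) = a" for Z by (simp add: code_initial a_def)
  have aD: "a < bound w" for w using D[of w "initial M"] by (simp add: a)
  let ?acc = "\<lambda>q. \<exists>x. q = pair (accept M) x"
  let ?G = "\<lambda>v w. graph (bound w) a (\<lambda>q. ?acc q = v) (transitions M S w)"
  have accept: "w \<in> L \<longleftrightarrow> (\<exists>q. (\<lambda>q r. r < bound w \<and> (r = q \<or> transitions M S w q r))\<^sup>*\<^sup>* a q \<and> ?acc q)" for w
  proof -
    have reach: "(\<lambda>q r. r < bound w \<and> (r = q \<or> transitions M S w q r))\<^sup>*\<^sup>* a q \<longleftrightarrow>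
        (\<exists>c. (step M w)\<^sup>*\<^sup>* (initial M) c \<and> q = code S (C * tape_len w) c)" for q
      by (rule reach_code_iff[where Z = "C * tape_len w", OF wf S fits _ D, unfolded a]) (simp_all add: inv)
    have "w \<in> L \<longleftrightarrow> (\<exists>c. (step M w)\<^sup>*\<^sup>* (initial M) c \<and> state c = accept M)"
      unfolding L accepts_def using run_iff_steps by blast
    also have "\<dots> \<longleftrightarrow> (\<exists>c. (step M w)\<^sup>*\<^sup>* (initial M) c \<and> ?acc (code S (C * tape_len w) c))"
      by (auto simp: code_def)
    also have "\<dots> \<longleftrightarrow> (\<exists>q. (\<lambda>q r. r < bound w \<and> (r = q \<or> transitions M S w q r))\<^sup>*\<^sup>* a q \<and> ?acc q)"
      unfolding reach by blast
    finally show ?thesis .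
  qed
  have print: "prints 0 (\<lambda>w \<sigma>. encode_structure 1 (?G v w))" for v
    by (rule prints_machine_graph[OF wf]) (use sym in auto)
  from FG show ?thesis
  proof
    assume F: "Temporal Eventually \<in> Ut"
    let ?f = "\<lambda>w. encode_input 1 [?G True w] [loop False] 2"
    have "prints 0 (\<lambda>w \<sigma>. (unary 1 @ unary 2 @ unary 1) @ encode_structure 1 (?G True w) @ encode_structures 1 [loop False])"
      by (intro prints_append print prints_const)
    then have "log_space_computable ?f"
      by (intro prints_computable) (simp add: encode_input_def encode_structures_def)
    moreover have "w \<in> L \<longleftrightarrow> ?f w \<in> CTL_Learn Ut Bl n" for w
    proof -
      have "?f w \<in> CTL_Learn Ut Bl n \<longleftrightarrow> learnable Ut Bl n {..<1} (set [?G True w]) (set [loop False]) 2"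
        by (rule encode_input_mem) (use graph_structure[OF aD] graph_structure[of 0 1] in auto)
      then show ?thesis using accept[of w] learnable_F[OF aD F, of Bl n w ?acc "transitions M S w"] by simp
    qed
    ultimately show ?thesis unfolding log_space_reducible_def by blast
  next
    assume G: "Temporal Globally \<in> Ut"
    let ?f = "\<lambda>w. encode_input 1 [loop True] [?G False w] 2"
    have "prints 0 (\<lambda>w \<sigma>. (unary 1 @ unary 2 @ encode_structures 1 [loop True] @ unary 1) @ encode_structure 1 (?G False w))"
      by (intro prints_append print prints_const)
    then have "log_space_computable ?f"
      by (intro prints_computable) (simp add: encode_input_def encode_structures_def)
    moreover have "w \<in> L \<longleftrightarrow> ?f w \<in> CTL_Learn Ut Bl n" for w
    proof -
      have "?f w \<in> CTL_Learn Ut Bl n \<longleftrightarrow> learnable Ut Bl n {..<1} (set [loop True]) (set [?G False w]) 2"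
        by (rule encode_input_mem) (use graph_structure[OF aD] graph_structure[of 0 1] in auto)
      then show ?thesis using accept[of w] learnable_G[OF aD G, of Bl n w ?acc "transitions M S w"] by simp
    qed
    ultimately show ?thesis unfolding log_space_reducible_def by blast
  qed
qed

theorem theorem6:
  fixes Ut :: "unop set" and Bl :: "binop set" and n :: nat
  shows "CTL_Learn Ut Bl n \<in> NL \<and>
    (Temporal Eventually \<in> Ut \<or> Temporal Globally \<in> Ut \<longrightarrow> NL_complete (CTL_Learn Ut Bl n))"
  unfolding NL_complete_def using CTL_Learn_in_NL NL_reducible by blast

end
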